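(* Let $G$ be a finite group of Lie type over $\mathbb{F}_q$ and $\mathcal{B}(G)$ its associated spherical building. For each edge eigenvalue $\lambda$ of $\mathcal{B}(G)$, there exists an integer $k>0$ such that $\lambda^k$ is an integer power of $q$.
   Context: $G$ has a $BN$-pair $(B,N)$ with Weyl group $W=N/(N\cap B)$ and set $S$ of simple reflections, so $(W,S)$ is a finite Coxeter system. For $I\subseteq S$ let $W_I=\langle I\rangle$, $w_I$ its longest element, $w_S$ the longest element of $W$, and $P_I=BW_IB$. The spherical building $\mathcal{B}(G)$ has as simplices the cosets $gP_I$ ($g\in G$, $I\subsetneq S$), ordered by reverse inclusion. Its vertices are the cosets $gP_{S-\{r\}}$ ($r\in S$ is the type of the vertex) and its edges are the cosets $gP_{S-\{r,s\}}$, $r\neq s$; let $X_1(\mathcal{B})$ be the $1$-skeleton graph. A length-$2$ path $(aP_{S-\{r\}},\,bP_{S-\{s\}},\,cP_{S-\{t\}})$ in $X_1(\mathcal{B})$ is a geodesic path if the first and third vertices are opposite in the link of the middle vertex; equivalently, $t=w_{S-\{s\}}\,r\,w_{S-\{s\}}$ and $a^{-1}c\in P_{S-\{r\}}\,w_{S-\{s\}}\,P_{S-\{t\}}$. A geodesic cycle of length $n$ is a cyclic sequence of vertices $(x_0,\dots,x_{n-1},x_n=x_0)$ such that every triple $(x_{i-1},x_i,x_{i+1})$ (indices mod $n$) is a geodesic path. Let $N(l)$ be the number of geodesic cycles of length $l$, and define the edge zeta function $Z(\mathcal{B},u)=\exp\bigl(\sum_{l\ge1}\frac{N(l)}{l}u^l\bigr)$.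 Then $1/Z(\mathcal{B},u)$ is a polynomial in $u$ with constant term $1$; writing $1/Z(\mathcal{B},u)=\prod_i(1-\lambda_iu)$, the nonzero $\lambda_i$ are called the edge eigenvalues of $\mathcal{B}(G)$. *)

theory Defs
  imports
    "HOL-Analysis.Determinants"
    "HOL-Algebra.Coset"
    "HOL-Algebra.Generated_Groups"
    "HOL-Algebra.Solvable_Groups"
    "HOL-Algebra.Algebraic_Closure_Type"
    "HOL-Computational_Algebra.Formal_Power_Series"
begin

section \<open>Linear algebraic groups\<close>

text \<open>
  Linear algebraic groups are Zariski-closed subgroups of the group of invertible
  matrices over an algebraically closed field. As such a field is infinite, polynomials
  in the matrix entries may be identified with the functions they induce.
\<close>

definition GL :: "('k::field ^ 'n ^ 'n) monoid" where
  "GL = \<lparr>carrier = {A. invertible A}, monoid.mult = (\<lambda>A B. A ** B), one = mat 1\<rparr>"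

inductive_set poly_functions :: "('k::field ^ 'n ^ 'n \<Rightarrow> 'k) set" where
  const: "(\<lambda>_. c) \<in> poly_functions"
| entry: "(\<lambda>A. A $ i $ j) \<in> poly_functions"
| add: "f \<in> poly_functions \<Longrightarrow> g \<in> poly_functions \<Longrightarrow> (\<lambda>A. f A + g A) \<in> poly_functions"
| mult: "f \<in> poly_functions \<Longrightarrow> g \<in> poly_functions \<Longrightarrow> (\<lambda>A. f A * g A) \<in> poly_functions"

definition zariski_closed :: "('k::field ^ 'n ^ 'n) set \<Rightarrow> bool" where
  "zariski_closed V \<longleftrightarrow>
     (\<exists>P \<subseteq> poly_functions. V = {A \<in> carrier GL. \<forall>f\<in>P. f A = 0})"

definition zariski_connected :: "('k::field ^ 'n ^ 'n) set \<Rightarrow> bool" where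
  "zariski_connected V \<longleftrightarrow>
     \<not> (\<exists>C D. zariski_closed C \<and> zariski_closed D \<and> V \<subseteq> C \<union> D \<and>
            C \<inter> D \<inter> V = {} \<and> C \<inter> V \<noteq> {} \<and> D \<inter> V \<noteq> {})"

definition closed_connected_subgroup :: "('k::field ^ 'n ^ 'n) set \<Rightarrow> bool" where
  "closed_connected_subgroup H \<longleftrightarrow> subgroup H GL \<and> zariski_closed H \<and> zariski_connected H"

text \<open>Regular maps: the coordinate ring of \<open>GL\<close> is generated by the entries and \<open>1/det\<close>.\<close>

definition regular_on ::
    "('k::field ^ 'n ^ 'n) set \<Rightarrow> ('k ^ 'n ^ 'n \<Rightarrow> 'k ^ 'n ^ 'n) \<Rightarrow> bool" where
  "regular_on V F \<longleftrightarrow>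
     (\<forall>i j. \<exists>f\<in>poly_functions. \<exists>k::nat. \<forall>A\<in>V. F A $ i $ j = f A / det A ^ k)"

definition unipotent :: "('k::field ^ 'n ^ 'n) \<Rightarrow> bool" where
  "unipotent A \<longleftrightarrow> (\<exists>k::nat. ((\<lambda>M. (A - mat 1) ** M) ^^ k) (mat 1) = 0)"

definition torus :: "('k::field ^ 'n ^ 'n) set \<Rightarrow> bool" where
  "torus T \<longleftrightarrow> closed_connected_subgroup T \<and>
     (\<exists>Q :: 'k ^ 'n ^ 'n. invertible Q \<and> (\<forall>A\<in>T. \<forall>i j. i \<noteq> j \<longrightarrow> (Q ** A ** matrix_inv Q) $ i $ j = 0))"

definition maximal_torus :: "('k::field ^ 'n ^ 'n) set \<Rightarrow> ('k ^ 'n ^ 'n) set \<Rightarrow> bool" where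
  "maximal_torus \<G> T \<longleftrightarrow> torus T \<and> T \<subseteq> \<G> \<and> (\<forall>T'. torus T' \<and> T \<subseteq> T' \<and> T' \<subseteq> \<G> \<longrightarrow> T' = T)"

definition closed_connected_solvable :: "('k::field ^ 'n ^ 'n) set \<Rightarrow> bool" where
  "closed_connected_solvable H \<longleftrightarrow>
     closed_connected_subgroup H \<and> solvable (GL\<lparr>carrier := H\<rparr>)"

definition borel_subgroup :: "('k::field ^ 'n ^ 'n) set \<Rightarrow> ('k ^ 'n ^ 'n) set \<Rightarrow> bool" where
  "borel_subgroup \<G> H \<longleftrightarrow> closed_connected_solvable H \<and> H \<subseteq> \<G> \<and>
     (\<forall>H'. closed_connected_solvable H' \<and> H \<subseteq> H' \<and> H' \<subseteq> \<G> \<longrightarrow> H' = H)"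

text \<open>The second conjunct says that the unipotent radical is trivial.\<close>

definition connected_reductive :: "('k::field ^ 'n ^ 'n) set \<Rightarrow> bool" where
  "connected_reductive \<G> \<longleftrightarrow> closed_connected_subgroup \<G> \<and>
     (\<forall>U. closed_connected_subgroup U \<and> U \<lhd> (GL\<lparr>carrier := \<G>\<rparr>) \<and> (\<forall>A\<in>U. unipotent A)
        \<longrightarrow> U = {mat 1})"


section \<open>Finite groups of Lie type\<close>

definition frobenius ::
    "('f::{field,finite}) alg_closure ^ 'n ^ 'n \<Rightarrow> 'f alg_closure ^ 'n ^ 'n" where
  "frobenius A = (\<chi> i j. (A $ i $ j) ^ CARD('f))"

text \<open>
  A Steinberg endomorphism with associated number \<open>q\<close>, where \<open>q\<close> is the size of the finite
  field \<open>'f\<close>: an algebraic group endomorphism \<open>F\<close> such that \<open>F\<^sup>m\<close> is the standard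
  \<open>q\<^sup>m\<close>-Frobenius map in the given matrix realisation for some \<open>m > 0\<close>. As the realisation
  is arbitrary, this covers Frobenius maps of nonsplit \<open>q\<close>-structures, i.e.\ the Steinberg
  variations. The second alternative covers the Suzuki and Ree groups, under the convention
  that \<open>q\<close> is the odd power of 2 or 3 for which \<open>F\<^sup>2\<close> is a \<open>q\<close>-Frobenius map (so that the
  number associated with \<open>F\<close> in the former sense would be the irrational square root of \<open>q\<close>).
\<close>

definition steinberg_endomorphism ::
    "(('f::{field,finite}) alg_closure ^ 'n ^ 'n) set \<Rightarrow>
     ('f alg_closure ^ 'n ^ 'n \<Rightarrow> 'f alg_closure ^ 'n ^ 'n) \<Rightarrow> bool" where
  "steinberg_endomorphism \<G> F \<longleftrightarrow>
     F \<in> hom (GL\<lparr>carrier := \<G>\<rparr>) (GL\<lparr>carrier := \<G>\<rparr>) \<and> regular_on \<G> F \<and>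
     ((\<exists>m>0. \<forall>A\<in>\<G>. (F ^^ m) A = (frobenius ^^ m) A) \<or>
      (\<nexists>r::nat. r\<^sup>2 = CARD('f)) \<and> (\<exists>m>0. \<forall>A\<in>\<G>. (F ^^ (2 * m)) A = (frobenius ^^ m) A))"

definition fixed_points :: "('a \<Rightarrow> 'a) \<Rightarrow> 'a set \<Rightarrow> 'a set" where
  "fixed_points F V = {x \<in> V. F x = x}"

definition torus_normalizer :: "('k::field ^ 'n ^ 'n) set \<Rightarrow> ('k ^ 'n ^ 'n) set \<Rightarrow> ('k ^ 'n ^ 'n) set" where
  "torus_normalizer \<G> T = {A \<in> \<G>. (\<lambda>M. A ** M ** matrix_inv A) ` T = T}"

text \<open>
  Data defining a finite group of Lie type over the finite field \<open>'f\<close>: a connected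
  reductive group over the algebraic closure of \<open>'f\<close>, a Steinberg endomorphism \<open>F\<close>, and an
  \<open>F\<close>-stable maximal torus inside an \<open>F\<close>-stable Borel subgroup.
\<close>

locale lie_type_datum =
  fixes \<G> :: "(('f::{field,finite}) alg_closure ^ 'n ^ 'n) set"
    and F :: "'f alg_closure ^ 'n ^ 'n \<Rightarrow> 'f alg_closure ^ 'n ^ 'n"
    and \<B> \<T> :: "('f alg_closure ^ 'n ^ 'n) set"
  assumes reductive: "connected_reductive \<G>"
    and steinberg: "steinberg_endomorphism \<G> F"
    and borel: "borel_subgroup \<G> \<B>" "F ` \<B> = \<B>"
    and torus: "maximal_torus \<G> \<T>" "F ` \<T> = \<T>" "\<T> \<subseteq> \<B>"
begin

definition finite_lie_group :: "('f alg_closure ^ 'n ^ 'n) monoid" where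
  "finite_lie_group = GL\<lparr>carrier := fixed_points F \<G>\<rparr>"

definition finite_borel :: "('f alg_closure ^ 'n ^ 'n) set" where
  "finite_borel = fixed_points F \<B>"

definition finite_normalizer :: "('f alg_closure ^ 'n ^ 'n) set" where
  "finite_normalizer = fixed_points F (torus_normalizer \<G> \<T>)"

end


section \<open>BN-pairs, their buildings and edge zeta functions\<close>

definition weyl_group :: "('a, 'b) monoid_scheme \<Rightarrow> 'a set \<Rightarrow> 'a set \<Rightarrow> 'a set monoid" where
  "weyl_group G B N = (G\<lparr>carrier := N\<rparr>) Mod (B \<inter> N)"

text \<open>
  An element of the Weyl group is a coset of \<open>B \<inter> N\<close>, hence a subset of \<open>G\<close>, and the
  products \<open>B w B\<close> and \<open>s B w\<close> below are products of subsets of \<open>G\<close>.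
\<close>

locale BN_pair = group G for G :: "('a, 'b) monoid_scheme" (structure) +
  fixes B N :: "'a set" and S :: "'a set set"
  assumes B_subgroup: "subgroup B G"
    and N_subgroup: "subgroup N G"
    and generate_BN: "generate G (B \<union> N) = carrier G"
    and normal_torus: "(B \<inter> N) \<lhd> (G\<lparr>carrier := N\<rparr>)"
    and S_subset: "S \<subseteq> carrier (weyl_group G B N)"
    and S_generates: "generate (weyl_group G B N) S = carrier (weyl_group G B N)"
    and S_involution: "s \<in> S \<Longrightarrow>
          s \<noteq> \<one>\<^bsub>weyl_group G B N\<^esub> \<and> s \<otimes>\<^bsub>weyl_group G B N\<^esub> s = \<one>\<^bsub>weyl_group G B N\<^esub>"
    and exchange: "s \<in> S \<Longrightarrow> w \<in> carrier (weyl_group G B N) \<Longrightarrow>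
          s <#> B <#> w \<subseteq> (B <#> w <#> B) \<union> (B <#> (s \<otimes>\<^bsub>weyl_group G B N\<^esub> w) <#> B)"
    and nondegenerate: "s \<in> S \<Longrightarrow> \<not> s <#> B <#> s \<subseteq> B"
begin

abbreviation W :: "'a set monoid" where "W \<equiv> weyl_group G B N"

definition weyl_length :: "'a set \<Rightarrow> nat" where
  "weyl_length w = (LEAST n. \<exists>ss. set ss \<subseteq> S \<and> length ss = n \<and> w = foldr (\<otimes>\<^bsub>W\<^esub>) ss \<one>\<^bsub>W\<^esub>)"

definition longest :: "'a set set \<Rightarrow> 'a set" where
  "longest I = (THE w. w \<in> generate W I \<and> (\<forall>v\<in>generate W I. weyl_length v \<le> weyl_length w))"

definition parabolic :: "'a set set \<Rightarrow> 'a set" where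
  "parabolic I = B <#> \<Union>(generate W I) <#> B"

text \<open>Simplices are represented by cosets, and \<open>x\<close> is a face of \<open>y\<close> iff \<open>y \<subseteq> x\<close>.\<close>

definition vertices :: "'a set set" where
  "vertices = {g <# parabolic (S - {r}) | g r. g \<in> carrier G \<and> r \<in> S}"

definition edges :: "'a set set" where
  "edges = {g <# parabolic (S - {r, s}) | g r s. g \<in> carrier G \<and> r \<in> S \<and> s \<in> S \<and> r \<noteq> s}"

definition adjacent :: "'a set \<Rightarrow> 'a set \<Rightarrow> bool" where
  "adjacent x y \<longleftrightarrow> x \<in> vertices \<and> y \<in> vertices \<and> x \<noteq> y \<and> (\<exists>e\<in>edges. e \<subseteq> x \<and> e \<subseteq> y)"

definition geodesic_path :: "'a set \<Rightarrow> 'a set \<Rightarrow> 'a set \<Rightarrow> bool" where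
  "geodesic_path x y z \<longleftrightarrow> adjacent x y \<and> adjacent y z \<and>
     (\<exists>a\<in>carrier G. \<exists>b\<in>carrier G. \<exists>c\<in>carrier G. \<exists>r\<in>S. \<exists>s\<in>S. \<exists>t\<in>S.
        x = a <# parabolic (S - {r}) \<and>
        y = b <# parabolic (S - {s}) \<and>
        z = c <# parabolic (S - {t}) \<and>
        t = longest (S - {s}) \<otimes>\<^bsub>W\<^esub> r \<otimes>\<^bsub>W\<^esub> longest (S - {s}) \<and>
        inv a \<otimes> c \<in> parabolic (S - {r}) <#> longest (S - {s}) <#> parabolic (S - {t}))"

text \<open>Cycles carry a base point: different rotations of a list count as different cycles.\<close>

definition geodesic_cycles :: "nat \<Rightarrow> 'a set list set" where
  "geodesic_cycles n = {xs. length xs = n \<and> set xs \<subseteq> vertices \<and>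
     (\<forall>i<n. geodesic_path (xs ! i) (xs ! ((i + 1) mod n)) (xs ! ((i + 2) mod n)))}"

definition edge_zeta :: "complex fps" where
  "edge_zeta = fps_exp 1 oo
     Abs_fps (\<lambda>l. if l = 0 then 0 else of_nat (card (geodesic_cycles l)) / of_nat l)"

definition edge_eigenvalue :: "complex \<Rightarrow> bool" where
  "edge_eigenvalue \<alpha> \<longleftrightarrow> \<alpha> \<noteq> 0 \<and>
     (\<exists>ms. inverse edge_zeta = (\<Prod>\<mu>\<leftarrow>ms. 1 - fps_const \<mu> * fps_X) \<and> \<alpha> \<in> set ms)"

end

end

theory Submission
  imports Defs "Jordan_Normal_Form.Schur_Decomposition" "HOL-Algebra.Sylow"
    "HOL-Number_Theory.Residues" "HOL-Library.Function_Algebras"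
begin

text \<open>
  The geodesic cycles are the closed walks of the transfer operator that moves an oriented edge of the
  building to the edges continuing it geodesically; hence the edge eigenvalues are the nonzero eigenvalues
  of this operator. Read on functions on \<open>G\<close> that are right invariant under a parabolic subgroup, one step
  is a Hecke operator \<open>T\<^sub>w\<close>, and the steps along half of a closed geodesic in an apartment multiply, with
  lengths adding up, to the longest element \<open>w\<^sub>S\<close> up to a parabolic factor. So an eigenvector \<open>f\<close> satisfies
  \<open>\<alpha>\<^sup>M f = \<kappa> T\<^sub>S\<^sup>2\<^sup>j f\<close>, where \<open>T\<^sub>S\<close> is the Hecke operator of \<open>w\<^sub>S\<close> and \<open>\<kappa>\<close> is a product of indices
  \<open>q\<^sub>w = \<bar>B w B\<bar> / \<bar>B\<bar>\<close>. As \<open>T\<^sub>S\<^sup>2\<close> is central in the Hecke algebra, the generators \<open>T\<^sub>s\<close> act on its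
  eigenspaces with eigenvalues \<open>q\<^sub>s\<close> and \<open>-1\<close> only, and determinants show that a power of \<open>\<alpha>\<close> is a quotient
  of products of indices, up to sign.

  It remains to see that these indices are powers of the characteristic \<open>p\<close>. Every
  matrix over the algebraic closure of a finite field has finite order, which gives elementary proofs of
  the Lie--Kolchin theorem and of the decomposition of a Borel subgroup into its elements of \<open>p\<close>-power order
  and a maximal torus. The decomposition passes to the points fixed by the Steinberg endomorphism, and the
  torus is normalised by \<open>N\<close>, so the index is the index of a subgroup in a \<open>p\<close>-group.
\<close>

hide_const (open) Determinant.det Matrix.mat

text \<open>Only \<open>T_S^2\<close> is central: conjugation by \<open>w_S\<close> permutes the
  generators, so \<open>T_S\<close> merely turns \<open>T_s\<close> into \<open>T_t\<close> with t
  the conjugate of s, and its own eigenspaces need not be stable under the generators. On an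
  eigenspace E of \<open>T_S^(2m)\<close> the operator is a scalar and at the same time a product of
  generators read off from a reduced word. Taking determinants equates the dim(E)-th power of the
  scalar with a product of numbers \<open>q_s\<close> and -1, without any knowledge of the
  representations of the Hecke algebra or of multiplicities. The number m comes from a pigeonhole
  argument: a half circle carries an ordered pair of types to another ordered pair, there are
  finitely many pairs, and injectivity of the Hecke operators keeps the functions nonzero along the
  way. A final squaring removes the sign. The set S is given only through the axioms of a BN-pair,
  so the exchange condition has to be derived from them, and the indices are computed cell by cell,
  through the torus and the elements of p-power order of B and not through root subgroups.\<close>

lemma (in group) inv_mult_cancel [simp]:
  "x \<in> carrier G \<Longrightarrow> y \<in> carrier G \<Longrightarrow> inv x \<otimes> (x \<otimes> y) = y"
  "x \<in> carrier G \<Longrightarrow> y \<in> carrier G \<Longrightarrow> x \<otimes> (inv x \<otimes> y) = y"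
  by (simp_all add: m_assoc[symmetric])

section \<open>Groups generated by involutions: words and length\<close>

locale involutive_generators = group W for W :: "('a, 'b) monoid_scheme" (structure) +
  fixes S :: "'a set"
  assumes S_sub: "S \<subseteq> carrier W"
    and S_gen: "generate W S = carrier W"
    and S_invol: "s \<in> S \<Longrightarrow> s \<noteq> \<one> \<and> s \<otimes> s = \<one>"
begin

definition word :: "'a list \<Rightarrow> 'a" where "word ss = foldr (\<otimes>) ss \<one>"

lemma word_Nil [simp]: "word [] = \<one>" and word_Cons [simp]: "word (s # ss) = s \<otimes> word ss"
  by (simp_all add: word_def)

text \<open>The same \<open>LEAST\<close> as in \<open>weyl_length\<close>, so that the two lengths
  are identified by unfolding once a BN-pair is known to be an instance.\<close>

definition len :: "'a \<Rightarrow> nat" where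
  "len w = (LEAST n. \<exists>ss. set ss \<subseteq> S \<and> length ss = n \<and> w = word ss)"

lemma S_carrier [simp, intro]: "s \<in> S \<Longrightarrow> s \<in> carrier W"
  using S_sub by auto

lemma S_square [simp]: "s \<in> S \<Longrightarrow> s \<otimes> s = \<one>"
  using S_invol by auto

lemma S_inv [simp]: "s \<in> S \<Longrightarrow> inv s = s"
  by (simp add: inv_equality)

lemma S_cancel [simp]: "s \<in> S \<Longrightarrow> x \<in> carrier W \<Longrightarrow> s \<otimes> (s \<otimes> x) = x"
  by (simp add: m_assoc[symmetric])

lemma S_cancel_right [simp]: "s \<in> S \<Longrightarrow> x \<in> carrier W \<Longrightarrow> x \<otimes> s \<otimes> s = x"
  by (simp add: m_assoc)

lemma word_closed [simp]: "set ss \<subseteq> S \<Longrightarrow> word ss \<in> carrier W"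
  by (induction ss) auto

lemma word_append: "set ss \<subseteq> S \<Longrightarrow> set ts \<subseteq> S \<Longrightarrow> word (ss @ ts) = word ss \<otimes> word ts"
  by (induction ss) (auto simp: m_assoc)

lemma word_rev: "set ss \<subseteq> S \<Longrightarrow> word (rev ss) = inv (word ss)"
proof (induction ss)
  case (Cons s ss)
  then have "word (rev (s # ss)) = inv (word ss) \<otimes> s"
    by (simp add: word_append)
  with Cons show ?case by (simp add: inv_mult_group)
qed simp

lemma parabolic_iff_word:
  assumes "I \<subseteq> S"
  shows "w \<in> generate W I \<longleftrightarrow> (\<exists>ss. set ss \<subseteq> I \<and> w = word ss)"
proof
  assume "w \<in> generate W I"
  then show "\<exists>ss. set ss \<subseteq> I \<and> w = word ss"
  proof (induction rule: generate.induct)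
    case one
    show ?case by (rule exI[of _ "[]"]) simp
  next
    case (incl h)
    then show ?case using assms by (intro exI[of _ "[h]"]) auto
  next
    case (inv h)
    then show ?case using assms S_inv by (intro exI[of _ "[h]"]) auto
  next
    case (eng h1 h2)
    then obtain ss ts where "set ss \<subseteq> I" "h1 = word ss" "set ts \<subseteq> I" "h2 = word ts" by auto
    then show ?case using assms by (intro exI[of _ "ss @ ts"]) (auto simp: word_append subset_trans)
  qed
next
  have "set ss \<subseteq> I \<Longrightarrow> word ss \<in> generate W I" for ss
    by (induction ss) (auto intro: generate.intros)
  then show "\<exists>ss. set ss \<subseteq> I \<and> w = word ss \<Longrightarrow> w \<in> generate W I" by auto
qed

lemma parabolic_subgroup: "I \<subseteq> S \<Longrightarrow> subgroup (generate W I) W"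
  by (rule generate_is_subgroup[OF subset_trans[OF _ S_sub]])

lemma parabolic_carrier [intro]: "I \<subseteq> S \<Longrightarrow> w \<in> generate W I \<Longrightarrow> w \<in> carrier W"
  by (rule subgroup.mem_carrier[OF parabolic_subgroup])

lemma parabolic_mult [intro]:
  "I \<subseteq> S \<Longrightarrow> x \<in> generate W I \<Longrightarrow> y \<in> generate W I \<Longrightarrow> x \<otimes> y \<in> generate W I"
  by (rule generate.eng)

lemma parabolic_inv [intro]: "I \<subseteq> S \<Longrightarrow> x \<in> generate W I \<Longrightarrow> inv x \<in> generate W I"
  by (rule subgroup.m_inv_closed[OF parabolic_subgroup])

lemma parabolic_incl [intro]: "s \<in> I \<Longrightarrow> s \<in> generate W I"
  by (rule generate.incl)

lemma parabolic_one [simp]: "\<one> \<in> generate W I"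
  by (rule generate.one)

lemma parabolic_mono: "I \<subseteq> J \<Longrightarrow> x \<in> generate W I \<Longrightarrow> x \<in> generate W J"
  using mono_generate by blast

lemma len_le: "set ss \<subseteq> S \<Longrightarrow> len (word ss) \<le> length ss"
  unfolding len_def by (rule Least_le) auto

lemma reduced_word:
  assumes "w \<in> carrier W"
  obtains ss where "set ss \<subseteq> S" "w = word ss" "length ss = len w"
proof -
  have "\<exists>n ss. set ss \<subseteq> S \<and> length ss = n \<and> w = word ss"
    using assms S_gen parabolic_iff_word[of S w] by auto
  then have "\<exists>ss. set ss \<subseteq> S \<and> length ss = len w \<and> w = word ss"
    unfolding len_def by (rule LeastI_ex)
  then show thesis using that by auto
qed

lemma len_one [simp]: "len \<one> = 0"
  using len_le[of "[]"] by simp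

lemma len_eq_0: "w \<in> carrier W \<Longrightarrow> len w = 0 \<longleftrightarrow> w = \<one>"
  by (metis length_0_conv reduced_word word_Nil len_one)

lemma len_mult: "x \<in> carrier W \<Longrightarrow> y \<in> carrier W \<Longrightarrow> len (x \<otimes> y) \<le> len x + len y"
proof -
  assume "x \<in> carrier W" "y \<in> carrier W"
  then obtain ss ts where "set ss \<subseteq> S" "x = word ss" "length ss = len x"
     "set ts \<subseteq> S" "y = word ts" "length ts = len y"
    by (metis reduced_word)
  then show ?thesis using len_le[of "ss @ ts"] by (simp add: word_append)
qed

lemma len_inv_le: "x \<in> carrier W \<Longrightarrow> len (inv x) \<le> len x"
  by (metis len_le length_rev reduced_word set_rev word_rev)

lemma len_inv [simp]: "x \<in> carrier W \<Longrightarrow> len (inv x) = len x"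
  by (metis inv_closed inv_inv le_antisym len_inv_le)

lemma len_1_iff: "w \<in> carrier W \<Longrightarrow> len w = 1 \<longleftrightarrow> w \<in> S"
proof
  assume w: "w \<in> carrier W" and "len w = 1"
  then obtain ss where "set ss \<subseteq> S" "w = word ss" "length ss = 1" by (metis reduced_word)
  then show "w \<in> S" by (cases ss) auto
next
  assume w: "w \<in> carrier W" and s: "w \<in> S"
  then have "len w \<le> 1" using len_le[of "[w]"] by simp
  moreover have "len w \<noteq> 0" using len_eq_0 w s S_invol by auto
  ultimately show "len w = 1" by simp
qed

lemma len_S [simp]: "s \<in> S \<Longrightarrow> len s = 1"
  using len_1_iff by blast

lemma len_S_mult_le: "s \<in> S \<Longrightarrow> w \<in> carrier W \<Longrightarrow> len (s \<otimes> w) \<le> len w + 1"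
  using len_mult[of s w] by auto

lemma len_S_mult_ge: "s \<in> S \<Longrightarrow> w \<in> carrier W \<Longrightarrow> len w \<le> len (s \<otimes> w) + 1"
  using len_S_mult_le[of s "s \<otimes> w"] by auto

lemma len_mult_S_le: "s \<in> S \<Longrightarrow> w \<in> carrier W \<Longrightarrow> len (w \<otimes> s) \<le> len w + 1"
  using len_mult[of w s] by auto

lemma len_inv_mult: "x \<in> carrier W \<Longrightarrow> y \<in> carrier W \<Longrightarrow> len (inv x \<otimes> inv y) = len (y \<otimes> x)"
  by (metis inv_mult_group len_inv m_closed)

lemma ex_left_descent:
  assumes "w \<in> carrier W" "w \<noteq> \<one>"
  obtains s v where "s \<in> S" "v \<in> carrier W" "w = s \<otimes> v" "len w = len v + 1"
proof -
  obtain ss where ss: "set ss \<subseteq> S" "w = word ss" "length ss = len w"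
    using assms reduced_word by blast
  then obtain s ts where c: "ss = s # ts" using assms by (cases ss) auto
  then have w: "w = s \<otimes> word ts" and s: "s \<in> S" and t: "word ts \<in> carrier W"
    and l: "len (word ts) \<le> length ts"
    using ss len_le by auto
  have "len w \<le> len (word ts) + 1" unfolding w using len_S_mult_le s t by blast
  moreover have "len w = length ts + 1" using ss c by simp
  ultimately show thesis using that[OF s t w] l by linarith
qed

lemma ex_right_descent:
  assumes "w \<in> carrier W" "w \<noteq> \<one>"
  obtains s v where "s \<in> S" "v \<in> carrier W" "w = v \<otimes> s" "len w = len v + 1"
proof -
  have "inv w \<noteq> \<one>" "inv w \<in> carrier W" using assms inv_eq_1_iff by auto
  then obtain s v where sv: "s \<in> S" "v \<in> carrier W" "inv w = s \<otimes> v" "len (inv w) = len v + 1"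
    by (metis ex_left_descent)
  then have w: "w = inv v \<otimes> s" using assms by (metis S_carrier S_inv inv_inv inv_mult_group)
  show thesis by (rule that[OF sv(1) _ w]) (use sv(2,4) assms(1) in simp_all)
qed

end

section \<open>The exchange condition and reduced coset representatives\<close>

locale exchange_system = involutive_generators +
  assumes exchange_word: "\<lbrakk>s \<in> S; set ss \<subseteq> S; len (word ss) = length ss; len (s \<otimes> word ss) \<le> length ss\<rbrakk>
     \<Longrightarrow> \<exists>as a bs. ss = as @ a # bs \<and> s \<otimes> word ss = word (as @ bs)"
begin

text \<open>Exchange is assumed for \<open>len (s \<otimes> word ss) \<le> length ss\<close>,
  equality included. In the case of equality a letter would still be deleted, which leaves too short
  a word. No sign character of the group enters.\<close>

lemma len_S_mult_neq: "s \<in> S \<Longrightarrow> w \<in> carrier W \<Longrightarrow> len (s \<otimes> w) \<noteq> len w"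
proof
  assume s: "s \<in> S" and w: "w \<in> carrier W" and l: "len (s \<otimes> w) = len w"
  obtain ss where ss: "set ss \<subseteq> S" "w = word ss" "length ss = len w" using w reduced_word by blast
  then obtain as a bs where "ss = as @ a # bs" "s \<otimes> w = word (as @ bs)"
    using exchange_word[of s ss] s l by auto
  then have "len (s \<otimes> w) \<le> length ss - 1" "length ss \<ge> 1" using len_le[of "as @ bs"] ss by auto
  then show False using l ss by auto
qed

lemma len_S_mult_less: "s \<in> S \<Longrightarrow> w \<in> carrier W \<Longrightarrow> \<not> len w < len (s \<otimes> w) \<Longrightarrow> len w = len (s \<otimes> w) + 1"
  using len_S_mult_neq[of s w] len_S_mult_ge[of s w] by linarith

lemma len_S_mult_greater: "s \<in> S \<Longrightarrow> w \<in> carrier W \<Longrightarrow> \<not> len (s \<otimes> w) < len w \<Longrightarrow> len (s \<otimes> w) = len w + 1"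
  using len_S_mult_neq[of s w] len_S_mult_le[of s w] by linarith

lemma len_mult_S_inv: "s \<in> S \<Longrightarrow> w \<in> carrier W \<Longrightarrow> len (w \<otimes> s) = len (s \<otimes> inv w)"
  using len_inv_mult[of s w] by simp

lemma len_mult_S_greater: "s \<in> S \<Longrightarrow> w \<in> carrier W \<Longrightarrow> \<not> len (w \<otimes> s) < len w \<Longrightarrow> len (w \<otimes> s) = len w + 1"
  using len_S_mult_greater[of s "inv w"] by (simp add: len_mult_S_inv)

text \<open>Letters are prepended one at a time. Either the length grows, or exchange deletes a
  letter of the reduced word found so far; in neither case does a letter appear that was not
  there.\<close>

lemma reduced_word_subset:
  assumes "set ss \<subseteq> S"
  shows "\<exists>ts. set ts \<subseteq> set ss \<and> word ts = word ss \<and> len (word ss) = length ts"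
  using assms
proof (induction ss)
  case (Cons a ss)
  then obtain ts where ts: "set ts \<subseteq> set ss" "word ts = word ss" "len (word ss) = length ts" by auto
  have tS: "set ts \<subseteq> S" and a: "a \<in> S" and c: "word ts \<in> carrier W" using ts Cons.prems by auto
  show ?case
  proof (cases "len (a \<otimes> word ts) \<le> length ts")
    case False
    then have "len (a \<otimes> word ts) = length (a # ts)" using len_S_mult_le[OF a c] ts by auto
    then show ?thesis using ts Cons.prems by (intro exI[of _ "a # ts"]) auto
  next
    case True
    then obtain as b bs where e: "ts = as @ b # bs" "a \<otimes> word ts = word (as @ bs)"
      using exchange_word[of a ts] a tS ts by auto
    then have "len (a \<otimes> word ts) \<le> length (as @ bs)" using len_le[of "as @ bs"] tS by auto
    then have "len (a \<otimes> word ts) = length (as @ bs)"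
      using len_S_mult_ge[OF a c] ts e by simp
    then show ?thesis using ts e by (intro exI[of _ "as @ bs"]) auto
  qed
qed simp

lemma parabolic_reduced_word:
  assumes "I \<subseteq> S" "w \<in> generate W I"
  obtains ss where "set ss \<subseteq> I" "w = word ss" "length ss = len w"
proof -
  obtain ss where "set ss \<subseteq> I" "w = word ss" using assms parabolic_iff_word by auto
  then show thesis using reduced_word_subset[of ss] assms that by (metis subset_trans)
qed

lemma parabolic_Int_S: "I \<subseteq> S \<Longrightarrow> s \<in> S \<Longrightarrow> s \<in> generate W I \<Longrightarrow> s \<in> I"
proof -
  assume I: "I \<subseteq> S" and s: "s \<in> S" "s \<in> generate W I"
  obtain ss where ss: "set ss \<subseteq> I" "s = word ss" "length ss = len s"
    using parabolic_reduced_word[OF I s(2)] by blast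
  then have "length ss = 1" using s by simp
  then show ?thesis using I ss(1,2) by (cases ss) auto
qed

text \<open>Exchange writes \<open>s \<otimes> w\<close> as a subword of a reduced word over
  \<open>I\<close>, so \<open>s\<close> itself is a quotient of two elements of the parabolic
  subgroup.\<close>

lemma parabolic_descent:
  assumes I: "I \<subseteq> S" and w: "w \<in> generate W I" and s: "s \<in> S" and l: "len (s \<otimes> w) < len w"
  shows "s \<in> I"
proof -
  obtain ss where ss: "set ss \<subseteq> I" "w = word ss" "length ss = len w"
    using parabolic_reduced_word I w by blast
  then obtain as a bs where e: "ss = as @ a # bs" "s \<otimes> w = word (as @ bs)"
    using exchange_word[OF s subset_trans[OF ss(1) I]] l by (metis less_imp_le_nat)
  then have sw: "s \<otimes> w \<in> generate W I" using ss parabolic_iff_word[OF I] by (metis set_append Un_subset_iff set_subset_Cons subset_trans)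
  have "s = (s \<otimes> w) \<otimes> inv w" using s w I parabolic_carrier by (simp add: m_assoc)
  also have "\<dots> \<in> generate W I" using sw w I by blast
  finally show ?thesis using parabolic_Int_S I s by blast
qed

lemma parabolic_descent_right:
  assumes I: "I \<subseteq> S" and w: "w \<in> generate W I" and s: "s \<in> S" and l: "len (w \<otimes> s) < len w"
  shows "s \<in> I"
  using parabolic_descent[OF I parabolic_inv[OF I w] s] l len_mult_S_inv[OF s] parabolic_carrier[OF I w]
  by simp

text \<open>Every reduced expression is meant, not only a suitable one: its first letter is a left
  descent, hence lies in \<open>I\<close>, and can be stripped. Intersections of parabolic subgroups
  and the two-factor exchange rest on this.\<close>

lemma parabolic_reduced_letters:
  assumes I: "I \<subseteq> S"
  shows "set ss \<subseteq> S \<Longrightarrow> word ss \<in> generate W I \<Longrightarrow> len (word ss) = length ss \<Longrightarrow> set ss \<subseteq> I"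
proof (induction ss)
  case (Cons a ss)
  have a: "a \<in> S" and c: "word ss \<in> carrier W" using Cons.prems by auto
  have "len (word ss) \<le> length ss" using len_le Cons.prems by auto
  then have l: "len (word ss) = length ss" using len_S_mult_le[OF a c] Cons.prems by simp
  have "len (a \<otimes> word (a # ss)) < len (word (a # ss))" using l a c Cons.prems by simp
  then have aI: "a \<in> I" using parabolic_descent[OF I Cons.prems(2) a] by blast
  have "a \<otimes> word (a # ss) \<in> generate W I" using aI Cons.prems(2) I by blast
  then have "word ss \<in> generate W I" using a c by simp
  then show ?case using Cons l aI by auto
qed simp

lemma parabolic_Int:
  assumes I: "I \<subseteq> S" and J: "J \<subseteq> S"
  shows "generate W I \<inter> generate W J = generate W (I \<inter> J)"
proof
  show "generate W (I \<inter> J) \<subseteq> generate W I \<inter> generate W J"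
    using parabolic_mono by (meson Int_lower1 Int_lower2 le_inf_iff subsetI)
  show "generate W I \<inter> generate W J \<subseteq> generate W (I \<inter> J)"
  proof
    fix w assume w: "w \<in> generate W I \<inter> generate W J"
    then obtain ss where ss: "set ss \<subseteq> I" "w = word ss" "length ss = len w"
      using parabolic_reduced_word I by blast
    then have "set ss \<subseteq> J" using parabolic_reduced_letters[OF J, of ss] w I by auto
    then show "w \<in> generate W (I \<inter> J)" using ss parabolic_iff_word[of "I \<inter> J" w] I by auto
  qed
qed

text \<open>The letter removed by the exchange condition lies in one of the two factors.\<close>

lemma exchange_mult_left:
  assumes x: "x \<in> carrier W" and y: "y \<in> carrier W" and l: "len (x \<otimes> y) = len x + len y"
    and s: "s \<in> S" and d: "len (s \<otimes> (x \<otimes> y)) \<le> len (x \<otimes> y)"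
  shows "len (s \<otimes> x) < len x \<or>
    (\<exists>y'\<in>carrier W. len y' < len y \<and> s \<otimes> (x \<otimes> y) = x \<otimes> y' \<and>
        (\<forall>A. A \<subseteq> S \<longrightarrow> y \<in> generate W A \<longrightarrow> y' \<in> generate W A))"
proof -
  obtain ss ts where ss: "set ss \<subseteq> S" "x = word ss" "length ss = len x"
    and ts: "set ts \<subseteq> S" "y = word ts" "length ts = len y"
    by (metis reduced_word x y)
  have w: "x \<otimes> y = word (ss @ ts)" using ss ts by (simp add: word_append)
  then obtain as a bs where e: "ss @ ts = as @ a # bs" "s \<otimes> (x \<otimes> y) = word (as @ bs)"
    using exchange_word[of s "ss @ ts"] s ss ts l d by auto
  from e(1) consider (1) us where "ss = as @ a # us" "bs = us @ ts"
    | (2) us where "as = ss @ us" "ts = us @ a # bs"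
    by (auto simp: append_eq_append_conv2 append_eq_Cons_conv)
  then show ?thesis
  proof cases
    case 1
    then have "s \<otimes> (x \<otimes> y) = word (as @ us) \<otimes> y" using e ss ts by (simp add: word_append m_assoc)
    then have "(s \<otimes> x) \<otimes> y = word (as @ us) \<otimes> y" using s x y by (simp add: m_assoc)
    then have "s \<otimes> x = word (as @ us)" using s x y ss 1 by (subst (asm) r_cancel) auto
    then have "len (s \<otimes> x) \<le> length (as @ us)" using len_le[of "as @ us"] ss 1 by simp
    then show ?thesis using 1 ss by simp
  next
    case 2
    have u: "set (us @ bs) \<subseteq> S" using 2 ts by auto
    have "s \<otimes> (x \<otimes> y) = x \<otimes> word (us @ bs)" using 2 e ss ts by (simp add: word_append)
    moreover have "len (word (us @ bs)) < len y" using len_le[OF u] 2 ts by simp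
    moreover have "word (us @ bs) \<in> generate W A" if "A \<subseteq> S" "y \<in> generate W A" for A
    proof -
      have "set ts \<subseteq> A" using parabolic_reduced_letters[OF that(1) ts(1)] that(2) ts(2,3) by simp
      then have "set (us @ bs) \<subseteq> A" using 2(2) by auto
      then show ?thesis using parabolic_iff_word[OF that(1)] by blast
    qed
    ultimately show ?thesis using word_closed[OF u] by blast
  qed
qed

lemma exchange_mult_right:
  assumes x: "x \<in> carrier W" and y: "y \<in> carrier W" and l: "len (x \<otimes> y) = len x + len y"
    and s: "s \<in> S" and d: "len (x \<otimes> y \<otimes> s) \<le> len (x \<otimes> y)"
  shows "len (y \<otimes> s) < len y \<or>
    (\<exists>x'\<in>carrier W. len x' < len x \<and> x \<otimes> y \<otimes> s = x' \<otimes> y)"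
proof -
  have i: "inv (x \<otimes> y) = inv y \<otimes> inv x" using x y by (simp add: inv_mult_group)
  have c: "s \<otimes> (inv y \<otimes> inv x) = inv (x \<otimes> y \<otimes> s)" using x y s by (simp add: inv_mult_group m_assoc)
  have "len (inv y \<otimes> inv x) = len (inv y) + len (inv x)" using l x y by (simp flip: i)
  moreover have "len (s \<otimes> (inv y \<otimes> inv x)) \<le> len (inv y \<otimes> inv x)"
    using d x y s unfolding c by (simp flip: i)
  ultimately consider "len (s \<otimes> inv y) < len (inv y)"
    | z where "z \<in> carrier W" "len z < len (inv x)" "s \<otimes> (inv y \<otimes> inv x) = inv y \<otimes> z"
    using exchange_mult_left[of "inv y" "inv x" s] x y s by auto
  then show ?thesis
  proof cases
    case 1
    then show ?thesis using len_mult_S_inv[OF s y] y by simp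
  next
    case 2
    then have "inv (inv (x \<otimes> y \<otimes> s)) = inv (inv y \<otimes> z)" unfolding c by simp
    then have "x \<otimes> y \<otimes> s = inv z \<otimes> y" using x y s 2(1) by (simp add: inv_mult_group)
    then show ?thesis using 2 x by (intro disjI2 bexI[of _ "inv z"]) auto
  qed
qed

definition reduced_right :: "'a set \<Rightarrow> 'a \<Rightarrow> bool" where
  "reduced_right J x \<longleftrightarrow> (\<forall>s\<in>J. len x < len (x \<otimes> s))"

definition reduced_left :: "'a set \<Rightarrow> 'a \<Rightarrow> bool" where
  "reduced_left J x \<longleftrightarrow> (\<forall>s\<in>J. len x < len (s \<otimes> x))"

text \<open>The element \<open>u\<close> is built letter by letter. If a letter \<open>s\<close>
  failed to lengthen \<open>x \<otimes> v\<close>, exchange would remove a letter of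
  \<open>v\<close>, against the reducedness of \<open>u\<close>, or one of \<open>x\<close>, giving
  a shorter element of the coset \<open>x W_J\<close>.\<close>

lemma coset_minimal_len:
  assumes J: "J \<subseteq> S" and x: "x \<in> carrier W"
    and m: "\<And>v. v \<in> generate W J \<Longrightarrow> len x \<le> len (x \<otimes> v)"
    and u: "u \<in> generate W J"
  shows "len (x \<otimes> u) = len x + len u"
  using u
proof (induction "len u" arbitrary: u)
  case 0
  then have "u = \<one>" using len_eq_0 parabolic_carrier[OF J] by metis
  then show ?case using x by simp
next
  case (Suc n)
  have uc: "u \<in> carrier W" and u1: "u \<noteq> \<one>" using Suc parabolic_carrier[OF J] by auto
  obtain s v where s: "s \<in> S" "v \<in> carrier W" "u = v \<otimes> s" "len u = len v + 1"
    by (rule ex_right_descent[OF uc u1])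
  have sJ: "s \<in> J" using parabolic_descent_right[OF J Suc.prems s(1)] s by simp
  have "v = u \<otimes> s" using s(1-3) by simp
  then have vJ: "v \<in> generate W J" using sJ Suc.prems J by blast
  have lv: "len (x \<otimes> v) = len x + len v" using Suc.hyps(1)[of v] Suc.hyps(2) s vJ by simp
  have e: "x \<otimes> u = x \<otimes> v \<otimes> s" using s x by (simp add: m_assoc)
  show ?case
  proof (cases "len (x \<otimes> v \<otimes> s) \<le> len (x \<otimes> v)")
    case True
    then consider "len (v \<otimes> s) < len v"
      | x' where "x' \<in> carrier W" "len x' < len x" "x \<otimes> v \<otimes> s = x' \<otimes> v"
      using exchange_mult_right[OF x s(2) lv s(1)] by auto
    then show ?thesis
    proof cases
      case 1
      then show ?thesis using s by simp
    next
      case 2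
      have "x' = x \<otimes> (v \<otimes> s \<otimes> inv v)"
        using 2 x s by (metis S_carrier inv_closed inv_solve_right m_assoc m_closed)
      moreover have "v \<otimes> s \<otimes> inv v \<in> generate W J" using vJ sJ J by blast
      ultimately show ?thesis using m 2 by fastforce
    qed
  next
    case False
    then show ?thesis using e lv s len_mult_S_le[OF s(1), of "x \<otimes> v"] x by auto
  qed
qed

lemma ex_coset_minimal:
  assumes J: "J \<subseteq> S" and w: "w \<in> carrier W"
  obtains x u where "x \<in> carrier W" "u \<in> generate W J" "w = x \<otimes> u"
    "\<And>v. v \<in> generate W J \<Longrightarrow> len x \<le> len (x \<otimes> v)"
proof -
  obtain v where v: "v \<in> generate W J" "\<And>v'. v' \<in> generate W J \<Longrightarrow> len (w \<otimes> v) \<le> len (w \<otimes> v')"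
    using ex_min_if_finite ex_has_least_nat[of "\<lambda>v. v \<in> generate W J" \<one> "\<lambda>v. len (w \<otimes> v)"] by auto
  have vc: "v \<in> carrier W" using v J by blast
  show thesis
  proof
    show "w \<otimes> v \<in> carrier W" "inv v \<in> generate W J" "w = (w \<otimes> v) \<otimes> inv v"
      using w vc v J by (auto simp: m_assoc)
    fix u assume "u \<in> generate W J"
    moreover from this have "w \<otimes> v \<otimes> u = w \<otimes> (v \<otimes> u)" using J w vc by (intro m_assoc) auto
    ultimately show "len (w \<otimes> v) \<le> len (w \<otimes> v \<otimes> u)" using v J by auto
  qed
qed

text \<open>Passes from single generators to the whole coset: in \<open>x = y \<otimes> v\<close>
  with \<open>y\<close> shortest in the coset, the last letter of a nontrivial \<open>v\<close>
  would be a descent of \<open>x\<close> in \<open>J\<close>.\<close>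

lemma reduced_right_minimal:
  assumes J: "J \<subseteq> S" and x: "x \<in> carrier W" and r: "reduced_right J x" and u: "u \<in> generate W J"
  shows "len x \<le> len (x \<otimes> u)"
proof -
  obtain y v where y: "y \<in> carrier W" "v \<in> generate W J" "x = y \<otimes> v"
    "\<And>v. v \<in> generate W J \<Longrightarrow> len y \<le> len (y \<otimes> v)" using ex_coset_minimal[OF J x] by blast
  have vc: "v \<in> carrier W" using y J by blast
  have "v = \<one>"
  proof (rule ccontr)
    assume "v \<noteq> \<one>"
    then obtain s v' where s: "s \<in> S" "v' \<in> carrier W" "v = v' \<otimes> s" "len v = len v' + 1"
      using ex_right_descent[OF vc] by metis
    then have "s \<in> J" using parabolic_descent_right[OF J y(2) s(1)] by simp
    then have "len x < len (x \<otimes> s)" using r reduced_right_def by auto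
    moreover have "x \<otimes> s = y \<otimes> v'" using y s vc by (simp add: m_assoc)
    moreover have "len x = len y + len v" using coset_minimal_len[OF J y(1) y(4) y(2)] y by simp
    ultimately show False using len_mult[OF y(1) s(2)] s by simp
  qed
  then show ?thesis using y u by simp
qed

lemma reduced_right_len:
  "J \<subseteq> S \<Longrightarrow> x \<in> carrier W \<Longrightarrow> reduced_right J x \<Longrightarrow> u \<in> generate W J \<Longrightarrow> len (x \<otimes> u) = len x + len u"
  using coset_minimal_len reduced_right_minimal by blast

lemma minimal_reduced_right:
  assumes J: "J \<subseteq> S" and x: "x \<in> carrier W" and m: "\<And>v. v \<in> generate W J \<Longrightarrow> len x \<le> len (x \<otimes> v)"
  shows "reduced_right J x"
  unfolding reduced_right_def using coset_minimal_len[OF J x m] J by (auto simp: parabolic_incl subset_iff)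

text \<open>If \<open>m\<close> is a shortest element of the double coset, every other element is
  \<open>x \<otimes> m \<otimes> y\<close> with additive lengths for suitable \<open>x\<close> and
  \<open>y\<close>. An element reduced on both sides leaves no room for \<open>x\<close> and
  \<open>y\<close>. The lemma later pins down the double coset of opposition by its shortest
  representative.\<close>

lemma double_coset_reduced_unique:
  assumes A: "A \<subseteq> S" and B: "B \<subseteq> S" and d: "d \<in> carrier W" "reduced_left A d" "reduced_right B d"
    and d': "d' \<in> carrier W" "reduced_left A d'" "reduced_right B d'"
    and u: "u \<in> generate W A" and v: "v \<in> generate W B" and e: "d' = u \<otimes> d \<otimes> v"
  shows "d' = d"
proof -
  let ?D = "{u \<otimes> d \<otimes> v | u v. u \<in> generate W A \<and> v \<in> generate W B}"
  have "d \<in> ?D" using d by (force intro: exI[of _ \<one>])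
  then obtain m where m: "m \<in> ?D" "\<And>z. z \<in> ?D \<Longrightarrow> len m \<le> len z"
    using ex_has_least_nat[of "\<lambda>z. z \<in> ?D" d len] by auto
  then obtain p q where pq: "p \<in> generate W A" "q \<in> generate W B" "m = p \<otimes> d \<otimes> q" by auto
  have cA: "\<And>x. x \<in> generate W A \<Longrightarrow> x \<in> carrier W" and cB: "\<And>x. x \<in> generate W B \<Longrightarrow> x \<in> carrier W"
    using A B by auto
  have mc: "m \<in> carrier W" using pq cA cB d by simp
  have D: "x \<otimes> m \<otimes> y \<in> ?D" if "x \<in> generate W A" "y \<in> generate W B" for x y
  proof -
    have "x \<otimes> m \<otimes> y = (x \<otimes> p) \<otimes> d \<otimes> (q \<otimes> y)" using that pq cA cB d by (simp add: m_assoc)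
    then show ?thesis using that pq A B by blast
  qed
  have minA: "len m \<le> len (x \<otimes> m)" if "x \<in> generate W A" for x
    using D[OF that parabolic_one] m(2) mc cA[OF that] by simp
  have minB: "len m \<le> len (m \<otimes> y)" if "y \<in> generate W B" for y
    using D[OF parabolic_one that] m(2) mc cB[OF that] by simp
  \<comment> \<open>The factors are renegotiated at each letter: if multiplying by \<open>s\<close>
    shortens the product, the deleted letter comes from \<open>y'\<close>, from \<open>x'\<close>,
    or from \<open>m\<close>; the last would give a shorter \<open>m'\<close> in
    \<open>W_A m\<close>.\<close>
  have add: "\<exists>x'\<in>generate W A. \<exists>y'\<in>generate W B. word ss \<otimes> m \<otimes> y = x' \<otimes> m \<otimes> y' \<and>
        len (word ss \<otimes> m \<otimes> y) = len x' + len m + len y'"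
    if y: "y \<in> generate W B" and "set ss \<subseteq> A" for ss y
    using that(2)
  proof (induction ss)
    case Nil
    then show ?case using coset_minimal_len[OF B mc minB y] y mc cB[OF y] by (intro bexI[of _ \<one>] bexI[of _ y]) auto
  next
    case (Cons s ss)
    then obtain x' y' where h: "x' \<in> generate W A" "y' \<in> generate W B" "word ss \<otimes> m \<otimes> y = x' \<otimes> m \<otimes> y'"
        "len (word ss \<otimes> m \<otimes> y) = len x' + len m + len y'" by auto
    have sA: "s \<in> A" and s: "s \<in> S" and wc: "word ss \<in> carrier W" using Cons.prems A by auto
    note c = mc cA[OF h(1)] cB[OF h(2)] cB[OF y] wc S_carrier[OF s]
    let ?z = "x' \<otimes> m \<otimes> y'"
    have zc: "?z \<in> carrier W" using c by simp
    have e1: "word (s # ss) \<otimes> m \<otimes> y = s \<otimes> ?z" using h(3) c by (simp add: m_assoc)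
    have e2: "s \<otimes> ?z = (s \<otimes> x') \<otimes> m \<otimes> y'" using c by (simp add: m_assoc)
    have sx: "s \<otimes> x' \<in> generate W A" using sA h A by blast
    have lz: "len ?z = len x' + len m + len y'" using h by simp
    have ub: "len (s \<otimes> ?z) \<le> len (s \<otimes> x') + len m + len y'"
      unfolding e2 using len_mult[of "s \<otimes> x' \<otimes> m" y'] len_mult[of "s \<otimes> x'" m] c by simp
    have lxm: "len (x' \<otimes> m) = len x' + len m"
      using lz len_mult[of "x' \<otimes> m" y'] len_mult[of x' m] c by simp
    show ?case
    proof (cases "len (s \<otimes> ?z) \<le> len ?z")
      case False
      then have "len (s \<otimes> ?z) = len (s \<otimes> x') + len m + len y'"
        using ub lz len_S_mult_le[OF s c(2)] by linarith
      then show ?thesis using e1 e2 sx h(2) by metis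
    next
      case True
      then have l1: "len (s \<otimes> ?z) + 1 = len ?z" using len_S_mult_less[OF s zc] by simp
      have *: ?thesis if "len (s \<otimes> x') < len x'"
      proof -
        have "len (s \<otimes> ?z) = len (s \<otimes> x') + len m + len y'" using that l1 lz ub by linarith
        then show ?thesis using e1 e2 sx h(2) by metis
      qed
      consider "len (s \<otimes> (x' \<otimes> m)) < len (x' \<otimes> m)"
        | y'' where "y'' \<in> carrier W" "len y'' < len y'" "s \<otimes> ?z = x' \<otimes> m \<otimes> y''" "y'' \<in> generate W B"
        using exchange_mult_left[of "x' \<otimes> m" y' s] c s lz lxm True B h(2) by auto
      then show ?thesis
      proof cases
        case 2
        have "len (s \<otimes> ?z) \<le> len x' + len m + len y''" unfolding 2(3)
          using len_mult[of "x' \<otimes> m" y''] lxm c 2(1) by simp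
        then have "len (s \<otimes> ?z) = len x' + len m + len y''" using l1 lz 2(2) by linarith
        then show ?thesis using e1 2 h(1) by metis
      next
        case 1
        then consider "len (s \<otimes> x') < len x'"
          | m' where "m' \<in> carrier W" "len m' < len m" "s \<otimes> (x' \<otimes> m) = x' \<otimes> m'"
          using exchange_mult_left[of x' m s] c s lxm by auto
        then show ?thesis
        proof cases
          case 1
          then show ?thesis by (rule *)
        next
          case 2
          have "inv x' \<otimes> (s \<otimes> (x' \<otimes> m)) = m'" using 2 c by (simp add: m_assoc[symmetric])
          then have "m' = (inv x' \<otimes> s \<otimes> x') \<otimes> m" using c by (simp add: m_assoc)
          moreover have "inv x' \<otimes> s \<otimes> x' \<in> generate W A" using h sA A by blast
          ultimately show ?thesis using minA 2(2) by fastforce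
        qed
      qed
    qed
  qed
  have uniq: "z = m" if z: "z \<in> ?D" "reduced_left A z" "reduced_right B z" for z
  proof -
    obtain x y where xy: "x \<in> generate W A" "y \<in> generate W B" "z = x \<otimes> d \<otimes> y" using z by auto
    have "z = (x \<otimes> inv p) \<otimes> m \<otimes> (inv q \<otimes> y)"
    proof -
      have "inv p \<otimes> (p \<otimes> d \<otimes> q \<otimes> (inv q \<otimes> y)) = d \<otimes> y"
        using cA[OF pq(1)] cB[OF pq(2)] d(1) cB[OF xy(2)] by (simp add: m_assoc)
      then show ?thesis unfolding xy(3) pq(3)
        using cA[OF pq(1)] cB[OF pq(2)] d(1) cB[OF xy(2)] cA[OF xy(1)] by (simp add: m_assoc)
    qed
    moreover have "x \<otimes> inv p \<in> generate W A" "inv q \<otimes> y \<in> generate W B" using xy pq A B by blast+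
    ultimately obtain x' y' where h: "x' \<in> generate W A" "y' \<in> generate W B" "z = x' \<otimes> m \<otimes> y'"
        "len z = len x' + len m + len y'"
      using add parabolic_iff_word[OF A] by metis
    note c = mc cA[OF h(1)] cB[OF h(2)]
    have "x' = \<one>"
    proof (rule ccontr)
      assume "x' \<noteq> \<one>"
      then obtain s t where s: "s \<in> S" "t \<in> carrier W" "x' = s \<otimes> t" "len x' = len t + 1"
        using ex_left_descent[OF c(2)] by metis
      then have "s \<in> A" using parabolic_descent[OF A h(1) s(1)] by simp
      then have "len z < len (s \<otimes> z)" using z(2) reduced_left_def by auto
      moreover have "s \<otimes> z = t \<otimes> m \<otimes> y'" using h s c by (simp add: m_assoc)
      ultimately show False using h(4) s(4) len_mult[of "t \<otimes> m" y'] len_mult[of t m] c s(2) by simp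
    qed
    moreover have "y' = \<one>"
    proof (rule ccontr)
      assume "y' \<noteq> \<one>"
      then obtain s t where s: "s \<in> S" "t \<in> carrier W" "y' = t \<otimes> s" "len y' = len t + 1"
        using ex_right_descent[OF c(3)] by metis
      then have "s \<in> B" using parabolic_descent_right[OF B h(2) s(1)] by simp
      then have "len z < len (z \<otimes> s)" using z(3) reduced_right_def by auto
      moreover have "z \<otimes> s = x' \<otimes> m \<otimes> t" using h s c by (simp add: m_assoc)
      ultimately show False using h(4) s(4) len_mult[of "x' \<otimes> m" t] len_mult[of x' m] c s(2) by simp
    qed
    ultimately show ?thesis using h(3) mc by simp
  qed
  show ?thesis using uniq[OF \<open>d \<in> ?D\<close> d(2,3)] uniq[of d'] d' u v e by auto
qed

end

text \<open>Splits an element of \<open>W_I\<close> off \<open>w\<close> with additive length. When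
  its reduced word \<open>u\<close> grows by \<open>t\<close>, the descent at \<open>t\<close>
  forces an exchange; \<open>u \<otimes> t\<close> being longer than \<open>u\<close>, the deleted
  letter sits in the other factor.\<close>

lemma (in exchange_system) all_descents_len:
  assumes w: "w \<in> carrier W" and I: "I \<subseteq> S" and d: "\<And>s. s \<in> I \<Longrightarrow> len (w \<otimes> s) < len w"
  shows "set ss \<subseteq> I \<Longrightarrow> len (word ss) = length ss \<Longrightarrow>
    len w = len (w \<otimes> inv (word ss)) + len (word ss)"
proof (induction ss rule: rev_induct)
  case Nil
  then show ?case using w by simp
next
  case (snoc t ss)
  have ssS: "set ss \<subseteq> S" and t: "t \<in> I" "t \<in> S" using snoc.prems I by auto
  let ?u = "word ss"
  let ?x = "w \<otimes> inv ?u"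
  have u: "?u \<in> carrier W" and x: "?x \<in> carrier W" using w ssS by auto
  have e: "word (ss @ [t]) = ?u \<otimes> t" using ssS t by (simp add: word_append)
  have "len ?u \<le> length ss" by (rule len_le[OF ssS])
  then have lu: "len ?u = length ss" "len (?u \<otimes> t) = len ?u + 1"
    using snoc.prems(2) len_mult_S_le[OF t(2) u] unfolding e by simp_all
  then have IH: "len w = len ?x + len ?u" using snoc by simp
  have w': "w = ?x \<otimes> ?u" using w u by (simp add: m_assoc)
  have "len (?x \<otimes> ?u \<otimes> t) \<le> len (?x \<otimes> ?u)" using d[OF t(1)] by (simp flip: w')
  moreover have "len (?x \<otimes> ?u) = len ?x + len ?u" using IH by (simp flip: w')
  ultimately obtain x' where x': "x' \<in> carrier W" "len x' < len ?x" "?x \<otimes> ?u \<otimes> t = x' \<otimes> ?u"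
    using exchange_mult_right[OF x u _ t(2)] lu by auto
  have "w = x' \<otimes> (?u \<otimes> t)"
  proof -
    have "w = ?x \<otimes> ?u \<otimes> t \<otimes> t" using t w w' by (metis S_cancel_right)
    then show ?thesis unfolding x'(3) using x'(1) u t by (simp add: m_assoc)
  qed
  then have "w \<otimes> inv (?u \<otimes> t) = x'" and "len w \<le> len x' + len (?u \<otimes> t)"
    using x' u t len_mult[of x' "?u \<otimes> t"] by (auto simp: m_assoc)
  then show ?case unfolding e using lu IH x'(2) by simp
qed

section \<open>Longest elements, elementary steps and half circles\<close>

locale finite_exchange_system = exchange_system +
  assumes finite_carrier: "finite (carrier W)"
begin

definition wlong :: "'a set \<Rightarrow> 'a" where
  "wlong I = (THE w. w \<in> generate W I \<and> (\<forall>v\<in>generate W I. len v \<le> len w))"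

context
  fixes I assumes I: "I \<subseteq> S"
begin

lemma finite_parabolic: "finite (generate W I)"
  using finite_subset[OF _ finite_carrier] I by blast

lemma maximal_descents:
  assumes w: "w \<in> generate W I" and m: "\<And>v. v \<in> generate W I \<Longrightarrow> len v \<le> len w" and s: "s \<in> I"
  shows "len (w \<otimes> s) < len w" "len (s \<otimes> w) < len w"
proof -
  have c: "w \<in> carrier W" "s \<in> S" using w s I by auto
  have "w \<otimes> s \<in> generate W I" "s \<otimes> w \<in> generate W I" using w s I by blast+
  then show "len (w \<otimes> s) < len w" "len (s \<otimes> w) < len w"
    using m len_mult_S_greater[OF c(2,1)] len_S_mult_greater[OF c(2,1)] by fastforce+
qed

lemma all_descents_parabolic_len:
  assumes w: "w \<in> generate W I" and d: "\<And>s. s \<in> I \<Longrightarrow> len (w \<otimes> s) < len w" and u: "u \<in> generate W I"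
  shows "len w = len (w \<otimes> inv u) + len u"
  using all_descents_len[OF parabolic_carrier[OF I w] I d] parabolic_reduced_word[OF I u] by metis

text \<open>The working criterion for longest elements: if all of \<open>I\<close> are right
  descents, each element of \<open>W_I\<close> splits off with additive length, so none is longer,
  and one of equal length differs from \<open>w\<close> by an element of length 0.\<close>

lemma wlong_eqI:
  assumes w: "w \<in> generate W I" and d: "\<And>s. s \<in> I \<Longrightarrow> len (w \<otimes> s) < len w"
  shows "wlong I = w"
  unfolding wlong_def
proof (rule the_equality)
  show "w \<in> generate W I \<and> (\<forall>v\<in>generate W I. len v \<le> len w)"
    using w all_descents_parabolic_len[OF w d] by (metis le_add2)
  fix v assume v: "v \<in> generate W I \<and> (\<forall>u\<in>generate W I. len u \<le> len v)"
  have "len w = len (w \<otimes> inv v) + len v" using all_descents_parabolic_len[OF w d] v by blast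
  then have "len (w \<otimes> inv v) = 0" using v w by force
  then have "w \<otimes> inv v = \<one>" using len_eq_0 parabolic_carrier[OF I] w v by simp
  then show "v = w" using parabolic_carrier[OF I] w v by (metis inv_comm inv_equality inv_inv inv_closed)
qed

lemma wlong_maximal: "wlong I \<in> generate W I \<and> (\<forall>v\<in>generate W I. len v \<le> len (wlong I))"
proof -
  obtain w where w: "w \<in> generate W I" "\<And>v. v \<in> generate W I \<Longrightarrow> len v \<le> len w"
  proof -
    have "Max (len ` generate W I) \<in> len ` generate W I"
      by (intro Max_in finite_imageI finite_parabolic) (use parabolic_one[of I] in blast)
    then obtain w where "w \<in> generate W I" "len w = Max (len ` generate W I)" by auto
    then show thesis using that[of w] finite_parabolic by simp
  qed
  then have "wlong I = w" using wlong_eqI maximal_descents(1) by blast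
  then show ?thesis using w by blast
qed

lemma wlong_in: "wlong I \<in> generate W I"
  using wlong_maximal by blast

lemma wlong_closed [simp]: "wlong I \<in> carrier W"
  using parabolic_carrier[OF I wlong_in] .

lemma wlong_descent: "s \<in> I \<Longrightarrow> len (wlong I \<otimes> s) < len (wlong I)"
  using maximal_descents(1) wlong_maximal by blast

lemma wlong_inv [simp]: "inv (wlong I) = wlong I"
proof (rule sym, rule wlong_eqI)
  show "inv (wlong I) \<in> generate W I" using wlong_in I by blast
  fix s assume s: "s \<in> I"
  then have "len (s \<otimes> wlong I) < len (wlong I)" using maximal_descents(2) wlong_maximal by blast
  then show "len (inv (wlong I) \<otimes> s) < len (inv (wlong I))"
    using len_mult_S_inv[of s "inv (wlong I)"] s I by (simp add: subset_iff)
qed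

lemma wlong_square [simp]: "wlong I \<otimes> wlong I = \<one>"
  using r_inv[of "wlong I"] by simp

lemma wlong_cancel [simp]: "x \<in> carrier W \<Longrightarrow> wlong I \<otimes> (wlong I \<otimes> x) = x"
  by (simp add: m_assoc[symmetric])

lemma wlong_len: "u \<in> generate W I \<Longrightarrow> len (wlong I) = len (wlong I \<otimes> u) + len u"
  using all_descents_parabolic_len[OF wlong_in wlong_descent parabolic_inv[OF I]] parabolic_carrier[OF I] by simp

text \<open>Multiplication by \<open>wlong I\<close> replaces a length by its complement within
  \<open>W_I\<close>, on either side; doing so twice sends length 1 to length 1.\<close>

lemma wlong_conj:
  assumes s: "s \<in> I"
  shows "wlong I \<otimes> s \<otimes> wlong I \<in> I"
proof -
  have sS: "s \<in> S" using s I by auto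
  have u: "s \<otimes> wlong I \<in> generate W I" using s wlong_in I by blast
  have 1: "len (wlong I) = len (wlong I \<otimes> s) + 1" using wlong_len[OF parabolic_incl[OF s]] sS by simp
  have 2: "len (s \<otimes> wlong I) = len (wlong I \<otimes> s)" using len_mult_S_inv[OF sS wlong_closed] by simp
  have "len (wlong I \<otimes> (s \<otimes> wlong I)) = 1" using wlong_len[OF u] 1 2 by simp
  moreover have e: "wlong I \<otimes> (s \<otimes> wlong I) = wlong I \<otimes> s \<otimes> wlong I" using sS by (simp add: m_assoc)
  ultimately have S: "wlong I \<otimes> s \<otimes> wlong I \<in> S" using len_1_iff[of "wlong I \<otimes> s \<otimes> wlong I"] sS by simp
  moreover have "wlong I \<otimes> (s \<otimes> wlong I) \<in> generate W I" using u wlong_in I by blast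
  ultimately show ?thesis using parabolic_Int_S[OF I] e by simp
qed

lemma wlong_conj_conj: "s \<in> carrier W \<Longrightarrow> wlong I \<otimes> (wlong I \<otimes> s \<otimes> wlong I) \<otimes> wlong I = s"
  by (simp add: m_assoc)

lemma wlong_conj_image: "(\<lambda>s. wlong I \<otimes> s \<otimes> wlong I) ` I = I"
proof
  show "(\<lambda>s. wlong I \<otimes> s \<otimes> wlong I) ` I \<subseteq> I" using wlong_conj by blast
  show "I \<subseteq> (\<lambda>s. wlong I \<otimes> s \<otimes> wlong I) ` I"
  proof
    fix s assume s: "s \<in> I"
    then have "s = wlong I \<otimes> (wlong I \<otimes> s \<otimes> wlong I) \<otimes> wlong I"
      using wlong_conj_conj[of s] I by auto
    then show "s \<in> (\<lambda>s. wlong I \<otimes> s \<otimes> wlong I) ` I" using wlong_conj[OF s] by blast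
  qed
qed

end

lemma finite_S: "finite S"
  using finite_subset[OF S_sub finite_carrier] .

text \<open>
  The elementary steps \<open>wlong K \<otimes> wlong J\<close>, where \<open>K\<close> arises from \<open>J\<close> by adding one reflection,
  generate the groupoid of elements carrying one standard simple system onto another.
\<close>

lemma elementary_step:
  assumes w: "w \<in> carrier W" and J: "J \<subseteq> S" and a: "a \<in> S" "a \<notin> J"
    and r: "reduced_right J w" and c: "\<And>j. j \<in> J \<Longrightarrow> w \<otimes> j \<otimes> inv w \<in> S"
    and d: "len (w \<otimes> a) < len w"
    and K: "K = insert a J" and x_def: "x = wlong K \<otimes> wlong J" and u_def: "u = w \<otimes> inv x"
  shows "len w = len u + len x" and "reduced_right K u"
    and "j \<in> J \<Longrightarrow> u \<otimes> (wlong K \<otimes> j \<otimes> wlong K) \<otimes> inv u \<in> S"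
proof -
  have KS: "K \<subseteq> S" and JK: "J \<subseteq> K" using K a J by auto
  \<comment> \<open>The claim amounts to \<open>y = x\<close>: it suffices to see that
    \<open>y \<otimes> wlong J\<close> is the longest element of \<open>W_K\<close>, up to
    inversion.\<close>
  obtain v y where v: "v \<in> carrier W" "y \<in> generate W K" "w = v \<otimes> y"
    "\<And>z. z \<in> generate W K \<Longrightarrow> len v \<le> len (v \<otimes> z)"
    using ex_coset_minimal[OF KS w] by blast
  have yc: "y \<in> carrier W" using v(2) KS by blast
  have add: "len (v \<otimes> z) = len v + len z" if "z \<in> generate W K" for z
    using coset_minimal_len[OF KS v(1,4) that] .
  have y1: "y \<noteq> \<one>"
    using v add[OF parabolic_incl, of a] d a K by auto
  define f where "f j = y \<otimes> j \<otimes> inv y" for j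
  \<comment> \<open>By the hypothesis on \<open>w\<close>, \<open>v \<otimes> f j\<close> is a
    generator times \<open>v\<close>. Lengths add in \<open>v W_K\<close>, so the nontrivial element
    \<open>f j\<close> has length 1, and conjugation by \<open>y\<close> maps \<open>J\<close> into
    \<open>K\<close>.\<close>
  have f: "f j \<in> K" "f j \<otimes> y = y \<otimes> j" if j: "j \<in> J" for j
  proof -
    have jS: "j \<in> S" using j J by auto
    have fW: "f j \<in> generate W K" unfolding f_def using v(2) j JK KS by blast
    have fc: "f j \<in> carrier W" using fW KS by blast
    show fy: "f j \<otimes> y = y \<otimes> j" unfolding f_def using yc jS by (simp add: m_assoc)
    have "v \<otimes> f j = (w \<otimes> j \<otimes> inv w) \<otimes> v"
      unfolding f_def v(3) using v(1) yc jS by (simp add: m_assoc inv_mult_group)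
    then have "len (v \<otimes> f j) \<le> 1 + len v"
      using len_mult[of "w \<otimes> j \<otimes> inv w" v] len_S[OF c[OF j]] w jS v(1) by simp
    then have "len (f j) \<le> 1" using add[OF fW] by simp
    moreover have "f j \<noteq> \<one>"
    proof
      assume "f j = \<one>"
      then have "y = y \<otimes> j" using fy yc by simp
      then have "j = \<one>" using yc jS by (metis S_carrier l_cancel_one')
      then show False using S_invol jS by blast
    qed
    ultimately have "len (f j) = 1" using len_eq_0[OF fc] by linarith
    then have "f j \<in> S" using len_1_iff[OF fc] by blast
    then show "f j \<in> K" using parabolic_Int_S[OF KS _ fW] by blast
  qed
  have injf: "inj_on f J"
    unfolding f_def inj_on_def using yc J by (auto simp: subset_iff)
  have rJ: "len y < len (y \<otimes> j)" if j: "j \<in> J" for j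
  proof -
    have "y \<otimes> j \<in> generate W K" using v(2) j JK KS by blast
    then have "len (v \<otimes> (y \<otimes> j)) = len v + len (y \<otimes> j)" by (rule add)
    moreover have "v \<otimes> (y \<otimes> j) = w \<otimes> j" using v yc j J by (simp add: m_assoc subset_iff)
    moreover have "len w < len (w \<otimes> j)" using r j reduced_right_def by blast
    ultimately show ?thesis using add[OF v(2)] v(3) by simp
  qed
  have JSfin: "finite J" "finite K" using finite_subset[OF J finite_S] finite_subset[OF KS finite_S] by auto
  have cardK: "card K = Suc (card (f ` J))" using card_image[OF injf] K a JSfin by simp
  have fJK: "f ` J \<subseteq> K" using f by auto
  \<comment> \<open>The map \<open>f\<close> is injective and \<open>K\<close> has one element more
    than \<open>J\<close>. A left descent of \<open>y\<close> cannot be some \<open>f j\<close>,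
    because \<open>f j \<otimes> y = y \<otimes> j\<close> is longer than \<open>y\<close>; so it is
    the one missing element of \<open>K\<close>.\<close>
  have "card (K - f ` J) = 1" using card_Diff_subset[OF finite_imageI[OF JSfin(1)] fJK] cardK by simp
  then obtain a' where a': "K - f ` J = {a'}" using card_1_singletonE by blast
  obtain s0 t where s0: "s0 \<in> S" "t \<in> carrier W" "y = s0 \<otimes> t" "len y = len t + 1"
    using ex_left_descent[OF yc y1] by metis
  have s0l: "len (s0 \<otimes> y) < len y" using s0 by simp
  have s0K: "s0 \<in> K" using parabolic_descent[OF KS v(2) s0(1) s0l] .
  have "s0 \<notin> f ` J"
  proof
    assume "s0 \<in> f ` J"
    then obtain j where "j \<in> J" "s0 = f j" by auto
    then show False using s0l rJ f(2) by fastforce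
  qed
  then have s0a: "s0 = a'" using a' s0K by auto
  let ?z = "y \<otimes> wlong J"
  have rrJ: "reduced_right J y" using rJ reduced_right_def by blast
  have zK: "?z \<in> generate W K" using v(2) wlong_in[OF J] parabolic_mono[OF JK] KS by blast
  have lz: "len ?z = len y + len (wlong J)" using reduced_right_len[OF J yc rrJ wlong_in[OF J]] .
  have zc: "?z \<in> carrier W" using yc J by simp
  \<comment> \<open>Elements of the image of \<open>J\<close> descend through
    \<open>wlong J\<close>, the missing one through \<open>y\<close>; together all of
    \<open>K\<close> are left descents.\<close>
  have desc: "len (s \<otimes> ?z) < len ?z" if s: "s \<in> K" for s
  proof (cases "s \<in> f ` J")
    case True
    then obtain j where j: "j \<in> J" "s = f j" by auto
    have jS: "j \<in> S" using j J by auto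
    have sc: "f j \<in> carrier W" using f(1)[OF j(1)] KS by auto
    have "s \<otimes> ?z = (f j \<otimes> y) \<otimes> wlong J" using j sc yc J by (simp add: m_assoc)
    also have "\<dots> = y \<otimes> (j \<otimes> wlong J)" unfolding f(2)[OF j(1)] using j yc J jS by (simp add: m_assoc)
    finally have "len (s \<otimes> ?z) \<le> len y + len (j \<otimes> wlong J)"
      using len_mult[OF yc, of "j \<otimes> wlong J"] J jS by simp
    moreover have "len (j \<otimes> wlong J) < len (wlong J)"
      using maximal_descents(2)[OF J wlong_in[OF J] _ j(1)] wlong_maximal[OF J] by blast
    ultimately show ?thesis using lz by linarith
  next
    case False
    then have "s = s0" using a' s s0a by auto
    then have "s \<otimes> ?z = t \<otimes> wlong J" using s0 J by (simp add: m_assoc)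
    then show ?thesis using len_mult[OF s0(2) wlong_closed[OF J]] lz s0(4) by simp
  qed
  have "wlong K = inv ?z"
  proof (rule wlong_eqI[OF KS])
    show "inv ?z \<in> generate W K" using zK KS by blast
    fix s assume s: "s \<in> K"
    then have "s \<in> S" using KS by auto
    then show "len (inv ?z \<otimes> s) < len (inv ?z)"
      using len_mult_S_inv[of s "inv ?z"] desc[OF s] zc by simp
  qed
  then have "wlong K = ?z" using zc wlong_inv[OF KS] by (metis inv_inv)
  then have xy: "x = y" unfolding x_def using yc J by (simp add: m_assoc)
  have uv: "u = v" unfolding u_def xy using v yc by (simp add: m_assoc)
  show "len w = len u + len x" unfolding uv xy using add[OF v(2)] v(3) by simp
  show "reduced_right K u" unfolding uv by (rule minimal_reduced_right[OF KS v(1,4)])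
  assume j: "j \<in> J"
  have jS: "j \<in> S" using j J by auto
  define i where "i = wlong J \<otimes> j \<otimes> wlong J"
  have i: "i \<in> J" "i \<in> S" unfolding i_def using wlong_conj[OF J j] J by auto
  have ij: "j = wlong J \<otimes> i \<otimes> wlong J" unfolding i_def using wlong_conj_conj[OF J] jS by simp
  have ix: "inv x = wlong J \<otimes> wlong K" unfolding x_def using J KS by (simp add: inv_mult_group)
  have "wlong K \<otimes> j \<otimes> wlong K = x \<otimes> i \<otimes> inv x"
    unfolding ix unfolding ij x_def using i(2) J KS by (simp add: m_assoc)
  then have "u \<otimes> (wlong K \<otimes> j \<otimes> wlong K) \<otimes> inv u = w \<otimes> i \<otimes> inv w"
    unfolding uv xy v(3) using v(1) yc i(2) by (simp add: m_assoc inv_mult_group)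
  then show "u \<otimes> (wlong K \<otimes> j \<otimes> wlong K) \<otimes> inv u \<in> S" using c[OF i(1)] by simp
qed

text \<open>\<open>straight w b a b0 a0 n\<close> records a geodesic of \<open>n\<close> turns in an
  apartment, from an oriented edge of types \<open>(b0, a0)\<close> to one of types
  \<open>(b, a)\<close>, with \<open>w\<close> the product of the turns. The edge before one of
  types \<open>(b, a)\<close> has types \<open>(r, b)\<close> with \<open>r\<close> the conjugate of
  \<open>a\<close>, which explains the premise. The length condition lets the Hecke operators
  multiply.\<close>

inductive straight :: "'a \<Rightarrow> 'a \<Rightarrow> 'a \<Rightarrow> 'a \<Rightarrow> 'a \<Rightarrow> nat \<Rightarrow> bool" where
  refl: "b \<in> S \<Longrightarrow> a \<in> S \<Longrightarrow> a \<noteq> b \<Longrightarrow> straight \<one> b a b a 0"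
| step: "\<lbrakk>straight u (wlong (S - {b}) \<otimes> a \<otimes> wlong (S - {b})) b b0 a0 n; u \<in> carrier W;
     b \<in> S; a \<in> S; a \<noteq> b; x = wlong (S - {b}) \<otimes> wlong (S - {b, a});
     len (u \<otimes> x) = len u + len x\<rbrakk> \<Longrightarrow> straight (u \<otimes> x) b a b0 a0 (Suc n)"

text \<open>As long as \<open>a\<close> is a descent, \<open>elementary_step\<close> removes one
  turn on the right. The remaining factor is reduced with respect to \<open>S - {b}\<close>, so if
  nontrivial it descends at \<open>b\<close>, and the hypotheses recur for the preceding pair of
  types.\<close>

lemma ex_straight:
  assumes "w \<in> carrier W" "b \<in> S" "a \<in> S" "a \<noteq> b" "reduced_right (S - {b, a}) w"
    and "\<And>j. j \<in> S - {b, a} \<Longrightarrow> w \<otimes> j \<otimes> inv w \<in> S"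
    and "w = \<one> \<or> len (w \<otimes> a) < len w"
  shows "\<exists>b0 a0 n. straight w b a b0 a0 n \<and> (w \<noteq> \<one> \<longrightarrow> n > 0) \<and> b0 \<in> S \<and> a0 \<in> S \<and> a0 \<noteq> b0"
  using assms
proof (induction "len w" arbitrary: w b a rule: less_induct)
  case less
  show ?case
  proof (cases "w = \<one>")
    case True
    then show ?thesis using straight.refl less.prems by blast
  next
    case False
    then have d: "len (w \<otimes> a) < len w" using less.prems by blast
    let ?J = "S - {b, a}" let ?K = "S - {b}"
    let ?x = "wlong ?K \<otimes> wlong ?J"
    define u where "u = w \<otimes> inv ?x"
    have J: "?J \<subseteq> S" "a \<notin> ?J" and K: "?K = insert a ?J" "?K \<subseteq> S" using less.prems by auto
    note st = elementary_step[OF less.prems(1) J(1) less.prems(3) J(2) less.prems(5,6) d K(1) HOL.refl u_def]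
    have xc: "?x \<in> carrier W" using J(1) K(2) by simp
    have uc: "u \<in> carrier W" unfolding u_def using less.prems(1) xc by simp
    have wux: "w = u \<otimes> ?x" unfolding u_def using less.prems(1) xc by (simp add: m_assoc)
    define a' where "a' = wlong ?K \<otimes> a \<otimes> wlong ?K"
    have aK: "a \<in> ?K" using less.prems by auto
    have a': "a' \<in> ?K" unfolding a'_def using wlong_conj[OF K(2) aK] .
    have "?x \<noteq> \<one>"
    proof
      assume "?x = \<one>"
      then have "reduced_right ?K w" using st(2) wux uc by simp
      then have "len w < len (w \<otimes> a)" using aK unfolding reduced_right_def by blast
      then show False using d by simp
    qed
    then have lx: "len ?x > 0" using len_eq_0[OF xc] by simp
    \<comment> \<open>The set for the new pair is the conjugate of the old one by the longest
      element of \<open>S - {b}\<close>; this carries over the condition on conjugates.\<close>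
    have img: "S - {a', b} = (\<lambda>j. wlong ?K \<otimes> j \<otimes> wlong ?K) ` ?J"
    proof -
      have inj: "inj_on (\<lambda>j. wlong ?K \<otimes> j \<otimes> wlong ?K) ?K"
        by (rule inj_on_inverseI[of _ "\<lambda>j. wlong ?K \<otimes> j \<otimes> wlong ?K"]) (use wlong_conj_conj[OF K(2)] in auto)
      have "(\<lambda>j. wlong ?K \<otimes> j \<otimes> wlong ?K) ` (?K - {a}) = ?K - {a'}"
        using inj_on_image_set_diff[OF inj Diff_subset, of "{a}"] aK wlong_conj_image[OF K(2)]
        by (simp add: a'_def)
      moreover have "?K - {a} = ?J" "?K - {a'} = S - {a', b}" by auto
      ultimately show ?thesis by simp
    qed
    have 1: "reduced_right (S - {a', b}) u" using st(2) unfolding reduced_right_def by blast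
    have 2: "u \<otimes> j \<otimes> inv u \<in> S" if "j \<in> S - {a', b}" for j
      using that st(3) unfolding img by blast
    have 3: "u = \<one> \<or> len (u \<otimes> b) < len u"
    proof (rule disjCI)
      assume nl: "\<not> len (u \<otimes> b) < len u"
      show "u = \<one>"
      proof (rule ccontr)
        assume "u \<noteq> \<one>"
        then obtain s v where s: "s \<in> S" "v \<in> carrier W" "u = v \<otimes> s" "len u = len v + 1"
          using ex_right_descent[OF uc] by metis
        then have l: "len (u \<otimes> s) < len u" by simp
        have "s \<notin> ?K"
        proof
          assume "s \<in> ?K"
          then have "len u < len (u \<otimes> s)" using st(2) unfolding reduced_right_def by blast
          then show False using l by simp
        qed
        then have "s = b" using s(1) by blast
        then show False using l nl by simp
      qed
    qed
    have ab': "a' \<in> S" "b \<noteq> a'" using a' by auto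
    obtain b0 a0 n where h: "straight u a' b b0 a0 n" "b0 \<in> S" "a0 \<in> S" "a0 \<noteq> b0"
      using less.hyps[OF _ uc ab'(1) less.prems(2) ab'(2) 1 2 3] st(1) lx by auto
    have "straight (u \<otimes> ?x) b a b0 a0 (Suc n)"
      by (rule straight.step[OF h(1)[unfolded a'_def] uc less.prems(2,3,4) HOL.refl]) (use st(1) wux in simp)
    then show ?thesis using h wux by (metis zero_less_Suc)
  qed
qed

text \<open>Multiplication by \<open>w_S\<close> complements lengths, so for \<open>w_S w_J\<close>
  the generator \<open>a\<close> is a descent while those in \<open>J\<close> are ascents.
  Conjugation by it maps \<open>J\<close> into \<open>S\<close>, because both longest elements
  permute their generators.\<close>

lemma ex_straight_half_circle:
  assumes b: "b \<in> S" and a: "a \<in> S" and ab: "a \<noteq> b"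
  shows "\<exists>b0 a0 n. straight (wlong S \<otimes> wlong (S - {b, a})) b a b0 a0 n \<and> n > 0 \<and> b0 \<in> S \<and> a0 \<in> S \<and> a0 \<noteq> b0"
proof -
  let ?J = "S - {b, a}" let ?w = "wlong S \<otimes> wlong ?J"
  have J: "?J \<subseteq> S" by auto
  have wc: "?w \<in> carrier W" using J by simp
  have l: "len (wlong S) = len (wlong S \<otimes> u) + len u" if "u \<in> carrier W" for u
    using wlong_len[OF subset_refl] that S_gen by simp
  have ls: "len (?w \<otimes> s) + len (wlong ?J \<otimes> s) = len (wlong S)" if "s \<in> S" for s
    using l[of "wlong ?J \<otimes> s"] that J by (simp add: m_assoc)
  have lw: "len ?w + len (wlong ?J) = len (wlong S)" using l[of "wlong ?J"] J by simp
  have d: "len (?w \<otimes> a) < len ?w"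
  proof -
    have "\<not> len (wlong ?J \<otimes> a) < len (wlong ?J)"
      using parabolic_descent_right[OF J wlong_in[OF J] a] by auto
    then have "len (wlong ?J \<otimes> a) = len (wlong ?J) + 1" using len_mult_S_greater[OF a wlong_closed[OF J]] by simp
    then show ?thesis using ls[OF a] lw by simp
  qed
  have 1: "reduced_right ?J ?w"
    unfolding reduced_right_def
  proof
    fix s assume s: "s \<in> ?J"
    then have "len (wlong ?J \<otimes> s) < len (wlong ?J)" using wlong_descent[OF J] by simp
    then show "len ?w < len (?w \<otimes> s)" using ls[of s] lw s by simp
  qed
  have 2: "?w \<otimes> j \<otimes> inv ?w \<in> S" if j: "j \<in> ?J" for j
  proof -
    have i: "wlong ?J \<otimes> j \<otimes> wlong ?J \<in> S" using wlong_conj[OF J j] by auto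
    have "?w \<otimes> j \<otimes> inv ?w = wlong S \<otimes> (wlong ?J \<otimes> j \<otimes> wlong ?J) \<otimes> wlong S"
      using J j by (simp add: inv_mult_group m_assoc)
    then show ?thesis using wlong_conj[OF subset_refl i] by simp
  qed
  have "?w \<noteq> \<one>" using d by auto
  then show ?thesis using ex_straight[OF wc b a ab 1 2] d by blast
qed

end

section \<open>Tits systems and their double cosets\<close>

lemma (in group) card_l_translate:
  assumes "x \<in> carrier G" "A \<subseteq> carrier G"
  shows "card ((\<lambda>b. x \<otimes> b) ` A) = card A"
  by (rule card_image) (use assms in \<open>auto simp: inj_on_def subset_iff\<close>)

text \<open>A family of double cosets \<open>C w\<close> indexed by the Weyl group and satisfying the axioms of a Tits system.\<close>

locale tits_system = G: group G + W: involutive_generators W S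
  for G :: "('a, 'b) monoid_scheme" (structure) and W :: "('w, 'c) monoid_scheme" and S +
  fixes B :: "'a set" and C :: "'w \<Rightarrow> 'a set"
  assumes B_subgroup: "subgroup B G"
    and C_sub: "w \<in> carrier W \<Longrightarrow> C w \<subseteq> carrier G"
    and C_double: "w \<in> carrier W \<Longrightarrow> g \<in> C w \<Longrightarrow> C w = {b \<otimes> g \<otimes> b' | b b'. b \<in> B \<and> b' \<in> B}"
    and C_one: "C \<one>\<^bsub>W\<^esub> = B"
    and C_one_inj: "w \<in> carrier W \<Longrightarrow> C w = B \<Longrightarrow> w = \<one>\<^bsub>W\<^esub>"
    and C_inv: "w \<in> carrier W \<Longrightarrow> g \<in> C w \<Longrightarrow> inv g \<in> C (inv\<^bsub>W\<^esub> w)"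
    and C_ex_mult: "w \<in> carrier W \<Longrightarrow> v \<in> carrier W \<Longrightarrow> \<exists>x\<in>C w. \<exists>y\<in>C v. x \<otimes> y \<in> C (w \<otimes>\<^bsub>W\<^esub> v)"
    and C_S_mult: "s \<in> S \<Longrightarrow> w \<in> carrier W \<Longrightarrow> x \<in> C s \<Longrightarrow> y \<in> C w \<Longrightarrow> x \<otimes> y \<in> C w \<union> C (s \<otimes>\<^bsub>W\<^esub> w)"
    and C_nondegenerate: "s \<in> S \<Longrightarrow> \<exists>x\<in>C s. \<exists>y\<in>C s. x \<otimes> y \<in> C s"
begin

abbreviation weyl_mult (infixl "\<cdot>" 70) where "x \<cdot> y \<equiv> x \<otimes>\<^bsub>W\<^esub> y"

lemma B_carrier [simp]: "b \<in> B \<Longrightarrow> b \<in> carrier G"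
  using subgroup.mem_carrier[OF B_subgroup] .

lemma B_mult [simp]: "b \<in> B \<Longrightarrow> c \<in> B \<Longrightarrow> b \<otimes> c \<in> B"
  using subgroup.m_closed[OF B_subgroup] .

lemma B_inv [simp]: "b \<in> B \<Longrightarrow> inv b \<in> B"
  using subgroup.m_inv_closed[OF B_subgroup] .

lemma B_one [simp]: "\<one> \<in> B"
  using subgroup.one_closed[OF B_subgroup] .

lemma C_carrier: "w \<in> carrier W \<Longrightarrow> g \<in> C w \<Longrightarrow> g \<in> carrier G"
  using C_sub by auto

lemma C_nonempty: "w \<in> carrier W \<Longrightarrow> \<exists>g. g \<in> C w"
  using C_ex_mult[of w w] by blast

lemma C_left [simp]:
  assumes w: "w \<in> carrier W" and b: "b \<in> B" and g: "g \<in> C w"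
  shows "b \<otimes> g \<in> C w"
proof -
  have "b \<otimes> g = b \<otimes> g \<otimes> \<one>" using b C_carrier[OF w g] by simp
  then show ?thesis using C_double[OF w g] b B_one by blast
qed

lemma C_right [simp]:
  assumes w: "w \<in> carrier W" and b: "b \<in> B" and g: "g \<in> C w"
  shows "g \<otimes> b \<in> C w"
proof -
  have "g \<otimes> b = \<one> \<otimes> g \<otimes> b" using b C_carrier[OF w g] by simp
  then show ?thesis using C_double[OF w g] b B_one by blast
qed

lemma C_eqI: "w \<in> carrier W \<Longrightarrow> v \<in> carrier W \<Longrightarrow> g \<in> C w \<Longrightarrow> g \<in> C v \<Longrightarrow> C w = C v"
  using C_double[of w g] C_double[of v g] by simp

lemma C_mult_S:
  assumes s: "s \<in> S" and w: "w \<in> carrier W" and x: "x \<in> C w" and y: "y \<in> C s"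
  shows "x \<otimes> y \<in> C w \<union> C (w \<cdot> s)"
proof -
  have sW: "s \<in> carrier W" using s by simp
  have xy: "x \<in> carrier G" "y \<in> carrier G" using x y C_carrier w sW by blast+
  have "inv y \<otimes> inv x \<in> C (inv\<^bsub>W\<^esub> w) \<union> C (s \<cdot> inv\<^bsub>W\<^esub> w)"
    using C_S_mult[OF s, of "inv\<^bsub>W\<^esub> w" "inv y" "inv x"] C_inv[OF sW y] C_inv[OF w x] w s by simp
  then have "inv (inv y \<otimes> inv x) \<in> C w \<union> C (w \<cdot> s)"
    using C_inv[of "inv\<^bsub>W\<^esub> w" "inv y \<otimes> inv x"] C_inv[of "s \<cdot> inv\<^bsub>W\<^esub> w" "inv y \<otimes> inv x"] w s
    by (auto simp: W.inv_mult_group)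
  then show ?thesis using xy by (simp add: G.inv_mult_group)
qed

lemma C_factor:
  assumes w: "w \<in> carrier W" and v: "v \<in> carrier W" and g: "g \<in> C (w \<cdot> v)"
  shows "\<exists>x\<in>C w. \<exists>y\<in>C v. g = x \<otimes> y"
proof -
  obtain x y where xy: "x \<in> C w" "y \<in> C v" "x \<otimes> y \<in> C (w \<cdot> v)" using C_ex_mult w v by blast
  then obtain b b' where b: "b \<in> B" "b' \<in> B" "g = b \<otimes> (x \<otimes> y) \<otimes> b'"
    using C_double[of "w \<cdot> v" "x \<otimes> y"] g w v by auto
  then have "g = (b \<otimes> x) \<otimes> (y \<otimes> b')"
    using C_carrier[OF w xy(1)] C_carrier[OF v xy(2)] by (simp add: G.m_assoc)
  then show ?thesis using b xy w v C_left C_right by blast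
qed

text \<open>Strip a letter \<open>s\<close> from the shorter element,
  \<open>w = s \<cdot> u\<close>. Multiplying back by an element of \<open>C s\<close> gives
  \<open>C u = C v\<close> or \<open>C u = C (s \<cdot> v)\<close>, and induction applies; the first
  case contradicts the lengths.\<close>

lemma C_inj_le:
  "\<lbrakk>w \<in> carrier W; v \<in> carrier W; C w = C v; W.len w \<le> W.len v\<rbrakk> \<Longrightarrow> w = v"
proof (induction "W.len w" arbitrary: w v)
  case 0
  then have "w = \<one>\<^bsub>W\<^esub>" using W.len_eq_0[of w] by simp
  then show ?case using 0 C_one C_one_inj by metis
next
  case (Suc n)
  then have "w \<noteq> \<one>\<^bsub>W\<^esub>" by auto
  then obtain s u where s: "s \<in> S" "u \<in> carrier W" "w = s \<cdot> u" "W.len w = W.len u + 1"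
    using W.ex_left_descent[OF Suc.prems(1)] by metis
  have sW: "s \<in> carrier W" using s by simp
  obtain x y where xy: "x \<in> C s" "y \<in> C u" "x \<otimes> y \<in> C v"
    using C_ex_mult[OF sW s(2)] Suc.prems(3) unfolding s(3) by blast
  have xyc: "x \<in> carrier G" "y \<in> carrier G" using xy C_carrier s(2) sW by blast+
  have "inv x \<in> C s" using C_inv[OF sW xy(1)] s by simp
  then have "inv x \<otimes> (x \<otimes> y) \<in> C v \<union> C (s \<cdot> v)" using C_S_mult[OF s(1) Suc.prems(2)] xy by blast
  then have "y \<in> C v \<union> C (s \<cdot> v)" using xyc by simp
  then consider "C u = C v" | "C u = C (s \<cdot> v)"
    using C_eqI[of u v y] C_eqI[of u "s \<cdot> v" y] xy(2) s(2) sW Suc.prems(2) by auto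
  then show ?case
  proof cases
    case 1
    then have "u = v" using Suc.hyps(1)[of u v] Suc.hyps(2) Suc.prems s by simp
    then show ?thesis using s Suc.prems by simp
  next
    case 2
    have "W.len v \<le> W.len (s \<cdot> v) + 1" using W.len_S_mult_ge[OF s(1) Suc.prems(2)] .
    then have "u = s \<cdot> v" using Suc.hyps(1)[of u "s \<cdot> v"] 2 Suc.hyps(2) Suc.prems s sW by simp
    then show ?thesis using s Suc.prems(2) by simp
  qed
qed

lemma C_inj: "w \<in> carrier W \<Longrightarrow> v \<in> carrier W \<Longrightarrow> g \<in> C w \<Longrightarrow> g \<in> C v \<Longrightarrow> w = v"
  using C_inj_le[of w v] C_inj_le[of v w] C_eqI[of w v g] by (metis nat_le_linear)

text \<open>If \<open>x \<in> C s\<close> and both \<open>u\<close> and \<open>x u\<close> lie in \<open>C (w t)\<close>, strip a factor in \<open>C t\<close> from \<open>u\<close>.\<close>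

lemma C_exchange:
  assumes s: "s \<in> S" and t: "t \<in> S" and w: "w \<in> carrier W"
    and IH: "\<And>y. y \<in> C w \<Longrightarrow> x \<otimes> y \<in> C (s \<cdot> w)"
    and x: "x \<in> C s" and u: "u \<in> C (w \<cdot> t)" and xu: "x \<otimes> u \<in> C (w \<cdot> t)"
  shows "s \<cdot> w = w \<cdot> t"
proof -
  have tW: "t \<in> carrier W" "s \<in> carrier W" using s t by simp_all
  obtain y z where yz: "y \<in> C w" "z \<in> C t" "u = y \<otimes> z" using C_factor[OF w tW(1) u] by blast
  have c: "x \<in> carrier G" "y \<in> carrier G" "z \<in> carrier G"
    using C_carrier yz x tW w by blast+
  have "inv z \<in> C t" using C_inv[OF tW(1) yz(2)] t by simp
  then have "(x \<otimes> u) \<otimes> inv z \<in> C (w \<cdot> t) \<union> C (w \<cdot> t \<cdot> t)" using C_mult_S[OF t _ xu] w tW by simp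
  then have "x \<otimes> y \<in> C (w \<cdot> t) \<union> C w" using c w t unfolding yz(3) by (simp add: G.m_assoc)
  then have "s \<cdot> w = w \<cdot> t \<or> s \<cdot> w = w"     using IH[OF yz(1)] C_inj[of "s \<cdot> w" "w \<cdot> t"] C_inj[of "s \<cdot> w" w] w tW by auto
  moreover have "s \<cdot> w \<noteq> w" using W.S_invol[OF s] w tW W.r_cancel_one'[of w s] by auto
  ultimately show ?thesis by blast
qed

text \<open>If the product stayed in \<open>C w\<close>, \<open>C_exchange\<close> for the last
  letter \<open>t\<close> of \<open>w = v \<cdot> t\<close> would give
  \<open>s \<cdot> v = w\<close>, hence \<open>s \<cdot> w = v\<close>, which is shorter. The length
  premise is not strict, because equal lengths are excluded only after exchange has been
  established.\<close>

lemma C_S_mult_ge: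
  "\<lbrakk>s \<in> S; w \<in> carrier W; W.len w \<le> W.len (s \<cdot> w); x \<in> C s; y \<in> C w\<rbrakk> \<Longrightarrow> x \<otimes> y \<in> C (s \<cdot> w)"
proof (induction "W.len w" arbitrary: w y rule: less_induct)
  case less
  note s = less.prems(1) and w = less.prems(2)
  show ?case
  proof (rule ccontr)
    assume "x \<otimes> y \<notin> C (s \<cdot> w)"
    then have xy: "x \<otimes> y \<in> C w" using C_S_mult[OF s w less.prems(4,5)] by blast
    show False
    proof (cases "w = \<one>\<^bsub>W\<^esub>")
      case True
      then have "y \<in> B" using less.prems(5) C_one by simp
      then have "x \<otimes> y \<in> C s" using less.prems s by simp
      then show ?thesis using True \<open>x \<otimes> y \<notin> C (s \<cdot> w)\<close> s by simp
    next
      case False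
      then obtain t v where t: "t \<in> S" "v \<in> carrier W" "w = v \<cdot> t" "W.len w = W.len v + 1"
        using W.ex_right_descent[OF w] by metis
      have sv: "s \<cdot> v \<in> carrier W" using s t by simp
      have sw: "s \<cdot> w = s \<cdot> v \<cdot> t" using s t by (simp add: W.m_assoc)
      have "W.len v \<le> W.len (s \<cdot> v)" using W.len_mult_S_le[OF t(1) sv] less.prems(3) t(4) sw by simp
      then have "s \<cdot> v = v \<cdot> t"
        using C_exchange[OF s t(1,2) _ less.prems(4), of y] less.hyps[of v] s t xy less.prems(4,5) by simp
      then have "s \<cdot> w = v" using t s by (metis W.S_carrier W.S_cancel)
      then show ?thesis using less.prems(3) t(4) by simp
    qed
  qed
qed

lemma exchange_word:
  "\<lbrakk>s \<in> S; set ss \<subseteq> S; W.len (W.word ss) = length ss; W.len (s \<cdot> W.word ss) \<le> length ss\<rbrakk>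
     \<Longrightarrow> \<exists>as a bs. ss = as @ a # bs \<and> s \<cdot> W.word ss = W.word (as @ bs)"
proof (induction ss rule: rev_induct)
  case Nil
  then show ?case by simp
next
  case (snoc t ss)
  let ?v = "W.word ss"
  have t: "t \<in> S" and ss: "set ss \<subseteq> S" and s: "s \<in> S" and sW: "s \<in> carrier W" using snoc.prems by auto
  have v: "?v \<in> carrier W" using ss by simp
  have e: "W.word (ss @ [t]) = ?v \<cdot> t" using ss t by (simp add: W.word_append)
  have lv: "W.len ?v = length ss"
    using W.len_le[OF ss] W.len_mult_S_le[OF t v] snoc.prems(3) unfolding e by simp
  show ?case
  proof (cases "W.len (s \<cdot> ?v) \<le> length ss")
    case True
    then obtain as a bs where h: "ss = as @ a # bs" "s \<cdot> ?v = W.word (as @ bs)" using snoc.IH s ss lv by blast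
    then have "s \<cdot> (?v \<cdot> t) = W.word (as @ bs) \<cdot> t" using sW v t by (simp flip: W.m_assoc)
    also have "\<dots> = W.word (as @ (bs @ [t]))" using h ss t W.word_append[of "as @ bs" "[t]"] by simp
    finally show ?thesis using h unfolding e by (intro exI[of _ as] exI[of _ a] exI[of _ "bs @ [t]"]) simp
  next
    case False
    let ?w = "?v \<cdot> t"
    have w: "?w \<in> carrier W" and sw: "s \<cdot> ?w \<in> carrier W" using v t sW by auto
    have ge: "W.len (s \<cdot> ?w) \<le> W.len (s \<cdot> (s \<cdot> ?w))" using snoc.prems(3,4) s w unfolding e by simp
    \<comment> \<open>Nondegeneracy makes \<open>C s\<close> meet its own square, so some
      \<open>u = a2 \<otimes> z\<close> in \<open>C ?w\<close> stays in \<open>C ?w\<close> under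
      \<open>a1\<close>. This is what \<open>C_exchange\<close> requires, and the deleted letter is
      the last one.\<close>
    obtain a1 a2 where a: "a1 \<in> C s" "a2 \<in> C s" "a1 \<otimes> a2 \<in> C s" using C_nondegenerate[OF s] by blast
    obtain z where z: "z \<in> C (s \<cdot> ?w)" using C_nonempty[OF sw] by blast
    have c: "a1 \<in> carrier G" "a2 \<in> carrier G" "z \<in> carrier G"
      using C_carrier[OF sW] a z C_carrier[OF sw] by blast+
    have "a2 \<otimes> z \<in> C ?w" "(a1 \<otimes> a2) \<otimes> z \<in> C ?w"
      using C_S_mult_ge[OF s sw ge _ z] a s w by simp_all
    then have m: "a2 \<otimes> z \<in> C ?w" "a1 \<otimes> (a2 \<otimes> z) \<in> C ?w" using c by (simp_all add: G.m_assoc)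
    have "a1 \<otimes> y \<in> C (s \<cdot> ?v)" if "y \<in> C ?v" for y
      using C_S_mult_ge[OF s v _ a(1) that] False lv by simp
    then have "s \<cdot> ?v = ?w" using C_exchange[OF s t v _ a(1) m] by blast
    then have "s \<cdot> ?w = ?v" using s v by (metis W.S_cancel)
    then show ?thesis unfolding e by (intro exI[of _ ss] exI[of _ t] exI[of _ "[]"]) simp
  qed
qed

end

locale finite_tits_system = tits_system G W S B C
  for G :: "('a, 'b) monoid_scheme" (structure) and W :: "('w, 'c) monoid_scheme" and S B C +
  assumes finite_G: "finite (carrier G)"

sublocale finite_tits_system \<subseteq> W: finite_exchange_system W S
proof unfold_locales
  show "\<lbrakk>s \<in> S; set ss \<subseteq> S; W.len (W.word ss) = length ss; W.len (s \<cdot> W.word ss) \<le> length ss\<rbrakk>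
     \<Longrightarrow> \<exists>as a bs. ss = as @ a # bs \<and> s \<cdot> W.word ss = W.word (as @ bs)" for s ss
    by (rule exchange_word)
  have "inj_on (\<lambda>w. SOME g. g \<in> C w) (carrier W)"
    by (rule inj_onI) (metis C_inj C_nonempty someI_ex)
  moreover have "(\<lambda>w. SOME g. g \<in> C w) ` carrier W \<subseteq> carrier G"
    using C_carrier C_nonempty by (metis (mono_tags, lifting) image_subsetI someI_ex)
  ultimately show "finite (carrier W)" using finite_G by (meson inj_on_finite)
qed

context finite_tits_system
begin

definition P :: "'w set \<Rightarrow> 'a set" where "P I = (\<Union>w\<in>generate W I. C w)"

lemma P_sub: "I \<subseteq> S \<Longrightarrow> P I \<subseteq> carrier G"
  unfolding P_def using C_carrier W.parabolic_carrier by blast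

lemma B_P: "B \<subseteq> P I"
  unfolding P_def using C_one W.parabolic_one by blast

lemma C_P: "w \<in> generate W I \<Longrightarrow> C w \<subseteq> P I"
  unfolding P_def by blast

lemma C_P_iff: "I \<subseteq> S \<Longrightarrow> w \<in> carrier W \<Longrightarrow> g \<in> C w \<Longrightarrow> g \<in> P I \<longleftrightarrow> w \<in> generate W I"
  unfolding P_def using C_inj W.parabolic_carrier by blast

lemma C_word_mult:
  assumes I: "I \<subseteq> S" and w: "w \<in> carrier W"
  shows "set ss \<subseteq> I \<Longrightarrow> x \<in> C (W.word ss) \<Longrightarrow> y \<in> C w \<Longrightarrow> \<exists>v\<in>generate W I. x \<otimes> y \<in> C (v \<cdot> w)"
proof (induction ss arbitrary: x)
  case Nil
  then have "x \<in> B" using C_one by simp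
  then have "x \<otimes> y \<in> C (\<one>\<^bsub>W\<^esub> \<cdot> w)" using Nil w by simp
  then show ?case using W.parabolic_one by blast
next
  case (Cons s ss)
  have sI: "s \<in> I" and s: "s \<in> S" "s \<in> carrier W" and ss: "W.word ss \<in> carrier W" using Cons.prems I by auto
  obtain a x' where a: "a \<in> C s" "x' \<in> C (W.word ss)" "x = a \<otimes> x'"
    using C_factor[OF s(2) ss, of x] Cons.prems(2) by auto
  obtain v where v: "v \<in> generate W I" "x' \<otimes> y \<in> C (v \<cdot> w)" using Cons a by auto
  have vc: "v \<in> carrier W" using v I by blast
  have "x \<otimes> y = a \<otimes> (x' \<otimes> y)"
    using a(3) C_carrier[OF s(2) a(1)] C_carrier[OF ss a(2)] C_carrier[OF w Cons.prems(3)] by (simp add: G.m_assoc)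
  then have "x \<otimes> y \<in> C (v \<cdot> w) \<union> C (s \<cdot> (v \<cdot> w))"
    using C_S_mult[OF s(1) _ a(1) v(2)] vc w by simp
  then have "x \<otimes> y \<in> C (v \<cdot> w) \<union> C ((s \<cdot> v) \<cdot> w)" using vc w s by (simp add: W.m_assoc)
  moreover have "s \<cdot> v \<in> generate W I" using sI v I by blast
  ultimately show ?case using v(1) by blast
qed

lemma P_C_mult:
  assumes I: "I \<subseteq> S" and w: "w \<in> carrier W" and x: "x \<in> P I" and y: "y \<in> C w"
  shows "\<exists>v\<in>generate W I. x \<otimes> y \<in> C (v \<cdot> w)"
proof -
  obtain v where "v \<in> generate W I" "x \<in> C v" using x P_def by auto
  then show ?thesis using C_word_mult[OF I w _ _ y] W.parabolic_iff_word[OF I] by metis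
qed

lemma P_subgroup: assumes I: "I \<subseteq> S" shows "subgroup (P I) G"
proof
  show "P I \<subseteq> carrier G" using P_sub[OF I] .
  show "\<one> \<in> P I" using B_P[of I] B_one by blast
  show "x \<otimes> y \<in> P I" if x: "x \<in> P I" and y: "y \<in> P I" for x y
  proof -
    obtain w where w: "w \<in> generate W I" "y \<in> C w" using y P_def by auto
    then show ?thesis using P_C_mult[OF I _ x w(2)] I C_P by blast
  qed
  show "inv x \<in> P I" if x: "x \<in> P I" for x
  proof -
    obtain w where w: "w \<in> generate W I" "x \<in> C w" using x P_def by auto
    then have "inv x \<in> C (inv\<^bsub>W\<^esub> w)" using C_inv W.parabolic_carrier[OF I] by blast
    then show ?thesis using C_P[OF W.parabolic_inv[OF I w(1)]] by blast
  qed
qed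

lemma C_P_mult:
  assumes I: "I \<subseteq> S" and w: "w \<in> carrier W" and x: "x \<in> C w" and y: "y \<in> P I"
  shows "\<exists>v\<in>generate W I. x \<otimes> y \<in> C (w \<cdot> v)"
proof -
  have c: "x \<in> carrier G" "y \<in> carrier G" using C_carrier[OF w x] P_sub[OF I] y by auto
  have "inv y \<in> P I" using subgroup.m_inv_closed[OF P_subgroup[OF I] y] .
  then obtain v where v: "v \<in> generate W I" "inv y \<otimes> inv x \<in> C (v \<cdot> inv\<^bsub>W\<^esub> w)"
    using P_C_mult[OF I _ _ C_inv[OF w x]] w by auto
  have vc: "v \<in> carrier W" using v I by blast
  have "inv (inv y \<otimes> inv x) \<in> C (inv\<^bsub>W\<^esub> (v \<cdot> inv\<^bsub>W\<^esub> w))" using C_inv[OF _ v(2)] vc w by simp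
  then have "x \<otimes> y \<in> C (w \<cdot> inv\<^bsub>W\<^esub> v)" using c w vc by (simp add: G.inv_mult_group W.inv_mult_group)
  then show ?thesis using v(1) I by blast
qed

lemma P_Int: "I \<subseteq> S \<Longrightarrow> J \<subseteq> S \<Longrightarrow> P I \<inter> P J = P (I \<inter> J)"
proof
  assume I: "I \<subseteq> S" and J: "J \<subseteq> S"
  show "P I \<inter> P J \<subseteq> P (I \<inter> J)"
  proof
    fix g assume g: "g \<in> P I \<inter> P J"
    then obtain w where w: "w \<in> generate W I" "g \<in> C w" using P_def by auto
    then have "w \<in> generate W J" using C_P_iff[OF J _ w(2)] W.parabolic_carrier[OF I] g by auto
    then show "g \<in> P (I \<inter> J)" using w W.parabolic_Int[OF I J] P_def by auto
  qed
  show "P (I \<inter> J) \<subseteq> P I \<inter> P J"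
    unfolding P_def using W.parabolic_mono[of "I \<inter> J" I] W.parabolic_mono[of "I \<inter> J" J] by blast
qed

lemma P_mono: "I \<subseteq> J \<Longrightarrow> P I \<subseteq> P J"
  unfolding P_def using W.parabolic_mono by blast

lemma P_inj: "I \<subseteq> S \<Longrightarrow> J \<subseteq> S \<Longrightarrow> P I \<subseteq> P J \<Longrightarrow> I \<subseteq> J"
proof
  fix s assume I: "I \<subseteq> S" and J: "J \<subseteq> S" and P: "P I \<subseteq> P J" and s: "s \<in> I"
  have sS: "s \<in> S" using s I by auto
  obtain g where g: "g \<in> C s" using C_nonempty sS by auto
  then have "g \<in> P J" using C_P[OF W.parabolic_incl[OF s]] P by blast
  then have "s \<in> generate W J" using C_P_iff[OF J _ g] sS by simp
  then show "s \<in> J" using W.parabolic_Int_S[OF J sS] by blast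
qed

end

section \<open>Traces, power sums and determinants\<close>

definition mat_trace :: "'a::comm_monoid_add mat \<Rightarrow> 'a" where
  "mat_trace A = (\<Sum>i<dim_row A. A $$ (i, i))"

lemma mat_trace_mult_commute:
  fixes A :: "'a::comm_semiring_0 mat"
  assumes "A \<in> carrier_mat n m" "B \<in> carrier_mat m n"
  shows "mat_trace (A * B) = mat_trace (B * A)"
proof -
  have "mat_trace (A * B) = (\<Sum>i<n. \<Sum>k<m. A $$ (i, k) * B $$ (k, i))"
    using assms unfolding mat_trace_def
    by (auto simp: scalar_prod_def atLeast0LessThan intro!: sum.cong)
  also have "\<dots> = (\<Sum>k<m. \<Sum>i<n. B $$ (k, i) * A $$ (i, k))"
    by (subst sum.swap) (simp add: mult.commute)
  also have "\<dots> = mat_trace (B * A)"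
    using assms unfolding mat_trace_def
    by (auto simp: scalar_prod_def atLeast0LessThan intro!: sum.cong)
  finally show ?thesis .
qed

lemma upper_triangular_mult_diag:
  fixes A :: "'a::comm_semiring_1 mat"
  assumes A: "A \<in> carrier_mat n n" "upper_triangular A" and B: "B \<in> carrier_mat n n" "upper_triangular B"
  shows "upper_triangular (A * B)" and "i < n \<Longrightarrow> (A * B) $$ (i, i) = A $$ (i, i) * B $$ (i, i)"
proof -
  have e: "(A * B) $$ (i, j) = (\<Sum>k<n. A $$ (i, k) * B $$ (k, j))" if "i < n" "j < n" for i j
    using A B that by (simp add: scalar_prod_def atLeast0LessThan)
  have z: "A $$ (i, k) * B $$ (k, j) = 0" if "i < n" "j < n" "k < n" "j \<le> i" "k \<noteq> i \<or> j < i" for i j k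
  proof (cases "k < i")
    case True
    then show ?thesis using upper_triangularD[OF A(2), of k i] A that by simp
  next
    case False
    then have "j < k" using that by auto
    then show ?thesis using upper_triangularD[OF B(2), of j k] B that by simp
  qed
  show "upper_triangular (A * B)"
  proof
    fix i j assume ij: "j < i" "i < dim_row (A * B)"
    then have "i < n" "j < n" using A B by auto
    then show "(A * B) $$ (i, j) = 0" using e z ij by simp
  qed
  assume i: "i < n"
  have "(\<Sum>k<n. A $$ (i, k) * B $$ (k, i)) = (\<Sum>k\<in>{i}. A $$ (i, k) * B $$ (k, i))"
    by (rule sum.mono_neutral_right) (use i z in auto)
  then show "(A * B) $$ (i, i) = A $$ (i, i) * B $$ (i, i)" using e i by simp
qed

lemma upper_triangular_pow_diag:
  fixes A :: "'a::comm_semiring_1 mat"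
  assumes A: "A \<in> carrier_mat n n" "upper_triangular A"
  shows "upper_triangular (A ^\<^sub>m k) \<and> (\<forall>i<n. (A ^\<^sub>m k) $$ (i, i) = A $$ (i, i) ^ k)"
proof (induction k)
  case 0
  then show ?case using A by simp
next
  case (Suc k)
  have "A ^\<^sub>m k \<in> carrier_mat n n" using A by simp
  then show ?case using upper_triangular_mult_diag[OF _ _ A, of "A ^\<^sub>m k"] Suc by (simp add: mult.commute)
qed

lemma complex_mat_triangularize:
  fixes A :: "complex mat"
  assumes A: "A \<in> carrier_mat n n"
  obtains B where "B \<in> carrier_mat n n" "upper_triangular B" "similar_mat A B"
    "\<And>i. i < n \<Longrightarrow> eigenvalue A (B $$ (i, i))"
proof -
  obtain es where "char_poly A = (\<Prod>a\<leftarrow>es. [:- a, 1:])" using char_poly_factorized[OF A] by auto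
  then obtain B where B: "B \<in> carrier_mat n n" "upper_triangular B" "similar_mat A B"
    using schur_decomposition_exists[OF A] by auto
  have "eigenvalue A (B $$ (i, i))" if i: "i < n" for i
  proof -
    have "char_poly A = (\<Prod>a\<leftarrow>diag_mat B. [:- a, 1:])"
      using char_poly_similar[OF B(3)] char_poly_upper_triangular[OF B(1,2)] by simp
    moreover have "B $$ (i, i) \<in> set (diag_mat B)" using i B by (auto simp: diag_mat_def)
    ultimately have "poly (char_poly A) (B $$ (i, i)) = 0"
      by (simp add: poly_prod_list prod_list_zero_iff)
    then show ?thesis using eigenvalue_root_char_poly[OF A] by simp
  qed
  then show thesis using that B by blast
qed

text \<open>The list is the diagonal of a triangular form, with multiplicities; similarity preserves
  the trace of every power.\<close>

lemma mat_trace_pow_eigenvalues: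
  fixes A :: "complex mat"
  assumes A: "A \<in> carrier_mat n n"
  obtains es where "\<And>k. mat_trace (A ^\<^sub>m k) = (\<Sum>e\<leftarrow>es. e ^ k)" "\<And>e. e \<in> set es \<Longrightarrow> eigenvalue A e"
proof -
  obtain B where B: "B \<in> carrier_mat n n" "upper_triangular B" "similar_mat A B"
    and ev: "\<And>i. i < n \<Longrightarrow> eigenvalue A (B $$ (i, i))" using complex_mat_triangularize[OF A] by blast
  obtain P Q where w: "similar_mat_wit A B P Q" using B(3) similar_mat_def by blast
  note pq = similar_mat_witD2[OF A w]
  show thesis
  proof
    fix k
    have Bk: "B ^\<^sub>m k \<in> carrier_mat n n" using B by simp
    have "mat_trace (A ^\<^sub>m k) = mat_trace (P * B ^\<^sub>m k * Q)" using similar_mat_wit_pow_id[OF w] by simp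
    also have "\<dots> = mat_trace (Q * (P * B ^\<^sub>m k))"
      by (rule mat_trace_mult_commute) (use pq Bk in auto)
    also have "Q * (P * B ^\<^sub>m k) = B ^\<^sub>m k"
      by (simp add: pq(2) left_mult_one_mat[OF Bk] flip: assoc_mult_mat[OF pq(7,6) Bk])
    also have "mat_trace (B ^\<^sub>m k) = (\<Sum>i<n. B $$ (i, i) ^ k)"
      unfolding mat_trace_def using upper_triangular_pow_diag[OF B(1,2), of k] Bk B(1) by simp
    also have "\<dots> = (\<Sum>e\<leftarrow>diag_mat B. e ^ k)"
      using B(1) by (simp add: diag_mat_def interv_sum_list_conv_sum_set_nat atLeast0LessThan o_def)
    finally show "mat_trace (A ^\<^sub>m k) = (\<Sum>e\<leftarrow>diag_mat B. e ^ k)" .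
  next
    fix e assume "e \<in> set (diag_mat B)"
    then show "eigenvalue A e" using ev B(1) by (auto simp: diag_mat_def)
  qed
qed

text \<open>Both lists are tested with a polynomial that vanishes at 0 and at every entry except
  \<open>a\<close>. Vanishing at 0 discards the zeroth power sum: the lists may have different
  lengths, and zeros are invisible.\<close>

lemma eq_power_sums_mem:
  fixes xs ys :: "complex list"
  assumes eq: "\<And>k. k > 0 \<Longrightarrow> (\<Sum>x\<leftarrow>xs. x ^ k) = (\<Sum>y\<leftarrow>ys. y ^ k)" and a: "a \<in> set xs" "a \<noteq> 0"
  shows "a \<in> set ys"
proof (rule ccontr)
  assume n: "a \<notin> set ys"
  define R where "R = set xs \<union> set ys - {a}"
  define p where "p = [:0, 1:] * (\<Prod>r\<in>R. [:- r, 1:])"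
  have fR: "finite R" unfolding R_def by simp
  have p0: "poly p x = 0 \<longleftrightarrow> x = 0 \<or> x \<in> R" for x
    unfolding p_def using fR by (simp add: poly_prod)
  have \<nu>: "coeff p 0 = 0" unfolding p_def by simp
  have sums: "(\<Sum>x\<leftarrow>zs. poly p x) = (\<Sum>i\<le>degree p. coeff p i * (\<Sum>x\<leftarrow>zs. x ^ i))" for zs
    by (induction zs) (simp_all add: poly_altdef sum.distrib distrib_left)
  have "(\<Sum>x\<leftarrow>xs. poly p x) = (\<Sum>x\<leftarrow>ys. poly p x)"
    unfolding sums by (rule sum.cong[OF refl]) (metis \<nu> eq gr0I mult_zero_left)
  also have "\<dots> = 0"
  proof -
    have "x \<in> set ys \<Longrightarrow> poly p x = 0" for x using p0 n R_def by auto
    then show ?thesis by (induction ys) auto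
  qed
  finally have s: "(\<Sum>x\<leftarrow>xs. poly p x) = 0" .
  have "(\<Sum>x\<leftarrow>xs. poly p x) = of_nat (count_list xs a) * poly p a"
  proof -
    have "set zs \<subseteq> set xs \<Longrightarrow> (\<Sum>x\<leftarrow>zs. poly p x) = of_nat (count_list zs a) * poly p a" for zs
      by (induction zs) (use p0 R_def in \<open>auto simp: distrib_right\<close>)
    then show ?thesis by blast
  qed
  moreover have "poly p a \<noteq> 0" using p0 a R_def by simp
  moreover have "count_list xs a \<noteq> 0" using a by (simp add: count_list_0_iff)
  ultimately show False using s by simp
qed

text \<open>Logarithmic derivatives: \<open>E * P = 1\<close>, \<open>E' = E L'\<close> and
  \<open>P' = - P Q\<close>, where \<open>Q\<close> is the generating series of the power sums.
  Hence \<open>L' = Q\<close>, and coefficients are compared at \<open>l - 1\<close>.\<close>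

lemma fps_exp_eq_prod_power_sums:
  fixes c :: "nat \<Rightarrow> complex"
  defines "L \<equiv> Abs_fps (\<lambda>l. if l = 0 then 0 else c l / of_nat l)"
  assumes eq: "inverse (fps_exp 1 oo L) = (\<Prod>x\<leftarrow>xs. 1 - fps_const x * fps_X)" and l: "l > 0"
  shows "(\<Sum>x\<leftarrow>xs. x ^ l) = c l"
proof -
  define E where "E = fps_exp (1::complex) oo L"
  define P where "P = (\<Prod>x\<leftarrow>xs. 1 - fps_const x * fps_X)"
  define Q where "Q xs = Abs_fps (\<lambda>n. \<Sum>x\<leftarrow>xs. x ^ Suc n)" for xs :: "complex list"
  have L0: "fps_nth L 0 = 0" unfolding L_def by simp
  have E0: "fps_nth E 0 = 1" unfolding E_def by (simp add: fps_compose_nth_0)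
  have EP: "E * P = 1"
    using inverse_mult_eq_1'[of E] E0 eq unfolding E_def P_def by simp
  have dE: "fps_deriv E = E * fps_deriv L"
    unfolding E_def using fps_compose_deriv[OF L0, of "fps_exp 1"] by simp
  have geo: "(1 - fps_const x * fps_X) * Abs_fps (\<lambda>n. x ^ Suc n) = fps_const x" for x :: complex
  proof (rule fps_ext)
    fix n
    show "fps_nth ((1 - fps_const x * fps_X) * Abs_fps (\<lambda>n. x ^ Suc n)) n = fps_nth (fps_const x) n"
      by (cases n) (simp_all add: left_diff_distrib mult.assoc)
  qed
  have dP: "fps_deriv (\<Prod>x\<leftarrow>zs. 1 - fps_const x * fps_X) = - (\<Prod>x\<leftarrow>zs. 1 - fps_const x * fps_X) * Q zs"
    for zs :: "complex list"
  proof (induction zs)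
    case Nil
    have "Q [] = 0" by (simp add: Q_def fps_eq_iff)
    then show ?case by simp
  next
    case (Cons z zs)
    have "Q (z # zs) = Abs_fps (\<lambda>n. z ^ Suc n) + Q zs" by (simp add: Q_def fps_eq_iff)
    moreover define a where "a = 1 - fps_const z * fps_X"
    moreover define R where "R = (\<Prod>x\<leftarrow>zs. 1 - fps_const x * fps_X)"
    moreover define G where "G = Abs_fps (\<lambda>n. z ^ Suc n)"
    moreover have "fps_deriv (a * R) = - (a * R) * (G + Q zs)"
    proof -
      have "fps_deriv a = - fps_const z" "fps_deriv R = - R * Q zs" "a * G = fps_const z"
        using Cons geo[of z] by (simp_all add: a_def R_def G_def)
      then show ?thesis by (simp add: algebra_simps flip: \<open>a * G = fps_const z\<close>)
    qed
    ultimately show ?case by simp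
  qed
  have "fps_deriv (E * P) = 0" using EP by simp
  moreover have "fps_deriv P = - P * Q xs" unfolding P_def by (rule dP)
  ultimately have "E * (P * (fps_deriv L - Q xs)) = 0"
    using dE by (simp add: algebra_simps)
  then have "fps_deriv L = Q xs"
    using EP by (metis mult.assoc mult_1 right_minus_eq mult_zero_left zero_neq_one mult_eq_0_iff)
  then have "fps_nth (fps_deriv L) (l - 1) = (\<Sum>x\<leftarrow>xs. x ^ Suc (l - 1))" by (simp only: Q_def fps_nth_Abs_fps)
  then have "fps_nth (fps_deriv L) (l - 1) = (\<Sum>x\<leftarrow>xs. x ^ l)" using l by (simp only: Suc_diff_1)
  moreover have "fps_nth (fps_deriv L) (l - 1) = c l" using l by (simp add: L_def)
  ultimately show ?thesis by simp
qed

text \<open>The relation forces \<open>(e - q) (e + 1) = 0\<close> for every eigenvalue, and the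
  determinant is a product of eigenvalues. \<open>Q\<close> stands for any multiplicatively closed
  set; it will be the set of signed powers of \<open>p\<close>.\<close>

lemma det_quadratic_mem:
  fixes M :: "complex mat" and Q :: "complex set"
  assumes M: "M \<in> carrier_mat d d" and q: "M * M = (q - 1) \<cdot>\<^sub>m M + q \<cdot>\<^sub>m 1\<^sub>m d"
    and Q: "1 \<in> Q" "- 1 \<in> Q" "q \<in> Q" "\<And>x y. x \<in> Q \<Longrightarrow> y \<in> Q \<Longrightarrow> x * y \<in> Q"
  shows "Determinant.det M \<in> Q"
proof -
  obtain B where B: "B \<in> carrier_mat d d" "upper_triangular B" "similar_mat M B"
    and ev: "\<And>i. i < d \<Longrightarrow> eigenvalue M (B $$ (i, i))" using complex_mat_triangularize[OF M] by blast
  have e: "e = q \<or> e = - 1" if ev_e: "eigenvalue M e" for e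
  proof -
    obtain v where v: "v \<in> carrier_vec d" "v \<noteq> 0\<^sub>v d" "M *\<^sub>v v = e \<cdot>\<^sub>v v"
      using ev_e M unfolding eigenvalue_def eigenvector_def by auto
    have "(M * M) *\<^sub>v v = M *\<^sub>v (M *\<^sub>v v)" using M v by (simp add: assoc_mult_mat_vec)
    also have "\<dots> = e \<cdot>\<^sub>v (e \<cdot>\<^sub>v v)" using M v by (simp add: mult_mat_vec)
    finally have 1: "(M * M) *\<^sub>v v = (e * e) \<cdot>\<^sub>v v" by (simp add: smult_smult_assoc)
    have sm: "(k \<cdot>\<^sub>m A) *\<^sub>v v = k \<cdot>\<^sub>v (A *\<^sub>v v)" if "A \<in> carrier_mat d d" for k A
      by (rule eq_vecI) (use that v(1) in \<open>auto simp: scalar_prod_def sum_distrib_left mult.assoc\<close>)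
    have "(M * M) *\<^sub>v v = ((q - 1) \<cdot>\<^sub>m M) *\<^sub>v v + (q \<cdot>\<^sub>m 1\<^sub>m d) *\<^sub>v v"
      unfolding q using M v by (intro add_mult_distrib_mat_vec) auto
    also have "\<dots> = (q - 1) \<cdot>\<^sub>v (e \<cdot>\<^sub>v v) + q \<cdot>\<^sub>v v"
      using M v by (simp add: sm)
    finally have 2: "(e * e) \<cdot>\<^sub>v v = (q - 1) \<cdot>\<^sub>v (e \<cdot>\<^sub>v v) + q \<cdot>\<^sub>v v" using 1 by simp
    obtain i where i: "i < d" "vec_index v i \<noteq> 0" using v(1,2) by (auto simp: vec_eq_iff)
    have "vec_index ((e * e) \<cdot>\<^sub>v v) i = vec_index ((q - 1) \<cdot>\<^sub>v (e \<cdot>\<^sub>v v) + q \<cdot>\<^sub>v v) i" using 2 by simp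
    then have "e * e * vec_index v i = ((q - 1) * e + q) * vec_index v i"
      using v(1) i(1) by (simp add: algebra_simps)
    then have "e * e = (q - 1) * e + q" using i(2) by simp
    then have "(e - q) * (e + 1) = 0" by (simp add: algebra_simps)
    then show ?thesis by (auto simp: eq_neg_iff_add_eq_0)
  qed
  have "Determinant.det M = prod_list (diag_mat B)" using det_similar[OF B(3)] det_upper_triangular[OF B(2,1)] by simp
  moreover have "prod_list xs \<in> Q" if "set xs \<subseteq> Q" for xs using that by (induction xs) (auto intro: Q)
  moreover have "B $$ (i, i) \<in> Q" if "i < d" for i using e[OF ev[OF that]] Q(2,3) by auto
  then have "set (diag_mat B) \<subseteq> Q" using B(1) by (auto simp: diag_mat_def)
  ultimately show ?thesis by simp
qed

lemma sum_fun_apply: "(\<Sum>i\<in>A. h i) x = (\<Sum>i\<in>A. h i x)"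
  for h :: "'i \<Rightarrow> 'a \<Rightarrow> 'b::comm_monoid_add"
  by (induction A rule: infinite_finite_induct) simp_all

interpretation fun_vs: vector_space "\<lambda>(c::complex) (f::'a \<Rightarrow> complex) x. c * f x"
  by unfold_locales (auto simp: fun_eq_iff algebra_simps)

text \<open>The determinant on the common eigenspace \<open>E\<close> is multiplicative, and each factor has eigenvalues \<open>q s\<close> and \<open>-1\<close>.\<close>

lemma scalar_product_of_quadratic_ops:
  fixes E :: "('a \<Rightarrow> complex) set" and T :: "'s \<Rightarrow> ('a \<Rightarrow> complex) \<Rightarrow> 'a \<Rightarrow> complex" and Q :: "complex set"
  assumes V: "finite V" "\<And>f x. f \<in> E \<Longrightarrow> x \<notin> V \<Longrightarrow> f x = 0"
    and sub: "fun_vs.subspace E" and f0: "f0 \<in> E" "f0 \<noteq> 0"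
    and TE: "\<And>s f. s \<in> I \<Longrightarrow> f \<in> E \<Longrightarrow> T s f \<in> E"
    and Tadd: "\<And>s f g. s \<in> I \<Longrightarrow> T s (f + g) = T s f + T s g"
    and Tscale: "\<And>s c f. s \<in> I \<Longrightarrow> T s (\<lambda>x. c * f x) = (\<lambda>x. c * T s f x)"
    and Tq: "\<And>s f. s \<in> I \<Longrightarrow> f \<in> E \<Longrightarrow> T s (T s f) = (\<lambda>x. (q s - 1) * T s f x + q s * f x)"
    and Q: "1 \<in> Q" "- 1 \<in> Q" "\<And>s. s \<in> I \<Longrightarrow> q s \<in> Q" "\<And>x y. x \<in> Q \<Longrightarrow> y \<in> Q \<Longrightarrow> x * y \<in> Q"
    and ss: "set ss \<subseteq> I" and lam: "\<And>f. f \<in> E \<Longrightarrow> foldr T ss f = (\<lambda>x. \<nu> * f x)"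
  shows "\<exists>d>0. \<nu> ^ d \<in> Q"
proof -
  obtain D where D: "D \<subseteq> E" "fun_vs.independent D" "E \<subseteq> fun_vs.span D"
    using fun_vs.basis_exists[of E] by metis
  have DE: "fun_vs.span D = E" using D sub fun_vs.span_minimal by blast
  define \<delta> where "\<delta> a = (\<lambda>x. if x = a then 1 else 0 :: complex)" for a :: 'a
  \<comment> \<open>Functions supported on the finite set \<open>V\<close> are combinations of point
    masses, so \<open>E\<close> has a finite basis.\<close>
  have "E \<subseteq> fun_vs.span (\<delta> ` V)"
  proof
    fix f assume f: "f \<in> E"
    have "f = (\<Sum>a\<in>V. (\<lambda>x. f a * \<delta> a x))"
    proof
      fix x
      have "(\<Sum>a\<in>V. f a * \<delta> a x) = (\<Sum>a\<in>V. if a = x then f a else 0)"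
        by (rule sum.cong) (auto simp: \<delta>_def)
      also have "\<dots> = f x" using V f by (auto simp: sum.delta)
      finally show "f x = (\<Sum>a\<in>V. (\<lambda>x. f a * \<delta> a x)) x" by (simp add: sum_fun_apply)
    qed
    also have "\<dots> \<in> fun_vs.span (\<delta> ` V)"
      by (intro fun_vs.span_sum fun_vs.span_scale fun_vs.span_base) auto
    finally show "f \<in> fun_vs.span (\<delta> ` V)" .
  qed
  then have finD: "finite D"
    using fun_vs.independent_span_bound[OF finite_imageI[OF V(1)] D(2)] D(1) by blast
  \<comment> \<open>The nonzero element of \<open>E\<close> makes the dimension, and with it the
    exponent, positive.\<close>
  have Dne: "D \<noteq> {}" using f0 DE by auto
  define d where "d = card D"
  have d0: "d > 0" using finD Dne d_def by (simp add: card_gt_0_iff)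
  obtain b where b: "bij_betw b {..<d} D"
    using ex_bij_betw_nat_finite[OF finD] d_def by (auto simp: atLeast0LessThan)
  have bD: "b i \<in> D" if "i < d" for i using b that by (auto simp: bij_betw_def)
  have bE: "b i \<in> E" if "i < d" for i using bD[OF that] D(1) by blast
  define r where "r f i = fun_vs.representation D f (b i)" for f i
  have expand: "f = (\<Sum>i<d. (\<lambda>x. r f i * b i x))" if "f \<in> E" for f
  proof -
    have "(\<Sum>v\<in>D. (\<lambda>x. fun_vs.representation D f v * v x)) = f"
      using fun_vs.sum_representation_eq[OF D(2) _ finD subset_refl, of f] that DE by simp
    then show ?thesis unfolding r_def using sum.reindex_bij_betw[OF b, of "\<lambda>v x. fun_vs.representation D f v * v x"] by simp
  qed
  have runiq: "r (\<Sum>i<d. (\<lambda>x. c i * b i x)) j = c j" if j: "j < d" for c j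
  proof -
    have "fun_vs.representation D (\<Sum>i<d. (\<lambda>x. c i * b i x)) = (\<lambda>v. \<Sum>i<d. fun_vs.representation D (\<lambda>x. c i * b i x) v)"
      using bE DE by (intro fun_vs.representation_sum[OF D(2)]) (metis fun_vs.span_scale lessThan_iff)
    also have "\<dots> = (\<lambda>v. \<Sum>i<d. c i * (if v = b i then 1 else 0))"
      using bE DE bD by (intro ext sum.cong refl)
        (simp add: fun_vs.representation_scale[OF D(2)] fun_vs.representation_basis[OF D(2)])
    finally have "r (\<Sum>i<d. (\<lambda>x. c i * b i x)) j = (\<Sum>i<d. c i * (if b j = b i then 1 else 0))"
      unfolding r_def by simp
    also have "\<dots> = (\<Sum>i<d. if i = j then c i else 0)"
      by (rule sum.cong) (use b j in \<open>auto simp: bij_betw_def inj_on_def\<close>)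
    also have "\<dots> = c j" using j by simp
    finally show ?thesis .
  qed
  define M where "M U = Matrix.mat d d (\<lambda>(i, j). r (U (b j)) i)" for U :: "('a \<Rightarrow> complex) \<Rightarrow> 'a \<Rightarrow> complex"
  have Mc: "M U \<in> carrier_mat d d" for U unfolding M_def by simp
  have Tsum: "T s (\<Sum>i<d. (\<lambda>x. c i * h i x)) = (\<Sum>i<d. (\<lambda>x. c i * T s (h i) x))" if s: "s \<in> I" for s c h
  proof -
    have T0: "T s 0 = 0" using Tscale[OF s, of 0 0] by (simp add: zero_fun_def)
    have "T s (\<Sum>i\<in>A. (\<lambda>x. c i * h i x)) = (\<Sum>i\<in>A. (\<lambda>x. c i * T s (h i) x))" if "finite A" for A :: "nat set"
      using that
    proof induction
      case empty
      show ?case by (simp only: sum.empty T0)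
    next
      case (insert a F)
      show ?case unfolding sum.insert[OF insert.hyps] Tadd[OF s] Tscale[OF s] insert.IH ..
    qed
    then show ?thesis by blast
  qed
  \<comment> \<open>\<open>U\<close> must preserve \<open>E\<close>, since \<open>M U\<close> only
    sees coordinates in a basis of \<open>E\<close>; outside the span \<open>representation\<close>
    returns 0.\<close>
  have Mmult: "M (\<lambda>f. T s (U f)) = M (T s) * M U" if s: "s \<in> I" and U: "\<And>f. f \<in> E \<Longrightarrow> U f \<in> E" for s U
  proof (rule eq_matI)
    fix i j assume "i < dim_row (M (T s) * M U)" "j < dim_col (M (T s) * M U)"
    then have ij: "i < d" "j < d" using Mc by (auto simp: M_def)
    have "T s (U (b j)) = (\<Sum>k<d. (\<lambda>x. r (U (b j)) k * T s (b k) x))"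
      by (rule trans[OF arg_cong[OF expand[OF U[OF bE[OF ij(2)]]], of "T s"] Tsum[OF s]])
    also have "\<dots> = (\<Sum>k<d. (\<lambda>x. r (U (b j)) k * (\<Sum>i<d. (\<lambda>x. r (T s (b k)) i * b i x)) x))"
      by (rule sum.cong[OF refl], rule arg_cong[OF expand[OF TE[OF s bE]]]) simp
    also have "\<dots> = (\<Sum>i<d. (\<lambda>x. (\<Sum>k<d. r (T s (b k)) i * r (U (b j)) k) * b i x))"
      by (rule ext) (simp add: sum_fun_apply sum_distrib_left sum_distrib_right mult_ac, rule sum.swap)
    finally have e: "T s (U (b j)) = (\<Sum>i<d. (\<lambda>x. (\<Sum>k<d. r (T s (b k)) i * r (U (b j)) k) * b i x))" .
    have "r (T s (U (b j))) i = (\<Sum>k<d. r (T s (b k)) i * r (U (b j)) k)"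
      by (subst e) (rule runiq[OF ij(1)])
    then show "M (\<lambda>f. T s (U f)) $$ (i, j) = (M (T s) * M U) $$ (i, j)"
      using ij by (simp add: M_def scalar_prod_def atLeast0LessThan)
  qed (simp_all add: M_def)
  have rlin: "r (\<lambda>x. c * f x + e * g x) i = c * r f i + e * r g i" if "f \<in> E" "g \<in> E" "i < d" for c e f g i
  proof -
    have "(\<lambda>x. c * f x + e * g x) = (\<Sum>i<d. (\<lambda>x. (c * r f i + e * r g i) * b i x))"
    proof
      fix x
      have "f x = (\<Sum>i<d. r f i * b i x)" "g x = (\<Sum>i<d. r g i * b i x)"
        using fun_cong[OF expand[OF that(1)], of x] fun_cong[OF expand[OF that(2)], of x] by (simp_all add: sum_fun_apply)
      then show "c * f x + e * g x = (\<Sum>i<d. (\<lambda>x. (c * r f i + e * r g i) * b i x)) x"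
        by (simp add: sum_fun_apply sum_distrib_left sum.distrib algebra_simps)
    qed
    then show ?thesis using runiq[OF that(3), of "\<lambda>i. c * r f i + e * r g i"] by simp
  qed
  have rb: "r (b j) i = (if i = j then 1 else 0)" if "i < d" "j < d" for i j
    unfolding r_def using that b by (auto simp: fun_vs.representation_basis[OF D(2) bD] bij_betw_def inj_on_def)
  have MT: "Determinant.det (M (T s)) \<in> Q" if s: "s \<in> I" for s
  proof (rule det_quadratic_mem[OF Mc _ Q(1,2) Q(3)[OF s] Q(4)])
    have "M (T s) * M (T s) = M (\<lambda>f. T s (T s f))" using Mmult[OF s TE[OF s]] by simp
    also have "\<dots> = (q s - 1) \<cdot>\<^sub>m M (T s) + q s \<cdot>\<^sub>m 1\<^sub>m d"
      by (rule eq_matI) (simp_all add: M_def Tq[OF s bE] rlin[OF TE[OF s bE] bE] rb)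
    finally show "M (T s) * M (T s) = (q s - 1) \<cdot>\<^sub>m M (T s) + q s \<cdot>\<^sub>m 1\<^sub>m d" .
  qed
  have M1: "M (\<lambda>f. f) = 1\<^sub>m d" by (rule eq_matI) (simp_all add: M_def rb)
  have "set us \<subseteq> I \<Longrightarrow> (\<forall>f\<in>E. foldr T us f \<in> E) \<and> Determinant.det (M (foldr T us)) \<in> Q" for us
  proof (induction us)
    case Nil
    then show ?case using M1 Q(1) by (simp add: id_def)
  next
    case (Cons s us)
    have "M (\<lambda>f. T s (foldr T us f)) = M (T s) * M (foldr T us)"
      using Mmult[of s "foldr T us"] Cons by simp
    then show ?case using Cons TE MT Q(4) det_mult[OF Mc Mc] by (simp add: o_def)
  qed
  then have "Determinant.det (M (foldr T ss)) \<in> Q" using ss by blast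
  moreover have "M (foldr T ss) = \<nu> \<cdot>\<^sub>m 1\<^sub>m d"
  proof (rule eq_matI)
    fix i j assume "i < dim_row (\<nu> \<cdot>\<^sub>m 1\<^sub>m d)" "j < dim_col (\<nu> \<cdot>\<^sub>m 1\<^sub>m d)"
    then have ij: "i < d" "j < d" by auto
    have "r (\<lambda>x. \<nu> * b j x) i = \<nu> * r (b j) i"
      using rlin[OF bE[OF ij(2)] bE[OF ij(2)] ij(1), of \<nu> 0] by simp
    then show "M (foldr T ss) $$ (i, j) = (\<nu> \<cdot>\<^sub>m 1\<^sub>m d) $$ (i, j)"
      using ij lam[OF bE[OF ij(2)]] rb by (simp add: M_def)
  qed (simp_all add: M_def)
  ultimately have "\<nu> ^ d \<in> Q" by (simp add: det_smult)
  then show ?thesis using d0 by blast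
qed

section \<open>Hecke operators on functions on the group\<close>

context finite_tits_system
begin

lemma finite_C: "w \<in> carrier W \<Longrightarrow> finite (C w)"
  using finite_subset[OF C_sub finite_G] .

lemma finite_B: "finite B"
  using finite_subset[OF subgroup.subset[OF B_subgroup] finite_G] .

lemma card_B_pos: "card B > 0"
  using finite_B B_one by (metis card_gt_0_iff empty_iff)

lemma P_empty: "P {} = B"
  unfolding P_def using G.generate_empty W.generate_empty C_one by simp

text \<open>Functions on the cosets of \<open>P I\<close>, set to 0 outside \<open>carrier G\<close>
  so that equality as HOL functions is equality on the group.\<close>

definition invariant_fun :: "'w set \<Rightarrow> ('a \<Rightarrow> complex) set" where
  "invariant_fun I = {f. (\<forall>g. g \<notin> carrier G \<longrightarrow> f g = 0) \<and> (\<forall>g\<in>carrier G. \<forall>p\<in>P I. f (g \<otimes> p) = f g)}"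

lemma invariant_fun_B: "f \<in> invariant_fun I \<Longrightarrow> f \<in> invariant_fun {}"
  using P_empty B_P[of I] unfolding invariant_fun_def by blast

text \<open>Division by the order of \<open>B\<close> makes the operator of the identity element act
  as the identity on right \<open>B\<close>-invariant functions, and lets products with additive
  length come out without factors.\<close>

definition hecke :: "'w \<Rightarrow> ('a \<Rightarrow> complex) \<Rightarrow> 'a \<Rightarrow> complex" where
  "hecke w f = (\<lambda>g. if g \<in> carrier G then (\<Sum>x\<in>C w. f (g \<otimes> x)) / of_nat (card B) else 0)"

definition hecke_param :: "'w \<Rightarrow> complex" where
  "hecke_param w = of_nat (card (C w)) / of_nat (card B)"

lemma hecke_add: "hecke w (f + h) = hecke w f + hecke w h"
  unfolding hecke_def by (auto simp: fun_eq_iff sum.distrib add_divide_distrib)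

lemma hecke_scale: "hecke w (\<lambda>x. c * f x) = (\<lambda>x. c * hecke w f x)"
  unfolding hecke_def by (auto simp: fun_eq_iff sum_distrib_left)

lemma hecke_invariant:
  assumes w: "w \<in> carrier W" shows "hecke w f \<in> invariant_fun {}"
  unfolding invariant_fun_def
proof (intro CollectI conjI allI impI ballI)
  show "hecke w f g = 0" if "g \<notin> carrier G" for g using that by (simp add: hecke_def)
  fix g p assume g: "g \<in> carrier G" and "p \<in> P {}"
  then have p: "p \<in> B" using P_empty by simp
  have "(\<Sum>x\<in>C w. f (g \<otimes> p \<otimes> x)) = (\<Sum>x\<in>C w. f (g \<otimes> x))"
    by (rule sum.reindex_bij_witness[of _ "\<lambda>x. inv p \<otimes> x" "\<lambda>x. p \<otimes> x"])
      (use w p g C_carrier[OF w] in \<open>simp_all add: G.m_assoc\<close>)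
  then show "hecke w f (g \<otimes> p) = hecke w f g" using g p by (simp add: hecke_def)
qed

lemma sum_mult_fibres:
  fixes h :: "'a \<Rightarrow> complex"
  assumes A: "A \<subseteq> carrier G" and D: "D \<subseteq> carrier G" and Z: "Z \<subseteq> carrier G"
    and m: "\<And>x y. x \<in> A \<Longrightarrow> y \<in> D \<Longrightarrow> x \<otimes> y \<in> Z"
  shows "(\<Sum>x\<in>A. \<Sum>y\<in>D. h (x \<otimes> y)) = (\<Sum>z\<in>Z. of_nat (card {x\<in>A. inv x \<otimes> z \<in> D}) * h z)"
proof -
  have fin: "finite A" "finite D" "finite Z" using A D Z finite_G finite_subset by blast+
  have "(\<Sum>y\<in>D. h (x \<otimes> y)) = (\<Sum>z\<in>Z. if inv x \<otimes> z \<in> D then h z else 0)" if x: "x \<in> A" for x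
  proof -
    have xc: "x \<in> carrier G" using x A by blast
    have "(\<Sum>y\<in>D. h (x \<otimes> y)) = (\<Sum>z\<in>{z\<in>Z. inv x \<otimes> z \<in> D}. h z)"
      by (rule sum.reindex_bij_witness[of _ "\<lambda>z. inv x \<otimes> z" "\<lambda>y. x \<otimes> y"])
        (use x xc m D Z in \<open>auto simp: subset_iff\<close>)
    then show ?thesis using fin by (simp add: sum.inter_filter)
  qed
  then have "(\<Sum>x\<in>A. \<Sum>y\<in>D. h (x \<otimes> y)) = (\<Sum>x\<in>A. \<Sum>z\<in>Z. if inv x \<otimes> z \<in> D then h z else 0)" by simp
  also have "\<dots> = (\<Sum>z\<in>Z. \<Sum>x\<in>A. if inv x \<otimes> z \<in> D then h z else 0)" by (rule sum.swap)
  also have "\<dots> = (\<Sum>z\<in>Z. of_nat (card {x\<in>A. inv x \<otimes> z \<in> D}) * h z)"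
    using fin by (simp flip: sum.inter_filter)
  finally show ?thesis .
qed

text \<open>The first members form one coset \<open>x0 B\<close>: for another \<open>x\<close>, an
  element \<open>inv x \<otimes> x0\<close> in \<open>C s\<close> would push
  \<open>inv x \<otimes> z\<close> into \<open>C (s \<cdot> w)\<close>, away from
  \<open>C w\<close>.\<close>

lemma card_fibre_S:
  assumes s: "s \<in> S" and w: "w \<in> carrier W" and l: "W.len w \<le> W.len (s \<cdot> w)" and z: "z \<in> C (s \<cdot> w)"
  shows "card {x \<in> C s. inv x \<otimes> z \<in> C w} = card B"
proof -
  have sW: "s \<in> carrier W" using s by simp
  obtain x0 y0 where 0: "x0 \<in> C s" "y0 \<in> C w" "z = x0 \<otimes> y0" using C_factor[OF sW w z] by blast
  have c: "x0 \<in> carrier G" "y0 \<in> carrier G" using 0 C_carrier sW w by blast+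
  have "{x \<in> C s. inv x \<otimes> z \<in> C w} = (\<lambda>b. x0 \<otimes> b) ` B"
  proof (intro equalityI subsetI)
    fix x assume "x \<in> (\<lambda>b. x0 \<otimes> b) ` B"
    then obtain b where b: "b \<in> B" "x = x0 \<otimes> b" by blast
    have "inv x \<otimes> z = inv b \<otimes> y0" using b c 0(3) by (simp add: G.inv_mult_group G.m_assoc)
    then show "x \<in> {x \<in> C s. inv x \<otimes> z \<in> C w}" using b 0 sW w by simp
  next
    fix x assume "x \<in> {x \<in> C s. inv x \<otimes> z \<in> C w}"
    then have x: "x \<in> C s" "inv x \<otimes> z \<in> C w" by auto
    have xc: "x \<in> carrier G" using x C_carrier sW by blast
    have ix: "inv x \<in> C s" using C_inv[OF sW x(1)] s by simp
    have "inv x \<otimes> x0 \<in> C s \<union> C (s \<cdot> s)" using C_S_mult[OF s sW ix 0(1)] .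
    moreover have "inv x \<otimes> x0 \<notin> C s"
    proof
      assume "inv x \<otimes> x0 \<in> C s"
      then have "(inv x \<otimes> x0) \<otimes> y0 \<in> C (s \<cdot> w)" by (rule C_S_mult_ge[OF s w l _ 0(2)])
      moreover have "(inv x \<otimes> x0) \<otimes> y0 = inv x \<otimes> z" using c xc 0(3) by (simp add: G.m_assoc)
      ultimately have "s \<cdot> w = w" using C_inj[of "s \<cdot> w" w] x(2) sW w by simp
      then show False using W.S_invol[OF s] w sW W.r_cancel_one'[of w s] by auto
    qed
    ultimately have b: "inv x \<otimes> x0 \<in> B" using s C_one by simp
    have "x = x0 \<otimes> inv (inv x \<otimes> x0)" using c xc by (simp add: G.inv_mult_group)
    then show "x \<in> (\<lambda>b. x0 \<otimes> b) ` B" using B_inv[OF b] by (rule image_eqI)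
  qed
  then show ?thesis using G.card_l_translate[OF c(1) subgroup.subset[OF B_subgroup]] by simp
qed

lemma hecke_hecke:
  assumes "w \<in> carrier W" "v \<in> carrier W" and g: "g \<in> carrier G"
  shows "hecke w (hecke v f) g = (\<Sum>x\<in>C w. \<Sum>y\<in>C v. f (g \<otimes> (x \<otimes> y))) / (of_nat (card B) * of_nat (card B))"
proof -
  have "hecke v f (g \<otimes> x) = (\<Sum>y\<in>C v. f (g \<otimes> (x \<otimes> y))) / of_nat (card B)" if "x \<in> C w" for x
    using that assms C_carrier[of w x] C_carrier[of v] by (simp add: hecke_def G.m_assoc)
  then show ?thesis using g by (simp add: hecke_def[of w] sum_divide_distrib)
qed

lemma hecke_S_mult:
  assumes s: "s \<in> S" and w: "w \<in> carrier W" and l: "W.len w \<le> W.len (s \<cdot> w)"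
  shows "hecke s (hecke w f) = hecke (s \<cdot> w) f"
proof
  fix g
  have sW: "s \<in> carrier W" and sw: "s \<cdot> w \<in> carrier W" using s w by auto
  show "hecke s (hecke w f) g = hecke (s \<cdot> w) f g"
  proof (cases "g \<in> carrier G")
    case g: True
    have "(\<Sum>x\<in>C s. \<Sum>y\<in>C w. f (g \<otimes> (x \<otimes> y)))
        = (\<Sum>z\<in>C (s \<cdot> w). of_nat (card {x\<in>C s. inv x \<otimes> z \<in> C w}) * f (g \<otimes> z))"
      by (rule sum_mult_fibres[OF C_sub[OF sW] C_sub[OF w] C_sub[OF sw], of "\<lambda>z. f (g \<otimes> z)"])
        (rule C_S_mult_ge[OF s w l])
    also have "\<dots> = (\<Sum>z\<in>C (s \<cdot> w). of_nat (card B) * f (g \<otimes> z))"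
      by (rule sum.cong[OF refl]) (simp add: card_fibre_S[OF s w l])
    finally show ?thesis using g card_B_pos
      by (simp add: hecke_hecke[OF sW w g]) (simp add: hecke_def flip: sum_distrib_left)
  qed (simp add: hecke_def)
qed

lemma hecke_one:
  assumes f: "f \<in> invariant_fun {}" shows "hecke \<one>\<^bsub>W\<^esub> f = f"
proof
  fix g
  have "(\<Sum>x\<in>B. f (g \<otimes> x)) = of_nat (card B) * f g" if "g \<in> carrier G"
    using f that P_empty by (simp add: invariant_fun_def)
  then show "hecke \<one>\<^bsub>W\<^esub> f g = f g" using f card_B_pos C_one by (auto simp: hecke_def invariant_fun_def)
qed

text \<open>Products of two elements of \<open>C s\<close> fall into \<open>B\<close> or
  \<open>C s\<close>. Over a point of \<open>B\<close> every first member occurs; over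
  \<open>z\<close> in \<open>C s\<close> the coset \<open>z B\<close> is excluded. These two counts
  are the coefficients.\<close>

lemma hecke_quadratic:
  assumes s: "s \<in> S" and f: "f \<in> invariant_fun {}"
  shows "hecke s (hecke s f) = (\<lambda>g. (hecke_param s - 1) * hecke s f g + hecke_param s * f g)"
proof
  fix g
  have sW: "s \<in> carrier W" using s by simp
  let ?b = "of_nat (card B) :: complex" and ?c = "of_nat (card (C s)) :: complex"
  have b0: "?b \<noteq> 0" using card_B_pos by simp
  have dis: "B \<inter> C s = {}"
    using C_inj[of "\<one>\<^bsub>W\<^esub>" s] C_one W.S_invol[OF s] sW by auto
  have Bc: "B \<subseteq> carrier G" using subgroup.subset[OF B_subgroup] .
  show "hecke s (hecke s f) g = (hecke_param s - 1) * hecke s f g + hecke_param s * f g"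
  proof (cases "g \<in> carrier G")
    case False
    then show ?thesis using f by (simp add: hecke_def invariant_fun_def)
  next
    case g: True
    have 1: "x \<otimes> y \<in> B \<union> C s" if "x \<in> C s" "y \<in> C s" for x y
      using C_S_mult[OF s sW that] s C_one by auto
    have cB: "card {x\<in>C s. inv x \<otimes> z \<in> C s} = card (C s)" if "z \<in> B" for z
    proof -
      have "inv x \<otimes> z \<in> C s" if "x \<in> C s" for x
        using C_right[OF sW \<open>z \<in> B\<close>, of "inv x"] C_inv[OF sW that] s by simp
      then show ?thesis by (metis (mono_tags, lifting) Collect_cong Collect_mem_eq)
    qed
    have cC: "of_nat (card {x\<in>C s. inv x \<otimes> z \<in> C s}) = ?c - ?b" if z: "z \<in> C s" for z
    proof -
      have zc: "z \<in> carrier G" using z C_carrier sW by blast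
      have e: "{x\<in>C s. inv x \<otimes> z \<in> C s} = C s - (\<lambda>b. z \<otimes> b) ` B"
      proof (intro equalityI subsetI)
        fix x assume x: "x \<in> {x\<in>C s. inv x \<otimes> z \<in> C s}"
        then have xc: "x \<in> carrier G" using C_carrier sW by blast
        have "x \<notin> (\<lambda>b. z \<otimes> b) ` B"
        proof
          assume "x \<in> (\<lambda>b. z \<otimes> b) ` B"
          then obtain b where "b \<in> B" "x = z \<otimes> b" by blast
          then have "inv x \<otimes> z = inv b" "inv b \<in> B" using zc by (simp_all add: G.inv_mult_group G.m_assoc)
          then show False using x dis by auto
        qed
        then show "x \<in> C s - (\<lambda>b. z \<otimes> b) ` B" using x by blast
      next
        fix x assume x: "x \<in> C s - (\<lambda>b. z \<otimes> b) ` B"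
        then have xc: "x \<in> carrier G" using C_carrier sW by blast
        have "inv x \<in> C s" using C_inv[OF sW, of x] x s by simp
        then have "inv x \<otimes> z \<in> B \<union> C s" using 1 z by blast
        moreover have "inv x \<otimes> z \<notin> B"
        proof
          assume "inv x \<otimes> z \<in> B"
          then have "inv (inv x \<otimes> z) \<in> B" by simp
          moreover have "x = z \<otimes> inv (inv x \<otimes> z)" using xc zc by (simp add: G.inv_mult_group)
          ultimately show False using x by blast
        qed
        ultimately show "x \<in> {x\<in>C s. inv x \<otimes> z \<in> C s}" using x by blast
      qed
      have sub: "(\<lambda>b. z \<otimes> b) ` B \<subseteq> C s" using z sW by auto
      have cz: "card ((\<lambda>b. z \<otimes> b) ` B) = card B" by (rule G.card_l_translate[OF zc Bc])
      have "card B \<le> card (C s)" using card_mono[OF finite_C[OF sW] sub] cz by simp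
      then show ?thesis unfolding e
        using card_Diff_subset[OF finite_subset[OF sub finite_C[OF sW]] sub] cz by (simp add: of_nat_diff)
    qed
    have "(\<Sum>x\<in>C s. \<Sum>y\<in>C s. f (g \<otimes> (x \<otimes> y)))
        = (\<Sum>z\<in>B \<union> C s. of_nat (card {x\<in>C s. inv x \<otimes> z \<in> C s}) * f (g \<otimes> z))"
      by (rule sum_mult_fibres[OF C_sub[OF sW] C_sub[OF sW], of _ "\<lambda>z. f (g \<otimes> z)"])
        (use 1 Bc C_sub[OF sW] in auto)
    also have "\<dots> = (\<Sum>z\<in>B. of_nat (card {x\<in>C s. inv x \<otimes> z \<in> C s}) * f (g \<otimes> z))
                 + (\<Sum>z\<in>C s. of_nat (card {x\<in>C s. inv x \<otimes> z \<in> C s}) * f (g \<otimes> z))"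
      by (rule sum.union_disjoint[OF finite_B finite_C[OF sW] dis])
    also have "(\<Sum>z\<in>B. of_nat (card {x\<in>C s. inv x \<otimes> z \<in> C s}) * f (g \<otimes> z)) = (\<Sum>z\<in>B. ?c * f g)"
      by (rule sum.cong[OF refl]) (use f g P_empty in \<open>simp add: cB invariant_fun_def\<close>)
    also have "\<dots> = ?b * ?c * f g" by simp
    also have "(\<Sum>z\<in>C s. of_nat (card {x\<in>C s. inv x \<otimes> z \<in> C s}) * f (g \<otimes> z)) = (?c - ?b) * (\<Sum>z\<in>C s. f (g \<otimes> z))"
      unfolding sum_distrib_left by (rule sum.cong[OF refl]) (simp only: cC)
    finally have "hecke s (hecke s f) g = (?b * ?c * f g + (?c - ?b) * (\<Sum>z\<in>C s. f (g \<otimes> z))) / (?b * ?b)"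
      using hecke_hecke[OF sW sW g] by simp
    also have "\<dots> = (hecke_param s - 1) * hecke s f g + hecke_param s * f g"
      using g b0 by (simp add: hecke_def hecke_param_def field_simps)
    finally show ?thesis .
  qed
qed

lemma hecke_word_mult:
  assumes y: "y \<in> carrier W" and f: "f \<in> invariant_fun {}"
  shows "set ss \<subseteq> S \<Longrightarrow> W.len (W.word ss \<cdot> y) = length ss + W.len y \<Longrightarrow>
    hecke (W.word ss \<cdot> y) f = foldr hecke ss (hecke y f)"
proof (induction ss)
  case Nil
  then show ?case using y by simp
next
  case (Cons s ss)
  have s: "s \<in> S" "s \<in> carrier W" and ss: "W.word ss \<in> carrier W" "set ss \<subseteq> S" using Cons.prems by auto
  let ?v = "W.word ss \<cdot> y"
  have v: "?v \<in> carrier W" using ss y by simp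
  have e: "W.word (s # ss) \<cdot> y = s \<cdot> ?v" using s ss y by (simp add: W.m_assoc)
  have "W.len ?v \<le> length ss + W.len y" using W.len_mult[OF ss(1) y] W.len_le[OF ss(2)] by linarith
  then have l: "W.len ?v = length ss + W.len y" "W.len ?v \<le> W.len (s \<cdot> ?v)"
    using Cons.prems(2) W.len_S_mult_le[OF s(1) v] unfolding e by simp_all
  show ?case unfolding e by (simp flip: hecke_S_mult[OF s(1) v l(2)] add: Cons.IH[OF ss(2) l(1)])
qed

lemma hecke_reduced_word:
  assumes f: "f \<in> invariant_fun {}" and "set ss \<subseteq> S" "W.len (W.word ss) = length ss"
  shows "hecke (W.word ss) f = foldr hecke ss f"
  using hecke_word_mult[OF W.one_closed f assms(2)] assms hecke_one[OF f] by simp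

lemma hecke_mult:
  assumes x: "x \<in> carrier W" and y: "y \<in> carrier W" and l: "W.len (x \<cdot> y) = W.len x + W.len y"
    and f: "f \<in> invariant_fun {}"
  shows "hecke x (hecke y f) = hecke (x \<cdot> y) f"
proof -
  obtain ss where ss: "set ss \<subseteq> S" "x = W.word ss" "length ss = W.len x" using W.reduced_word x by blast
  then show ?thesis
    using hecke_word_mult[OF y f ss(1)] hecke_reduced_word[OF hecke_invariant[OF y] ss(1), of f] l by simp
qed

lemma hecke_parabolic:
  assumes J: "J \<subseteq> S" and u: "u \<in> generate W J" and f: "f \<in> invariant_fun J"
  shows "hecke u f = (\<lambda>g. hecke_param u * f g)"
proof
  fix g
  have "f (g \<otimes> x) = f g" if "x \<in> C u" "g \<in> carrier G" for x
    using f that C_P[OF u] unfolding invariant_fun_def by blast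
  then show "hecke u f g = hecke_param u * f g"
    using f by (auto simp: hecke_def hecke_param_def invariant_fun_def)
qed

text \<open>With \<open>v = w_S s\<close> one has \<open>w_S = v s = t v\<close>, both with additive
  length, so \<open>T_w T_s = T_t T_v T_s = T_t T_w\<close>. Only the conjugate of \<open>s\<close>
  comes out, which is why the square is formed next.\<close>

lemma hecke_wlong_S:
  assumes s: "s \<in> S" and f: "f \<in> invariant_fun {}"
  shows "hecke (W.wlong S) (hecke s f) = hecke (W.wlong S \<cdot> s \<cdot> W.wlong S) (hecke (W.wlong S) f)"
proof -
  let ?w = "W.wlong S"
  let ?t = "?w \<cdot> s \<cdot> ?w"
  have w: "?w \<in> carrier W" and sW: "s \<in> carrier W" using s by auto
  have t: "?t \<in> S" using W.wlong_conj[OF subset_refl s] .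
  have lw: "W.len (?w \<cdot> u) + W.len u = W.len ?w" if "u \<in> carrier W" for u
    using W.wlong_len[OF subset_refl, of u] that W.S_gen by simp
  let ?v = "?w \<cdot> s"
  have v: "?v \<in> carrier W" using w sW by simp
  have lv: "W.len ?v + 1 = W.len ?w" using lw[OF sW] s by simp
  have vs: "?v \<cdot> s = ?w" using s w by simp
  have tv: "?t \<cdot> ?v = ?w" using s w sW by (simp add: W.m_assoc)
  have fi: "hecke s f \<in> invariant_fun {}" by (rule hecke_invariant[OF sW])
  have 1: "hecke ?v (hecke s f) = hecke ?w f" using hecke_mult[OF v sW _ f] vs lv s by simp
  have 2: "hecke ?t (hecke ?v h) = hecke ?w h" if "h \<in> invariant_fun {}" for h
    using hecke_mult[OF W.S_carrier[OF t] v _ that] tv lv t by simp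
  show ?thesis using 1 2[OF fi] by simp
qed

lemma hecke_wlong_square_commute:
  assumes s: "s \<in> S" and f: "f \<in> invariant_fun {}"
  shows "hecke (W.wlong S) (hecke (W.wlong S) (hecke s f)) = hecke s (hecke (W.wlong S) (hecke (W.wlong S) f))"
proof -
  let ?w = "W.wlong S"
  have t: "?w \<cdot> s \<cdot> ?w \<in> S" using W.wlong_conj[OF subset_refl s] .
  have i: "hecke ?w f \<in> invariant_fun {}" by (rule hecke_invariant) simp
  show ?thesis
    using hecke_wlong_S[OF s f] hecke_wlong_S[OF t i] W.wlong_conj_conj[OF subset_refl W.S_carrier[OF s]] by simp
qed

end

section \<open>Geodesic continuation as a double coset\<close>

context finite_tits_system
begin

lemma l_coset_eq_iff:
  assumes I: "I \<subseteq> S" and a: "a \<in> carrier G" and b: "b \<in> carrier G"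
  shows "a <# P I = b <# P I \<longleftrightarrow> inv a \<otimes> b \<in> P I"
proof
  assume e: "a <# P I = b <# P I"
  have "\<one> \<in> P I" using B_P B_one by blast
  then have "b \<otimes> \<one> \<in> b <# P I" unfolding l_coset_def by blast
  then have "b \<in> b <# P I" using b by simp
  then obtain p where "p \<in> P I" "b = a \<otimes> p" using e unfolding l_coset_def by blast
  then show "inv a \<otimes> b \<in> P I" using a P_sub[OF I] by auto
next
  assume p: "inv a \<otimes> b \<in> P I"
  have "b = a \<otimes> (inv a \<otimes> b)" using a b by simp
  then have "b <# P I = (a \<otimes> (inv a \<otimes> b)) <# P I" by simp
  also have "\<dots> = a <# ((inv a \<otimes> b) <# P I)" using a b P_sub[OF I] by (simp add: G.lcos_m_assoc)
  also have "(inv a \<otimes> b) <# P I = P I" using G.coset_join3[OF _ P_subgroup[OF I] p] a b by simp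
  finally show "a <# P I = b <# P I" by simp
qed

text \<open>The pullback to \<open>G\<close> of a function on oriented edges: \<open>g\<close>
  stands for the edge formed by its two vertices of types \<open>a\<close> and
  \<open>b\<close>.\<close>

definition lift_pair :: "('a set \<times> 'a set \<Rightarrow> complex) \<Rightarrow> 'w \<Rightarrow> 'w \<Rightarrow> 'a \<Rightarrow> complex" where
  "lift_pair v a b = (\<lambda>g. if g \<in> carrier G then v (g <# P (S - {a}), g <# P (S - {b})) else 0)"

definition mid :: "'w \<Rightarrow> 'w set" where
  "mid s = S - {s}"

text \<open>The type opposite to \<open>r\<close> in the link of a vertex of type \<open>s\<close>;
  the formula is the one in \<open>geodesic_path\<close>.\<close>

definition opp :: "'w \<Rightarrow> 'w \<Rightarrow> 'w" where
  "opp r s = W.wlong (mid s) \<cdot> r \<cdot> W.wlong (mid s)"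

text \<open>\<open>S - {r, s}\<close> and \<open>S - {s, opp r s}\<close> are the types of two consecutive edges of a geodesic through a vertex of type \<open>s\<close>.\<close>

definition lside :: "'w \<Rightarrow> 'w \<Rightarrow> 'w set" where
  "lside r s = S - {r, s}"

definition rside :: "'w \<Rightarrow> 'w \<Rightarrow> 'w set" where
  "rside r s = S - {s, opp r s}"

text \<open>The longest element of the parabolic subgroup of the middle vertex with its right-hand
  factor from \<open>W_rside\<close> removed, hence shortest in its coset of
  \<open>W_rside\<close>.\<close>

definition turn :: "'w \<Rightarrow> 'w \<Rightarrow> 'w" where
  "turn r s = W.wlong (mid s) \<cdot> W.wlong (rside r s)"

text \<open>The double coset of \<open>turn\<close> between \<open>P (lside r s)\<close> and
  \<open>P (rside r s)\<close>. The index \<open>u\<close> runs over the right factor only, as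
  \<open>turn\<close> moves \<open>W_lside\<close> past itself into \<open>W_rside\<close>
  (\<open>lside_turn\<close>).\<close>

definition turns :: "'w \<Rightarrow> 'w \<Rightarrow> 'a set" where
  "turns r s = (\<Union>u\<in>generate W (rside r s). C (turn r s \<cdot> u))"

lemma mid_S: "mid s \<subseteq> S" and lside_S: "lside r s \<subseteq> S" and rside_S: "rside r s \<subseteq> S"
  and rside_mid: "rside r s \<subseteq> mid s" and lside_mid: "lside r s \<subseteq> mid s"
  unfolding mid_def lside_def rside_def by auto

lemma turn_closed: "turn r s \<in> carrier W"
  unfolding turn_def using W.wlong_closed[OF mid_S] W.wlong_closed[OF rside_S] by simp

lemma turn_mid: "turn r s \<in> generate W (mid s)"
  unfolding turn_def using W.wlong_in[OF mid_S] W.wlong_in[OF rside_S] W.parabolic_mono[OF rside_mid] mid_S by blast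

lemma turn_len: "u \<in> generate W (rside r s) \<Longrightarrow> W.len (turn r s \<cdot> u) = W.len (turn r s) + W.len u"
proof -
  assume u: "u \<in> generate W (rside r s)"
  have c: "u \<in> carrier W" "W.wlong (mid s) \<in> carrier W" "W.wlong (rside r s) \<in> carrier W"
    using u rside_S mid_S by auto
  have m: "W.wlong (rside r s) \<cdot> u \<in> generate W (mid s)" "W.wlong (rside r s) \<in> generate W (mid s)"
    using u W.wlong_in[OF rside_S] W.parabolic_mono[OF rside_mid] mid_S by blast+
  have e: "(turn r s) \<cdot> u = W.wlong (mid s) \<cdot> (W.wlong (rside r s) \<cdot> u)" unfolding turn_def using c by (simp add: W.m_assoc)
  show ?thesis unfolding e unfolding turn_def
    using W.wlong_len[OF mid_S m(1)] W.wlong_len[OF mid_S m(2)] W.wlong_len[OF rside_S u] by linarith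
qed

context
  fixes r s :: 'w
  assumes r: "r \<in> S" and s: "s \<in> S" and rs: "r \<noteq> s"
begin

lemma opp_mid: "(opp r s) \<in> (mid s)"
  unfolding opp_def using W.wlong_conj[OF mid_S[of s], of r] r rs mid_def by auto

lemma opp_S: "(opp r s) \<in> S" and opp_neq: "(opp r s) \<noteq> s"
  using opp_mid unfolding mid_def by auto

lemma conj_lside:
  assumes i: "i \<in> (lside r s)" shows "W.wlong (mid s) \<cdot> i \<cdot> W.wlong (mid s) \<in> (rside r s)"
proof -
  have im: "i \<in> (mid s)" using i lside_mid[of r s] by blast
  have ic: "i \<in> carrier W" using im mid_S[of s] by auto
  have "W.wlong (mid s) \<cdot> i \<cdot> W.wlong (mid s) \<noteq> (opp r s)"
  proof
    assume "W.wlong (mid s) \<cdot> i \<cdot> W.wlong (mid s) = (opp r s)"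
    then have "i = r" unfolding opp_def
      using W.wlong_conj_conj[OF mid_S[of s] ic] W.wlong_conj_conj[OF mid_S[of s] W.S_carrier[OF r]] by metis
    then show False using i lside_def by auto
  qed
  then show ?thesis using W.wlong_conj[OF mid_S[of s] im] unfolding rside_def mid_def by auto
qed

lemma conj_parabolic_lside:
  assumes "u \<in> generate W (lside r s)" shows "W.wlong (mid s) \<cdot> u \<cdot> W.wlong (mid s) \<in> generate W (rside r s)"
  using assms
proof (induction rule: generate.induct)
  case one
  then show ?case using mid_S[of s] by simp
next
  case (incl h)
  then show ?case using conj_lside W.parabolic_incl by blast
next
  case (inv h)
  then have "inv\<^bsub>W\<^esub> h = h" using lside_S[of r s] by auto
  then show ?case using conj_lside[OF inv] W.parabolic_incl by simp
next
  case (eng h1 h2)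
  have c: "h1 \<in> carrier W" "h2 \<in> carrier W" using eng.hyps lside_S[of r s] by auto
  have "W.wlong (mid s) \<cdot> (h1 \<cdot> h2) \<cdot> W.wlong (mid s)
      = (W.wlong (mid s) \<cdot> h1 \<cdot> W.wlong (mid s)) \<cdot> (W.wlong (mid s) \<cdot> h2 \<cdot> W.wlong (mid s))"
    using c mid_S[of s] by (simp add: W.m_assoc)
  then show ?case using eng.IH rside_S[of r s] by (metis W.parabolic_mult)
qed

lemma lside_turn:
  assumes "u \<in> generate W (lside r s)" shows "\<exists>v\<in>generate W (rside r s). u \<cdot> (turn r s) = (turn r s) \<cdot> v"
proof -
  have uc: "u \<in> carrier W" using assms lside_S[of r s] by blast
  let ?u' = "W.wlong (mid s) \<cdot> u \<cdot> W.wlong (mid s)"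
  have u': "?u' \<in> generate W (rside r s)" by (rule conj_parabolic_lside[OF assms])
  have "u \<cdot> (turn r s) = (turn r s) \<cdot> (W.wlong (rside r s) \<cdot> ?u' \<cdot> W.wlong (rside r s))"
    unfolding turn_def using uc mid_S[of s] rside_S[of r s] by (simp add: W.m_assoc)
  moreover have "W.wlong (rside r s) \<cdot> ?u' \<cdot> W.wlong (rside r s) \<in> generate W (rside r s)"
    using u' W.wlong_in[OF rside_S[of r s]] rside_S[of r s] by blast
  ultimately show ?thesis by blast
qed

text \<open>Besides the generators in \<open>lside r s\<close> only \<open>s\<close> is to be
  checked, and \<open>s\<close> is no descent of an element of the parabolic subgroup that omits
  it.\<close>

lemma mid_reduced_left:
  assumes d: "d \<in> generate W (mid s)" and l: "W.reduced_left (lside r s) d"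
  shows "W.reduced_left (S - {r}) d"
  unfolding W.reduced_left_def
proof
  fix x assume x: "x \<in> S - {r}"
  then have xS: "x \<in> S" by blast
  have dc: "d \<in> carrier W" using d mid_S[of s] by blast
  show "W.len d < W.len (x \<cdot> d)"
  proof (cases "x = s")
    case True
    then have "\<not> W.len (x \<cdot> d) < W.len d" using W.parabolic_descent[OF mid_S[of s] d xS] mid_def by blast
    then show ?thesis using W.len_S_mult_neq[OF xS dc] by simp
  next
    case False
    then show ?thesis using l x unfolding W.reduced_left_def lside_def by blast
  qed
qed

lemma mid_reduced_right:
  assumes d: "d \<in> generate W (mid s)" and l: "W.reduced_right (rside r s) d"
  shows "W.reduced_right (S - {(opp r s)}) d"
  unfolding W.reduced_right_def
proof
  fix x assume x: "x \<in> S - {(opp r s)}"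
  then have xS: "x \<in> S" by blast
  have dc: "d \<in> carrier W" using d mid_S[of s] by blast
  show "W.len d < W.len (d \<cdot> x)"
  proof (cases "x = s")
    case True
    then have "\<not> W.len (d \<cdot> x) < W.len d" using W.parabolic_descent_right[OF mid_S[of s] d xS] mid_def by blast
    then show ?thesis using W.len_mult_S_greater[OF xS dc] by simp
  next
    case False
    then show ?thesis using l x unfolding W.reduced_right_def rside_def by blast
  qed
qed

lemma turn_reduced: "W.reduced_left (lside r s) (turn r s)" "W.reduced_right (rside r s) (turn r s)"
proof -
  show "W.reduced_right (rside r s) (turn r s)"
    unfolding W.reduced_right_def using turn_len[OF W.parabolic_incl] rside_S[of r s] by auto
  show "W.reduced_left (lside r s) (turn r s)"
    unfolding W.reduced_left_def
  proof
    fix i assume i: "i \<in> (lside r s)"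
    have iS: "i \<in> S" using i lside_S[of r s] by blast
    obtain v where v: "v \<in> generate W (rside r s)" "i \<cdot> (turn r s) = (turn r s) \<cdot> v" using lside_turn[OF W.parabolic_incl[OF i]] by blast
    have vc: "v \<in> carrier W" using v rside_S[of r s] by blast
    have "v \<noteq> \<one>\<^bsub>W\<^esub>"
    proof
      assume "v = \<one>\<^bsub>W\<^esub>"
      then have "i \<cdot> (turn r s) = (turn r s)" using v turn_closed by simp
      then have "i = \<one>\<^bsub>W\<^esub>" using W.r_cancel_one'[of "turn r s" i] turn_closed iS by auto
      then show False using W.S_invol iS by blast
    qed
    then show "W.len (turn r s) < W.len (i \<cdot> (turn r s))" using turn_len[OF v(1)] v(2) W.len_eq_0[OF vc] by simp
  qed
qed

text \<open>Opposition is stated with the large parabolic subgroups of types \<open>S - {r}\<close>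
  and \<open>S - {opp r s}\<close>. Inside \<open>W_mid\<close> the double coset shrinks: a shortest
  element \<open>d\<close> of \<open>W_lside m W_rside\<close> is reduced even for the large
  parabolics, and so is \<open>turn\<close>. Both lie in one large double coset, so uniqueness gives
  \<open>d = turn\<close>.\<close>

lemma double_coset_mid:
  assumes u: "u \<in> generate W (S - {r})" and v: "v \<in> generate W (S - {(opp r s)})"
    and m: "u \<cdot> W.wlong (mid s) \<cdot> v \<in> generate W (mid s)"
  shows "\<exists>j\<in>generate W (rside r s). u \<cdot> W.wlong (mid s) \<cdot> v = (turn r s) \<cdot> j"
proof -
  let ?m = "u \<cdot> W.wlong (mid s) \<cdot> v"
  let ?D = "{i \<cdot> ?m \<cdot> j | i j. i \<in> generate W (lside r s) \<and> j \<in> generate W (rside r s)}"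
  have Sr: "S - {r} \<subseteq> S" "S - {(opp r s)} \<subseteq> S" by auto
  have c: "u \<in> carrier W" "v \<in> carrier W" "?m \<in> carrier W" "W.wlong (mid s) \<in> carrier W" "W.wlong (rside r s) \<in> carrier W"
    using W.parabolic_carrier[OF Sr(1) u] W.parabolic_carrier[OF Sr(2) v] W.wlong_closed[OF mid_S[of s]]
      W.wlong_closed[OF rside_S[of r s]] by auto
  have "?m \<in> ?D" using c by (force intro: exI[of _ "\<one>\<^bsub>W\<^esub>"])
  then obtain d where d: "d \<in> ?D" "\<And>z. z \<in> ?D \<Longrightarrow> W.len d \<le> W.len z"
    using ex_has_least_nat[of "\<lambda>z. z \<in> ?D" ?m W.len] by auto
  then obtain i j where ij: "i \<in> generate W (lside r s)" "j \<in> generate W (rside r s)" "d = i \<cdot> ?m \<cdot> j" by auto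
  have ijc: "i \<in> carrier W" "j \<in> carrier W" using ij lside_S[of r s] rside_S[of r s] by auto
  have dm: "d \<in> generate W (mid s)" unfolding ij(3)
    using ij(1,2) m W.parabolic_mono[OF rside_mid[of r s]] W.parabolic_mono[OF lside_mid[of r s]] mid_S[of s] by blast
  have dc: "d \<in> carrier W" using dm mid_S[of s] by blast
  have "W.reduced_left (lside r s) d"
    unfolding W.reduced_left_def
  proof
    fix x assume x: "x \<in> (lside r s)"
    have xS: "x \<in> S" using x lside_S[of r s] by blast
    have "x \<cdot> d = (x \<cdot> i) \<cdot> ?m \<cdot> j" unfolding ij(3) using xS c(3) ijc by (simp add: W.m_assoc)
    moreover have "x \<cdot> i \<in> generate W (lside r s)" using x ij(1) lside_S[of r s] by blast
    ultimately have "x \<cdot> d \<in> ?D" using ij(2) by blast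
    then show "W.len d < W.len (x \<cdot> d)" using d(2) W.len_S_mult_neq[OF xS dc] by fastforce
  qed
  then have dl: "W.reduced_left (S - {r}) d" by (rule mid_reduced_left[OF dm])
  have "W.reduced_right (rside r s) d"
    unfolding W.reduced_right_def
  proof
    fix x assume x: "x \<in> (rside r s)"
    have xS: "x \<in> S" using x rside_S[of r s] by blast
    have "d \<cdot> x = i \<cdot> ?m \<cdot> (j \<cdot> x)" unfolding ij(3) using xS c(3) ijc by (simp add: W.m_assoc)
    moreover have "j \<cdot> x \<in> generate W (rside r s)" using x ij(2) rside_S[of r s] by blast
    ultimately have "d \<cdot> x \<in> ?D" using ij(1) by blast
    then have "W.len d \<le> W.len (d \<cdot> x)" using d(2) by blast
    then show "W.len d < W.len (d \<cdot> x)" using W.len_mult_S_greater[OF xS dc] by linarith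
  qed
  then have dr: "W.reduced_right (S - {(opp r s)}) d" by (rule mid_reduced_right[OF dm])
  have e1: "d = (i \<cdot> u) \<cdot> (turn r s) \<cdot> (W.wlong (rside r s) \<cdot> v \<cdot> j)"
    unfolding ij(3) turn_def using c ijc rside_S[of r s] by (simp add: W.m_assoc)
  have l: "(lside r s) \<subseteq> S - {r}" "(rside r s) \<subseteq> S - {(opp r s)}" unfolding lside_def rside_def by auto
  have "i \<cdot> u \<in> generate W (S - {r})" using ij(1) u W.parabolic_mono[OF l(1)] Sr by blast
  moreover have "W.wlong (rside r s) \<cdot> v \<cdot> j \<in> generate W (S - {(opp r s)})"
    using ij(2) v W.wlong_in[OF rside_S[of r s]] W.parabolic_mono[OF l(2)] Sr by blast
  ultimately have dt: "d = (turn r s)"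
    using W.double_coset_reduced_unique[OF Sr turn_closed _ _ dc dl dr _ _ e1]
      mid_reduced_left[OF turn_mid turn_reduced(1)] mid_reduced_right[OF turn_mid turn_reduced(2)] by blast
  have "?m = (inv\<^bsub>W\<^esub> i \<cdot> (turn r s)) \<cdot> inv\<^bsub>W\<^esub> j"
  proof -
    have "?m = inv\<^bsub>W\<^esub> i \<cdot> d \<cdot> inv\<^bsub>W\<^esub> j" unfolding ij(3) using c(3) ijc by (simp add: W.m_assoc)
    then show ?thesis unfolding dt .
  qed
  moreover obtain v' where v': "v' \<in> generate W (rside r s)" "inv\<^bsub>W\<^esub> i \<cdot> (turn r s) = (turn r s) \<cdot> v'"
    using lside_turn[OF W.parabolic_inv[OF lside_S[of r s] ij(1)]] by blast
  moreover have "v' \<in> carrier W" using v' rside_S[of r s] by blast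
  ultimately have "?m = (turn r s) \<cdot> (v' \<cdot> inv\<^bsub>W\<^esub> j)" using turn_closed ijc by (simp add: W.m_assoc)
  moreover have "v' \<cdot> inv\<^bsub>W\<^esub> j \<in> generate W (rside r s)" using v'(1) ij(2) rside_S[of r s] by blast
  ultimately show ?thesis by blast
qed

text \<open>For \<open>k\<close> in the stabiliser of the middle vertex, the opposition condition
  becomes membership in a disjoint union of cells, over which functions can be summed.\<close>

lemma turns_iff:
  "k \<in> (turns r s) \<longleftrightarrow> k \<in> P (mid s) \<and> (\<exists>p\<in>P (S - {r}). \<exists>x\<in>C (W.wlong (mid s)). \<exists>p'\<in>P (S - {(opp r s)}). k = p \<otimes> x \<otimes> p')"
proof
  assume "k \<in> (turns r s)"
  then obtain u where u: "u \<in> generate W (rside r s)" "k \<in> C ((turn r s) \<cdot> u)" unfolding turns_def by blast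
  have uc: "u \<in> carrier W" using u rside_S[of r s] by blast
  have um: "(turn r s) \<cdot> u \<in> generate W (mid s)" using turn_mid u W.parabolic_mono[OF rside_mid[of r s]] mid_S[of s] by blast
  have e: "(turn r s) \<cdot> u = W.wlong (mid s) \<cdot> (W.wlong (rside r s) \<cdot> u)"
    unfolding turn_def using uc mid_S[of s] rside_S[of r s] by (simp add: W.m_assoc)
  have w: "W.wlong (rside r s) \<cdot> u \<in> generate W (rside r s)" using u(1) W.wlong_in[OF rside_S[of r s]] rside_S[of r s] by blast
  have wS: "W.wlong (rside r s) \<cdot> u \<in> generate W (S - {(opp r s)})"
    by (rule W.parabolic_mono[OF _ w]) (auto simp: rside_def)
  obtain x y where xy: "x \<in> C (W.wlong (mid s))" "y \<in> C (W.wlong (rside r s) \<cdot> u)" "k = x \<otimes> y"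
    using C_factor[of "W.wlong (mid s)" "W.wlong (rside r s) \<cdot> u" k] u(2) uc mid_S[of s] rside_S[of r s] unfolding e by auto
  have "x \<in> carrier G" using C_carrier[OF _ xy(1)] mid_S[of s] by simp
  then have "k = \<one> \<otimes> x \<otimes> y" using xy(3) by simp
  moreover have "\<one> \<in> P (S - {r})" using B_P B_one by blast
  moreover have "y \<in> P (S - {(opp r s)})" using C_P[OF wS] xy(2) by blast
  moreover have "k \<in> P (mid s)" using C_P[OF um] u(2) by blast
  ultimately show "k \<in> P (mid s) \<and> (\<exists>p\<in>P (S - {r}). \<exists>x\<in>C (W.wlong (mid s)). \<exists>p'\<in>P (S - {(opp r s)}). k = p \<otimes> x \<otimes> p')"
    using xy(1) by blast
next
  assume "k \<in> P (mid s) \<and> (\<exists>p\<in>P (S - {r}). \<exists>x\<in>C (W.wlong (mid s)). \<exists>p'\<in>P (S - {(opp r s)}). k = p \<otimes> x \<otimes> p')"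
  then obtain p x p' where k: "k \<in> P (mid s)" "p \<in> P (S - {r})" "x \<in> C (W.wlong (mid s))" "p' \<in> P (S - {(opp r s)})"
    "k = p \<otimes> x \<otimes> p'" by blast
  have Sr: "S - {r} \<subseteq> S" "S - {(opp r s)} \<subseteq> S" by auto
  have wm: "W.wlong (mid s) \<in> carrier W" using mid_S[of s] by simp
  obtain u where u: "u \<in> generate W (S - {r})" "p \<otimes> x \<in> C (u \<cdot> W.wlong (mid s))"
    using P_C_mult[OF Sr(1) wm k(2,3)] by blast
  have uc: "u \<in> carrier W" using u(1) Sr by blast
  obtain v where v: "v \<in> generate W (S - {(opp r s)})" "k \<in> C (u \<cdot> W.wlong (mid s) \<cdot> v)"
    using C_P_mult[OF Sr(2) _ u(2) k(4)] uc wm k(5) by auto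
  have vc: "v \<in> carrier W" using v(1) Sr by blast
  have "u \<cdot> W.wlong (mid s) \<cdot> v \<in> generate W (mid s)"
    using C_P_iff[OF mid_S[of s] _ v(2)] uc wm vc k(1) by simp
  then obtain j where "j \<in> generate W (rside r s)" "u \<cdot> W.wlong (mid s) \<cdot> v = (turn r s) \<cdot> j" using double_coset_mid[OF u(1) v(1)] by blast
  then show "k \<in> (turns r s)" using v(2) unfolding turns_def by auto
qed

lemma turns_carrier: "(turns r s) \<subseteq> carrier G"
  unfolding turns_iff using P_sub[OF mid_S[of s]] turns_iff by blast

end

end

section \<open>Eigenvectors of the geodesic transfer operator\<close>

context finite_tits_system
begin

lemma l_coset_mult_P:
  assumes "I \<subseteq> S" "g \<in> carrier G" "p \<in> P I"
  shows "(g \<otimes> p) <# P I = g <# P I"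
proof -
  have p: "p \<in> carrier G" using assms P_sub by blast
  have "inv g \<otimes> (g \<otimes> p) \<in> P I" using assms p by simp
  then show ?thesis using l_coset_eq_iff[OF assms(1,2), of "g \<otimes> p"] assms(2) p by simp
qed

lemma lift_pair_invariant:
  assumes "a \<in> S" "b \<in> S"
  shows "lift_pair v a b \<in> invariant_fun (S - {a, b})"
proof -
  have sub: "S - {a} \<subseteq> S" "S - {b} \<subseteq> S" "S - {a, b} \<subseteq> S" by auto
  have "P (S - {a, b}) \<subseteq> P (S - {a})" "P (S - {a, b}) \<subseteq> P (S - {b})" by (rule P_mono; blast)+
  then show ?thesis unfolding invariant_fun_def lift_pair_def
    using l_coset_mult_P[OF sub(1)] l_coset_mult_P[OF sub(2)] P_sub[OF sub(3)]
    by (auto simp: subset_iff)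
qed

lemma finite_P: "I \<subseteq> S \<Longrightarrow> finite (P I)"
  using P_sub finite_G finite_subset by blast

lemma card_P:
  assumes I: "I \<subseteq> S" shows "card (P I) = (\<Sum>w\<in>generate W I. card (C w))"
  unfolding P_def
proof (rule card_UN_disjoint)
  show "finite (generate W I)" using W.finite_parabolic[OF I] .
  show "\<forall>w\<in>generate W I. finite (C w)" using finite_C I by blast
  show "\<forall>w\<in>generate W I. \<forall>v\<in>generate W I. w \<noteq> v \<longrightarrow> C w \<inter> C v = {}"
    using C_inj W.parabolic_carrier[OF I] by blast
qed

context
  fixes r s :: 'w
  assumes r: "r \<in> S" and s: "s \<in> S" and rs: "r \<noteq> s"
begin

text \<open>On each cell the factor \<open>T_u\<close> acts by the scalar \<open>q_u\<close>, as
  \<open>f\<close> is invariant under \<open>P (rside r s)\<close>; the sizes of the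
  \<open>C u\<close> add up to the order of this parabolic subgroup.\<close>

lemma sum_turns:
  assumes f: "f \<in> invariant_fun (rside r s)" and g: "g \<in> carrier G"
  shows "(\<Sum>k\<in>turns r s. f (g \<otimes> k)) = of_nat (card (P (rside r s))) * hecke (turn r s) f g"
proof -
  let ?J = "rside r s" let ?t = "turn r s"
  note J = rside_S[of r s] and tc = turn_closed[of r s]
  have uc: "u \<in> carrier W" if "u \<in> generate W ?J" for u using that J by blast
  have b0: "of_nat (card B) \<noteq> (0::complex)" using card_B_pos by simp
  have 1: "(\<Sum>k\<in>C (?t \<cdot> u). f (g \<otimes> k)) = of_nat (card (C u)) * hecke ?t f g" if u: "u \<in> generate W ?J" for u
  proof -
    have "hecke (?t \<cdot> u) f = hecke ?t (hecke u f)"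
      using hecke_mult[OF tc uc[OF u] turn_len[OF u] invariant_fun_B[OF f]] by simp
    also have "\<dots> = (\<lambda>g. hecke_param u * hecke ?t f g)"
      unfolding hecke_parabolic[OF J u f] by (rule hecke_scale)
    finally have "hecke (?t \<cdot> u) f g = hecke_param u * hecke ?t f g" by simp
    then show ?thesis using g b0 by (simp add: hecke_def[of "?t \<cdot> u"] hecke_param_def field_simps)
  qed
  have "(\<Sum>k\<in>turns r s. f (g \<otimes> k)) = (\<Sum>u\<in>generate W ?J. \<Sum>k\<in>C (?t \<cdot> u). f (g \<otimes> k))"
    unfolding turns_def
  proof (rule sum.UNION_disjoint)
    show "finite (generate W ?J)" using W.finite_parabolic[OF J] .
    show "\<forall>u\<in>generate W ?J. finite (C (?t \<cdot> u))" using finite_C uc tc by simp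
    show "\<forall>u\<in>generate W ?J. \<forall>v\<in>generate W ?J. u \<noteq> v \<longrightarrow> C (?t \<cdot> u) \<inter> C (?t \<cdot> v) = {}"
    proof (intro ballI impI)
      fix u v assume uv: "u \<in> generate W ?J" "v \<in> generate W ?J" "u \<noteq> v"
      then have "?t \<cdot> u \<noteq> ?t \<cdot> v" using uc tc by simp
      then show "C (?t \<cdot> u) \<inter> C (?t \<cdot> v) = {}" using C_inj[of "?t \<cdot> u" "?t \<cdot> v"] uc uv tc by auto
    qed
  qed
  also have "\<dots> = (\<Sum>u\<in>generate W ?J. of_nat (card (C u)) * hecke ?t f g)"
    by (rule sum.cong[OF refl 1])
  also have "\<dots> = of_nat (card (P ?J)) * hecke ?t f g"
    using card_P[OF J] by (simp add: sum_distrib_right)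
  finally show ?thesis .
qed

text \<open>For \<open>g\<close> fixed, the third vertices of the geodesic paths through its edge of
  types \<open>r\<close> and \<open>s\<close>, as \<open>geodesic_path_iff_ends\<close>
  confirms.\<close>

definition "ends g = (\<lambda>k. (g \<otimes> k) <# P (S - {opp r s})) ` turns r s"

text \<open>Two turns have the same end exactly when they differ by an element of the stabilisers of
  both the middle and the end vertex, hence of \<open>P (rside r s)\<close>. So the map from turns
  to ends has fibres of constant size, which cancels the factor in \<open>sum_turns\<close>.\<close>

lemma sum_ends:
  assumes g: "g \<in> carrier G"
  shows "(\<Sum>z\<in>ends g. v (g <# P (S - {s}), z)) = hecke (turn r s) (lift_pair v s (opp r s)) g"
proof -
  let ?J = "rside r s" let ?Pt = "P (S - {opp r s})" let ?f = "lift_pair v s (opp r s)"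
  let ?h = "\<lambda>k. (g \<otimes> k) <# ?Pt"
  have St: "S - {opp r s} \<subseteq> S" "S - {s} \<subseteq> S" by auto
  note J = rside_S[of r s]
  have tc: "k \<in> carrier G" if "k \<in> turns r s" for k using that turns_carrier[OF r s rs] by blast
  have fin: "finite (turns r s)" using finite_subset[OF turns_carrier[OF r s rs] finite_G] .
  have f: "?f (g \<otimes> k) = v (g <# P (S - {s}), ?h k)" if k: "k \<in> turns r s" for k
  proof -
    have "k \<in> P (S - {s})" using turns_iff[OF r s rs, of k] k unfolding mid_def by blast
    then have "(g \<otimes> k) <# P (S - {s}) = g <# P (S - {s})" using l_coset_mult_P[OF St(2) g] by blast
    then show ?thesis using g tc[OF k] by (simp add: lift_pair_def)
  qed
  have fib: "card {k \<in> turns r s. ?h k = ?h k0} = card (P ?J)" if k0: "k0 \<in> turns r s" for k0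
  proof -
    have c0: "k0 \<in> carrier G" using tc[OF k0] .
    have "{k \<in> turns r s. ?h k = ?h k0} = (\<lambda>p. k0 \<otimes> p) ` P ?J"
    proof (intro equalityI subsetI)
      fix k assume "k \<in> {k \<in> turns r s. ?h k = ?h k0}"
      then have k: "k \<in> turns r s" "?h k0 = ?h k" by auto
      have kc: "k \<in> carrier G" using tc[OF k(1)] .
      have "inv (g \<otimes> k0) \<otimes> (g \<otimes> k) \<in> ?Pt" using l_coset_eq_iff[OF St(1), of "g \<otimes> k0" "g \<otimes> k"] k(2) g c0 kc by simp
      then have 1: "inv k0 \<otimes> k \<in> ?Pt" using g c0 kc by (simp add: G.inv_mult_group G.m_assoc)
      have "k0 \<in> P (mid s)" "k \<in> P (mid s)" using turns_iff[OF r s rs] k0 k(1) by blast+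
      then have "inv k0 \<otimes> k \<in> P (mid s)"
        using P_subgroup[OF mid_S] subgroup.m_closed subgroup.m_inv_closed by metis
      then have "inv k0 \<otimes> k \<in> P (mid s \<inter> (S - {opp r s}))" using 1 P_Int[OF mid_S St(1)] by blast
      moreover have "mid s \<inter> (S - {opp r s}) = ?J" unfolding mid_def rside_def by blast
      ultimately have "inv k0 \<otimes> k \<in> P ?J" by simp
      moreover have "k = k0 \<otimes> (inv k0 \<otimes> k)" using c0 kc by simp
      ultimately show "k \<in> (\<lambda>p. k0 \<otimes> p) ` P ?J" by blast
    next
      fix k assume "k \<in> (\<lambda>p. k0 \<otimes> p) ` P ?J"
      then obtain p where p: "p \<in> P ?J" "k = k0 \<otimes> p" by blast
      obtain u where u: "u \<in> generate W ?J" "k0 \<in> C (turn r s \<cdot> u)" using k0 unfolding turns_def by blast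
      have uc: "u \<in> carrier W" using u J by blast
      obtain u' where u': "u' \<in> generate W ?J" "k \<in> C (turn r s \<cdot> u \<cdot> u')"
        using C_P_mult[OF J _ u(2) p(1)] uc turn_closed[of r s] p(2) by auto
      have "k \<in> C (turn r s \<cdot> (u \<cdot> u'))" using u' uc J turn_closed[of r s] by (metis W.m_assoc W.parabolic_carrier)
      moreover have "u \<cdot> u' \<in> generate W ?J" using u(1) u'(1) J by blast
      ultimately have kt: "k \<in> turns r s" unfolding turns_def by blast
      have "?J \<subseteq> S - {opp r s}" unfolding rside_def by blast
      then have pt: "p \<in> ?Pt" using P_mono p(1) by blast
      have "p \<in> carrier G" using P_sub[OF J] p(1) by blast
      then have "g \<otimes> k = (g \<otimes> k0) \<otimes> p" using p(2) g c0 by (simp add: G.m_assoc)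
      then have "?h k = ?h k0" using l_coset_mult_P[OF St(1) _ pt, of "g \<otimes> k0"] g c0 by simp
      then show "k \<in> {k \<in> turns r s. ?h k = ?h k0}" using kt by blast
    qed
    then show ?thesis using G.card_l_translate[OF c0 P_sub[OF J]] by simp
  qed
  have "P ?J \<noteq> {}" using B_P[of ?J] B_one by blast
  then have pos: "of_nat (card (P ?J)) \<noteq> (0::complex)" using finite_P[OF J] by simp
  have "(\<Sum>k\<in>turns r s. ?f (g \<otimes> k)) = (\<Sum>k\<in>turns r s. v (g <# P (S - {s}), ?h k))"
    by (rule sum.cong[OF refl f])
  also have "\<dots> = (\<Sum>z\<in>ends g. \<Sum>k\<in>{k\<in>turns r s. ?h k = z}. v (g <# P (S - {s}), ?h k))"
    unfolding ends_def using fin by (intro sum.group[symmetric]) auto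
  also have "\<dots> = (\<Sum>z\<in>ends g. of_nat (card (P ?J)) * v (g <# P (S - {s}), z))"
  proof (rule sum.cong[OF refl])
    fix z assume "z \<in> ends g"
    then obtain k0 where k0: "k0 \<in> turns r s" "z = ?h k0" unfolding ends_def by blast
    then show "(\<Sum>k\<in>{k\<in>turns r s. ?h k = z}. v (g <# P (S - {s}), ?h k)) = of_nat (card (P ?J)) * v (g <# P (S - {s}), z)"
      using fib[OF k0(1)] by simp
  qed
  also have "\<dots> = of_nat (card (P ?J)) * (\<Sum>z\<in>ends g. v (g <# P (S - {s}), z))"
    by (simp add: sum_distrib_left)
  finally have "of_nat (card (P ?J)) * hecke (turn r s) ?f g = of_nat (card (P ?J)) * (\<Sum>z\<in>ends g. v (g <# P (S - {s}), z))"
    using sum_turns[OF _ g, of ?f] lift_pair_invariant[OF s opp_S[OF r s rs], of v] unfolding rside_def by simp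
  then show ?thesis using pos by simp
qed

end

text \<open>The quadratic relation has constant term \<open>q_s\<close>, which is nonzero, so no
  invariant function is killed.\<close>

lemma hecke_S_injective:
  assumes s: "s \<in> S" and f: "f \<in> invariant_fun {}" and z: "hecke s f = 0"
  shows "f = 0"
proof
  fix g
  have sW: "s \<in> carrier W" using s by simp
  have "hecke s (0 :: 'a \<Rightarrow> complex) = 0" by (simp add: hecke_def fun_eq_iff)
  then have "0 = hecke_param s * f g" using fun_cong[OF hecke_quadratic[OF s f], of g] z by simp
  moreover have "hecke_param s \<noteq> 0"
    using finite_C[OF sW] C_nonempty[OF sW] card_B_pos by (auto simp: hecke_param_def)
  ultimately show "f g = 0 g" by simp
qed

lemma foldr_hecke_invariant: "set ss \<subseteq> S \<Longrightarrow> f \<in> invariant_fun {} \<Longrightarrow> foldr hecke ss f \<in> invariant_fun {}"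
  by (induction ss) (auto intro: hecke_invariant)

lemma foldr_hecke_injective:
  "set ss \<subseteq> S \<Longrightarrow> f \<in> invariant_fun {} \<Longrightarrow> foldr hecke ss f = 0 \<Longrightarrow> f = 0"
proof (induction ss)
  case (Cons s ss)
  have "hecke s (foldr hecke ss f) = 0" using Cons.prems(3) by (simp only: foldr_Cons o_apply)
  then have z: "foldr hecke ss f = 0"
    using hecke_S_injective[OF _ foldr_hecke_invariant] Cons.prems(1,2) by (metis list.set_intros(1) set_subset_Cons subset_eq)
  show ?case by (rule Cons.IH[OF _ Cons.prems(2) z]) (use Cons.prems(1) in simp)
qed simp

lemma hecke_injective:
  assumes w: "w \<in> carrier W" and f: "f \<in> invariant_fun {}" and z: "hecke w f = 0"
  shows "f = 0"
proof -
  obtain ss where ss: "set ss \<subseteq> S" "w = W.word ss" "length ss = W.len w" using W.reduced_word w by blast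
  have "foldr hecke ss f = 0" using hecke_reduced_word[OF f ss(1)] ss z by metis
  then show ?thesis by (rule foldr_hecke_injective[OF ss(1) f])
qed

text \<open>The eigenvector equation of the geodesic transfer operator, read on \<open>G\<close>.\<close>

context
  fixes v :: "'a set \<times> 'a set \<Rightarrow> complex" and \<alpha> :: complex and p :: nat
  assumes eig: "\<And>r s g. r \<in> S \<Longrightarrow> s \<in> S \<Longrightarrow> r \<noteq> s \<Longrightarrow> g \<in> carrier G \<Longrightarrow>
      \<alpha> * v (g <# P (S - {r}), g <# P (S - {s})) = (\<Sum>z\<in>ends r s g. v (g <# P (S - {s}), z))"
    and \<alpha>0: "\<alpha> \<noteq> 0" and p0: "p > 0"
    and param: "\<And>w. w \<in> carrier W \<Longrightarrow> \<exists>a. card (C w) = card B * p ^ a"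
begin

lemma lift_pair_step:
  assumes r: "r \<in> S" and s: "s \<in> S" and rs: "r \<noteq> s"
  shows "hecke (turn r s) (lift_pair v s (opp r s)) = (\<lambda>g. \<alpha> * lift_pair v r s g)"
proof
  fix g
  show "hecke (turn r s) (lift_pair v s (opp r s)) g = \<alpha> * lift_pair v r s g"
    using eig[OF r s rs, of g] sum_ends[OF r s rs, of g v] by (cases "g \<in> carrier G") (simp_all add: lift_pair_def hecke_def)
qed

text \<open>Induction along the geodesic: each turn costs one factor \<open>\<alpha>\<close> by
  \<open>lift_pair_step\<close>, and the length condition in \<open>straight\<close> allows the
  operators to be composed.\<close>

lemma straight_hecke:
  "W.straight w b a b0 a0 n \<Longrightarrow> hecke w (lift_pair v b a) = (\<lambda>g. \<alpha> ^ n * lift_pair v b0 a0 g)"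
proof (induction rule: W.straight.induct)
  case (refl b a)
  then show ?case using hecke_one[OF invariant_fun_B[OF lift_pair_invariant[of b a v]]] by simp
next
  case (step u b a b0 a0 n x)
  let ?K = "S - {b}"
  define r where "r = W.wlong ?K \<cdot> a \<cdot> W.wlong ?K"
  have K: "?K \<subseteq> S" and aK: "a \<in> ?K" using step.hyps by auto
  have "r \<in> ?K" unfolding r_def by (rule W.wlong_conj[OF K aK])
  then have r: "r \<in> S" "r \<noteq> b" by auto
  \<comment> \<open>\<open>opp\<close> is an involution for a fixed middle type, so the edge
    preceding one of types \<open>(b, a)\<close> has types \<open>(r, b)\<close>.\<close>
  have o: "opp r b = a" unfolding opp_def mid_def r_def using W.wlong_conj_conj[OF K] step.hyps by simp
  have t: "turn r b = x" unfolding turn_def rside_def o mid_def using step.hyps by simp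
  have xc: "x \<in> carrier W" using turn_closed[of r b] t by simp
  have fi: "lift_pair v b a \<in> invariant_fun {}"
    using invariant_fun_B[OF lift_pair_invariant] step.hyps by blast
  have "hecke (u \<cdot> x) (lift_pair v b a) = hecke u (hecke x (lift_pair v b a))"
    using hecke_mult[OF _ xc _ fi] step.hyps by simp
  also have "hecke x (lift_pair v b a) = (\<lambda>g. \<alpha> * lift_pair v r b g)"
    using lift_pair_step[OF r(1) step.hyps(3) r(2)] unfolding o t .
  also have "hecke u (\<lambda>g. \<alpha> * lift_pair v r b g) = (\<lambda>g. \<alpha> * hecke u (lift_pair v r b) g)" by (rule hecke_scale)
  also have "hecke u (lift_pair v r b) = (\<lambda>g. \<alpha> ^ n * lift_pair v b0 a0 g)" using step.IH unfolding r_def .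
  finally show ?case by (simp only: power_Suc mult.assoc)
qed

text \<open>\<open>w_S\<close> is \<open>w_S w_J\<close> times \<open>w_J\<close> with additive
  length. The second factor acts on a \<open>J\<close>-invariant function by its index, a power of
  \<open>p\<close>; the first is a product of turns.\<close>

lemma half_circle_hecke:
  assumes b: "b \<in> S" and a: "a \<in> S" and ab: "a \<noteq> b"
  shows "\<exists>b0 a0 n e. b0 \<in> S \<and> a0 \<in> S \<and> a0 \<noteq> b0 \<and> n > 0 \<and>
    hecke (W.wlong S) (lift_pair v b a) = (\<lambda>g. of_nat p ^ e * \<alpha> ^ n * lift_pair v b0 a0 g)"
proof -
  let ?J = "S - {b, a}" and ?w = "W.wlong S"
  have J: "?J \<subseteq> S" by auto
  obtain b0 a0 n where h: "W.straight (?w \<cdot> W.wlong ?J) b a b0 a0 n" "n > 0" "b0 \<in> S" "a0 \<in> S" "a0 \<noteq> b0"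
    using W.ex_straight_half_circle[OF b a ab] by blast
  have wJ: "W.wlong ?J \<in> carrier W" using J by simp
  obtain e where e: "card (C (W.wlong ?J)) = card B * p ^ e" using param[OF wJ] by blast
  have q: "hecke_param (W.wlong ?J) = of_nat p ^ e" unfolding hecke_param_def e using card_B_pos by simp
  have fJ: "lift_pair v b a \<in> invariant_fun ?J" using lift_pair_invariant[OF b a] .
  have "?w = ?w \<cdot> W.wlong ?J \<cdot> W.wlong ?J" using J by (simp add: W.m_assoc)
  moreover have "W.len ?w = W.len (?w \<cdot> W.wlong ?J) + W.len (W.wlong ?J)"
    using W.wlong_len[OF subset_refl, of "W.wlong ?J"] wJ W.S_gen by simp
  ultimately have "hecke ?w (lift_pair v b a) = hecke (?w \<cdot> W.wlong ?J) (hecke (W.wlong ?J) (lift_pair v b a))"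
    using hecke_mult[OF _ wJ _ invariant_fun_B[OF fJ], of "?w \<cdot> W.wlong ?J"] wJ by simp
  also have "\<dots> = (\<lambda>g. of_nat p ^ e * hecke (?w \<cdot> W.wlong ?J) (lift_pair v b a) g)"
    unfolding hecke_parabolic[OF J W.wlong_in[OF J] fJ] q by (rule hecke_scale)
  finally have "hecke ?w (lift_pair v b a) = (\<lambda>g. of_nat p ^ e * \<alpha> ^ n * lift_pair v b0 a0 g)"
    unfolding straight_hecke[OF h(1)] by (simp only: mult.assoc)
  then show ?thesis using h(2-5) by blast
qed

lemma eigenvalue_power:
  assumes nz: "r0 \<in> S" "s0 \<in> S" "r0 \<noteq> s0" "g0 \<in> carrier G" "v (g0 <# P (S - {r0}), g0 <# P (S - {s0})) \<noteq> 0"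
  shows "\<exists>k>0. \<exists>j::int. \<alpha> ^ k = of_nat p powi j"
proof -
  let ?w = "W.wlong S"
  let ?T = "hecke ?w"
  define Prs where "Prs = {c. fst c \<in> S \<and> snd c \<in> S \<and> snd c \<noteq> fst c}"
  define F where "F c = lift_pair v (fst c) (snd c)" for c
  have wc: "?w \<in> carrier W" by simp
  have Finv: "F c \<in> invariant_fun {}" if "c \<in> Prs" for c
    using that invariant_fun_B[OF lift_pair_invariant] unfolding F_def Prs_def by blast
  have "\<forall>c\<in>Prs. \<exists>c'\<in>Prs. \<exists>n>0. \<exists>e. ?T (F c) = (\<lambda>g. of_nat p ^ e * \<alpha> ^ n * F c' g)"
  proof
    fix c assume "c \<in> Prs"
    then obtain b0 a0 n e where "b0 \<in> S" "a0 \<in> S" "a0 \<noteq> b0" "n > 0"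
      "?T (F c) = (\<lambda>g. of_nat p ^ e * \<alpha> ^ n * lift_pair v b0 a0 g)"
      using half_circle_hecke[of "fst c" "snd c"] unfolding Prs_def F_def by blast
    then show "\<exists>c'\<in>Prs. \<exists>n>0. \<exists>e. ?T (F c) = (\<lambda>g. of_nat p ^ e * \<alpha> ^ n * F c' g)"
      by (intro bexI[of _ "(b0, a0)"]) (auto simp: Prs_def F_def)
  qed
  then obtain nxt where nxt: "\<And>c. c \<in> Prs \<Longrightarrow> nxt c \<in> Prs \<and> (\<exists>n>0. \<exists>e. ?T (F c) = (\<lambda>g. of_nat p ^ e * \<alpha> ^ n * F (nxt c) g))"
    by metis
  define c where "c i = (nxt ^^ i) (r0, s0)" for i
  have cP: "c i \<in> Prs" for i
    unfolding c_def by (induction i) (use nz nxt in \<open>auto simp: Prs_def\<close>)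
  have cS: "c (Suc i) = nxt (c i)" for i unfolding c_def by simp
  have Fnz: "F (c i) \<noteq> 0" for i
  proof (induction i)
    case 0
    then show ?case using nz by (auto simp: c_def F_def lift_pair_def fun_eq_iff)
  next
    case (Suc i)
    obtain n e where "?T (F (c i)) = (\<lambda>g. of_nat p ^ e * \<alpha> ^ n * F (c (Suc i)) g)" using nxt[OF cP] cS by metis
    moreover have "?T (F (c i)) \<noteq> 0" using hecke_injective[OF wc Finv[OF cP]] Suc by blast
    ultimately show ?case by (auto simp: fun_eq_iff)
  qed
  have finPrs: "finite Prs"
    by (rule finite_subset[of _ "S \<times> S"]) (use W.finite_S in \<open>auto simp: Prs_def\<close>)
  \<comment> \<open>Pigeonhole: the orbit of pairs of types in the finite set \<open>Prs\<close>
    repeats, so a power of \<open>T\<close> maps \<open>F (c i)\<close> to a multiple of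
    itself.\<close>
  obtain i j where ij: "i < j" "c i = c j"
  proof -
    have "finite (range c)" using finite_subset[of "range c" Prs] cP finPrs by blast
    then have "\<not> inj c" using finite_imageD by blast
    then show thesis using that by (metis injI linorder_neqE_nat)
  qed
  \<comment> \<open>The bound \<open>n \<ge> m\<close> keeps the exponent of \<open>\<alpha>\<close>
    positive in the end.\<close>
  have iter: "\<exists>n\<ge>m. \<exists>e. (?T ^^ m) (F (c i)) = (\<lambda>g. of_nat p ^ e * \<alpha> ^ n * F (c (i + m)) g)" for m
  proof (induction m)
    case 0
    show ?case by (rule exI[of _ 0], simp, rule exI[of _ 0], simp)
  next
    case (Suc m)
    then obtain n e where n: "n \<ge> m" "(?T ^^ m) (F (c i)) = (\<lambda>g. of_nat p ^ e * \<alpha> ^ n * F (c (i + m)) g)" by blast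
    obtain n' e' where n': "n' > 0" "?T (F (c (i + m))) = (\<lambda>g. of_nat p ^ e' * \<alpha> ^ n' * F (c (i + Suc m)) g)"
      using nxt[OF cP] cS[of "i + m"] by (metis add_Suc_right)
    have "(?T ^^ Suc m) (F (c i)) = (\<lambda>g. of_nat p ^ e * \<alpha> ^ n * ?T (F (c (i + m))) g)"
      using n(2) hecke_scale[of ?w "of_nat p ^ e * \<alpha> ^ n" "F (c (i + m))"] by simp
    also have "\<dots> = (\<lambda>g. of_nat p ^ (e + e') * \<alpha> ^ (n + n') * F (c (i + Suc m)) g)"
      unfolding n'(2) by (simp only: power_add mult.assoc mult.left_commute[of "\<alpha> ^ n"])
    finally show ?case using n(1) n'(1) by (intro exI[of _ "n + n'"]) auto
  qed
  define m where "m = j - i"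
  obtain n e where n: "n \<ge> m" "(?T ^^ m) (F (c i)) = (\<lambda>g. of_nat p ^ e * \<alpha> ^ n * F (c i) g)"
    using iter[of m] ij unfolding m_def by auto
  have m0: "m > 0" using ij m_def by simp
  define K where "K = of_nat p ^ e * \<alpha> ^ n"
  obtain ss where ss: "set ss \<subseteq> S" "?w = W.word ss" "length ss = W.len ?w" using W.reduced_word[OF wc] by blast
  have Tss: "?T f = foldr hecke ss f" if "f \<in> invariant_fun {}" for f
    using hecke_reduced_word[OF that ss(1)] ss by simp
  \<comment> \<open>The reduced word taken twice, \<open>m\<close> times over, so that folding
    \<open>hecke\<close> along it yields \<open>T\<close> to the power \<open>2 * m\<close>.\<close>
  define us where "us = concat (replicate m (ss @ ss))"
  have us: "set us \<subseteq> S" unfolding us_def using ss(1) by auto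
  let ?Z = "\<lambda>f. ?T (?T f)"
  have Zinv: "?Z f \<in> invariant_fun {}" for f by (rule hecke_invariant[OF wc])
  have Zus: "foldr hecke us f = (?Z ^^ m) f" if "f \<in> invariant_fun {}" for f
  proof -
    have "foldr hecke (concat (replicate k (ss @ ss))) f = (?Z ^^ k) f \<and> (?Z ^^ k) f \<in> invariant_fun {}" for k
    proof (induction k)
      case 0
      then show ?case using that by simp
    next
      case (Suc k)
      let ?y = "(?Z ^^ k) f"
      have y: "?y \<in> invariant_fun {}" using Suc by blast
      have "foldr hecke (concat (replicate (Suc k) (ss @ ss))) f = foldr hecke ss (foldr hecke ss ?y)"
        using Suc by simp
      also have "\<dots> = ?Z ?y" by (simp only: Tss[OF y, symmetric] Tss[OF hecke_invariant[OF wc], symmetric])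
      finally show ?case using Zinv[of ?y] by (simp only: funpow.simps o_apply)
    qed
    then show ?thesis unfolding us_def by blast
  qed
  have Zcomm: "(?Z ^^ k) (hecke s f) = hecke s ((?Z ^^ k) f)" if "s \<in> S" "f \<in> invariant_fun {}" for k s f
  proof -
    have "(?Z ^^ k) (hecke s f) = hecke s ((?Z ^^ k) f) \<and> (?Z ^^ k) f \<in> invariant_fun {}"
      by (induction k) (use that hecke_wlong_square_commute Zinv in simp_all)
    then show ?thesis by blast
  qed
  have "?Z = ?T ^^ 2" by (simp add: numeral_2_eq_2 fun_eq_iff)
  then have ZT: "(?Z ^^ k) = (?T ^^ (2 * k))" for k by (simp only: funpow_mult)
  \<comment> \<open>The eigenspace is taken for the central operator, with eigenvalue
    \<open>K ^ 2\<close>: it is stable under every generator, while an eigenspace of the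
    \<open>m\<close>-th power of \<open>T\<close> might not be.\<close>
  define E where "E = {f \<in> invariant_fun {}. (?Z ^^ m) f = (\<lambda>x. K ^ 2 * f x)}"
  have FE: "F (c i) \<in> E"
  proof -
    have "(?T ^^ (m + m)) (F (c i)) = (?T ^^ m) ((?T ^^ m) (F (c i)))" by (simp add: funpow_add)
    also have "\<dots> = (?T ^^ m) (\<lambda>x. K * F (c i) x)" using n(2) K_def by simp
    also have "\<dots> = (\<lambda>x. K * (?T ^^ m) (F (c i)) x)"
    proof -
      have "(?T ^^ k) (\<lambda>x. a * f x) = (\<lambda>x. a * (?T ^^ k) f x)" for k a and f :: "'a \<Rightarrow> complex"
        by (induction k) (simp_all add: hecke_scale)
      then show ?thesis by blast
    qed
    also have "\<dots> = (\<lambda>x. K ^ 2 * F (c i) x)" unfolding n(2) K_def[symmetric] by (simp only: power2_eq_square mult.assoc)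
    finally show ?thesis using Finv[OF cP] unfolding E_def ZT by (simp add: mult_2)
  qed
  define Q where "Q = {x :: complex. \<exists>k. x = of_nat p ^ k \<or> x = - (of_nat p ^ k)}"
  have Qpow: "of_nat p ^ k \<in> Q" for k unfolding Q_def by blast
  have "\<exists>d>0. (K ^ 2) ^ d \<in> Q"
  proof (rule scalar_product_of_quadratic_ops[where E = E and V = "carrier G" and T = hecke and I = S
        and q = hecke_param and ss = us and ?f0.0 = "F (c i)"])
    show "finite (carrier G)" by (rule finite_G)
    show "f x = 0" if "f \<in> E" "x \<notin> carrier G" for f x using that unfolding E_def invariant_fun_def by blast
    show "F (c i) \<in> E" "F (c i) \<noteq> 0" by (rule FE, rule Fnz)
    show "hecke s f \<in> E" if "s \<in> S" "f \<in> E" for s f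
      using that Zcomm[OF that(1)] hecke_invariant[of s f] hecke_scale[of s "K ^ 2" f] unfolding E_def by simp
    show "hecke s (f + h) = hecke s f + hecke s h" for s f h by (rule hecke_add)
    show "hecke s (\<lambda>x. a * f x) = (\<lambda>x. a * hecke s f x)" for s a f by (rule hecke_scale)
    show "hecke s (hecke s f) = (\<lambda>x. (hecke_param s - 1) * hecke s f x + hecke_param s * f x)"
      if "s \<in> S" "f \<in> E" for s f using hecke_quadratic that unfolding E_def by blast
    show "1 \<in> Q" "- 1 \<in> Q" using Qpow[of 0] unfolding Q_def by (auto intro: exI[of _ 0])
    show "hecke_param s \<in> Q" if s: "s \<in> S" for s
    proof -
      obtain a where "card (C s) = card B * p ^ a" using param[of s] s by auto
      then have "hecke_param s = of_nat p ^ a" unfolding hecke_param_def using card_B_pos by simp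
      then show ?thesis using Qpow by simp
    qed
    show "x * y \<in> Q" if xy: "x \<in> Q" "y \<in> Q" for x y
    proof -
      obtain k l where "x = of_nat p ^ k \<or> x = - (of_nat p ^ k)" "y = of_nat p ^ l \<or> y = - (of_nat p ^ l)"
        using xy unfolding Q_def by blast
      then have "x * y = of_nat p ^ (k + l) \<or> x * y = - (of_nat p ^ (k + l))" by (auto simp: power_add)
      then show ?thesis unfolding Q_def by blast
    qed
    show "set us \<subseteq> S" by (rule us)
    show "foldr hecke us f = (\<lambda>x. K ^ 2 * f x)" if "f \<in> E" for f using that Zus unfolding E_def by simp
    have Zadd: "(?Z ^^ k) (f + h) = (?Z ^^ k) f + (?Z ^^ k) h" for k and f h :: "'a \<Rightarrow> complex"
      by (induction k) (simp_all only: funpow.simps id_apply o_apply hecke_add)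
    have Zscale: "(?Z ^^ k) (\<lambda>x. a * f x) = (\<lambda>x. a * (?Z ^^ k) f x)" for k a and f :: "'a \<Rightarrow> complex"
      by (induction k) (simp_all only: funpow.simps id_apply o_apply hecke_scale)
    show "fun_vs.subspace E"
    proof (rule fun_vs.subspaceI)
      have "(?Z ^^ m) (\<lambda>x. 0 * F (c i) x) = (\<lambda>x. 0 * (?Z ^^ m) (F (c i)) x)" by (rule Zscale)
      then show "0 \<in> E" unfolding E_def invariant_fun_def by (simp add: zero_fun_def)
      show "f + h \<in> E" if "f \<in> E" "h \<in> E" for f h
        using that unfolding E_def invariant_fun_def by (simp add: Zadd fun_eq_iff distrib_left)
      show "(\<lambda>x. a * f x) \<in> E" if "f \<in> E" for f a
        using that unfolding E_def invariant_fun_def by (simp add: Zscale fun_eq_iff mult_ac)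
    qed
  qed
  then obtain d k where d: "d > 0" "(K ^ 2) ^ d = of_nat p ^ k \<or> (K ^ 2) ^ d = - (of_nat p ^ k)"
    unfolding Q_def by blast
  \<comment> \<open>Squaring once more disposes of the sign, whence the factor 4 in the
    exponents.\<close>
  then have "((K ^ 2) ^ d) ^ 2 = (of_nat p ^ k) ^ 2" by auto
  then have e1: "of_nat p ^ (e * 4 * d) * \<alpha> ^ (n * 4 * d) = of_nat p ^ (2 * k)"
    unfolding K_def by (simp add: power_mult_distrib mult_ac flip: power_mult)
  have pc: "of_nat p \<noteq> (0 :: complex)" using p0 by simp
  have "\<alpha> ^ (n * 4 * d) = of_nat p powi (int (2 * k) - int (e * 4 * d))"
    using e1 pc by (simp add: power_int_diff power_int_of_nat field_simps del: of_nat_mult)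
  moreover have "n * 4 * d > 0" using n(1) m0 d(1) by simp
  ultimately show ?thesis by blast
qed

end

end

section \<open>Closed walks and the zeta function\<close>

definition walks :: "'v set \<Rightarrow> ('v \<Rightarrow> 'v \<Rightarrow> bool) \<Rightarrow> nat \<Rightarrow> 'v \<Rightarrow> 'v \<Rightarrow> 'v list set" where
  "walks E R l a b = {ps. length ps = l \<and> set ps \<subseteq> E \<and>
     (\<forall>k<l. R ((ps @ [b]) ! k) ((ps @ [b]) ! Suc k)) \<and> (ps @ [b]) ! 0 = a}"

definition closed_walks :: "'v set \<Rightarrow> ('v \<Rightarrow> 'v \<Rightarrow> bool) \<Rightarrow> nat \<Rightarrow> 'v list set" where
  "closed_walks E R l = {ps. length ps = l \<and> set ps \<subseteq> E \<and> (\<forall>k<l. R (ps ! k) (ps ! (Suc k mod l)))}"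

lemma finite_walks: "finite E \<Longrightarrow> finite (walks E R l a b)"
  by (rule finite_subset[OF _ finite_lists_length_eq[of E l]]) (auto simp: walks_def)

text \<open>In \<open>walks\<close> the end point \<open>b\<close> is not part of the list: a walk
  with \<open>Suc l\<close> steps is a walk to its last listed point \<open>c\<close>, followed by
  \<open>c\<close>. With this convention closed walks are lists without a repeated end
  point.\<close>

lemma walks_Suc:
  "walks E R (Suc l) a b = (\<Union>c\<in>{c\<in>E. R c b}. (\<lambda>ps. ps @ [c]) ` walks E R l a c)"
proof (intro equalityI subsetI)
  fix qs assume qs: "qs \<in> walks E R (Suc l) a b"
  then have "length qs = Suc l" by (simp add: walks_def)
  then obtain ps c where q: "qs = ps @ [c]" "length ps = l" by (metis length_Suc_conv_rev)
  have R: "R ((ps @ [c, b]) ! k) ((ps @ [c, b]) ! Suc k)" if "k < Suc l" for k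
    using qs that unfolding walks_def q by simp
  have "R c b" using R[of l] q(2) by (simp add: nth_append)
  moreover have "c \<in> E" "set ps \<subseteq> E" using qs unfolding walks_def q by auto
  moreover have "R ((ps @ [c]) ! k) ((ps @ [c]) ! Suc k)" if "k < l" for k
    using R[of k] that q(2) by (auto simp: nth_append nth_Cons split: if_splits nat.splits)
  moreover have "(ps @ [c]) ! 0 = a" using qs q(2) unfolding walks_def q by (auto simp: nth_append split: if_splits)
  ultimately have "ps \<in> walks E R l a c" using q(2) by (simp add: walks_def)
  then show "qs \<in> (\<Union>c\<in>{c\<in>E. R c b}. (\<lambda>ps. ps @ [c]) ` walks E R l a c)"
    using \<open>R c b\<close> \<open>c \<in> E\<close> q(1) by blast
next
  fix qs assume "qs \<in> (\<Union>c\<in>{c\<in>E. R c b}. (\<lambda>ps. ps @ [c]) ` walks E R l a c)"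
  then obtain ps c where q: "c \<in> E" "R c b" "ps \<in> walks E R l a c" "qs = ps @ [c]" by blast
  have l: "length ps = l" and s: "set ps \<subseteq> E" and R: "\<And>k. k < l \<Longrightarrow> R ((ps @ [c]) ! k) ((ps @ [c]) ! Suc k)"
    and a: "(ps @ [c]) ! 0 = a" using q(3) by (auto simp: walks_def)
  have "R ((ps @ [c, b]) ! k) ((ps @ [c, b]) ! Suc k)" if "k < Suc l" for k
  proof (cases "k = l")
    case True
    then show ?thesis using q(2) l by (simp add: nth_append)
  next
    case False
    then have "k < l" using that by simp
    then show ?thesis using R[of k] l by (auto simp: nth_append nth_Cons split: if_splits nat.splits)
  qed
  moreover have "(ps @ [c, b]) ! 0 = a" using a l by (auto simp: nth_append split: if_splits)
  ultimately show "qs \<in> walks E R (Suc l) a b" using q(1,4) l s by (simp add: walks_def)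
qed

lemma adjacency_power_walks:
  fixes E :: "'v set" and R :: "'v \<Rightarrow> 'v \<Rightarrow> bool" and e :: "nat \<Rightarrow> 'v"
  assumes E: "finite E" and e: "bij_betw e {..<n} E"
  defines "A \<equiv> Matrix.mat n n (\<lambda>(i, j). if R (e i) (e j) then 1 else 0 :: complex)"
  assumes i: "i < n"
  shows "j < n \<Longrightarrow> (A ^\<^sub>m l) $$ (i, j) = of_nat (card (walks E R l (e i) (e j)))"
proof (induction l arbitrary: j)
  case 0
  have "walks E R 0 (e i) (e j) = (if e i = e j then {[]} else {})" by (auto simp: walks_def)
  moreover have "e i = e j \<longleftrightarrow> i = j" using e i 0 by (auto simp: bij_betw_def inj_on_def)
  ultimately show ?case using i 0 by (simp add: A_def)
next
  case (Suc l)
  have Ac: "A \<in> carrier_mat n n" by (simp add: A_def)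
  have Al: "A ^\<^sub>m l \<in> carrier_mat n n" using Ac by simp
  have "(A ^\<^sub>m Suc l) $$ (i, j) = (\<Sum>k<n. (A ^\<^sub>m l) $$ (i, k) * A $$ (k, j))"
    using i Suc.prems Ac Al by (simp add: scalar_prod_def atLeast0LessThan)
  also have "\<dots> = (\<Sum>k<n. if R (e k) (e j) then of_nat (card (walks E R l (e i) (e k))) else 0)"
    using Suc by (intro sum.cong) (auto simp: A_def)
  also have "\<dots> = (\<Sum>c\<in>E. if R c (e j) then of_nat (card (walks E R l (e i) c)) else 0)"
    by (rule sum.reindex_bij_betw[OF e])
  also have "\<dots> = (\<Sum>c\<in>{c\<in>E. R c (e j)}. of_nat (card (walks E R l (e i) c)))"
    using E by (simp add: sum.inter_filter)
  also have "\<dots> = (\<Sum>c\<in>{c\<in>E. R c (e j)}. of_nat (card ((\<lambda>ps. ps @ [c]) ` walks E R l (e i) c)))"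
    by (intro sum.cong refl) (simp add: card_image inj_on_def)
  also have "\<dots> = of_nat (card (walks E R (Suc l) (e i) (e j)))"
    unfolding walks_Suc using E finite_walks[OF E]
    by (subst card_UN_disjoint) auto
  finally show ?case .
qed

lemma closed_walks_UN:
  assumes l: "l > 0"
  shows "closed_walks E R l = (\<Union>a\<in>E. walks E R l a a)"
proof (intro equalityI subsetI)
  fix ps assume ps: "ps \<in> closed_walks E R l"
  then have len: "length ps = l" and s: "set ps \<subseteq> E" by (auto simp: closed_walks_def)
  have "R ((ps @ [ps ! 0]) ! k) ((ps @ [ps ! 0]) ! Suc k)" if k: "k < l" for k
  proof (cases "Suc k = l")
    case True
    then show ?thesis using ps k len by (auto simp: closed_walks_def nth_append)
  next
    case False
    then show ?thesis using ps k len by (auto simp: closed_walks_def nth_append)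
  qed
  then have "ps \<in> walks E R l (ps ! 0) (ps ! 0)" using len s l by (simp add: walks_def nth_append)
  moreover have "ps ! 0 \<in> E" using len s l by (metis nth_mem subsetD)
  ultimately show "ps \<in> (\<Union>a\<in>E. walks E R l a a)" by blast
next
  fix ps assume "ps \<in> (\<Union>a\<in>E. walks E R l a a)"
  then obtain a where ps: "ps \<in> walks E R l a a" by blast
  then have len: "length ps = l" and s: "set ps \<subseteq> E" and a: "ps ! 0 = a"
    and R: "\<And>k. k < l \<Longrightarrow> R ((ps @ [a]) ! k) ((ps @ [a]) ! Suc k)"
    using l by (auto simp: walks_def nth_append)
  have "R (ps ! k) (ps ! (Suc k mod l))" if k: "k < l" for k
    using R[OF k] k len a by (cases "Suc k = l") (auto simp: nth_append)
  then show "ps \<in> closed_walks E R l" using len s by (simp add: closed_walks_def)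
qed

lemma trace_closed_walks:
  fixes E :: "'v set"
  assumes E: "finite E" and e: "bij_betw e {..<n} E" and l: "l > 0"
  shows "mat_trace (Matrix.mat n n (\<lambda>(i, j). if R (e i) (e j) then 1 else 0 :: complex) ^\<^sub>m l)
    = of_nat (card (closed_walks E R l))" (is "mat_trace (?A ^\<^sub>m l) = _")
proof -
  have "?A ^\<^sub>m l \<in> carrier_mat n n" by simp
  then have "mat_trace (?A ^\<^sub>m l) = (\<Sum>i<n. of_nat (card (walks E R l (e i) (e i))))"
    unfolding mat_trace_def using adjacency_power_walks[OF E e] by (intro sum.cong) auto
  also have "\<dots> = (\<Sum>a\<in>E. of_nat (card (walks E R l a a)))"
    by (rule sum.reindex_bij_betw[OF e])
  also have "\<dots> = of_nat (card (closed_walks E R l))"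
    unfolding closed_walks_UN[OF l] using E finite_walks[OF E] l
    by (subst card_UN_disjoint) (auto simp: walks_def nth_append)
  finally show ?thesis .
qed

text \<open>A cycle of vertices is traded for the cyclic sequence of its oriented edges, so that the
  condition on three consecutive vertices becomes a relation between two consecutive entries.
  Indices are read modulo \<open>n\<close>, which covers the short cycles with \<open>n\<close>
  equal to 1 or 2.\<close>

lemma card_cycles_eq_closed_walks:
  fixes V :: "'v set"
  assumes n: "n > 0"
  shows "card {xs. length xs = n \<and> set xs \<subseteq> V \<and> (\<forall>i<n. g (xs ! i) (xs ! ((i + 1) mod n)) (xs ! ((i + 2) mod n)))}
    = card (closed_walks (V \<times> V) (\<lambda>c d. snd c = fst d \<and> g (fst c) (snd c) (snd d)) n)"
    (is "card ?L = card ?R")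
proof -
  let ?f = "\<lambda>xs. map (\<lambda>i. (xs ! i, xs ! (Suc i mod n))) [0..<n]"
  have "bij_betw ?f ?L ?R"
  proof (rule bij_betw_byWitness[where f' = "map fst"])
    show "\<forall>xs\<in>?L. map fst (?f xs) = xs" by (auto simp: o_def map_nth intro: nth_equalityI)
    show "\<forall>ps\<in>?R. ?f (map fst ps) = ps"
    proof
      fix ps assume ps: "ps \<in> ?R"
      then have len: "length ps = n" by (simp add: closed_walks_def)
      show "?f (map fst ps) = ps"
      proof (rule nth_equalityI)
        fix i assume "i < length (?f (map fst ps))"
        then have i: "i < n" by simp
        then have "snd (ps ! i) = fst (ps ! (Suc i mod n))" using ps by (simp add: closed_walks_def)
        then show "?f (map fst ps) ! i = ps ! i" using i len n by (simp add: prod_eq_iff)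
      qed (simp add: len)
    qed
    show "?f ` ?L \<subseteq> ?R"
    proof
      fix ps assume "ps \<in> ?f ` ?L"
      then obtain xs where xs: "xs \<in> ?L" "ps = ?f xs" by blast
      then have len: "length xs = n" and V: "set xs \<subseteq> V" by auto
      have V': "xs ! i \<in> V" if "i < n" for i using V len that nth_mem by blast
      have m: "Suc (Suc k mod n) mod n = (k + 2) mod n" for k by (simp add: mod_Suc_eq)
      have "snd (ps ! k) = fst (ps ! (Suc k mod n)) \<and> g (fst (ps ! k)) (snd (ps ! k)) (snd (ps ! (Suc k mod n)))"
        if k: "k < n" for k
        using xs(1) k n by (simp add: xs(2) m)
      moreover have "set ps \<subseteq> V \<times> V" using V' n by (auto simp: xs(2))
      ultimately show "ps \<in> ?R" by (simp add: closed_walks_def xs(2))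
    qed
    show "map fst ` ?R \<subseteq> ?L"
    proof
      fix xs assume "xs \<in> map fst ` ?R"
      then obtain ps where ps: "ps \<in> ?R" "xs = map fst ps" by blast
      then have len: "length ps = n" and V: "set ps \<subseteq> V \<times> V"
        and R: "\<And>k. k < n \<Longrightarrow> snd (ps ! k) = fst (ps ! (Suc k mod n)) \<and> g (fst (ps ! k)) (snd (ps ! k)) (snd (ps ! (Suc k mod n)))"
        unfolding closed_walks_def by blast+
      have "g (xs ! i) (xs ! ((i + 1) mod n)) (xs ! ((i + 2) mod n))" if i: "i < n" for i
      proof -
        have m: "Suc (Suc i mod n) mod n = (i + 2) mod n" by (simp add: mod_Suc_eq)
        have "snd (ps ! (Suc i mod n)) = fst (ps ! ((i + 2) mod n))" using R[of "Suc i mod n"] n m by simp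
        then show ?thesis using R[OF i] i n len by (auto simp: ps(2))
      qed
      moreover have "set xs \<subseteq> V" using V by (auto simp: ps(2))
      ultimately show "xs \<in> ?L" using len by (simp add: ps(2))
    qed
  qed
  then show ?thesis by (rule bij_betw_same_card)
qed

text \<open>Power sums of the reciprocal zeros of the zeta polynomial are traces of the transfer operator.\<close>

lemma zeta_zero_eigenvector:
  fixes V :: "'v set" and g :: "'v \<Rightarrow> 'v \<Rightarrow> 'v \<Rightarrow> bool"
  defines "c \<equiv> \<lambda>n. card {xs. length xs = n \<and> set xs \<subseteq> V \<and> (\<forall>i<n. g (xs ! i) (xs ! ((i + 1) mod n)) (xs ! ((i + 2) mod n)))}"
  assumes V: "finite V"
    and eq: "inverse (fps_exp 1 oo Abs_fps (\<lambda>l. if l = 0 then 0 else of_nat (c l) / of_nat l))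
      = (\<Prod>m\<leftarrow>ms. 1 - fps_const m * fps_X)"
    and a: "\<alpha> \<in> set ms" "\<alpha> \<noteq> (0 :: complex)"
  shows "\<exists>v. (\<exists>x\<in>V. \<exists>y\<in>V. v (x, y) \<noteq> 0) \<and>
     (\<forall>x\<in>V. \<forall>y\<in>V. \<alpha> * v (x, y) = (\<Sum>z\<in>{z\<in>V. g x y z}. v (y, z)))"
proof -
  define E where "E = V \<times> V"
  define R where "R = (\<lambda>c d. snd c = fst d \<and> g (fst c) (snd c) (snd d))"
  have fE: "finite E" using V E_def by simp
  obtain e where e: "bij_betw e {..<card E} E"
    using ex_bij_betw_nat_finite[OF fE] by (auto simp: atLeast0LessThan)
  define n where "n = card E"
  define A where "A = Matrix.mat n n (\<lambda>(i, j). if R (e i) (e j) then 1 else 0 :: complex)"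
  have Ac: "A \<in> carrier_mat n n" by (simp add: A_def)
  obtain es where es: "\<And>k. mat_trace (A ^\<^sub>m k) = (\<Sum>x\<leftarrow>es. x ^ k)" "\<And>x. x \<in> set es \<Longrightarrow> eigenvalue A x"
    by (rule mat_trace_pow_eigenvalues[OF Ac]) blast
  have "(\<Sum>x\<leftarrow>ms. x ^ l) = (\<Sum>x\<leftarrow>es. x ^ l)" if l: "l > 0" for l
  proof -
    have "(\<Sum>x\<leftarrow>ms. x ^ l) = of_nat (c l)" by (rule fps_exp_eq_prod_power_sums[OF eq l])
    also have "c l = card (closed_walks E R l)"
      unfolding c_def E_def R_def by (rule card_cycles_eq_closed_walks[OF l])
    also have "of_nat \<dots> = mat_trace (A ^\<^sub>m l)"
      unfolding A_def n_def by (rule trace_closed_walks[OF fE e l, symmetric])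
    finally show ?thesis using es(1) by simp
  qed
  then have "\<alpha> \<in> set es" using eq_power_sums_mem a by blast
  then obtain w where w: "w \<in> carrier_vec n" "w \<noteq> 0\<^sub>v n" "A *\<^sub>v w = \<alpha> \<cdot>\<^sub>v w"
    using es(2) Ac unfolding eigenvalue_def eigenvector_def by fastforce
  define v where "v d = vec_index w (inv_into {..<n} e d)" for d
  have ve: "v (e i) = vec_index w i" if "i < n" for i
    using bij_betw_inv_into_left[OF e] that by (simp add: v_def n_def)
  have "\<exists>i<n. vec_index w i \<noteq> 0" using w(1,2) by (auto simp: vec_eq_iff)
  then obtain i where i: "i < n" "vec_index w i \<noteq> 0" by blast
  have "e i \<in> E" using e i(1) by (auto simp: bij_betw_def n_def)
  then have 1: "\<exists>x\<in>V. \<exists>y\<in>V. v (x, y) \<noteq> 0" using ve[OF i(1)] i(2) unfolding E_def by (metis SigmaE)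
  have 2: "\<alpha> * v (x, y) = (\<Sum>z\<in>{z\<in>V. g x y z}. v (y, z))" if xy: "x \<in> V" "y \<in> V" for x y
  proof -
    have "(x, y) \<in> E" using xy E_def by simp
    then obtain j where j: "j < n" "e j = (x, y)" using e unfolding bij_betw_def n_def by (metis imageE lessThan_iff)
    have "\<alpha> * v (x, y) = vec_index (A *\<^sub>v w) j" using w j(1) ve[OF j(1)] unfolding j(2) by simp
    also have "\<dots> = (\<Sum>k<n. (if R (e j) (e k) then 1 else 0) * vec_index w k)"
      using j(1) w(1) by (simp add: A_def scalar_prod_def atLeast0LessThan)
    also have "\<dots> = (\<Sum>k<n. if R (x, y) (e k) then v (e k) else 0)"
      by (rule sum.cong) (auto simp: ve j(2))
    also have "\<dots> = (\<Sum>d\<in>E. if R (x, y) d then v d else 0)"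
      using sum.reindex_bij_betw[OF e, of "\<lambda>d. if R (x, y) d then v d else 0"] by (simp add: n_def)
    also have "\<dots> = (\<Sum>d\<in>{d\<in>E. R (x, y) d}. v d)" using fE by (simp add: sum.inter_filter)
    also have "\<dots> = (\<Sum>z\<in>{z\<in>V. g x y z}. v (y, z))"
      by (rule sum.reindex_bij_witness[of _ "\<lambda>z. (y, z)" snd]) (use xy in \<open>auto simp: E_def R_def\<close>)
    finally show ?thesis .
  qed
  show ?thesis using 1 2 by blast
qed

no_notation subset_mset (infix \<open><#\<close> 50)

section \<open>BN-pairs as Tits systems, and the building\<close>

context BN_pair
begin

lemma weyl_is_group: "group W"
  unfolding weyl_group_def by (rule normal.factorgroup_is_group[OF normal_torus])

lemma weyl_elemE:
  assumes "w \<in> carrier W"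
  obtains n where "n \<in> N" "n \<in> w" "w = {t \<otimes> n | t. t \<in> B \<inter> N}"
proof -
  obtain n where n: "n \<in> N" "w = {t \<otimes> n | t. t \<in> B \<inter> N}"
    using assms unfolding weyl_group_def FactGroup_def RCOSETS_def r_coset_def by auto
  have "\<one> \<in> B \<inter> N" using subgroup.one_closed[OF B_subgroup] subgroup.one_closed[OF N_subgroup] by blast
  moreover have "n = \<one> \<otimes> n" using subgroup.mem_carrier[OF N_subgroup n(1)] by simp
  ultimately have "n \<in> w" unfolding n(2) by blast
  then show thesis using that n by blast
qed

lemma weyl_elem_N: "w \<in> carrier W \<Longrightarrow> x \<in> w \<Longrightarrow> x \<in> N"
  using weyl_elemE[of w] subgroup.m_closed[OF N_subgroup] by (smt (verit) IntD2 mem_Collect_eq)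

lemma B_carr: "b \<in> B \<Longrightarrow> b \<in> carrier G" and N_carr: "n \<in> N \<Longrightarrow> n \<in> carrier G"
  using subgroup.mem_carrier[OF B_subgroup] subgroup.mem_carrier[OF N_subgroup] by blast+

lemma weyl_elem_rep:
  assumes w: "w \<in> carrier W" and x: "x \<in> w"
  shows "w = {t \<otimes> x | t. t \<in> B \<inter> N}"
proof -
  obtain n where nw: "n \<in> N" "n \<in> w" "w = {t \<otimes> n | t. t \<in> B \<inter> N}" by (rule weyl_elemE[OF w])
  note n = nw(1,3)
  have H: "subgroup (B \<inter> N) G" using subgroups_Inter_pair[OF B_subgroup N_subgroup] .
  obtain t0 where t0: "t0 \<in> B \<inter> N" "x = t0 \<otimes> n" using x n by blast
  have nc: "n \<in> carrier G" and tc: "t0 \<in> carrier G" using n t0 N_carr B_carr by auto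
  show ?thesis unfolding n(2)
  proof (intro equalityI subsetI)
    fix y assume "y \<in> {t \<otimes> n | t. t \<in> B \<inter> N}"
    then obtain t where t: "t \<in> B \<inter> N" "y = t \<otimes> n" by blast
    have "y = (t \<otimes> inv t0) \<otimes> x" using t t0 nc tc B_carr[of t] by (simp add: m_assoc)
    moreover have "t \<otimes> inv t0 \<in> B \<inter> N"
      using subgroup.m_closed[OF H t(1) subgroup.m_inv_closed[OF H t0(1)]] .
    ultimately show "y \<in> {t \<otimes> x | t. t \<in> B \<inter> N}" by blast
  next
    fix y assume "y \<in> {t \<otimes> x | t. t \<in> B \<inter> N}"
    then obtain t where t: "t \<in> B \<inter> N" "y = t \<otimes> x" by blast
    have "y = (t \<otimes> t0) \<otimes> n" using t t0 nc tc B_carr[of t] by (simp add: m_assoc)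
    moreover have "t \<otimes> t0 \<in> B \<inter> N" using subgroup.m_closed[OF H t(1) t0(1)] .
    ultimately show "y \<in> {t \<otimes> n | t. t \<in> B \<inter> N}" by blast
  qed
qed

lemma weyl_elem_eqI: "w \<in> carrier W \<Longrightarrow> v \<in> carrier W \<Longrightarrow> x \<in> w \<Longrightarrow> x \<in> v \<Longrightarrow> w = v"
  using weyl_elem_rep[of w x] weyl_elem_rep[of v x] by simp

lemma weyl_one: "\<one>\<^bsub>W\<^esub> = B \<inter> N"
  by (simp add: weyl_group_def FactGroup_def)

lemma weyl_mult: "x \<in> w \<Longrightarrow> y \<in> v \<Longrightarrow> x \<otimes> y \<in> w \<otimes>\<^bsub>W\<^esub> v"
  by (auto simp: weyl_group_def FactGroup_def set_mult_def)

lemma weyl_inv: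
  assumes w: "w \<in> carrier W" and x: "x \<in> w" shows "inv x \<in> inv\<^bsub>W\<^esub> w"
proof -
  interpret Wg: group W by (rule weyl_is_group)
  have iw: "inv\<^bsub>W\<^esub> w \<in> carrier W" using w by simp
  obtain y where y: "y \<in> inv\<^bsub>W\<^esub> w" using weyl_elemE[OF iw] by blast
  have yc: "y \<in> carrier G" and xc: "x \<in> carrier G"
    using weyl_elem_N[OF iw y] weyl_elem_N[OF w x] N_carr by auto
  have t: "y \<otimes> x \<in> B \<inter> N" using weyl_mult[OF y x] w weyl_one by simp
  have H: "subgroup (B \<inter> N) G" using subgroups_Inter_pair[OF B_subgroup N_subgroup] .
  have "inv x = inv (y \<otimes> x) \<otimes> y" using xc yc by (simp add: inv_mult_group m_assoc)
  then show ?thesis using weyl_elem_rep[OF iw y] subgroup.m_inv_closed[OF H t] by blast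
qed

definition cell :: "'a set \<Rightarrow> 'a set" where "cell w = B <#> w <#> B"

lemma cell_iff: "g \<in> cell w \<longleftrightarrow> (\<exists>b\<in>B. \<exists>n\<in>w. \<exists>b'\<in>B. g = b \<otimes> n \<otimes> b')"
  unfolding cell_def set_mult_def by blast

text \<open>The axiom \<open>exchange\<close> bounds \<open>s B w\<close> by double cosets, and
  multiplying by \<open>B\<close> on both sides extends this to the product of two cells.
  Nondegeneracy becomes the statement that \<open>cell s\<close> meets its own square: an element of
  \<open>s B s\<close> outside \<open>B\<close> has no other place to go.\<close>

lemma tits_system_cell: "tits_system G W S B cell"
proof -
  interpret Wg: group W by (rule weyl_is_group)
  note Bm = subgroup.m_closed[OF B_subgroup] and Bi = subgroup.m_inv_closed[OF B_subgroup]
    and B1 = subgroup.one_closed[OF B_subgroup]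
  have wc: "n \<in> carrier G" if "w \<in> carrier W" "n \<in> w" for n w
    using weyl_elem_N[OF that] N_carr by blast
  have sW: "s \<in> carrier W" if "s \<in> S" for s using that S_subset by blast
  have sub: "w \<subseteq> cell w" if w: "w \<in> carrier W" for w
  proof
    fix n assume n: "n \<in> w"
    have "n = \<one> \<otimes> n \<otimes> \<one>" using wc[OF w n] by simp
    then show "n \<in> cell w" using n B1 cell_iff by blast
  qed
  have lr: "b \<otimes> g \<otimes> b' \<in> cell w" if w: "w \<in> carrier W" and h: "b \<in> B" "b' \<in> B" "g \<in> cell w" for w b b' g
  proof -
    obtain c n c' where c: "c \<in> B" "n \<in> w" "c' \<in> B" "g = c \<otimes> n \<otimes> c'" using h cell_iff by blast
    have "b \<otimes> g \<otimes> b' = (b \<otimes> c) \<otimes> n \<otimes> (c' \<otimes> b')" using h c wc[OF w c(2)] B_carr by (simp add: m_assoc)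
    then show ?thesis using Bm h c cell_iff by blast
  qed
  have one: "cell \<one>\<^bsub>W\<^esub> = B"
  proof
    show "cell \<one>\<^bsub>W\<^esub> \<subseteq> B" using cell_iff weyl_one Bm by auto
    show "B \<subseteq> cell \<one>\<^bsub>W\<^esub>"
    proof
      fix b assume b: "b \<in> B"
      have "b = b \<otimes> \<one> \<otimes> \<one>" using B_carr[OF b] by simp
      moreover have "\<one> \<in> \<one>\<^bsub>W\<^esub>" using weyl_one B1 subgroup.one_closed[OF N_subgroup] by blast
      ultimately show "b \<in> cell \<one>\<^bsub>W\<^esub>" using b B1 cell_iff by blast
    qed
  qed
  have Smult: "x \<otimes> y \<in> cell w \<union> cell (s \<otimes>\<^bsub>W\<^esub> w)"
    if s: "s \<in> S" and w: "w \<in> carrier W" and x: "x \<in> cell s" and y: "y \<in> cell w" for s w x y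
  proof -
    obtain b n b' where b: "b \<in> B" "n \<in> s" "b' \<in> B" "x = b \<otimes> n \<otimes> b'" using x cell_iff by blast
    obtain c m c' where c: "c \<in> B" "m \<in> w" "c' \<in> B" "y = c \<otimes> m \<otimes> c'" using y cell_iff by blast
    note cc = B_carr[OF b(1)] B_carr[OF b(3)] B_carr[OF c(1)] B_carr[OF c(3)] wc[OF sW[OF s] b(2)] wc[OF w c(2)]
    have "n \<otimes> (b' \<otimes> c) \<otimes> m \<in> s <#> B <#> w" unfolding set_mult_def using b(2) c(2) Bm[OF b(3) c(1)] by blast
    then have "n \<otimes> (b' \<otimes> c) \<otimes> m \<in> cell w \<union> cell (s \<otimes>\<^bsub>W\<^esub> w)" using exchange[OF s w] unfolding cell_def by blast
    moreover have "x \<otimes> y = b \<otimes> (n \<otimes> (b' \<otimes> c) \<otimes> m) \<otimes> c'" unfolding b(4) c(4) using cc by (simp add: m_assoc)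
    ultimately show ?thesis using lr[OF w b(1) c(3)] lr[OF _ b(1) c(3), of "s \<otimes>\<^bsub>W\<^esub> w"] sW[OF s] w by auto
  qed
  show ?thesis
  proof (intro tits_system.intro tits_system_axioms.intro involutive_generators.intro involutive_generators_axioms.intro)
    show "group G" by (rule is_group)
    show "group W" by (rule weyl_is_group)
    show "S \<subseteq> carrier W" by (rule S_subset)
    show "generate W S = carrier W" by (rule S_generates)
    show "s \<noteq> \<one>\<^bsub>W\<^esub> \<and> s \<otimes>\<^bsub>W\<^esub> s = \<one>\<^bsub>W\<^esub>" if "s \<in> S" for s by (rule S_involution[OF that])
    show "subgroup B G" by (rule B_subgroup)
    show csub: "cell w \<subseteq> carrier G" if w: "w \<in> carrier W" for w
      using cell_iff wc[OF w] B_carr by auto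
    show "cell w = {b \<otimes> g \<otimes> b' | b b'. b \<in> B \<and> b' \<in> B}" if w: "w \<in> carrier W" and g: "g \<in> cell w" for w g
    proof (intro equalityI subsetI)
      fix h assume h: "h \<in> cell w"
      obtain b n b' where b: "b \<in> B" "n \<in> w" "b' \<in> B" "g = b \<otimes> n \<otimes> b'" using g cell_iff by blast
      obtain c m c' where c: "c \<in> B" "m \<in> w" "c' \<in> B" "h = c \<otimes> m \<otimes> c'" using h cell_iff by blast
      obtain t where t: "t \<in> B" "m = t \<otimes> n" using weyl_elem_rep[OF w b(2)] c(2) by blast
      note cc = B_carr[OF b(1)] B_carr[OF b(3)] B_carr[OF c(1)] B_carr[OF c(3)] B_carr[OF t(1)] wc[OF w b(2)]
      have "h = (c \<otimes> t \<otimes> inv b) \<otimes> g \<otimes> (inv b' \<otimes> c')"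
        unfolding c(4) t(2) b(4) using cc by (simp add: m_assoc)
      moreover have "c \<otimes> t \<otimes> inv b \<in> B" "inv b' \<otimes> c' \<in> B" using b c t Bm Bi by auto
      ultimately show "h \<in> {b \<otimes> g \<otimes> b' | b b'. b \<in> B \<and> b' \<in> B}" by blast
    next
      fix h assume "h \<in> {b \<otimes> g \<otimes> b' | b b'. b \<in> B \<and> b' \<in> B}"
      then show "h \<in> cell w" using lr[OF w _ _ g] by blast
    qed
    show "cell \<one>\<^bsub>W\<^esub> = B" by (rule one)
    show "w = \<one>\<^bsub>W\<^esub>" if w: "w \<in> carrier W" and e: "cell w = B" for w
    proof -
      obtain n where n: "n \<in> N" "n \<in> w" using weyl_elemE[OF w] by blast
      then have "n \<in> B" using sub[OF w] e by blast
      then have "n \<in> \<one>\<^bsub>W\<^esub>" using n weyl_one by blast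
      then show ?thesis using weyl_elem_eqI[OF w _ n(2)] by simp
    qed
    show "inv g \<in> cell (inv\<^bsub>W\<^esub> w)" if w: "w \<in> carrier W" and g: "g \<in> cell w" for w g
    proof -
      obtain b n b' where b: "b \<in> B" "n \<in> w" "b' \<in> B" "g = b \<otimes> n \<otimes> b'" using g cell_iff by blast
      have "inv g = inv b' \<otimes> inv n \<otimes> inv b"
        unfolding b(4) using B_carr[OF b(1)] B_carr[OF b(3)] wc[OF w b(2)] by (simp add: inv_mult_group m_assoc)
      then show ?thesis using Bi b weyl_inv[OF w b(2)] cell_iff by blast
    qed
    show "\<exists>x\<in>cell w. \<exists>y\<in>cell v. x \<otimes> y \<in> cell (w \<otimes>\<^bsub>W\<^esub> v)" if w: "w \<in> carrier W" and v: "v \<in> carrier W" for w v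
    proof -
      obtain x where x: "x \<in> w" using weyl_elemE[OF w] by blast
      obtain y where y: "y \<in> v" using weyl_elemE[OF v] by blast
      note xy = x y
      then have "x \<otimes> y \<in> cell (w \<otimes>\<^bsub>W\<^esub> v)" using weyl_mult[OF xy] sub[of "w \<otimes>\<^bsub>W\<^esub> v"] w v by auto
      then show ?thesis using xy sub[OF w] sub[OF v] by blast
    qed
    show "x \<otimes> y \<in> cell w \<union> cell (s \<otimes>\<^bsub>W\<^esub> w)"
      if "s \<in> S" "w \<in> carrier W" "x \<in> cell s" "y \<in> cell w" for s w x y
      by (rule Smult[OF that])
    show "\<exists>x\<in>cell s. \<exists>y\<in>cell s. x \<otimes> y \<in> cell s" if s: "s \<in> S" for s
    proof -
      obtain z where z: "z \<in> s <#> B <#> s" "z \<notin> B" using nondegenerate[OF s] by blast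
      then obtain n b m where n: "n \<in> s" "b \<in> B" "m \<in> s" "z = n \<otimes> b \<otimes> m" unfolding set_mult_def by blast
      have nc: "n \<in> carrier G" using wc[OF sW[OF s] n(1)] .
      have "n \<otimes> b = \<one> \<otimes> n \<otimes> b" using nc by simp
      then have nb: "n \<otimes> b \<in> cell s" using n B1 cell_iff by blast
      have m: "m \<in> cell s" using sub[OF sW[OF s]] n by blast
      have "z \<in> cell s \<union> cell (s \<otimes>\<^bsub>W\<^esub> s)" using Smult[OF s sW[OF s] nb m] n(4) by simp
      then have "z \<in> cell s" using z(2) S_involution[OF s] one by auto
      then show ?thesis using nb m n(4) by blast
    qed
  qed
qed

end

locale finite_BN_pair = BN_pair +
  assumes finite_carrier: "finite (carrier G)"

sublocale finite_BN_pair \<subseteq> T: finite_tits_system G W S B cell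
proof -
  interpret T0: tits_system G W S B cell by (rule tits_system_cell)
  show "finite_tits_system G W S B cell" by unfold_locales (rule finite_carrier)
qed

context finite_BN_pair
begin

lemma weyl_length_eq: "weyl_length w = T.W.len w"
  unfolding weyl_length_def T.W.len_def T.W.word_def ..

lemma longest_eq: "longest I = T.W.wlong I"
  unfolding longest_def T.W.wlong_def weyl_length_eq ..

lemma parabolic_eq: "parabolic I = T.P I"
  unfolding parabolic_def T.P_def cell_def set_mult_def by blast

lemma finite_vertices: "finite vertices"
proof (rule finite_subset)
  show "vertices \<subseteq> (\<lambda>(g, r). g <# parabolic (S - {r})) ` (carrier G \<times> S)" unfolding vertices_def by auto
  show "finite ((\<lambda>(g, r). g <# parabolic (S - {r})) ` (carrier G \<times> S))"
    using finite_carrier T.W.finite_S by blast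
qed

lemma one_P: "\<one> \<in> T.P I"
  using T.B_P T.B_one by blast

lemma mem_l_coset_P: "g \<in> carrier G \<Longrightarrow> g \<in> g <# T.P I"
  using one_P[of I] unfolding l_coset_def by force

lemma l_coset_P_mem:
  assumes "I \<subseteq> S" "g \<in> carrier G" "h \<in> g <# T.P I"
  shows "h \<in> carrier G" "h <# T.P I = g <# T.P I" "inv g \<otimes> h \<in> T.P I"
proof -
  obtain p where p: "p \<in> T.P I" "h = g \<otimes> p" using assms(3) unfolding l_coset_def by blast
  have pc: "p \<in> carrier G" using p T.P_sub[OF assms(1)] by blast
  show "h \<in> carrier G" using p pc assms(2) by simp
  show "h <# T.P I = g <# T.P I" unfolding p(2) by (rule T.l_coset_mult_P[OF assms(1,2) p(1)])
  show "inv g \<otimes> h \<in> T.P I" using p pc assms(2) by simp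
qed

text \<open>Cosets with a common representative determine their parabolic subgroup, and
  \<open>P_inj\<close> recovers the set of generators from it.\<close>

lemma vertex_type_unique:
  assumes r: "r \<in> S" "r' \<in> S" and a: "a \<in> carrier G" "b \<in> carrier G"
    and e: "a <# T.P (S - {r}) = b <# T.P (S - {r'})"
  shows "r = r'"
proof -
  have sub: "S - {r} \<subseteq> S" "S - {r'} \<subseteq> S" by auto
  have "a \<in> b <# T.P (S - {r'})" using mem_l_coset_P[OF a(1), of "S - {r}"] e by simp
  then have e': "a <# T.P (S - {r}) = a <# T.P (S - {r'})" using l_coset_P_mem(2)[OF sub(2) a(2)] e by simp
  have *: "T.P I \<subseteq> T.P J" if "I \<subseteq> S" "J \<subseteq> S" "a <# T.P I = a <# T.P J" for I J
  proof
    fix p assume p: "p \<in> T.P I"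
    then have "a \<otimes> p \<in> a <# T.P J" using that(3) unfolding l_coset_def by blast
    then have "inv a \<otimes> (a \<otimes> p) \<in> T.P J" by (rule l_coset_P_mem(3)[OF that(2) a(1)])
    then show "p \<in> T.P J" using a(1) p T.P_sub[OF that(1)] by auto
  qed
  have "S - {r} \<subseteq> S - {r'}" "S - {r'} \<subseteq> S - {r}"
    using T.P_inj[OF sub *[OF sub e']] T.P_inj[OF sub(2,1) *[OF sub(2,1) e'[symmetric]]] .
  then show ?thesis using r by blast
qed

text \<open>Any element of a common edge coset represents both vertices; the types then differ
  because the vertices do.\<close>

lemma adjacent_rep:
  assumes "adjacent x y"
  obtains g r s where "g \<in> carrier G" "r \<in> S" "s \<in> S" "r \<noteq> s" "x = g <# T.P (S - {r})" "y = g <# T.P (S - {s})"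
proof -
  obtain a r b s where x: "a \<in> carrier G" "r \<in> S" "x = a <# T.P (S - {r})"
    and y: "b \<in> carrier G" "s \<in> S" "y = b <# T.P (S - {s})" and ne: "x \<noteq> y"
    using assms unfolding adjacent_def vertices_def parabolic_eq by blast
  obtain h I where h: "h \<in> carrier G" "h <# T.P I \<subseteq> x" "h <# T.P I \<subseteq> y"
    using assms unfolding adjacent_def edges_def parabolic_eq by blast
  have sub: "S - {r} \<subseteq> S" "S - {s} \<subseteq> S" by auto
  have "h \<in> x" "h \<in> y" using h mem_l_coset_P[OF h(1)] by blast+
  then have "x = h <# T.P (S - {r})" "y = h <# T.P (S - {s})"
    using l_coset_P_mem(2)[OF sub(1) x(1)] l_coset_P_mem(2)[OF sub(2) y(1)] x(3) y(3) by auto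
  then show thesis using that[OF h(1) x(2) y(2)] ne by blast
qed

lemma adjacentI:
  assumes g: "g \<in> carrier G" and r: "r \<in> S" and s: "s \<in> S" and rs: "r \<noteq> s"
  shows "adjacent (g <# T.P (S - {r})) (g <# T.P (S - {s}))"
  unfolding adjacent_def
proof (intro conjI)
  show "g <# T.P (S - {r}) \<in> vertices" "g <# T.P (S - {s}) \<in> vertices"
    unfolding vertices_def parabolic_eq using g r s by blast+
  show "g <# T.P (S - {r}) \<noteq> g <# T.P (S - {s})" using vertex_type_unique[OF r s g g] rs by blast
  have "T.P (S - {r, s}) \<subseteq> T.P (S - {r})" "T.P (S - {r, s}) \<subseteq> T.P (S - {s})" by (rule T.P_mono; blast)+
  then have "g <# T.P (S - {r, s}) \<subseteq> g <# T.P (S - {r})" "g <# T.P (S - {r, s}) \<subseteq> g <# T.P (S - {s})"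
    unfolding l_coset_def by blast+
  moreover have "g <# T.P (S - {r, s}) \<in> edges" unfolding edges_def parabolic_eq using g r s rs by blast
  ultimately show "\<exists>e\<in>edges. e \<subseteq> g <# T.P (S - {r}) \<and> e \<subseteq> g <# T.P (S - {s})" by blast
qed

text \<open>A Weyl group element is a coset of \<open>B \<inter> N\<close>; enlarging it to the full
  double coset changes nothing, because both parabolic factors absorb \<open>B\<close>.\<close>

lemma P_longest_P:
  assumes I: "I \<subseteq> S" and J: "J \<subseteq> S" and w: "w \<in> carrier W"
  shows "k \<in> T.P I <#> w <#> T.P J \<longleftrightarrow> (\<exists>p\<in>T.P I. \<exists>x\<in>cell w. \<exists>p'\<in>T.P J. k = p \<otimes> x \<otimes> p')"
proof
  assume "k \<in> T.P I <#> w <#> T.P J"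
  then obtain p n p' where k: "p \<in> T.P I" "n \<in> w" "p' \<in> T.P J" "k = p \<otimes> n \<otimes> p'" unfolding set_mult_def by blast
  have "n = \<one> \<otimes> n \<otimes> \<one>" using weyl_elem_N[OF w k(2)] N_carr by simp
  then have "n \<in> cell w" using k(2) T.B_one cell_iff by blast
  then show "\<exists>p\<in>T.P I. \<exists>x\<in>cell w. \<exists>p'\<in>T.P J. k = p \<otimes> x \<otimes> p'" using k by blast
next
  assume "\<exists>p\<in>T.P I. \<exists>x\<in>cell w. \<exists>p'\<in>T.P J. k = p \<otimes> x \<otimes> p'"
  then obtain p x p' where k: "p \<in> T.P I" "x \<in> cell w" "p' \<in> T.P J" "k = p \<otimes> x \<otimes> p'" by blast
  then obtain b n b' where x: "b \<in> B" "n \<in> w" "b' \<in> B" "x = b \<otimes> n \<otimes> b'" using cell_iff by blast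
  have c: "p \<in> carrier G" "p' \<in> carrier G" "b \<in> carrier G" "b' \<in> carrier G" "n \<in> carrier G"
    using k x T.P_sub[OF I] T.P_sub[OF J] B_carr weyl_elem_N[OF w x(2)] N_carr by auto
  have "k = (p \<otimes> b) \<otimes> n \<otimes> (b' \<otimes> p')" unfolding k(4) x(4) using c by (simp add: m_assoc)
  moreover have "p \<otimes> b \<in> T.P I" "b' \<otimes> p' \<in> T.P J"
    using subgroup.m_closed[OF T.P_subgroup[OF I] k(1)] subgroup.m_closed[OF T.P_subgroup[OF J] _ k(3)] T.B_P x by blast+
  ultimately show "k \<in> T.P I <#> w <#> T.P J" unfolding set_mult_def using x(2) by blast
qed

text \<open>The definition of \<open>geodesic_path\<close> allows unrelated representatives of the
  three vertices. Adjacency of the second and third supplies a common representative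
  \<open>h\<close>; then \<open>k = inv g \<otimes> h\<close> fixes the middle vertex, and changing
  representatives moves the opposition condition from \<open>inv a \<otimes> c\<close> to
  \<open>k\<close>.\<close>

lemma geodesic_path_iff_ends:
  assumes r: "r \<in> S" and s: "s \<in> S" and rs: "r \<noteq> s" and g: "g \<in> carrier G"
  shows "geodesic_path (g <# T.P (S - {r})) (g <# T.P (S - {s})) z \<longleftrightarrow> z \<in> T.ends r s g"
proof -
  let ?t = "T.opp r s" and ?w = "T.W.wlong (T.mid s)"
  have sub: "S - {r} \<subseteq> S" "S - {s} \<subseteq> S" "S - {?t} \<subseteq> S" by auto
  have w: "?w \<in> carrier W" using T.W.wlong_closed[OF T.mid_S] .
  have t: "?t \<in> S" "?t \<noteq> s" using T.opp_S[OF r s rs] T.opp_neq[OF r s rs] by auto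
  have turns: "k \<in> T.turns r s \<longleftrightarrow> k \<in> T.P (S - {s}) \<and> k \<in> T.P (S - {r}) <#> ?w <#> T.P (S - {?t})" for k
    using T.turns_iff[OF r s rs, of k] P_longest_P[OF sub(1,3) w] unfolding T.mid_def by blast
  show ?thesis
  proof
    assume geo: "geodesic_path (g <# T.P (S - {r})) (g <# T.P (S - {s})) z"
    then obtain a b c r' s' t' where abc: "a \<in> carrier G" "b \<in> carrier G" "c \<in> carrier G" "r' \<in> S" "s' \<in> S" "t' \<in> S"
      and x: "g <# T.P (S - {r}) = a <# T.P (S - {r'})" and y: "g <# T.P (S - {s}) = b <# T.P (S - {s'})"
      and z: "z = c <# T.P (S - {t'})" and t': "t' = T.W.wlong (S - {s'}) \<otimes>\<^bsub>W\<^esub> r' \<otimes>\<^bsub>W\<^esub> T.W.wlong (S - {s'})"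
      and ac: "inv a \<otimes> c \<in> T.P (S - {r'}) <#> T.W.wlong (S - {s'}) <#> T.P (S - {t'})"
      unfolding geodesic_path_def parabolic_eq longest_eq by blast
    have r': "r' = r" using vertex_type_unique[OF r abc(4) g abc(1) x] by simp
    have s': "s' = s" using vertex_type_unique[OF s abc(5) g abc(2) y] by simp
    have tt: "t' = ?t" unfolding t' r' s' T.opp_def T.mid_def ..
    have "adjacent (g <# T.P (S - {s})) z" using geo unfolding geodesic_path_def by blast
    then obtain h s2 t2 where h: "h \<in> carrier G" "s2 \<in> S" "t2 \<in> S"
      "g <# T.P (S - {s}) = h <# T.P (S - {s2})" "z = h <# T.P (S - {t2})" using adjacent_rep by metis
    have s2: "s2 = s" using vertex_type_unique[OF s h(2) g h(1) h(4)] by simp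
    have t2: "t2 = ?t" using vertex_type_unique[OF abc(6) h(3) abc(3) h(1)] z h(5) tt by simp
    define k where "k = inv g \<otimes> h"
    have hk: "h = g \<otimes> k" unfolding k_def using g h(1) by simp
    have kc: "k \<in> carrier G" unfolding k_def using g h(1) by simp
    have kP: "k \<in> T.P (S - {s})"
      unfolding k_def using l_coset_P_mem(3)[OF sub(2) g] mem_l_coset_P[OF h(1), of "S - {s}"] h(4) s2 by simp
    have 1: "inv g \<otimes> a \<in> T.P (S - {r})"
      using l_coset_P_mem(3)[OF sub(1) g] mem_l_coset_P[OF abc(1), of "S - {r}"] x r' by simp
    have 2: "inv c \<otimes> h \<in> T.P (S - {?t})"
      using l_coset_P_mem(3)[OF sub(3) abc(3)] mem_l_coset_P[OF h(1), of "S - {?t}"] z h(5) tt t2 by simp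
    obtain p n p' where pn: "p \<in> T.P (S - {r})" "n \<in> ?w" "p' \<in> T.P (S - {?t})" "inv a \<otimes> c = p \<otimes> n \<otimes> p'"
      using ac unfolding r' s' tt set_mult_def T.mid_def by blast
    have cc: "p \<in> carrier G" "p' \<in> carrier G" "n \<in> carrier G"
      using pn T.P_sub[OF sub(1)] T.P_sub[OF sub(3)] weyl_elem_N[OF w pn(2)] N_carr by auto
    have "k = (inv g \<otimes> a) \<otimes> (inv a \<otimes> c) \<otimes> (inv c \<otimes> h)"
      unfolding k_def using g h(1) abc by (simp add: m_assoc)
    also have "\<dots> = ((inv g \<otimes> a) \<otimes> p) \<otimes> n \<otimes> (p' \<otimes> (inv c \<otimes> h))"
      unfolding pn(4) using g h(1) abc cc by (simp add: m_assoc)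
    finally have "k \<in> T.P (S - {r}) <#> ?w <#> T.P (S - {?t})"
      unfolding set_mult_def
      using subgroup.m_closed[OF T.P_subgroup[OF sub(1)] 1 pn(1)] subgroup.m_closed[OF T.P_subgroup[OF sub(3)] pn(3) 2] pn(2)
      by blast
    then have "k \<in> T.turns r s" using turns kP by blast
    then show "z \<in> T.ends r s g" unfolding T.ends_def[OF r s rs] h(5) t2 hk by blast
  next
    assume "z \<in> T.ends r s g"
    then obtain k where k: "k \<in> T.turns r s" "z = (g \<otimes> k) <# T.P (S - {?t})" unfolding T.ends_def[OF r s rs] by blast
    have kP: "k \<in> T.P (S - {s})" and kw: "k \<in> T.P (S - {r}) <#> ?w <#> T.P (S - {?t})" using k turns by auto
    have kc: "k \<in> carrier G" using kP T.P_sub[OF sub(2)] by blast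
    have y: "g <# T.P (S - {s}) = (g \<otimes> k) <# T.P (S - {s})" using T.l_coset_mult_P[OF sub(2) g kP] by simp
    have adj: "adjacent (g <# T.P (S - {s})) z"
      unfolding y k(2) by (rule adjacentI) (use g kc s t in auto)
    have e: "inv g \<otimes> (g \<otimes> k) = k" using g kc by simp
    show "geodesic_path (g <# T.P (S - {r})) (g <# T.P (S - {s})) z"
      unfolding geodesic_path_def parabolic_eq longest_eq
      by (intro conjI adjacentI[OF g r s rs] adj bexI[of _ g] bexI[of _ "g \<otimes> k"] bexI[of _ r] bexI[of _ s] bexI[of _ ?t])
        (use k(2) kw e g kc r s t in \<open>simp_all add: T.opp_def T.mid_def\<close>)
  qed
qed

theorem edge_eigenvalue_power:
  fixes p :: nat
  assumes a: "edge_eigenvalue \<alpha>" and p: "p > 0"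
    and param: "\<And>w. w \<in> carrier W \<Longrightarrow> \<exists>e. card (cell w) = card B * p ^ e"
  shows "\<exists>k>0. \<exists>j::int. \<alpha> ^ k = of_nat p powi j"
proof -
  obtain ms where ms: "inverse edge_zeta = (\<Prod>m\<leftarrow>ms. 1 - fps_const m * fps_X)" "\<alpha> \<in> set ms" and a0: "\<alpha> \<noteq> 0"
    using a unfolding edge_eigenvalue_def by blast
  obtain v where v: "\<exists>x\<in>vertices. \<exists>y\<in>vertices. v (x, y) \<noteq> 0"
    "\<And>x y. x \<in> vertices \<Longrightarrow> y \<in> vertices \<Longrightarrow> \<alpha> * v (x, y) = (\<Sum>z\<in>{z\<in>vertices. geodesic_path x y z}. v (y, z))"
    using zeta_zero_eigenvector[OF finite_vertices ms(1)[unfolded edge_zeta_def geodesic_cycles_def] ms(2) a0] by blast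
  obtain x y where xy: "x \<in> vertices" "y \<in> vertices" "v (x, y) \<noteq> 0" using v(1) by blast
  \<comment> \<open>The eigenvector lives on all pairs of vertices; a pair where it is nonzero must
    have a successor since \<open>\<alpha> \<noteq> 0\<close>, and so is an edge.\<close>
  have "{z\<in>vertices. geodesic_path x y z} \<noteq> {}" using v(2)[OF xy(1,2)] xy(3) a0 by fastforce
  then have "adjacent x y" unfolding geodesic_path_def by blast
  then obtain g r s where g: "g \<in> carrier G" "r \<in> S" "s \<in> S" "r \<noteq> s" "x = g <# T.P (S - {r})" "y = g <# T.P (S - {s})"
    by (rule adjacent_rep)
  show ?thesis
  proof (rule T.eigenvalue_power[OF _ a0 p param g(2,3,4,1)])
    show "v (g <# T.P (S - {r}), g <# T.P (S - {s})) \<noteq> 0" using xy(3) g(5,6) by simp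
    fix r s g assume h: "r \<in> S" "s \<in> S" "r \<noteq> s" "g \<in> carrier G"
    have V: "g <# T.P (S - {r}) \<in> vertices" "g <# T.P (S - {s}) \<in> vertices"
      unfolding vertices_def parabolic_eq using h by blast+
    have "z \<in> vertices" if "z \<in> T.ends r s g" for z
    proof -
      have "geodesic_path (g <# T.P (S - {r})) (g <# T.P (S - {s})) z" using geodesic_path_iff_ends[OF h] that by blast
      then show ?thesis unfolding geodesic_path_def adjacent_def by (elim conjE)
    qed
    then have "{z \<in> vertices. z \<in> T.ends r s g} = T.ends r s g" by blast
    then show "\<alpha> * v (g <# T.P (S - {r}), g <# T.P (S - {s})) = (\<Sum>z\<in>T.ends r s g. v (g <# T.P (S - {s}), z))"
      unfolding v(2)[OF V] geodesic_path_iff_ends[OF h] by (rule arg_cong)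
  qed
qed

end

declare (in group) inv_mult_cancel [simp del]

section \<open>The general linear group\<close>

lemma group_GL: "group (GL :: ('k::field ^ 'n ^ 'n) monoid)"
proof (rule groupI)
  fix A :: "'k ^ 'n ^ 'n" assume "A \<in> carrier GL"
  then obtain B where "A ** B = mat 1" "B ** A = mat 1" by (auto simp: GL_def invertible_def)
  then show "\<exists>B\<in>carrier GL. B \<otimes>\<^bsub>GL\<^esub> A = \<one>\<^bsub>GL\<^esub>" by (auto simp: GL_def invertible_def)
next
  have "invertible (mat 1 :: 'k ^ 'n ^ 'n)" unfolding invertible_def by (rule exI[of _ "mat 1"]) simp
  then show "\<one>\<^bsub>GL\<^esub> \<in> carrier (GL :: ('k ^ 'n ^ 'n) monoid)" by (simp add: GL_def)
qed (auto simp: GL_def invertible_mult matrix_mul_assoc)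

global_interpretation GL: group "GL :: ('k::field ^ 'n ^ 'n) monoid"
  by (rule group_GL)

lemma GL_mult: "A \<otimes>\<^bsub>GL\<^esub> B = A ** B" and GL_one: "\<one>\<^bsub>GL\<^esub> = mat 1"
  and GL_carrier: "A \<in> carrier GL \<longleftrightarrow> invertible A"
  by (simp_all add: GL_def)

lemma GL_act: "(A \<otimes>\<^bsub>GL\<^esub> B) *v x = A *v (B *v x)"
  by (simp add: GL_mult matrix_vector_mul_assoc)

lemma GL_one_act [simp]: "\<one>\<^bsub>GL\<^esub> *v x = x"
  by (simp add: GL_one)

lemma GL_pow_act': "A \<in> carrier GL \<Longrightarrow> (A [^]\<^bsub>GL\<^esub> Suc n) *v x = A *v ((A [^]\<^bsub>GL\<^esub> n) *v x)"
  by (subst GL.nat_pow_Suc2) (simp_all only: GL_act)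

lemma GL_inv_act [simp]:
  "A \<in> carrier GL \<Longrightarrow> (inv\<^bsub>GL\<^esub> A) *v (A *v x) = x"
  "A \<in> carrier GL \<Longrightarrow> A *v ((inv\<^bsub>GL\<^esub> A) *v x) = x"
  by (simp_all flip: GL_act)

lemma GL_inv_eq: "A \<in> carrier GL \<Longrightarrow> inv\<^bsub>GL\<^esub> A = matrix_inv A"
proof -
  assume A: "A \<in> carrier GL"
  then have "\<exists>B. A ** B = mat 1 \<and> B ** A = mat 1" by (simp add: GL_carrier invertible_def)
  then have B: "A ** matrix_inv A = mat 1 \<and> matrix_inv A ** A = mat 1"
    unfolding matrix_inv_def by (rule someI_ex)
  then have "matrix_inv A \<in> carrier GL" by (auto simp: GL_carrier invertible_def)
  then show ?thesis using B A by (intro GL.inv_equality) (simp_all add: GL_mult GL_one)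
qed

subsection \<open>Regular functions and connectedness\<close>

lemma poly_functions_sum:
  "finite I \<Longrightarrow> (\<And>i. i \<in> I \<Longrightarrow> f i \<in> poly_functions) \<Longrightarrow> (\<lambda>A. \<Sum>i\<in>I. f i A) \<in> poly_functions"
  by (induction rule: finite_induct) (auto intro: poly_functions.intros)

lemma poly_functions_prod:
  "finite I \<Longrightarrow> (\<And>i. i \<in> I \<Longrightarrow> f i \<in> poly_functions) \<Longrightarrow> (\<lambda>A. \<Prod>i\<in>I. f i A) \<in> poly_functions"
  by (induction rule: finite_induct) (auto intro: poly_functions.intros)

lemma poly_functions_power: "f \<in> poly_functions \<Longrightarrow> (\<lambda>A. f A ^ k) \<in> poly_functions"
  by (induction k) (auto intro: poly_functions.intros)

lemma poly_functions_det:
  fixes E :: "'k::field ^ 'n ^ 'n \<Rightarrow> 'k ^ 'n ^ 'n"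
  assumes "\<And>i j. (\<lambda>A. E A $ i $ j) \<in> poly_functions"
  shows "(\<lambda>A. det (E A)) \<in> poly_functions"
  unfolding Determinants.det_def
  by (intro poly_functions_sum poly_functions.mult poly_functions.const poly_functions_prod assms) auto

text \<open>The coordinate ring of \<open>GL\<close>, as functions: only the values on invertible
  matrices are prescribed.\<close>

definition reg_functions :: "('k::field ^ 'n ^ 'n \<Rightarrow> 'k) set" where
  "reg_functions = {\<phi>. \<exists>f\<in>poly_functions. \<exists>k::nat. \<forall>A\<in>carrier GL. \<phi> A = f A / det A ^ k}"

lemma det_nonzero: "A \<in> carrier GL \<Longrightarrow> det A \<noteq> 0"
  by (simp add: GL_carrier invertible_det_nz)

lemma reg_poly: "f \<in> poly_functions \<Longrightarrow> f \<in> reg_functions"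
  unfolding reg_functions_def by (auto intro!: bexI[of _ f] exI[of _ 0])

lemma reg_const: "(\<lambda>_. c) \<in> reg_functions" and reg_entry: "(\<lambda>A. A $ i $ j) \<in> reg_functions"
  by (auto intro: reg_poly poly_functions.intros)

lemma reg_mult: "\<phi> \<in> reg_functions \<Longrightarrow> \<psi> \<in> reg_functions \<Longrightarrow> (\<lambda>A. \<phi> A * \<psi> A) \<in> reg_functions"
proof -
  assume "\<phi> \<in> reg_functions" "\<psi> \<in> reg_functions"
  then obtain f k g l where f: "f \<in> poly_functions" "\<And>A. A \<in> carrier GL \<Longrightarrow> \<phi> A = f A / det A ^ k"
    and g: "g \<in> poly_functions" "\<And>A. A \<in> carrier GL \<Longrightarrow> \<psi> A = g A / det A ^ l"
    unfolding reg_functions_def by blast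
  have "\<forall>A\<in>carrier GL. \<phi> A * \<psi> A = (f A * g A) / det A ^ (k + l)"
    using f g by (simp add: power_add)
  then show ?thesis unfolding reg_functions_def
    by (intro CollectI bexI[of _ "\<lambda>A. f A * g A"] exI[of _ "k + l"] poly_functions.mult f(1) g(1))
qed

lemma reg_add: "\<phi> \<in> reg_functions \<Longrightarrow> \<psi> \<in> reg_functions \<Longrightarrow> (\<lambda>A. \<phi> A + \<psi> A) \<in> reg_functions"
proof -
  assume "\<phi> \<in> reg_functions" "\<psi> \<in> reg_functions"
  then obtain f k g l where f: "f \<in> poly_functions" "\<And>A. A \<in> carrier GL \<Longrightarrow> \<phi> A = f A / det A ^ k"
    and g: "g \<in> poly_functions" "\<And>A. A \<in> carrier GL \<Longrightarrow> \<psi> A = g A / det A ^ l"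
    unfolding reg_functions_def by blast
  have d: "(\<lambda>A. det A ^ m) \<in> poly_functions" for m :: nat
    by (intro poly_functions_power poly_functions_det poly_functions.entry)
  have "\<forall>A\<in>carrier GL. \<phi> A + \<psi> A = (f A * det A ^ l + g A * det A ^ k) / det A ^ (k + l)"
  proof
    fix A :: "'a ^ 'b ^ 'b" assume A: "A \<in> carrier GL"
    show "\<phi> A + \<psi> A = (f A * det A ^ l + g A * det A ^ k) / det A ^ (k + l)"
      using f(2)[OF A] g(2)[OF A] det_nonzero[OF A] by (simp add: power_add add_divide_distrib)
  qed
  moreover have "(\<lambda>A. f A * det A ^ l + g A * det A ^ k) \<in> poly_functions"
    by (intro poly_functions.add poly_functions.mult f(1) g(1) d)
  ultimately show ?thesis unfolding reg_functions_def
    by (intro CollectI bexI[of _ "\<lambda>A. f A * det A ^ l + g A * det A ^ k"] exI[of _ "k + l"])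
qed

lemma reg_sum: "finite I \<Longrightarrow> (\<And>i. i \<in> I \<Longrightarrow> \<phi> i \<in> reg_functions) \<Longrightarrow> (\<lambda>A. \<Sum>i\<in>I. \<phi> i A) \<in> reg_functions"
  by (induction rule: finite_induct) (auto intro: reg_const reg_add)

text \<open>Cramer's rule: replace column \<open>i\<close> of the matrix by the \<open>j\<close>-th
  unit vector and divide by the determinant.\<close>

lemma reg_inverse_entry: "(\<lambda>A. (inv\<^bsub>GL\<^esub> A) $ i $ j) \<in> reg_functions"
proof -
  let ?E = "\<lambda>A :: 'a ^ 'b ^ 'b. \<chi> a b. if b = i then (axis j 1 :: 'a ^ 'b) $ a else A $ a $ b"
  have "(\<lambda>A. ?E A $ a $ b) \<in> poly_functions" for a b
    by (cases "b = i") (simp_all add: poly_functions.intros)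
  then have f: "(\<lambda>A. det (?E A)) \<in> poly_functions" by (rule poly_functions_det)
  have "(inv\<^bsub>GL\<^esub> A) $ i $ j = det (?E A) / det A ^ 1" if A: "A \<in> carrier GL" for A :: "'a ^ 'b ^ 'b"
  proof -
    have "A *v ((inv\<^bsub>GL\<^esub> A) *v axis j 1) = axis j 1" using A by simp
    then have "(inv\<^bsub>GL\<^esub> A) *v axis j 1 = (\<chi> k. det (\<chi> a b. if b = k then (axis j 1 :: 'a ^ 'b) $ a else A $ a $ b) / det A)"
      using cramer[OF det_nonzero[OF A]] by blast
    then have "((inv\<^bsub>GL\<^esub> A) *v axis j 1) $ i = det (?E A) / det A" by simp
    moreover have "((inv\<^bsub>GL\<^esub> A) *v axis j 1) $ i = (inv\<^bsub>GL\<^esub> A) $ i $ j"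
      by (simp add: matrix_vector_mult_def axis_def if_distrib cong: if_cong)
    ultimately show ?thesis by simp
  qed
  then show ?thesis unfolding reg_functions_def
    by (intro CollectI bexI[of _ "\<lambda>A. det (?E A)"] exI[of _ 1] ballI f)
qed

definition reg_map :: "('k::field ^ 'n ^ 'n \<Rightarrow> 'k ^ 'n ^ 'n) \<Rightarrow> bool" where
  "reg_map M \<longleftrightarrow> (\<forall>i j. (\<lambda>A. M A $ i $ j) \<in> reg_functions)"

lemma reg_map_const: "reg_map (\<lambda>_. C)" and reg_map_id: "reg_map (\<lambda>A. A)"
  and reg_map_inv: "reg_map (\<lambda>A. inv\<^bsub>GL\<^esub> A)"
  unfolding reg_map_def by (auto intro: reg_const reg_entry reg_inverse_entry)

lemma reg_map_mult: "reg_map M \<Longrightarrow> reg_map L \<Longrightarrow> reg_map (\<lambda>A. M A \<otimes>\<^bsub>GL\<^esub> L A)"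
  unfolding reg_map_def by (auto simp: GL_mult matrix_matrix_mult_def intro!: reg_sum reg_mult)

lemma poly_comp_reg_map:
  assumes M: "reg_map M" and "f \<in> poly_functions"
  shows "(\<lambda>A. f (M A)) \<in> reg_functions"
  using assms(2) by induction (use M in \<open>auto simp: reg_map_def intro: reg_const reg_add reg_mult\<close>)

text \<open>\<open>zariski_closed\<close> is phrased with polynomials. The determinant does not
  vanish on \<open>GL\<close>, so a regular function may be replaced by its numerator.\<close>

lemma reg_zero_closed:
  assumes "\<Phi> \<subseteq> reg_functions"
  shows "zariski_closed {A \<in> carrier GL. \<forall>\<phi>\<in>\<Phi>. \<phi> A = 0}"
proof -
  let ?P = "{f \<in> poly_functions. \<exists>\<phi>\<in>\<Phi>. \<exists>k::nat. \<forall>A\<in>carrier GL. \<phi> A = f A / det A ^ k}"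
  have "{A \<in> carrier GL. \<forall>\<phi>\<in>\<Phi>. \<phi> A = 0} = {A \<in> carrier GL. \<forall>f\<in>?P. f A = 0}"
  proof (intro equalityI subsetI)
    fix A assume A: "A \<in> {A \<in> carrier GL. \<forall>\<phi>\<in>\<Phi>. \<phi> A = 0}"
    then have Ac: "A \<in> carrier GL" by blast
    have "f A = 0" if f: "f \<in> ?P" for f
    proof -
      obtain \<phi> k where "\<phi> \<in> \<Phi>" "\<phi> A = f A / det A ^ k" using f Ac by blast
      moreover have "\<phi> A = 0" using A \<open>\<phi> \<in> \<Phi>\<close> by blast
      ultimately show ?thesis using det_nonzero[OF Ac] by simp
    qed
    then show "A \<in> {A \<in> carrier GL. \<forall>f\<in>?P. f A = 0}" using Ac by blast
  next
    fix A assume A: "A \<in> {A \<in> carrier GL. \<forall>f\<in>?P. f A = 0}"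
    have "\<phi> A = 0" if \<phi>: "\<phi> \<in> \<Phi>" for \<phi>
    proof -
      obtain f k where f: "f \<in> poly_functions" "\<forall>A\<in>carrier GL. \<phi> A = f A / det A ^ k"
        using \<phi> assms unfolding reg_functions_def by blast
      then have "f \<in> ?P" using \<phi> by blast
      then show ?thesis using A f by auto
    qed
    then show "A \<in> {A \<in> carrier GL. \<forall>\<phi>\<in>\<Phi>. \<phi> A = 0}" using A by blast
  qed
  then show ?thesis unfolding zariski_closed_def by (intro exI[of _ ?P]) blast
qed

lemma zariski_closed_vimage:
  assumes M: "reg_map M" and C: "zariski_closed C" and GL: "\<And>A. A \<in> carrier GL \<Longrightarrow> M A \<in> carrier GL"
  shows "zariski_closed {A \<in> carrier GL. M A \<in> C}"
proof -
  obtain P where P: "P \<subseteq> poly_functions" "C = {A \<in> carrier GL. \<forall>f\<in>P. f A = 0}"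
    using C unfolding zariski_closed_def by blast
  have "{A \<in> carrier GL. M A \<in> C} = {A \<in> carrier GL. \<forall>\<phi>\<in>(\<lambda>f A. f (M A)) ` P. \<phi> A = 0}"
    by (auto simp: P(2) GL)
  moreover have "(\<lambda>f A. f (M A)) ` P \<subseteq> reg_functions" using poly_comp_reg_map[OF M] P(1) by blast
  ultimately show ?thesis using reg_zero_closed[of "(\<lambda>f A. f (M A)) ` P"] by (simp only:)
qed

lemma zariski_closed_empty: "zariski_closed {}"
  unfolding zariski_closed_def by (rule exI[of _ "{\<lambda>_. 1}"]) (auto intro: poly_functions.const)

lemma zariski_closed_Un:
  assumes "zariski_closed C" "zariski_closed D" shows "zariski_closed (C \<union> D)"
proof -
  obtain P Q where P: "P \<subseteq> poly_functions" "C = {A \<in> carrier GL. \<forall>f\<in>P. f A = 0}"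
    and Q: "Q \<subseteq> poly_functions" "D = {A \<in> carrier GL. \<forall>f\<in>Q. f A = 0}"
    using assms unfolding zariski_closed_def by blast
  let ?R = "{\<lambda>A. f A * g A | f g. f \<in> P \<and> g \<in> Q}"
  have "?R \<subseteq> poly_functions" using P Q poly_functions.mult by blast
  moreover have "C \<union> D = {A \<in> carrier GL. \<forall>f\<in>?R. f A = 0}"
  proof (intro equalityI subsetI)
    fix A assume "A \<in> C \<union> D"
    then show "A \<in> {A \<in> carrier GL. \<forall>f\<in>?R. f A = 0}" unfolding P(2) Q(2) by auto
  next
    fix A assume A: "A \<in> {A \<in> carrier GL. \<forall>f\<in>?R. f A = 0}"
    show "A \<in> C \<union> D"
    proof (rule ccontr)
      assume "A \<notin> C \<union> D"
      then obtain f g where fg: "f \<in> P" "f A \<noteq> 0" "g \<in> Q" "g A \<noteq> 0" using A unfolding P(2) Q(2) by blast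
      have "\<forall>h\<in>?R. h A = 0" using A by (elim CollectE conjE)
      moreover have "(\<lambda>A. f A * g A) \<in> ?R" using fg by blast
      ultimately have "f A * g A = 0" by (rule bspec)
      then show False using fg by simp
    qed
  qed
  ultimately show ?thesis unfolding zariski_closed_def by blast
qed

lemma zariski_closed_UN: "finite I \<Longrightarrow> (\<And>i. i \<in> I \<Longrightarrow> zariski_closed (C i)) \<Longrightarrow> zariski_closed (\<Union>i\<in>I. C i)"
  by (induction rule: finite_induct) (auto intro: zariski_closed_empty zariski_closed_Un)

lemma zariski_connectedD:
  assumes "zariski_connected V" "zariski_closed C" "zariski_closed D" "V \<subseteq> C \<union> D" "C \<inter> D \<inter> V = {}" "C \<inter> V \<noteq> {}"
  shows "V \<subseteq> C"
  using assms unfolding zariski_connected_def by blast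

text \<open>Finitely many level sets, each closed relative to \<open>V\<close>, would disconnect
  \<open>V\<close> if there were two of them. Closedness is asked of the level sets, because the
  characters to which this is applied are given by an eigenvalue condition and not by a
  formula.\<close>

lemma zariski_connected_finite_image_const:
  assumes conn: "zariski_connected V" and fin: "finite (\<phi> ` V)"
    and lev: "\<And>c. \<exists>C. zariski_closed C \<and> V \<inter> C = {A \<in> V. \<phi> A = c}"
    and AB: "A \<in> V" "B \<in> V"
  shows "\<phi> A = \<phi> B"
proof -
  obtain C where C: "\<And>c. zariski_closed (C c)" "\<And>c. V \<inter> C c = {A \<in> V. \<phi> A = c}" using lev by metis
  let ?D = "\<Union>c\<in>\<phi> ` V - {\<phi> A}. C c"
  have D: "zariski_closed ?D" using fin C(1) by (intro zariski_closed_UN) auto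
  have "V \<subseteq> C (\<phi> A)"
  proof (rule zariski_connectedD[OF conn C(1) D])
    show "V \<subseteq> C (\<phi> A) \<union> ?D"
    proof
      fix x assume x: "x \<in> V"
      then have "x \<in> C (\<phi> x)" using C(2)[of "\<phi> x"] by blast
      then show "x \<in> C (\<phi> A) \<union> ?D" using x by (cases "\<phi> x = \<phi> A") auto
    qed
    show "C (\<phi> A) \<inter> ?D \<inter> V = {}"
    proof (rule equals0I)
      have *: "\<phi> x = c" if "x \<in> V" "x \<in> C c" for x c using C(2)[of c] that by blast
      fix x assume "x \<in> C (\<phi> A) \<inter> ?D \<inter> V"
      then obtain c where c: "c \<noteq> \<phi> A" "x \<in> C c" "x \<in> C (\<phi> A)" "x \<in> V" by auto
      show False using *[OF c(4,2)] *[OF c(4,3)] c(1) by simp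
    qed
    show "C (\<phi> A) \<inter> V \<noteq> {}" using C(2)[of "\<phi> A"] AB by blast
  qed
  then have "B \<in> V \<inter> C (\<phi> A)" using AB(2) by (simp add: subset_iff)
  then show ?thesis unfolding C(2) by simp
qed

text \<open>For fixed \<open>h\<close> and \<open>a\<close> the map from \<open>b\<close> to
  \<open>h\<close> times the commutator of \<open>a\<close> and \<open>b\<close> is regular and has
  the value \<open>h\<close> at the identity, so a part of a separation that contains
  \<open>h\<close> contains all these products. The part containing the identity thus absorbs all
  words in commutators.\<close>

lemma derived_connected:
  assumes H: "subgroup H (GL :: ('k::field ^ 'n ^ 'n) monoid)" and conn: "zariski_connected H"
  shows "zariski_connected (derived GL H)"
proof -
  have Hc: "a \<in> carrier GL" if "a \<in> H" for a using subgroup.mem_carrier[OF H that] .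
  have D: "subgroup (derived GL H) GL" using GL.derived_is_subgroup[OF subgroup.subset[OF H]] .
  have all: "derived GL H \<subseteq> C" if CD: "zariski_closed C" "zariski_closed D" "derived GL H \<subseteq> C \<union> D"
      "C \<inter> D \<inter> derived GL H = {}" and one: "\<one>\<^bsub>GL\<^esub> \<in> C" for C D
  proof -
    have comm: "h \<otimes>\<^bsub>GL\<^esub> (a \<otimes>\<^bsub>GL\<^esub> b \<otimes>\<^bsub>GL\<^esub> inv\<^bsub>GL\<^esub> a \<otimes>\<^bsub>GL\<^esub> inv\<^bsub>GL\<^esub> b) \<in> C"
      if h: "h \<in> derived GL H" "h \<in> C" and a: "a \<in> H" and b: "b \<in> H" for h a b
    proof -
      define M where "M = (\<lambda>b. h \<otimes>\<^bsub>GL\<^esub> (a \<otimes>\<^bsub>GL\<^esub> b \<otimes>\<^bsub>GL\<^esub> inv\<^bsub>GL\<^esub> a \<otimes>\<^bsub>GL\<^esub> inv\<^bsub>GL\<^esub> b))"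
      have hc: "h \<in> carrier GL" using subgroup.mem_carrier[OF D h(1)] .
      have M: "reg_map M" unfolding M_def by (intro reg_map_mult reg_map_const reg_map_id reg_map_inv)
      have MG: "M b \<in> carrier GL" if "b \<in> carrier GL" for b unfolding M_def using hc Hc[OF a] that by simp
      have MD: "M b \<in> derived GL H" if "b \<in> H" for b
      proof -
        have "a \<otimes>\<^bsub>GL\<^esub> b \<otimes>\<^bsub>GL\<^esub> inv\<^bsub>GL\<^esub> a \<otimes>\<^bsub>GL\<^esub> inv\<^bsub>GL\<^esub> b \<in> derived GL H"
          unfolding derived_def by (rule generate.incl) (use a that in blast)
        then show ?thesis unfolding M_def using subgroup.m_closed[OF D h(1)] by blast
      qed
      have "H \<subseteq> {A \<in> carrier GL. M A \<in> C}"
      proof (rule zariski_connectedD[OF conn zariski_closed_vimage[OF M CD(1) MG] zariski_closed_vimage[OF M CD(2) MG]])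
        show "H \<subseteq> {A \<in> carrier GL. M A \<in> C} \<union> {A \<in> carrier GL. M A \<in> D}" using MD CD(3) Hc by blast
        show "{A \<in> carrier GL. M A \<in> C} \<inter> {A \<in> carrier GL. M A \<in> D} \<inter> H = {}" using MD CD(4) by blast
        have "M \<one>\<^bsub>GL\<^esub> = h" unfolding M_def using hc Hc[OF a] by simp
        then show "{A \<in> carrier GL. M A \<in> C} \<inter> H \<noteq> {}" using h(2) subgroup.one_closed[OF H] by force
      qed
      then show ?thesis using b M_def by blast
    qed
    have "x \<in> derived GL H \<and> (\<forall>h\<in>derived GL H. h \<in> C \<longrightarrow> h \<otimes>\<^bsub>GL\<^esub> x \<in> C)" if "x \<in> derived GL H" for x
      using that unfolding derived_def[of GL H]
    proof (induction rule: generate.induct)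
      case one
      have "h \<otimes>\<^bsub>GL\<^esub> \<one>\<^bsub>GL\<^esub> = h" if "h \<in> derived GL H" for h using subgroup.mem_carrier[OF D that] by simp
      then show ?case using subgroup.one_closed[OF D] unfolding derived_def by auto
    next
      case (incl x)
      then show ?case using comm generate.incl[OF incl] unfolding derived_def by blast
    next
      case (inv x)
      then obtain a b where ab: "a \<in> H" "b \<in> H" "x = a \<otimes>\<^bsub>GL\<^esub> b \<otimes>\<^bsub>GL\<^esub> inv\<^bsub>GL\<^esub> a \<otimes>\<^bsub>GL\<^esub> inv\<^bsub>GL\<^esub> b" by blast
      have "inv\<^bsub>GL\<^esub> x = b \<otimes>\<^bsub>GL\<^esub> a \<otimes>\<^bsub>GL\<^esub> inv\<^bsub>GL\<^esub> b \<otimes>\<^bsub>GL\<^esub> inv\<^bsub>GL\<^esub> a"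
        unfolding ab(3) using Hc[OF ab(1)] Hc[OF ab(2)] by (simp add: GL.inv_mult_group GL.m_assoc)
      then show ?case using comm[OF _ _ ab(2,1)] generate.inv[OF inv, of GL] unfolding derived_def by simp
    next
      case (eng x y)
      have xy: "x \<in> carrier GL" "y \<in> carrier GL" using eng subgroup.mem_carrier[OF D] unfolding derived_def by blast+
      have "h \<otimes>\<^bsub>GL\<^esub> (x \<otimes>\<^bsub>GL\<^esub> y) \<in> C" if h: "h \<in> derived GL H" "h \<in> C" for h
      proof -
        have hc: "h \<in> carrier GL" using subgroup.mem_carrier[OF D h(1)] .
        have "h \<otimes>\<^bsub>GL\<^esub> x \<in> derived GL H" "h \<otimes>\<^bsub>GL\<^esub> x \<in> C"
          using eng h subgroup.m_closed[OF D] unfolding derived_def by blast+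
        then have "(h \<otimes>\<^bsub>GL\<^esub> x) \<otimes>\<^bsub>GL\<^esub> y \<in> C" using eng unfolding derived_def by blast
        then show ?thesis using hc xy by (simp add: GL.m_assoc)
      qed
      then show ?case using generate.eng[OF eng.hyps] unfolding derived_def by blast
    qed
    then show ?thesis using one subgroup.one_closed[OF D] subgroup.mem_carrier[OF D]
      by (metis GL.l_one subsetI)
  qed
  show ?thesis
    unfolding zariski_connected_def
  proof
    assume "\<exists>C D. zariski_closed C \<and> zariski_closed D \<and> derived GL H \<subseteq> C \<union> D \<and>
            C \<inter> D \<inter> derived GL H = {} \<and> C \<inter> derived GL H \<noteq> {} \<and> D \<inter> derived GL H \<noteq> {}"
    then obtain C D where CD: "zariski_closed C" "zariski_closed D" "derived GL H \<subseteq> C \<union> D"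
      "C \<inter> D \<inter> derived GL H = {}" "C \<inter> derived GL H \<noteq> {}" "D \<inter> derived GL H \<noteq> {}" by blast
    have "\<one>\<^bsub>GL\<^esub> \<in> C \<union> D" using CD(3) subgroup.one_closed[OF D] by blast
    then show False
      using all[OF CD(1-4)] all[OF CD(2,1)] CD by blast
  qed
qed

text \<open>A linear map that kills a basis of \<open>Y\<close> and fixes \<open>w\<close> outside
  \<open>Y\<close> has a coordinate that is nonzero at \<open>w\<close>; this coordinate is a linear
  form separating \<open>w\<close> from \<open>Y\<close>.\<close>

lemma subspace_eq_zeros:
  fixes Y :: "('k::field ^ 'n) set"
  assumes Y: "vec.subspace Y"
  shows "\<exists>R :: ('k ^ 'n) set. Y = {w. \<forall>a\<in>R. (\<Sum>i\<in>UNIV. a $ i * w $ i) = 0}"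
proof -
  define R where "R = {a :: 'k ^ 'n. \<forall>y\<in>Y. (\<Sum>i\<in>UNIV. a $ i * y $ i) = 0}"
  obtain D where D: "D \<subseteq> Y" "vec.independent D" "Y \<subseteq> vec.span D" by (rule vec.basis_exists[of Y])
  have sp: "vec.span D = Y" using D(3) vec.span_minimal[OF D(1) Y] by (rule equalityI[rotated])
  have "\<exists>a\<in>R. (\<Sum>i\<in>UNIV. a $ i * w $ i) \<noteq> 0" if w: "w \<notin> Y" for w
  proof -
    have "vec.independent (insert w D)" using w sp D(2) by (intro vec.independent_insertI) simp_all
    then obtain g where g: "Vector_Spaces.linear (*s) (*s) g" "\<forall>x\<in>insert w D. g x = (if x = w then w else 0)"
      using vec.linear_independent_extend[of "insert w D" "\<lambda>x. if x = w then w else 0"] by blast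
    have gw: "g w = w" using g(2) by simp
    have "w \<notin> D" using w D(1) by blast
    then have "g x = 0" if "x \<in> D" for x using g(2) that by auto
    then have gY: "g y = 0" if "y \<in> Y" for y
      using vec.linear_eq_0_on_span[OF g(1), of D y] that sp by simp
    have "w \<noteq> 0" using w vec.subspace_0[OF Y] by auto
    then obtain i where i: "w $ i \<noteq> 0" by (auto simp: Finite_Cartesian_Product.vec_eq_iff)
    define a where "a = (\<chi> j. g (axis j 1) $ i)"
    have ga: "(\<Sum>j\<in>UNIV. a $ j * x $ j) = g x $ i" for x
      using linear_componentwise[OF g(1), of x i] by (simp add: a_def mult.commute)
    have "a \<in> R" unfolding R_def using gY ga by simp
    moreover have "(\<Sum>j\<in>UNIV. a $ j * w $ j) \<noteq> 0" using ga gw i by simp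
    ultimately show ?thesis by blast
  qed
  then have "Y = {w. \<forall>a\<in>R. (\<Sum>i\<in>UNIV. a $ i * w $ i) = 0}" unfolding R_def by blast
  then show ?thesis by blast
qed

text \<open>Provides the closed level sets for eigenvalues modulo a subspace in the Lie--Kolchin
  argument; the condition is linear in the entries of both matrices.\<close>

lemma reg_map_subspace_closed:
  assumes Y: "vec.subspace Y" and M: "reg_map M" and L: "reg_map L"
  shows "zariski_closed {A \<in> carrier GL. M A *v w - c *s (L A *v w) \<in> Y}"
proof -
  obtain R where R: "Y = {w. \<forall>a\<in>R. (\<Sum>i\<in>UNIV. a $ i * w $ i) = 0}" using subspace_eq_zeros[OF Y] by blast
  define \<phi> where "\<phi> a A = (\<Sum>i\<in>UNIV. a $ i * (M A *v w - c *s (L A *v w)) $ i)" for a A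
  have "\<phi> a \<in> reg_functions" for a
  proof -
    have e: "(M A *v w - c *s (L A *v w)) $ i
        = (\<Sum>j\<in>UNIV. M A $ i $ j * w $ j) + (- c) * (\<Sum>j\<in>UNIV. L A $ i $ j * w $ j)" for A i
      by (simp add: matrix_vector_mult_def)
    show ?thesis unfolding \<phi>_def e using M L unfolding reg_map_def
      by (intro reg_sum reg_mult reg_add reg_const) auto
  qed
  then have "zariski_closed {A \<in> carrier GL. \<forall>\<psi>\<in>\<phi> ` R. \<psi> A = 0}" by (intro reg_zero_closed) auto
  moreover have "{A \<in> carrier GL. \<forall>\<psi>\<in>\<phi> ` R. \<psi> A = 0} = {A \<in> carrier GL. M A *v w - c *s (L A *v w) \<in> Y}"
    unfolding R by (auto simp: \<phi>_def)
  ultimately show ?thesis by simp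
qed

subsection \<open>Eigenvectors of matrices of finite order\<close>

definition shift :: "'k::field ^ 'n ^ 'n \<Rightarrow> 'k \<Rightarrow> 'k ^ 'n \<Rightarrow> 'k ^ 'n" where
  "shift A c x = A *v x - c *s x"

lemma shift_linear:
  "shift A c (x + y) = shift A c x + shift A c y" "shift A c (d *s x) = d *s shift A c x"
  "shift A c (x - y) = shift A c x - shift A c y" "shift A c 0 = 0"
  by (simp_all add: shift_def vec.add vec.scale vec.diff vec.scale_right_distrib vec.scale_right_diff_distrib
      vec.scale_left_commute)

text \<open>Horner's scheme for \<open>p(A) x\<close>, carried out on vectors.\<close>

definition poly_act :: "'k::field poly \<Rightarrow> 'k ^ 'n ^ 'n \<Rightarrow> 'k ^ 'n \<Rightarrow> 'k ^ 'n" where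
  "poly_act p A x = fold_coeffs (\<lambda>a y. a *s x + A *v y) p 0"

lemma poly_act_0 [simp]: "poly_act 0 A x = 0"
  by (simp add: poly_act_def)

lemma poly_act_pCons [simp]: "poly_act (pCons a p) A x = a *s x + A *v poly_act p A x"
proof (cases "pCons a p = 0")
  case False
  then show ?thesis by (simp add: poly_act_def fold_coeffs_def cCons_def)
qed simp

lemma poly_act_add: "poly_act (p + q) A x = poly_act p A x + poly_act q A x"
  by (induction p q rule: poly_induct2) (simp_all add: vec.add vec.scale_left_distrib algebra_simps)

lemma poly_act_smult: "poly_act (smult c p) A x = c *s poly_act p A x"
  by (induction p) (simp_all add: vec.scale_right_distrib vec.scale)

lemma poly_act_linear_factor: "poly_act ([:- c, 1:] * p) A x = shift A c (poly_act p A x)"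
proof -
  have "[:- c, 1:] * p = smult (- c) p + pCons 0 p" by simp
  then have "poly_act ([:- c, 1:] * p) A x = (- c) *s poly_act p A x + (0 *s x + A *v poly_act p A x)"
    by (simp only: poly_act_add poly_act_smult poly_act_pCons)
  then show ?thesis by (simp add: shift_def)
qed

lemma poly_act_list: "poly_act (\<Prod>c\<leftarrow>cs. [:- c, 1:]) A x = foldr (shift A) cs x"
proof (induction cs)
  case Nil
  have "poly_act [:1:] A x = x" by (simp only: poly_act_pCons poly_act_0) simp
  then show ?case by (simp add: one_pCons)
next
  case (Cons c cs)
  have "poly_act (\<Prod>c\<leftarrow>c # cs. [:- c, 1:]) A x = poly_act ([:- c, 1:] * (\<Prod>c\<leftarrow>cs. [:- c, 1:])) A x" by simp
  also have "\<dots> = shift A c (foldr (shift A) cs x)" unfolding poly_act_linear_factor Cons ..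
  finally show ?case by simp
qed

lemma poly_act_monom: "A \<in> carrier GL \<Longrightarrow> poly_act (monom 1 n) A x = (A [^]\<^bsub>GL\<^esub> n) *v x"
proof (induction n)
  case 0
  have "poly_act (monom 1 0) A x = 1 *s x + A *v 0" by (simp only: monom_0 poly_act_pCons poly_act_0)
  then show ?case by simp
next
  case (Suc n)
  have "poly_act (monom 1 (Suc n)) A x = 0 *s x + A *v ((A [^]\<^bsub>GL\<^esub> n) *v x)"
    unfolding monom_Suc poly_act_pCons Suc.IH[OF Suc.prems] ..
  then show ?case using GL_pow_act'[OF Suc.prems, of n x] by simp
qed

text \<open>The polynomial \<open>X^N - 1\<close> splits over an algebraically closed field and
  annihilates \<open>A\<close>. If \<open>N\<close> is nonzero in the field, its derivative vanishes
  at most at 0, which is not a root, so the roots are distinct.\<close>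

lemma torsion_annihilated:
  fixes A :: "'k::alg_closed_field ^ 'n ^ 'n"
  assumes A: "A \<in> carrier GL" and N: "N > 0" "A [^]\<^bsub>GL\<^esub> N = \<one>\<^bsub>GL\<^esub>"
  shows "\<exists>cs. (\<forall>x. foldr (shift A) cs x = 0) \<and> (of_nat N \<noteq> (0 :: 'k) \<longrightarrow> distinct cs)"
proof -
  define p :: "'k poly" where "p = monom 1 N + [:- 1:]"
  have dp: "degree p = N" "lead_coeff p = 1"
    unfolding p_def using N(1)
    by (simp_all add: degree_add_eq_left degree_monom_eq coeff_pCons split: nat.split)
  have "p \<noteq> 0" using dp by auto
  then obtain M where M: "p = smult (lead_coeff p) (\<Prod>x\<in>#M. [:- x, 1:])" using alg_closed_imp_factorization by blast
  obtain cs where cs: "M = mset cs" using ex_mset[of M] by blast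
  have p: "p = (\<Prod>c\<leftarrow>cs. [:- c, 1:])" using M dp(2) by (simp add: cs flip: prod_mset_prod_list mset_map)
  have "foldr (shift A) cs x = 0" for x
  proof -
    have "foldr (shift A) cs x = poly_act p A x" unfolding p poly_act_list ..
    also have "\<dots> = x + (- 1) *s x"
      unfolding p_def poly_act_add poly_act_monom[OF A] N(2) GL_one_act poly_act_pCons poly_act_0 by simp
    finally show ?thesis by simp
  qed
  moreover have "distinct cs" if n0: "of_nat N \<noteq> (0 :: 'k)"
  proof (rule ccontr)
    assume "\<not> distinct cs"
    then obtain us vs ws z where "cs = us @ [z] @ vs @ [z] @ ws" using not_distinct_decomp by blast
    then have pz: "p = [:- z, 1:] * ([:- z, 1:] * (\<Prod>c\<leftarrow>us @ vs @ ws. [:- c, 1:]))"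
      unfolding p by (simp only: map_append prod_list.append list.simps prod_list.Cons prod_list.Nil mult_1_left mult_1_right ac_simps)
    have "poly (pderiv p) z = 0" unfolding pz pderiv_mult by (simp add: pderiv_pCons)
    moreover have "pderiv p = monom (of_nat N) (N - 1)"
      unfolding p_def by (simp add: pderiv_add pderiv_monom pderiv_pCons)
    ultimately have "z = 0" using n0 by (auto simp: poly_monom)
    moreover have "poly p z = 0" unfolding pz by simp
    ultimately show False using N(1) by (simp add: p_def poly_monom power_0_left)
  qed
  ultimately show ?thesis by blast
qed

text \<open>Applying the factors \<open>A - c\<close> one after another leads from a vector outside
  \<open>V\<close> to 0; the last vector still outside \<open>V\<close> is the one wanted.\<close>

lemma eigenvector_mod_subspace:
  fixes A :: "'k::alg_closed_field ^ 'n ^ 'n" and N :: nat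
  assumes A: "A \<in> carrier GL" and N: "N > 0" "A [^]\<^bsub>GL\<^esub> N = \<one>\<^bsub>GL\<^esub>"
    and Y: "vec.subspace Y" "\<And>y. y \<in> Y \<Longrightarrow> A *v y \<in> Y"
    and V: "vec.subspace V" "V \<subseteq> Y" "V \<noteq> Y"
  shows "\<exists>w c. w \<in> Y \<and> w \<notin> V \<and> A *v w - c *s w \<in> V"
proof -
  obtain cs where cs: "\<And>x. foldr (shift A) cs x = 0" using torsion_annihilated[OF A N] by blast
  obtain y where y: "y \<in> Y" "y \<notin> V" using V by blast
  have "foldr (shift A) ds y \<in> V \<Longrightarrow> \<exists>w c. w \<in> Y \<and> w \<notin> V \<and> A *v w - c *s w \<in> V" for ds
  proof (induction ds)
    case Nil
    then show ?case using y by simp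
  next
    case (Cons d ds)
    have fY: "foldr (shift A) es y \<in> Y" for es
      by (induction es) (use y Y in \<open>auto simp: shift_def intro!: vec.subspace_diff vec.subspace_scale\<close>)
    show ?case
    proof (cases "foldr (shift A) ds y \<in> V")
      case True
      then show ?thesis by (rule Cons.IH)
    next
      case False
      have "shift A d (foldr (shift A) ds y) \<in> V" using Cons.prems by simp
      then show ?thesis using fY[of ds] False unfolding shift_def[of A d] by blast
    qed
  qed
  then show ?thesis using cs vec.subspace_0[OF V(1)] by metis
qed

lemma torsion_eigenvalue:
  fixes A :: "'k::field ^ 'n ^ 'n" and N :: nat
  assumes A: "A \<in> carrier GL" "A [^]\<^bsub>GL\<^esub> N = \<one>\<^bsub>GL\<^esub>"
    and V: "vec.subspace V" "\<And>v. v \<in> V \<Longrightarrow> A *v v \<in> V"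
    and w: "w \<notin> V" "A *v w - c *s w \<in> V"
  shows "c ^ N = 1"
proof -
  have "(A [^]\<^bsub>GL\<^esub> n) *v w - c ^ n *s w \<in> V" for n :: nat
  proof (induction n)
    case 0
    then show ?case using vec.subspace_0[OF V(1)] by simp
  next
    case (Suc n)
    have "(A [^]\<^bsub>GL\<^esub> Suc n) *v w - c ^ Suc n *s w
        = A *v ((A [^]\<^bsub>GL\<^esub> n) *v w - c ^ n *s w) + c ^ n *s (A *v w - c *s w)"
      unfolding GL_pow_act'[OF A(1)]
      by (simp add: vec.diff vec.scale vec.scale_right_diff_distrib vec.scale_scale mult.commute)
    then show ?case using V(2)[OF Suc] vec.subspace_scale[OF V(1) w(2)] vec.subspace_add[OF V(1)] by simp
  qed
  from this[of N] have "(1 - c ^ N) *s w \<in> V" using A(2) by (simp add: vec.scale_left_diff_distrib)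
  then have "1 - c ^ N = 0" using w(1) vec.subspace_scale[OF V(1), of "(1 - c ^ N) *s w" "inverse (1 - c ^ N)"]
    by (cases "1 - c ^ N = 0") (simp_all add: vec.scale_scale)
  then show ?thesis by simp
qed

lemma finite_roots_of_unity: "N > 0 \<Longrightarrow> finite {c :: 'k::field. c ^ N = 1}"
proof -
  assume N: "N > 0"
  have "monom 1 N + [:- 1:] \<noteq> (0 :: 'k poly)"
    using N degree_add_eq_left[of "[:- 1:]" "monom (1::'k) N"] by (auto simp: degree_monom_eq)
  then have "finite {c :: 'k. poly (monom 1 N + [:- 1:]) c = 0}" by (rule poly_roots_finite)
  then show ?thesis by (simp add: poly_monom)
qed

text \<open>For \<open>c\<close> outside a list of eigenvalues, \<open>A - c\<close> maps the span
  of their eigenvectors onto itself. So \<open>x\<close> can be corrected by an element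
  \<open>z\<close> of that span until \<open>A - c\<close> kills the difference, which is then an
  eigenvector for \<open>c\<close>.\<close>

lemma semisimple_span_eigenvectors:
  fixes A :: "'k::alg_closed_field ^ 'n ^ 'n"
  assumes A: "A \<in> carrier GL" and N: "N > 0" "A [^]\<^bsub>GL\<^esub> N = \<one>\<^bsub>GL\<^esub>" "of_nat N \<noteq> (0 :: 'k)"
    and Y: "vec.subspace Y" "\<And>y. y \<in> Y \<Longrightarrow> A *v y \<in> Y"
  shows "Y \<subseteq> vec.span {v \<in> Y. \<exists>c. A *v v = c *s v}"
proof -
  let ?S = "\<lambda>cs. {v \<in> Y. \<exists>c\<in>set cs. A *v v = c *s v}"
  have shY: "shift A c x \<in> Y" if "x \<in> Y" for x c
    using that Y by (auto simp: shift_def intro!: vec.subspace_diff vec.subspace_scale)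
  have solve: "\<exists>z\<in>vec.span (?S cs). shift A c z = y" if c: "c \<notin> set cs" and y: "y \<in> vec.span (?S cs)" for c cs y
  proof -
    have "vec.subspace {y. \<exists>z\<in>vec.span (?S cs). shift A c z = y}"
    proof (rule vec.subspaceI)
      show "0 \<in> {y. \<exists>z\<in>vec.span (?S cs). shift A c z = y}" using vec.span_zero shift_linear(4) by blast
      show "x + y \<in> {y. \<exists>z\<in>vec.span (?S cs). shift A c z = y}"
        if "x \<in> {y. \<exists>z\<in>vec.span (?S cs). shift A c z = y}" "y \<in> {y. \<exists>z\<in>vec.span (?S cs). shift A c z = y}" for x y
        using that vec.span_add shift_linear(1) by (smt (verit) mem_Collect_eq)
      show "d *s x \<in> {y. \<exists>z\<in>vec.span (?S cs). shift A c z = y}"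
        if "x \<in> {y. \<exists>z\<in>vec.span (?S cs). shift A c z = y}" for x d
        using that vec.span_scale shift_linear(2) by (smt (verit) mem_Collect_eq)
    qed
    moreover have "\<exists>z\<in>vec.span (?S cs). shift A c z = x" if x: "x \<in> ?S cs" for x
    proof -
      obtain e where e: "e \<in> set cs" "A *v x = e *s x" using x by blast
      then have ec: "e - c \<noteq> 0" using c by auto
      have "shift A c (inverse (e - c) *s x) = inverse (e - c) *s ((e - c) *s x)"
        unfolding shift_linear(2) by (simp add: shift_def e(2) vec.scale_left_diff_distrib)
      then have "shift A c (inverse (e - c) *s x) = x" using ec by (simp add: vec.scale_scale)
      then show ?thesis using vec.span_scale[OF vec.span_base[OF x]] by blast
    qed
    ultimately show ?thesis using vec.span_induct[OF y, of "\<lambda>y. \<exists>z\<in>vec.span (?S cs). shift A c z = y"] by blast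
  qed
  have main: "distinct cs \<Longrightarrow> x \<in> Y \<Longrightarrow> foldr (shift A) cs x = 0 \<Longrightarrow> x \<in> vec.span (?S cs)" for cs x
  proof (induction cs arbitrary: x rule: rev_induct)
    case Nil
    then show ?case using vec.span_zero by simp
  next
    case (snoc c cs)
    have "foldr (shift A) cs (shift A c x) = 0" using snoc.prems(3) by simp
    then have "shift A c x \<in> vec.span (?S cs)" using snoc.IH[OF _ shY] snoc.prems by simp
    then obtain z where z: "z \<in> vec.span (?S cs)" "shift A c z = shift A c x"
      using solve[of c cs] snoc.prems(1) by auto
    have "z \<in> Y" using z(1) vec.span_minimal[OF _ Y(1), of "?S cs"] by blast
    then have "x - z \<in> Y" using snoc.prems(2) Y(1) by (intro vec.subspace_diff)
    moreover have "shift A c (x - z) = 0" unfolding shift_linear(3) using z(2) by simp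
    then have "A *v (x - z) = c *s (x - z)" by (simp add: shift_def)
    ultimately have "x - z \<in> ?S (cs @ [c])" by auto
    then have "x - z \<in> vec.span (?S (cs @ [c]))" by (rule vec.span_base)
    moreover have "z \<in> vec.span (?S (cs @ [c]))" using z(1) vec.span_mono[of "?S cs" "?S (cs @ [c])"] by auto
    ultimately have "(x - z) + z \<in> vec.span (?S (cs @ [c]))" by (rule vec.span_add)
    then show ?case by simp
  qed
  obtain cs where cs: "\<And>x. foldr (shift A) cs x = 0" "distinct cs" using torsion_annihilated[OF A N(1,2)] N(3) by blast
  have "?S cs \<subseteq> {v \<in> Y. \<exists>c. A *v v = c *s v}" by blast
  then have "vec.span (?S cs) \<subseteq> vec.span {v \<in> Y. \<exists>c. A *v v = c *s v}" by (rule vec.span_mono)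
  then show ?thesis using main[OF cs(2) _ cs(1)] by blast
qed

definition stable :: "('k::field ^ 'n ^ 'n) set \<Rightarrow> ('k ^ 'n) set \<Rightarrow> bool" where
  "stable H Y \<longleftrightarrow> vec.subspace Y \<and> (\<forall>h\<in>H. \<forall>y\<in>Y. h *v y \<in> Y)"

text \<open>Elements of order prime to the characteristic.\<close>

definition ss_elem :: "'k::field ^ 'n ^ 'n \<Rightarrow> bool" where
  "ss_elem A \<longleftrightarrow> A \<in> carrier GL \<and> (\<exists>N::nat. N > 0 \<and> A [^]\<^bsub>GL\<^esub> N = \<one>\<^bsub>GL\<^esub> \<and> of_nat N \<noteq> (0 :: 'k))"

text \<open>Induction on the dimension: an element of \<open>D\<close> that is not scalar on
  \<open>Y\<close> has proper eigenspaces, which the other elements preserve by commutativity and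
  which together span \<open>Y\<close>.\<close>

lemma commuting_semisimple_span:
  fixes D :: "('k::alg_closed_field ^ 'n ^ 'n) set"
  assumes D: "\<And>d. d \<in> D \<Longrightarrow> ss_elem d" and comm: "\<And>d e. d \<in> D \<Longrightarrow> e \<in> D \<Longrightarrow> d ** e = e ** d"
  shows "stable D Y \<Longrightarrow> Y \<subseteq> vec.span {v \<in> Y. \<forall>d\<in>D. \<exists>c. d *v v = c *s v}"
proof (induction "vec.dim Y" arbitrary: Y rule: less_induct)
  case less
  have Y: "vec.subspace Y" and st: "\<And>d y. d \<in> D \<Longrightarrow> y \<in> Y \<Longrightarrow> d *v y \<in> Y"
    using less.prems unfolding stable_def by blast+
  let ?E = "\<lambda>Y. {v \<in> Y. \<forall>d\<in>D. \<exists>c. d *v v = c *s v}"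
  show ?case
  proof (cases "\<forall>d\<in>D. \<exists>c. \<forall>y\<in>Y. d *v y = c *s y")
    case True
    then have "?E Y = Y" by blast
    then show ?thesis using vec.span_superset[of Y] by simp
  next
    case False
    then obtain d where d: "d \<in> D" "\<And>c. \<exists>y\<in>Y. d *v y \<noteq> c *s y" by blast
    obtain N :: nat where N: "d \<in> carrier GL" "N > 0" "d [^]\<^bsub>GL\<^esub> N = \<one>\<^bsub>GL\<^esub>" "of_nat N \<noteq> (0 :: 'k)"
      using D[OF d(1)] unfolding ss_elem_def by blast
    have "{v \<in> Y. \<exists>c. d *v v = c *s v} \<subseteq> vec.span (?E Y)"
    proof
      fix v assume "v \<in> {v \<in> Y. \<exists>c. d *v v = c *s v}"
      then obtain c where v: "v \<in> Y" "d *v v = c *s v" by blast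
      define Z where "Z = {y \<in> Y. d *v y = c *s y}"
      have Zsub: "vec.subspace Z" unfolding Z_def
        by (rule vec.subspaceI)
          (use Y in \<open>auto simp: vec.subspace_0 vec.subspace_add vec.subspace_scale vec.add vec.scale vec.scale_right_distrib mult.commute vec.scale_left_commute\<close>)
      have "e *v y \<in> Z" if e: "e \<in> D" and y: "y \<in> Z" for e y
      proof -
        have "d *v (e *v y) = e *v (d *v y)" using comm[OF d(1) e] by (simp add: matrix_vector_mul_assoc)
        then show ?thesis using y st[OF e] unfolding Z_def by (simp add: vec.scale)
      qed
      then have Zst: "stable D Z" using Zsub unfolding stable_def by blast
      have "Z \<noteq> Y" using d(2)[of c] unfolding Z_def by blast
      moreover have ZY: "Z \<subseteq> Y" unfolding Z_def by blast
      ultimately have "vec.dim Z < vec.dim Y"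
        using vec.subspace_dim_equal[OF Zsub Y ZY] by linarith
      then have "Z \<subseteq> vec.span (?E Z)" using less.hyps Zst by blast
      moreover have "vec.span (?E Z) \<subseteq> vec.span (?E Y)" using ZY by (intro vec.span_mono) blast
      ultimately show "v \<in> vec.span (?E Y)" using v unfolding Z_def by blast
    qed
    then have "vec.span {v \<in> Y. \<exists>c. d *v v = c *s v} \<subseteq> vec.span (?E Y)" by (rule vec.span_minimal) (rule vec.subspace_span)
    then show ?thesis using semisimple_span_eigenvectors[OF N Y st[OF d(1)]] by blast
  qed
qed

subsection \<open>The Lie--Kolchin theorem for torsion groups\<close>

lemma stable_inv:
  assumes H: "subgroup H GL" and Y: "stable H Y" and h: "h \<in> H" and y: "h *v y \<in> Y"
  shows "y \<in> Y"
proof -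
  have "(inv\<^bsub>GL\<^esub> h) *v (h *v y) \<in> Y" using Y y subgroup.m_inv_closed[OF H h] unfolding stable_def by blast
  then show ?thesis using subgroup.mem_carrier[OF H h] by simp
qed

text \<open>Stated for a pair \<open>V\<close> inside \<open>Y\<close> in place of a quotient space,
  so that flags can be built vector by vector. Induction on the derived length: the derived group
  has an eigenvector modulo \<open>V\<close> in a minimal stable \<open>Z\<close>, and connectedness
  is used twice, each time because an eigenvalue of a torsion element takes only finitely many
  values.\<close>

lemma lie_kolchin_section:
  fixes H :: "('k::alg_closed_field ^ 'n ^ 'n) set"
  assumes "subgroup H GL" "zariski_connected H" "(derived GL ^^ d) H = {\<one>\<^bsub>GL\<^esub>}"
    and "\<And>h. h \<in> H \<Longrightarrow> \<exists>N::nat. N > 0 \<and> h [^]\<^bsub>GL\<^esub> N = \<one>\<^bsub>GL\<^esub>"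
    and "stable H V" "stable H Y" "V \<subseteq> Y" "V \<noteq> Y"
  shows "\<exists>v. v \<in> Y \<and> v \<notin> V \<and> (\<forall>h\<in>H. \<exists>c. h *v v - c *s v \<in> V)"
  using assms
proof (induction d arbitrary: H V Y)
  case 0
  have V0: "0 \<in> V" using "0.prems"(5) vec.subspace_0 unfolding stable_def by blast
  obtain v where "v \<in> Y" "v \<notin> V" using "0.prems" by blast
  moreover have "h *v v - 1 *s v \<in> V" if "h \<in> H" for h using that "0.prems"(3) V0 by simp
  ultimately show ?case by blast
next
  case (Suc d)
  note H = Suc.prems(1) and conn = Suc.prems(2) and tor = Suc.prems(4) and stV = Suc.prems(5)
  have Hc: "a \<in> carrier GL" if "a \<in> H" for a using subgroup.mem_carrier[OF H that] .
  have Vs: "vec.subspace V" and VH: "\<And>h y. h \<in> H \<Longrightarrow> y \<in> V \<Longrightarrow> h *v y \<in> V"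
    using stV unfolding stable_def by blast+
  let ?good = "\<lambda>Z. stable H Z \<and> V \<subseteq> Z \<and> V \<noteq> Z \<and> Z \<subseteq> Y"
  \<comment> \<open>A stable space strictly above \<open>V\<close>, of least dimension. Every stable
    subspace of it that is strictly above \<open>V\<close> equals \<open>Z\<close>, so each weight
    space found below is all of \<open>Z\<close>.\<close>
  obtain Z where Z: "?good Z" and Zmin: "\<And>Z'. ?good Z' \<Longrightarrow> vec.dim Z \<le> vec.dim Z'"
    using ex_has_least_nat[of ?good Y vec.dim] Suc.prems by blast
  have Zs: "vec.subspace Z" and ZH: "\<And>h y. h \<in> H \<Longrightarrow> y \<in> Z \<Longrightarrow> h *v y \<in> Z"
    using Z unfolding stable_def by blast+
  have minimal: "Z' = Z" if "stable H Z'" "V \<subseteq> Z'" "Z' \<subseteq> Z" "V \<noteq> Z'" for Z'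
  proof -
    have "vec.subspace Z'" using that(1) unfolding stable_def by blast
    then show ?thesis using vec.subspace_dim_equal[of Z' Z] Zs that Zmin[of Z'] Z by blast
  qed
  let ?D = "derived GL H"
  have DH: "?D \<subseteq> H" using GL.derived_incl[OF subset_refl H] .
  have Dsub: "subgroup ?D GL" using GL.derived_is_subgroup[OF subgroup.subset[OF H]] .
  have inD: "a \<otimes>\<^bsub>GL\<^esub> b \<otimes>\<^bsub>GL\<^esub> inv\<^bsub>GL\<^esub> a \<otimes>\<^bsub>GL\<^esub> inv\<^bsub>GL\<^esub> b \<in> ?D" if "a \<in> H" "b \<in> H" for a b
    unfolding derived_def by (rule generate.incl) (use that in blast)
  have "\<exists>v. v \<in> Z \<and> v \<notin> V \<and> (\<forall>h\<in>?D. \<exists>c. h *v v - c *s v \<in> V)"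
  proof (rule Suc.IH[OF Dsub derived_connected[OF H conn]])
    show "(derived GL ^^ d) ?D = {\<one>\<^bsub>GL\<^esub>}" using Suc.prems(3) by (simp add: funpow_swap1)
    show "\<exists>N::nat. N > 0 \<and> h [^]\<^bsub>GL\<^esub> N = \<one>\<^bsub>GL\<^esub>" if "h \<in> ?D" for h using tor that DH by blast
    show "stable ?D V" "stable ?D Z" using stV Z DH unfolding stable_def by blast+
    show "V \<subseteq> Z" "V \<noteq> Z" using Z by blast+
  qed
  then obtain v where v: "v \<in> Z" "v \<notin> V" "\<And>h. h \<in> ?D \<Longrightarrow> \<exists>c. h *v v - c *s v \<in> V" by blast
  then obtain \<chi>' where chi: "\<And>h. h \<in> ?D \<Longrightarrow> h *v v - \<chi>' h *s v \<in> V" by metis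
  have uniq: "c = e" if "x - c *s y \<in> V" "x - e *s y \<in> V" "y \<notin> V" for c e x y
  proof (rule ccontr)
    assume ne: "c \<noteq> e"
    have "(x - e *s y) - (x - c *s y) \<in> V" using vec.subspace_diff[OF Vs that(2,1)] .
    then have "(c - e) *s y \<in> V" by (simp add: vec.scale_left_diff_distrib)
    then have "inverse (c - e) *s ((c - e) *s y) \<in> V" by (rule vec.subspace_scale[OF Vs])
    then show False using ne that(3) by (simp add: vec.scale_scale)
  qed
  have notV: "h *v y \<notin> V" if "h \<in> H" "y \<notin> V" for h y
    using stable_inv[OF H stV that(1)] that(2) by blast
  have conj: "h *v (g *v v) - \<chi>' (inv\<^bsub>GL\<^esub> g \<otimes>\<^bsub>GL\<^esub> h \<otimes>\<^bsub>GL\<^esub> g) *s (g *v v) \<in> V \<and> inv\<^bsub>GL\<^esub> g \<otimes>\<^bsub>GL\<^esub> h \<otimes>\<^bsub>GL\<^esub> g \<in> ?D"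
    if g: "g \<in> H" and h: "h \<in> ?D" for g h
  proof -
    have gc: "g \<in> carrier GL" "h \<in> carrier GL" "inv\<^bsub>GL\<^esub> g \<in> H"
      using g h Hc DH subgroup.m_inv_closed[OF H g] by auto
    have eq: "inv\<^bsub>GL\<^esub> g \<otimes>\<^bsub>GL\<^esub> h \<otimes>\<^bsub>GL\<^esub> g = (inv\<^bsub>GL\<^esub> g \<otimes>\<^bsub>GL\<^esub> h \<otimes>\<^bsub>GL\<^esub> inv\<^bsub>GL\<^esub> (inv\<^bsub>GL\<^esub> g) \<otimes>\<^bsub>GL\<^esub> inv\<^bsub>GL\<^esub> h) \<otimes>\<^bsub>GL\<^esub> h"
      using gc by (simp add: GL.m_assoc)
    have D: "inv\<^bsub>GL\<^esub> g \<otimes>\<^bsub>GL\<^esub> h \<otimes>\<^bsub>GL\<^esub> g \<in> ?D"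
      unfolding eq using subgroup.m_closed[OF Dsub inD[OF gc(3)] h] h DH by blast
    have "(inv\<^bsub>GL\<^esub> g \<otimes>\<^bsub>GL\<^esub> h \<otimes>\<^bsub>GL\<^esub> g) *v v - \<chi>' (inv\<^bsub>GL\<^esub> g \<otimes>\<^bsub>GL\<^esub> h \<otimes>\<^bsub>GL\<^esub> g) *s v \<in> V" using chi[OF D] .
    then have "g *v ((inv\<^bsub>GL\<^esub> g \<otimes>\<^bsub>GL\<^esub> h \<otimes>\<^bsub>GL\<^esub> g) *v v - \<chi>' (inv\<^bsub>GL\<^esub> g \<otimes>\<^bsub>GL\<^esub> h \<otimes>\<^bsub>GL\<^esub> g) *s v) \<in> V" by (rule VH[OF g])
    then show ?thesis using D gc by (simp add: vec.diff vec.scale GL_act)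
  qed
  \<comment> \<open>The value of the character at a conjugate of \<open>h\<close> is an
    \<open>N\<close>-th root of unity, hence constant on the connected group
    \<open>H\<close>.\<close>
  have chi_conj: "\<chi>' (inv\<^bsub>GL\<^esub> g \<otimes>\<^bsub>GL\<^esub> h \<otimes>\<^bsub>GL\<^esub> g) = \<chi>' h" if g: "g \<in> H" and h: "h \<in> ?D" for g h
  proof -
    have hH: "h \<in> H" using h DH by blast
    obtain N :: nat where N: "N > 0" "h [^]\<^bsub>GL\<^esub> N = \<one>\<^bsub>GL\<^esub>" using tor[OF hH] by blast
    define \<phi> where "\<phi> g = \<chi>' (inv\<^bsub>GL\<^esub> g \<otimes>\<^bsub>GL\<^esub> h \<otimes>\<^bsub>GL\<^esub> g)" for g
    have "\<phi> g = \<phi> \<one>\<^bsub>GL\<^esub>"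
    proof (rule zariski_connected_finite_image_const[OF conn _ _ g subgroup.one_closed[OF H]])
      have "\<phi> a ^ N = 1" if "a \<in> H" for a
        using torsion_eigenvalue[OF Hc[OF hH] N(2) Vs VH[OF hH] notV[OF that v(2)]] conj[OF that h] unfolding \<phi>_def by blast
      then have "\<phi> ` H \<subseteq> {c. c ^ N = 1}" by blast
      then show "finite (\<phi> ` H)" using finite_roots_of_unity[OF N(1)] finite_subset by blast
      fix c
      let ?C = "{A \<in> carrier GL. (h \<otimes>\<^bsub>GL\<^esub> A) *v v - c *s (A *v v) \<in> V}"
      have "zariski_closed ?C" by (rule reg_map_subspace_closed[OF Vs reg_map_mult[OF reg_map_const reg_map_id] reg_map_id])
      moreover have "H \<inter> ?C = {A \<in> H. \<phi> A = c}"
      proof (intro equalityI subsetI)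
        fix A assume A: "A \<in> H \<inter> ?C"
        then have "h *v (A *v v) - c *s (A *v v) \<in> V" by (simp add: GL_act)
        then have "\<phi> A = c" using uniq[OF _ _ notV[OF _ v(2)]] conj[OF _ h, of A] A unfolding \<phi>_def by blast
        then show "A \<in> {A \<in> H. \<phi> A = c}" using A by blast
      next
        fix A assume A: "A \<in> {A \<in> H. \<phi> A = c}"
        then have "h *v (A *v v) - c *s (A *v v) \<in> V" using conj[OF _ h, of A] unfolding \<phi>_def by auto
        then show "A \<in> H \<inter> ?C" using A Hc by (simp add: GL_act)
      qed
      ultimately show "\<exists>C. zariski_closed C \<and> H \<inter> C = {A \<in> H. \<phi> A = c}" by blast
    qed
    then show ?thesis unfolding \<phi>_def using Hc[OF hH] by simp
  qed
  define Zc where "Zc = {y \<in> Z. \<forall>h\<in>?D. h *v y - \<chi>' h *s y \<in> V}"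
  \<comment> \<open>As the character is invariant under conjugation, its weight space is stable
    under \<open>H\<close>, and minimality of \<open>Z\<close> makes it everything.\<close>
  have scal: "h *v y - \<chi>' h *s y \<in> V" if h: "h \<in> ?D" and y: "y \<in> Z" for h y
  proof -
    have lin: "h *v (x + y) - c *s (x + y) = (h *v x - c *s x) + (h *v y - c *s y)"
      "h *v (e *s x) - c *s (e *s x) = e *s (h *v x - c *s x)" for h :: "'k ^ 'n ^ 'n" and x y c e
      by (simp_all add: vec.add vec.scale vec.scale_right_distrib vec.scale_right_diff_distrib vec.scale_left_commute)
    have "Zc = Z"
    proof (rule minimal)
      have "vec.subspace Zc"
      proof (rule vec.subspaceI)
        show "0 \<in> Zc" unfolding Zc_def using vec.subspace_0[OF Zs] vec.subspace_0[OF Vs] by simp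
        show "x + y \<in> Zc" if "x \<in> Zc" "y \<in> Zc" for x y
          using that vec.subspace_add[OF Zs] vec.subspace_add[OF Vs] unfolding Zc_def lin(1) mem_Collect_eq lin by blast
        show "e *s x \<in> Zc" if "x \<in> Zc" for x e
          using that vec.subspace_scale[OF Zs] vec.subspace_scale[OF Vs] unfolding Zc_def mem_Collect_eq lin by blast
      qed
      moreover have "g *v y \<in> Zc" if g: "g \<in> H" and y: "y \<in> Zc" for g y
      proof -
        have "h *v (g *v y) - \<chi>' h *s (g *v y) \<in> V" if h: "h \<in> ?D" for h
        proof -
          let ?k = "inv\<^bsub>GL\<^esub> g \<otimes>\<^bsub>GL\<^esub> h \<otimes>\<^bsub>GL\<^esub> g"
          have "?k *v y - \<chi>' ?k *s y \<in> V" using y conj[OF g h] unfolding Zc_def by blast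
          then have "g *v (?k *v y - \<chi>' h *s y) \<in> V" unfolding chi_conj[OF g h] by (rule VH[OF g])
          moreover have "h \<in> carrier GL" using h DH Hc by blast
          ultimately show ?thesis using Hc[OF g] by (simp add: vec.diff vec.scale GL_act)
        qed
        then show ?thesis using ZH[OF g] y unfolding Zc_def by blast
      qed
      ultimately show "stable H Zc" unfolding stable_def by blast
      show "V \<subseteq> Zc"
      proof
        fix y assume y: "y \<in> V"
        then have "h *v y - \<chi>' h *s y \<in> V" if "h \<in> ?D" for h
          using VH[of h y] that DH vec.subspace_scale[OF Vs y] vec.subspace_diff[OF Vs] by blast
        then show "y \<in> Zc" using y Z unfolding Zc_def by blast
      qed
      show "Zc \<subseteq> Z" unfolding Zc_def by blast
      show "V \<noteq> Zc" using v chi unfolding Zc_def by blast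
    qed
    then show ?thesis using h y unfolding Zc_def by blast
  qed
  define cm where "cm a b = a \<otimes>\<^bsub>GL\<^esub> b \<otimes>\<^bsub>GL\<^esub> inv\<^bsub>GL\<^esub> a \<otimes>\<^bsub>GL\<^esub> inv\<^bsub>GL\<^esub> b" for a b :: "'k ^ 'n ^ 'n"
  have cmD: "cm a b \<in> ?D" if "a \<in> H" "b \<in> H" for a b unfolding cm_def using inD that .
  have cmact: "cm a b *v (b *v (a *v w)) = a *v (b *v w)" if "a \<in> H" "b \<in> H" for a b w
    unfolding cm_def using Hc that by (simp add: GL_act)
  have swap: "a *v (b *v w) - \<chi>' (cm a b) *s (b *v (a *v w)) \<in> V" if "a \<in> H" "b \<in> H" "w \<in> Z" for a b w
    using scal[OF cmD[OF that(1,2)], of "b *v (a *v w)"] cmact[OF that(1,2)] ZH that by simp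
  \<comment> \<open>Commutators act on \<open>Z\<close> modulo \<open>V\<close> by scalars. For an
    eigenvector \<open>w\<close> of \<open>a\<close> with eigenvalue \<open>e\<close>, the image of
    \<open>w\<close> under \<open>b\<close> is one with eigenvalue
    \<open>\<chi>' (cm a b) * e\<close>, again an \<open>N\<close>-th root of unity; so the scalar
    is constant in \<open>b\<close> and equals its value 1 at the identity.\<close>
  have cm1: "\<chi>' (cm a b) = 1" if a: "a \<in> H" and b: "b \<in> H" for a b
  proof -
    obtain N :: nat where N: "N > 0" "a [^]\<^bsub>GL\<^esub> N = \<one>\<^bsub>GL\<^esub>" using tor[OF a] by blast
    obtain w e where w: "w \<in> Z" "w \<notin> V" "a *v w - e *s w \<in> V"
      using eigenvector_mod_subspace[OF Hc[OF a] N Zs ZH[OF a] Vs] Z by blast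
    have "e ^ N = 1" by (rule torsion_eigenvalue[OF Hc[OF a] N(2) Vs VH[OF a] w(2,3)])
    then have e0: "e \<noteq> 0" using N(1) by (auto simp: power_0_left)
    define \<phi> where "\<phi> b = \<chi>' (cm a b)" for b
    have baV: "b *v (a *v w) \<notin> V" if "b \<in> H" for b using notV[OF that notV[OF a w(2)]] .
    have "\<phi> b = \<phi> \<one>\<^bsub>GL\<^esub>"
    proof (rule zariski_connected_finite_image_const[OF conn _ _ b subgroup.one_closed[OF H]])
      have "\<phi> b \<in> (\<lambda>c. c * inverse e) ` {c. c ^ N = 1}" if b: "b \<in> H" for b
      proof -
        have "b *v (a *v w - e *s w) \<in> V" by (rule VH[OF b w(3)])
        then have "\<phi> b *s (b *v (a *v w - e *s w)) \<in> V" by (rule vec.subspace_scale[OF Vs])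
        with swap[OF a b w(1)] have "(a *v (b *v w) - \<phi> b *s (b *v (a *v w))) + \<phi> b *s (b *v (a *v w - e *s w)) \<in> V"
          unfolding \<phi>_def by (rule vec.subspace_add[OF Vs])
        then have "a *v (b *v w) - (\<phi> b * e) *s (b *v w) \<in> V"
          by (simp add: vec.diff vec.scale vec.scale_right_diff_distrib vec.scale_scale)
        then have "(\<phi> b * e) ^ N = 1"
          using torsion_eigenvalue[OF Hc[OF a] N(2) Vs VH[OF a] notV[OF b w(2)]] by blast
        moreover have "\<phi> b = (\<phi> b * e) * inverse e" using e0 by simp
        ultimately show ?thesis by blast
      qed
      then have "\<phi> ` H \<subseteq> (\<lambda>c. c * inverse e) ` {c. c ^ N = 1}" by blast
      then show "finite (\<phi> ` H)" using finite_roots_of_unity[OF N(1)] finite_subset by blast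
      fix c
      let ?C = "{A \<in> carrier GL. (a \<otimes>\<^bsub>GL\<^esub> A) *v w - c *s ((A \<otimes>\<^bsub>GL\<^esub> a) *v w) \<in> V}"
      have "zariski_closed ?C"
        by (rule reg_map_subspace_closed[OF Vs reg_map_mult[OF reg_map_const reg_map_id] reg_map_mult[OF reg_map_id reg_map_const]])
      moreover have "H \<inter> ?C = {A \<in> H. \<phi> A = c}"
      proof (intro equalityI subsetI)
        fix A assume A: "A \<in> H \<inter> ?C"
        then have "a *v (A *v w) - c *s (A *v (a *v w)) \<in> V" by (simp add: GL_act)
        then have "\<phi> A = c" using uniq[OF _ _ baV] swap[OF a _ w(1), of A] A unfolding \<phi>_def by blast
        then show "A \<in> {A \<in> H. \<phi> A = c}" using A by blast
      next
        fix A assume A: "A \<in> {A \<in> H. \<phi> A = c}"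
        then have "a *v (A *v w) - c *s (A *v (a *v w)) \<in> V" using swap[OF a _ w(1), of A] unfolding \<phi>_def by auto
        then show "A \<in> H \<inter> ?C" using A Hc by (simp add: GL_act)
      qed
      ultimately show "\<exists>C. zariski_closed C \<and> H \<inter> C = {A \<in> H. \<phi> A = c}" by blast
    qed
    also have "\<phi> \<one>\<^bsub>GL\<^esub> = 1"
    proof (rule uniq)
      show "a *v w - \<phi> \<one>\<^bsub>GL\<^esub> *s (a *v w) \<in> V"
        using swap[OF a subgroup.one_closed[OF H] w(1)] unfolding \<phi>_def by simp
      show "a *v w - 1 *s (a *v w) \<in> V" using vec.subspace_0[OF Vs] by simp
      show "a *v w \<notin> V" by (rule notV[OF a w(2)])
    qed
    finally show ?thesis unfolding \<phi>_def .
  qed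
  have comm: "a *v (b *v w) - b *v (a *v w) \<in> V" if "a \<in> H" "b \<in> H" "w \<in> Z" for a b w
    using swap[OF that] cm1[OF that(1,2)] by simp
  \<comment> \<open>Now \<open>H\<close> is commutative on \<open>Z\<close> modulo \<open>V\<close>,
    so an eigenspace of \<open>a\<close> is stable under \<open>H\<close> and again equals
    \<open>Z\<close>.\<close>
  have "\<exists>c. a *v v - c *s v \<in> V" if a: "a \<in> H" for a
  proof -
    obtain N :: nat where N: "N > 0" "a [^]\<^bsub>GL\<^esub> N = \<one>\<^bsub>GL\<^esub>" using tor[OF a] by blast
    obtain w e where w: "w \<in> Z" "w \<notin> V" "a *v w - e *s w \<in> V"
      using eigenvector_mod_subspace[OF Hc[OF a] N Zs ZH[OF a] Vs] Z by blast
    define Za where "Za = {y \<in> Z. a *v y - e *s y \<in> V}"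
    have lin: "a *v (x + y) - e *s (x + y) = (a *v x - e *s x) + (a *v y - e *s y)"
      "a *v (c *s x) - e *s (c *s x) = c *s (a *v x - e *s x)" for x y c
      by (simp_all add: vec.add vec.scale vec.scale_right_distrib vec.scale_right_diff_distrib vec.scale_left_commute)
    have "Za = Z"
    proof (rule minimal)
      have "vec.subspace Za"
      proof (rule vec.subspaceI)
        show "0 \<in> Za" unfolding Za_def using vec.subspace_0[OF Zs] vec.subspace_0[OF Vs] by simp
        show "x + y \<in> Za" if "x \<in> Za" "y \<in> Za" for x y
          using that vec.subspace_add[OF Zs] vec.subspace_add[OF Vs] unfolding Za_def mem_Collect_eq lin by blast
        show "c *s x \<in> Za" if "x \<in> Za" for x c
          using that vec.subspace_scale[OF Zs] vec.subspace_scale[OF Vs] unfolding Za_def mem_Collect_eq lin by blast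
      qed
      moreover have "g *v y \<in> Za" if g: "g \<in> H" and y: "y \<in> Za" for g y
      proof -
        have yZ: "y \<in> Z" and ay: "a *v y - e *s y \<in> V" using y unfolding Za_def by blast+
        have "(a *v (g *v y) - g *v (a *v y)) + g *v (a *v y - e *s y) \<in> V"
          by (rule vec.subspace_add[OF Vs comm[OF a g yZ] VH[OF g ay]])
        then have "a *v (g *v y) - e *s (g *v y) \<in> V" by (simp add: vec.diff vec.scale)
        then show ?thesis using ZH[OF g yZ] unfolding Za_def by blast
      qed
      ultimately show "stable H Za" unfolding stable_def by blast
      show "V \<subseteq> Za"
      proof
        fix y assume y: "y \<in> V"
        then have "a *v y - e *s y \<in> V"
          using VH[OF a y] vec.subspace_scale[OF Vs y] vec.subspace_diff[OF Vs] by blast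
        then show "y \<in> Za" using y Z unfolding Za_def by blast
      qed
      show "Za \<subseteq> Z" unfolding Za_def by blast
      show "V \<noteq> Za" using w unfolding Za_def by blast
    qed
    then show ?thesis using v(1) unfolding Za_def by blast
  qed
  then show ?case using v(1,2) Z by blast
qed

subsection \<open>Local finiteness over the algebraic closure of a finite field\<close>

lemma prime_power_of_unique_prime_divisor:
  fixes n p :: nat
  assumes "n > 0" "\<And>r. prime r \<Longrightarrow> r dvd n \<Longrightarrow> r = p"
  shows "\<exists>a. n = p ^ a"
proof -
  have "prime_factors n \<subseteq> {p}" using assms(2) by (auto simp: in_prime_factors_iff)
  then consider "prime_factors n = {}" | "prime_factors n = {p}" by blast
  then show ?thesis
  proof cases
    case 1
    then have "n = 1" using assms(1) prime_factorization_nat[of n] by simp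
    then show ?thesis by (intro exI[of _ 0]) simp
  next
    case 2
    then have "n = p ^ multiplicity p n" using assms(1) prime_factorization_nat[of n] by simp
    then show ?thesis by blast
  qed
qed

text \<open>A second prime divisor \<open>r\<close> of the order would give, by Sylow, a nontrivial
  subgroup of \<open>r\<close>-power order, in which only the identity can have
  \<open>p\<close>-power order.\<close>

lemma (in group) p_group_order:
  fixes p :: nat
  assumes fin: "finite (carrier G)" and p: "prime p"
    and el: "\<And>x. x \<in> carrier G \<Longrightarrow> \<exists>k. x [^] (p ^ k) = \<one>"
  shows "\<exists>a. card (carrier G) = p ^ a"
proof (rule prime_power_of_unique_prime_divisor)
  show c0: "card (carrier G) > 0" using fin by (auto simp: card_gt_0_iff)
  fix r :: nat assume r: "prime r" "r dvd card (carrier G)"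
  show "r = p"
  proof (rule ccontr)
    assume rp: "r \<noteq> p"
    define a where "a = multiplicity r (card (carrier G))"
    have a: "a > 0" unfolding a_def using r c0 by (simp add: prime_multiplicity_gt_zero_iff)
    obtain m where m: "Coset.order G = r ^ a * m" unfolding a_def Coset.order_def
      using multiplicity_dvd[of r "card (carrier G)"] unfolding dvd_def by blast
    have "sylow G r a m" unfolding sylow_eq sylow_axioms_def using m r(1) fin is_group by blast
    then obtain H where H: "subgroup H G" "card H = r ^ a" using sylow.sylow_thm by blast
    have "r ^ a > 1" by (rule one_less_power[OF prime_gt_1_nat[OF r(1)] a])
    then have "H \<noteq> {\<one>}" using H(2) by auto
    then obtain x where x: "x \<in> H" "x \<noteq> \<one>" using subgroup.one_closed[OF H(1)] by blast
    interpret H: group "G\<lparr>carrier := H\<rparr>" using subgroup_imp_group[OF H(1)] .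
    have xc: "x \<in> carrier G" using subgroup.mem_carrier[OF H(1) x(1)] .
    have "x [^]\<^bsub>G\<lparr>carrier := H\<rparr>\<^esub> Coset.order (G\<lparr>carrier := H\<rparr>) = \<one>" using H.pow_order_eq_1[of x] x(1) by simp
    then have "x [^] (r ^ a) = \<one>" using H(2) by (simp add: Coset.order_def nat_pow_consistent[symmetric])
    then have "ord x dvd r ^ a" using pow_eq_id[OF xc] by blast
    moreover obtain k where "x [^] (p ^ k) = \<one>" using el[OF xc] by blast
    then have "ord x dvd p ^ k" using pow_eq_id[OF xc] by blast
    moreover have "coprime (r ^ a) (p ^ k)" using r(1) p rp by (simp add: primes_coprime)
    ultimately have "ord x = 1" by (metis coprime_common_divisor_nat)
    then have "x [^] (1::nat) = \<one>" using pow_ord_eq_1[OF xc] by simp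
    then show False using x(2) xc by simp
  qed
qed

lemma CHAR_prime: "prime CHAR('f::{field,finite})"
  by (rule prime_CHAR_semidom) (rule finite_imp_CHAR_pos, simp)

text \<open>The additive group of the field, packed as the monoid \<open>A\<close>, has exponent
  \<open>p\<close>, so \<open>p_group_order\<close> applies.\<close>

lemma CARD_prime_power: "\<exists>e>0. CARD('f::{field,finite}) = CHAR('f) ^ e"
proof -
  define A :: "'f monoid" where "A = \<lparr>carrier = UNIV, monoid.mult = (+), one = 0\<rparr>"
  have gA: "group A"
    by (rule groupI) (auto simp: A_def add.assoc intro: exI[of _ "- x" for x] left_minus)
  interpret A: group A by (rule gA)
  have pw: "x [^]\<^bsub>A\<^esub> n = of_nat n * x" for x and n :: nat
  proof (induction n)
    case 0
    have "\<one>\<^bsub>A\<^esub> = 0" by (simp add: A_def)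
    then show ?case by simp
  next
    case (Suc n)
    have "x [^]\<^bsub>A\<^esub> Suc n = x [^]\<^bsub>A\<^esub> n + x" by (simp add: A_def nat_pow_def)
    then show ?case using Suc by (simp add: distrib_right)
  qed
  have "\<exists>k. x [^]\<^bsub>A\<^esub> (CHAR('f) ^ k) = \<one>\<^bsub>A\<^esub>" for x
  proof -
    have "x [^]\<^bsub>A\<^esub> (CHAR('f) ^ 1) = \<one>\<^bsub>A\<^esub>" unfolding pw by (simp add: A_def)
    then show ?thesis by blast
  qed
  then obtain e where e: "CARD('f) = CHAR('f) ^ e"
    using A.p_group_order[OF _ CHAR_prime[where 'f = 'f]] by (auto simp: A_def)
  have "card {0, 1 :: 'f} \<le> CARD('f)" by (rule card_mono) auto
  then have "e \<noteq> 0" using e by (intro notI) simp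
  then show ?thesis using e by blast
qed

lemma freshman_root:
  fixes y :: "'k::field"
  assumes p: "prime CHAR('k)" and "y ^ (CHAR('k) ^ a) = 1"
  shows "y = 1"
proof -
  have "((y - 1) + 1) ^ (CHAR('k) ^ a) = (y - 1) ^ (CHAR('k) ^ a) + 1 ^ (CHAR('k) ^ a)"
    by (rule freshmans_dream'[OF p refl])
  then have "(y - 1) ^ (CHAR('k) ^ a) = 0" using assms(2) by simp
  then show ?thesis by simp
qed

text \<open>By an equation of degree \<open>d\<close>, all powers of \<open>x\<close> lie in the set
  \<open>V\<close> of combinations of the first \<open>d\<close> powers with coefficients in the
  finite field. \<open>V\<close> is finite, so two powers agree.\<close>

lemma alg_closure_torsion:
  fixes x :: "'f::{field,finite} alg_closure"
  assumes x0: "x \<noteq> 0"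
  shows "\<exists>N>0. x ^ N = 1"
proof -
  obtain P :: "'f poly" where P: "P \<noteq> 0" "poly (map_poly to_ac P) x = 0" by (rule alg_closure_algebraic)
  define d where "d = degree P"
  define a where "a i = coeff P i" for i
  have "(\<Sum>i\<le>d. to_ac (a i) * x ^ i) = 0"
    using P(2) by (simp add: poly_altdef coeff_map_poly degree_map_poly d_def a_def)
  moreover have ad: "a d \<noteq> 0" using P(1) by (simp add: a_def d_def)
  ultimately have d0: "d \<noteq> 0" by (intro notI) simp
  then obtain d' where d': "d = Suc d'" using not0_implies_Suc by blast
  have xd: "x ^ d = (\<Sum>i<d. to_ac (- (a i / a d)) * x ^ i)"
  proof -
    have "(\<Sum>i<d. to_ac (a i) * x ^ i) + to_ac (a d) * x ^ d = 0"
      using \<open>(\<Sum>i\<le>d. to_ac (a i) * x ^ i) = 0\<close> by (simp add: lessThan_Suc_atMost[symmetric])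
    then have "to_ac (a d) * x ^ d = - (\<Sum>i<d. to_ac (a i) * x ^ i)" by (simp add: add_eq_0_iff)
    then have "x ^ d = - (\<Sum>i<d. to_ac (a i) * x ^ i) / to_ac (a d)" using ad by (simp add: field_simps)
    then show ?thesis by (simp add: sum_divide_distrib sum_negf flip: sum_negf)
  qed
  define V where "V = (\<lambda>c. \<Sum>i<d. to_ac (c i) * x ^ i) ` ({..<d} \<rightarrow>\<^sub>E (UNIV :: 'f set))"
  have finV: "finite V" unfolding V_def by (intro finite_imageI finite_PiE) auto
  have VI: "(\<Sum>i<d. to_ac (c i) * x ^ i) \<in> V" for c
    unfolding V_def by (rule image_eqI[of _ _ "restrict c {..<d}"]) auto
  have xV: "x ^ n \<in> V" for n
  proof (induction n)
    case 0
    have "(\<Sum>i<d. to_ac (if i = 0 then 1 else 0) * x ^ i) = (\<Sum>i<d. if i = 0 then 1 else 0)"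
      by (rule sum.cong) auto
    also have "\<dots> = 1" using d0 by simp
    finally show ?case using VI[of "\<lambda>i. if i = 0 then 1 else 0"] by simp
  next
    case (Suc n)
    then obtain c where c: "x ^ n = (\<Sum>i<d. to_ac (c i) * x ^ i)" unfolding V_def by blast
    have "x ^ Suc n = (\<Sum>i<d. to_ac (c i) * x ^ Suc i)" unfolding power_Suc c by (simp add: sum_distrib_left mult_ac)
    also have "\<dots> = (\<Sum>i<d'. to_ac (c i) * x ^ Suc i) + to_ac (c d') * x ^ d" unfolding d' by simp
    also have "(\<Sum>i<d'. to_ac (c i) * x ^ Suc i) = (\<Sum>i<d. to_ac (if i = 0 then 0 else c (i - 1)) * x ^ i)"
      unfolding d' by (subst sum.lessThan_Suc_shift) simp
    also have "to_ac (c d') * x ^ d = (\<Sum>i<d. to_ac (c d' * - (a i / a d)) * x ^ i)"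
      unfolding xd by (simp add: sum_distrib_left mult.assoc)
    finally have e: "x ^ Suc n = (\<Sum>i<d. to_ac (if i = 0 then 0 else c (i - 1)) * x ^ i)
        + (\<Sum>i<d. to_ac (c d' * - (a i / a d)) * x ^ i)" .
    have d: "to_ac u * z + to_ac v * z = to_ac (u + v) * z" for u v :: 'f and z
      by (simp add: distrib_right)
    have "x ^ Suc n = (\<Sum>i<d. to_ac ((if i = 0 then 0 else c (i - 1)) + c d' * - (a i / a d)) * x ^ i)"
      unfolding e sum.distrib[symmetric] d ..
    then show ?case using VI by (simp only:)
  qed
  have "\<not> inj (\<lambda>n::nat. x ^ n)"
  proof
    assume "inj (\<lambda>n::nat. x ^ n)"
    then have "finite (UNIV :: nat set)" using finite_imageD[of "\<lambda>n. x ^ n" UNIV] finite_subset[OF _ finV] xV by blast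
    then show False by simp
  qed
  then obtain i j :: nat where ij: "i < j" "x ^ i = x ^ j" by (metis injI linorder_neqE_nat)
  have "x ^ i * x ^ (j - i) = x ^ j" using ij(1) by (simp flip: power_add)
  then have "x ^ i * x ^ (j - i) = x ^ i * 1" using ij(2) by simp
  then have "x ^ (j - i) = 1" using x0 by simp
  then show ?thesis using ij(1) by (intro exI[of _ "j - i"]) simp
qed

lemma nat_p_part:
  fixes N p :: nat
  assumes "N > 0" "prime p"
  obtains a m where "N = p ^ a * m" "coprime p m" "m > 0"
proof -
  obtain m where "N = p ^ multiplicity p N * m" "\<not> p dvd m"
    using multiplicity_decompose'[of N p] assms by (metis not_gr_zero not_prime_unit)
  then show thesis using that[of "multiplicity p N" m] assms by (metis gr0I mult_0_right prime_imp_coprime)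
qed

text \<open>As \<open>p\<close>-power roots of unity are trivial, \<open>x ^ m = 1\<close> for some
  \<open>m\<close> prime to \<open>p\<close>; Euler's theorem then gives a power of \<open>q\<close>
  congruent to 1 modulo \<open>m\<close>.\<close>

lemma alg_closure_frobenius_fixed:
  fixes x :: "'f::{field,finite} alg_closure"
  shows "\<exists>m>0. x ^ (CARD('f) ^ m) = x"
proof (cases "x = 0")
  case True
  have "CARD('f) ^ 1 > 0" by simp
  then show ?thesis using True by (intro exI[of _ 1]) (simp add: power_0_left)
next
  case False
  let ?p = "CHAR('f)"
  obtain N where N: "N > 0" "x ^ N = 1" using alg_closure_torsion[OF False] by blast
  obtain a m where m: "N = ?p ^ a * m" "coprime ?p m" "m > 0" by (rule nat_p_part[OF N(1) CHAR_prime])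
  have "(x ^ m) ^ (CHAR('f alg_closure) ^ a) = 1" using N(2) m(1) by (simp add: mult.commute flip: power_mult)
  then have xm: "x ^ m = 1" by (rule freshman_root[rotated]) (simp add: CHAR_prime)
  obtain e where e: "CARD('f) = ?p ^ e" using CARD_prime_power[where 'f = 'f] by blast
  have "coprime (CARD('f)) m" unfolding e using m(2) by simp
  then have "[CARD('f) ^ totient m = 1] (mod m)" by (rule euler_theorem)
  moreover have "1 \<le> CARD('f) ^ totient m" by simp
  ultimately obtain t where "CARD('f) ^ totient m = 1 + m * t"
    by (metis cong_to_1_nat dvdE le_add_diff_inverse)
  then have "x ^ (CARD('f) ^ totient m) = x" using xm by (simp add: power_add power_mult)
  moreover have "totient m > 0" using m(3) by simp
  ultimately show ?thesis by blast
qed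

lemma frobenius_pow: "(frobenius ^^ m) (A :: 'f::{field,finite} alg_closure ^ 'n ^ 'n) = (\<chi> i j. (A $ i $ j) ^ (CARD('f) ^ m))"
  by (induction m) (simp_all add: frobenius_def Finite_Cartesian_Product.vec_eq_iff mult.commute flip: power_mult)

lemma frobenius_pow_hom:
  fixes A B :: "'f::{field,finite} alg_closure ^ 'n ^ 'n"
  shows "(frobenius ^^ m) (A ** B) = (frobenius ^^ m) A ** (frobenius ^^ m) B"
    and "(frobenius ^^ m) (mat 1 :: 'f alg_closure ^ 'n ^ 'n) = mat 1"
proof -
  obtain e where e: "CARD('f) = CHAR('f) ^ e" using CARD_prime_power[where 'f = 'f] by blast
  have q: "CARD('f) ^ m = CHAR('f alg_closure) ^ (e * m)" by (simp add: e power_mult)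
  have pr: "prime CHAR('f alg_closure)" by (simp add: CHAR_prime)
  show "(frobenius ^^ m) (A ** B) = (frobenius ^^ m) A ** (frobenius ^^ m) B"
    unfolding frobenius_pow
    by (simp add: Finite_Cartesian_Product.vec_eq_iff matrix_matrix_mult_def freshmans_dream_sum'[OF pr q] power_mult_distrib)
  show "(frobenius ^^ m) (mat 1 :: 'f alg_closure ^ 'n ^ 'n) = mat 1"
    unfolding frobenius_pow Finite_Cartesian_Product.vec_eq_iff Finite_Cartesian_Product.mat_def by auto
qed

lemma finite_frobenius_fixed:
  assumes m: "m > 0"
  shows "finite {A :: 'f::{field,finite} alg_closure ^ 'n ^ 'n. (frobenius ^^ m) A = A}"
proof -
  let ?q = "CARD('f) ^ m"
  define Fx where "Fx = {x :: 'f alg_closure. x ^ ?q = x}"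
  have "card {0, 1 :: 'f} \<le> CARD('f)" by (rule card_mono) auto
  then have q1: "?q > 1" using one_less_power[of "CARD('f)" m] m by simp
  have "coeff (monom 1 ?q - monom 1 1 :: 'f alg_closure poly) ?q = 1" using q1 by simp
  then have "monom 1 ?q - monom 1 1 \<noteq> (0 :: 'f alg_closure poly)" by (intro notI) (simp only: coeff_0 zero_neq_one)
  then have "finite {x :: 'f alg_closure. poly (monom 1 ?q - monom 1 1) x = 0}" by (rule poly_roots_finite)
  then have fF: "finite Fx" unfolding Fx_def by (simp add: poly_monom)
  let ?g = "\<lambda>(A :: 'f alg_closure ^ 'n ^ 'n) p. vec_nth (vec_nth A (fst p)) (snd p)"
  have "finite (UNIV \<rightarrow>\<^sub>E Fx :: ('n \<times> 'n \<Rightarrow> 'f alg_closure) set)" using fF by (intro finite_PiE) auto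
  moreover have "?g ` {A. (frobenius ^^ m) A = A} \<subseteq> (UNIV \<rightarrow>\<^sub>E Fx)"
    by (auto simp: Fx_def frobenius_pow Finite_Cartesian_Product.vec_eq_iff)
  moreover have "inj_on ?g {A. (frobenius ^^ m) A = A}"
    by (rule inj_onI) (auto simp: Finite_Cartesian_Product.vec_eq_iff fun_eq_iff)
  ultimately show ?thesis by (meson finite_imageD finite_subset)
qed

text \<open>Each entry is fixed by some power of Frobenius; the product of the exponents serves for
  all of them. The invertible matrices fixed by this power form a finite group, the points over a
  finite field.\<close>

lemma GL_locally_finite:
  fixes E :: "('f::{field,finite} alg_closure ^ 'n ^ 'n) set"
  assumes E: "finite E" "E \<subseteq> carrier GL"
  obtains \<Gamma> where "finite \<Gamma>" "subgroup \<Gamma> GL" "E \<subseteq> \<Gamma>"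
proof -
  obtain \<mu>' :: "'f alg_closure \<Rightarrow> nat" where mu: "\<And>x. \<mu>' x > 0 \<and> x ^ (CARD('f) ^ \<mu>' x) = x"
    using alg_closure_frobenius_fixed by metis
  define Z where "Z = (\<lambda>(A, i, j). A $ i $ j) ` (E \<times> (UNIV :: 'n set) \<times> (UNIV :: 'n set))"
  have fZ: "finite Z" unfolding Z_def using E(1) by (intro finite_imageI finite_cartesian_product) auto
  define m where "m = (\<Prod>x\<in>Z. \<mu>' x)"
  have m0: "m > 0" unfolding m_def using mu by (simp add: prod_pos)
  have fixed: "x ^ (CARD('f) ^ m) = x" if "x \<in> Z" for x
  proof -
    have "\<mu>' x dvd m" unfolding m_def using fZ that by (rule dvd_prodI)
    then obtain t where t: "m = \<mu>' x * t" by blast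
    have "x ^ (CARD('f) ^ (\<mu>' x * k)) = x" for k
      by (induction k) (simp_all add: power_add power_mult mu)
    then show ?thesis unfolding t .
  qed
  define \<Gamma> where "\<Gamma> = {A \<in> carrier GL. (frobenius ^^ m) A = (A :: 'f alg_closure ^ 'n ^ 'n)}"
  show thesis
  proof
    show "finite \<Gamma>" unfolding \<Gamma>_def by (rule finite_subset[OF _ finite_frobenius_fixed[OF m0]]) blast
    show "E \<subseteq> \<Gamma>"
    proof
      fix A assume A: "A \<in> E"
      have "A $ i $ j \<in> Z" for i j unfolding Z_def
        by (rule image_eqI[of _ _ "(A, i, j)"]) (use A in auto)
      then have "(frobenius ^^ m) A = A" using fixed by (simp add: frobenius_pow Finite_Cartesian_Product.vec_eq_iff)
      then show "A \<in> \<Gamma>" using A E(2) unfolding \<Gamma>_def by blast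
    qed
    show "subgroup \<Gamma> GL"
    proof (rule GL.subgroupI)
      show "\<Gamma> \<subseteq> carrier GL" unfolding \<Gamma>_def by blast
      have "\<one>\<^bsub>GL\<^esub> \<in> \<Gamma>" unfolding \<Gamma>_def GL_one
        using frobenius_pow_hom(2) GL.one_closed[unfolded GL_one] by blast
      then show "\<Gamma> \<noteq> {}" by blast
      fix A B assume A: "A \<in> \<Gamma>"
      then have Ac: "A \<in> carrier GL" "(frobenius ^^ m) A = A" unfolding \<Gamma>_def by auto
      have "(frobenius ^^ m) (inv\<^bsub>GL\<^esub> A) ** A = (frobenius ^^ m) (inv\<^bsub>GL\<^esub> A ** A)"
        by (simp only: frobenius_pow_hom(1) Ac(2))
      also have "\<dots> = mat 1"
        using GL.l_inv[OF Ac(1)] unfolding GL_mult GL_one by (simp only: frobenius_pow_hom(2))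
      finally have l: "(frobenius ^^ m) (inv\<^bsub>GL\<^esub> A) ** A = mat 1" .
      then have "A ** (frobenius ^^ m) (inv\<^bsub>GL\<^esub> A) = mat 1" by (rule matrix_left_right_inverse1)
      then have "(frobenius ^^ m) (inv\<^bsub>GL\<^esub> A) \<in> carrier GL"
        unfolding GL_carrier invertible_def by (intro exI[of _ A] conjI l)
      then have "inv\<^bsub>GL\<^esub> A = (frobenius ^^ m) (inv\<^bsub>GL\<^esub> A)"
        by (intro GL.inv_equality) (use l Ac(1) in \<open>simp_all only: GL_mult GL_one\<close>)
      then have "(frobenius ^^ m) (inv\<^bsub>GL\<^esub> A) = inv\<^bsub>GL\<^esub> A" by (rule sym)
      then show "inv\<^bsub>GL\<^esub> A \<in> \<Gamma>" using Ac(1) unfolding \<Gamma>_def by simp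
      assume B: "B \<in> \<Gamma>"
      then show "A \<otimes>\<^bsub>GL\<^esub> B \<in> \<Gamma>" using Ac frobenius_pow_hom(1)[of m A B] GL.m_closed[of A B]
        unfolding \<Gamma>_def GL_mult mem_Collect_eq by (simp only: simp_thms)
    qed
  qed
qed

lemma finite_subgroup_torsion:
  fixes \<Gamma> :: "('k::field ^ 'n ^ 'n) set"
  assumes "finite \<Gamma>" "subgroup \<Gamma> GL" "A \<in> \<Gamma>"
  shows "A [^]\<^bsub>GL\<^esub> card \<Gamma> = \<one>\<^bsub>GL\<^esub>" "card \<Gamma> > 0"
proof -
  interpret H: group "GL\<lparr>carrier := \<Gamma>\<rparr>" using GL.subgroup_imp_group[OF assms(2)] .
  have "A [^]\<^bsub>GL\<lparr>carrier := \<Gamma>\<rparr>\<^esub> Coset.order (GL\<lparr>carrier := \<Gamma>\<rparr>) = \<one>\<^bsub>GL\<^esub>" using H.pow_order_eq_1[of A] assms(3) by simp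
  then show "A [^]\<^bsub>GL\<^esub> card \<Gamma> = \<one>\<^bsub>GL\<^esub>" by (simp add: Coset.order_def flip: GL.nat_pow_consistent)
  show "card \<Gamma> > 0" using assms by (auto simp: card_gt_0_iff)
qed

lemma GL_torsion:
  fixes A :: "'f::{field,finite} alg_closure ^ 'n ^ 'n"
  assumes "A \<in> carrier GL" shows "\<exists>N::nat. N > 0 \<and> A [^]\<^bsub>GL\<^esub> N = \<one>\<^bsub>GL\<^esub>"
proof -
  obtain \<Gamma> where "finite \<Gamma>" "subgroup \<Gamma> GL" "{A} \<subseteq> \<Gamma>" using GL_locally_finite[of "{A}"] assms by auto
  then show ?thesis using finite_subgroup_torsion[of \<Gamma> A] by blast
qed

subsection \<open>Flags stabilised by connected solvable groups\<close>

lemma span_stable: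
  fixes h :: "'k::field ^ 'n ^ 'n"
  assumes "\<And>x. x \<in> S \<Longrightarrow> h *v x \<in> vec.span S" "y \<in> vec.span S"
  shows "h *v y \<in> vec.span S"
proof -
  have "vec.subspace {x. h *v x \<in> vec.span S}"
    by (rule vec.subspaceI) (auto simp: vec.add vec.scale intro: vec.span_add vec.span_scale vec.span_zero)
  then have "vec.span S \<subseteq> {x. h *v x \<in> vec.span S}" using assms(1) by (intro vec.span_minimal) auto
  then show ?thesis using assms(2) by blast
qed

text \<open>A basis in which \<open>H\<close> is triangular and \<open>D\<close> diagonal, built up
  to index \<open>m\<close>; strict growth of the spans expresses linear independence.\<close>

definition flag :: "('k::field ^ 'n ^ 'n) set \<Rightarrow> ('k ^ 'n ^ 'n) set \<Rightarrow> (nat \<Rightarrow> 'k ^ 'n) \<Rightarrow> nat \<Rightarrow> bool" where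
  "flag H D vs m \<longleftrightarrow> (\<forall>i<m. vs i \<notin> vec.span (vs ` {..<i}) \<and>
     (\<forall>h\<in>H. \<exists>c. h *v vs i - c *s vs i \<in> vec.span (vs ` {..<i})) \<and> (\<forall>d\<in>D. \<exists>c. d *v vs i = c *s vs i))"

lemma flag_stable:
  assumes f: "flag H D vs m" and i: "i \<le> m" and h: "h \<in> H" and y: "y \<in> vec.span (vs ` {..<i})"
  shows "h *v y \<in> vec.span (vs ` {..<i})"
proof (rule span_stable[OF _ y])
  fix x assume "x \<in> vs ` {..<i}"
  then obtain j where j: "j < i" "x = vs j" by blast
  obtain c where "h *v vs j - c *s vs j \<in> vec.span (vs ` {..<j})" using f h j(1) i unfolding flag_def by (meson less_le_trans)
  then have "h *v vs j - c *s vs j \<in> vec.span (vs ` {..<i})"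
    using vec.span_mono[of "vs ` {..<j}" "vs ` {..<i}"] j(1) by (auto simp: image_mono)
  moreover have "c *s vs j \<in> vec.span (vs ` {..<i})" using j(1) by (intro vec.span_scale vec.span_base) auto
  ultimately have "(h *v vs j - c *s vs j) + c *s vs j \<in> vec.span (vs ` {..<i})" by (rule vec.span_add)
  then show "h *v x \<in> vec.span (vs ` {..<i})" using j(2) by simp
qed

lemma flag_dim: "flag H D vs m \<Longrightarrow> i \<le> m \<Longrightarrow> vec.dim (vs ` {..<i}) = i"
proof (induction i)
  case (Suc i)
  then have "vs i \<notin> vec.span (vs ` {..<i})" unfolding flag_def by simp
  then show ?case using Suc by (simp add: lessThan_Suc vec.dim_insert)
qed simp

lemma flag_full:
  fixes vs :: "nat \<Rightarrow> 'k::field ^ 'n"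
  assumes "flag H D vs CARD('n)"
  shows "vec.span (vs ` {..<CARD('n)}) = UNIV"
proof -
  have "vec.dim (vs ` {..<CARD('n)}) = vec.dimension TYPE('k) TYPE('n)"
    using flag_dim[OF assms order_refl] by (simp add: vec.dimension_def card_cart_basis)
  then show ?thesis unfolding vec.dim_eq_full .
qed

text \<open>Lie--Kolchin gives the next vector \<open>v\<close> only modulo \<open>V\<close>. The
  span of \<open>v\<close> and \<open>V\<close> is stable under \<open>D\<close>, hence spanned by
  common eigenvectors of \<open>D\<close>; one of them lies outside \<open>V\<close> and takes the
  place of \<open>v\<close>.\<close>

lemma flag_exists:
  fixes H D :: "('k::alg_closed_field ^ 'n ^ 'n) set"
  assumes H: "subgroup H GL" "zariski_connected H" "(derived GL ^^ d) H = {\<one>\<^bsub>GL\<^esub>}"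
    and tor: "\<And>h. h \<in> H \<Longrightarrow> \<exists>N::nat. N > 0 \<and> h [^]\<^bsub>GL\<^esub> N = \<one>\<^bsub>GL\<^esub>"
    and D: "D \<subseteq> H" "\<And>d. d \<in> D \<Longrightarrow> ss_elem d" "\<And>d e. d \<in> D \<Longrightarrow> e \<in> D \<Longrightarrow> d ** e = e ** d"
    and m: "m \<le> CARD('n)"
  shows "\<exists>vs. flag H D vs m"
  using m
proof (induction m)
  case 0
  then show ?case unfolding flag_def by simp
next
  case (Suc m)
  then obtain vs where vs: "flag H D vs m" by auto
  let ?V = "vec.span (vs ` {..<m})"
  have VH: "h *v y \<in> ?V" if "h \<in> H" "y \<in> ?V" for h y using flag_stable[OF vs order_refl that] .
  have "vec.dim (vs ` {..<m}) \<noteq> vec.dimension TYPE('k) TYPE('n)"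
    using flag_dim[OF vs order_refl] Suc.prems by (simp add: vec.dimension_def card_cart_basis)
  then have VU: "?V \<noteq> UNIV" unfolding vec.dim_eq_full .
  have sV: "stable H ?V" unfolding stable_def using VH vec.subspace_span by blast
  have sU: "stable H (UNIV :: ('k ^ 'n) set)" unfolding stable_def using vec.subspace_UNIV by blast
  obtain v where v: "v \<notin> ?V" "\<And>h. h \<in> H \<Longrightarrow> \<exists>c. h *v v - c *s v \<in> ?V"
    using lie_kolchin_section[OF H tor sV sU subset_UNIV VU] by blast
  let ?Y = "vec.span (insert v ?V)"
  have VY: "?V \<subseteq> ?Y" using vec.span_superset[of "insert v ?V"] by blast
  have vY: "v \<in> ?Y" by (rule vec.span_base) simp
  have YH: "h *v y \<in> ?Y" if h: "h \<in> H" and y: "y \<in> ?Y" for h y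
  proof (rule span_stable[OF _ y])
    fix x assume x: "x \<in> insert v ?V"
    show "h *v x \<in> ?Y"
    proof (cases "x = v")
      case True
      obtain c where "h *v v - c *s v \<in> ?V" using v(2)[OF h] by blast
      then have "(h *v v - c *s v) + c *s v \<in> ?Y" using VY vY by (intro vec.span_add vec.span_scale) auto
      then show ?thesis using True by simp
    next
      case False
      then show ?thesis using VH[OF h] x VY by blast
    qed
  qed
  then have sY: "stable D ?Y" unfolding stable_def using D(1) vec.subspace_span by blast
  have "?Y \<subseteq> vec.span {w \<in> ?Y. \<forall>d\<in>D. \<exists>c. d *v w = c *s w}"
    by (rule commuting_semisimple_span[OF D(2) D(3) sY])
  moreover have "\<not> ?Y \<subseteq> vec.span ?V" using v(1) vY by (auto simp: vec.span_span)
  ultimately have "\<not> {w \<in> ?Y. \<forall>d\<in>D. \<exists>c. d *v w = c *s w} \<subseteq> ?V" using vec.span_mono by blast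
  then obtain w where w: "w \<in> ?Y" "w \<notin> ?V" "\<And>d. d \<in> D \<Longrightarrow> \<exists>c. d *v w = c *s w" by blast
  obtain k where k: "w - k *s v \<in> ?V" using w(1) unfolding vec.span_breakdown_eq vec.span_span by blast
  have wH: "\<exists>c. h *v w - c *s w \<in> ?V" if h: "h \<in> H" for h
  proof -
    obtain c where c: "h *v v - c *s v \<in> ?V" using v(2)[OF h] by blast
    have "(h *v (w - k *s v) - c *s (w - k *s v)) + k *s (h *v v - c *s v) \<in> ?V"
      by (intro vec.span_add vec.span_diff vec.span_scale VH[OF h] k c)
    moreover have "(h *v (w - k *s v) - c *s (w - k *s v)) + k *s (h *v v - c *s v) = h *v w - c *s w"
      by (simp add: vec.diff vec.scale vec.scale_right_diff_distrib vec.scale_left_commute)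
    ultimately show ?thesis by auto
  qed
  define vs' where "vs' = vs(m := w)"
  have im: "vs' ` {..<i} = vs ` {..<i}" if "i \<le> m" for i unfolding vs'_def using that by (intro image_cong) auto
  have "flag H D vs' (Suc m)"
    unfolding flag_def
  proof (intro allI impI)
    fix i assume i: "i < Suc m"
    show "vs' i \<notin> vec.span (vs' ` {..<i}) \<and> (\<forall>h\<in>H. \<exists>c. h *v vs' i - c *s vs' i \<in> vec.span (vs' ` {..<i}))
        \<and> (\<forall>d\<in>D. \<exists>c. d *v vs' i = c *s vs' i)"
    proof (cases "i = m")
      case True
      have "vs' m = w" unfolding vs'_def by simp
      then show ?thesis using True w(2,3) wH im[of m] by simp
    next
      case False
      then have "vs' i = vs i" "i < m" unfolding vs'_def using i by auto
      then show ?thesis using vs im[of i] unfolding flag_def by simp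
    qed
  qed
  then show ?case by blast
qed

subsection \<open>The elements of p-power order\<close>

definition p_elem :: "'k::field ^ 'n ^ 'n \<Rightarrow> bool" where
  "p_elem A \<longleftrightarrow> A \<in> carrier GL \<and> (\<exists>a::nat. A [^]\<^bsub>GL\<^esub> (CHAR('k) ^ a) = \<one>\<^bsub>GL\<^esub>)"

text \<open>On the quotient lines of the flag, an element of \<open>p\<close>-power order has
  \<open>p\<close>-power roots of unity as eigenvalues, hence 1. Conversely the
  \<open>p\<close>-part of the order is removed by passing to a power \<open>w\<close>; then
  \<open>w v_i = v_i + x\<close> with \<open>x\<close> fixed gives
  \<open>w^m v_i = v_i + m x\<close>, so \<open>x = 0\<close>. The criterion is what makes these
  elements closed under products.\<close>

lemma p_elem_flag_iff:
  fixes h :: "'k::field ^ 'n ^ 'n"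
  assumes p: "prime CHAR('k)" and f: "flag H D vs CARD('n)" and h: "h \<in> H" "h \<in> carrier GL"
    and tor: "N > 0" "h [^]\<^bsub>GL\<^esub> (N::nat) = \<one>\<^bsub>GL\<^esub>"
  shows "p_elem h \<longleftrightarrow> (\<forall>i<CARD('n). h *v vs i - vs i \<in> vec.span (vs ` {..<i}))"
proof
  assume "p_elem h"
  then obtain a where a: "h [^]\<^bsub>GL\<^esub> (CHAR('k) ^ a) = \<one>\<^bsub>GL\<^esub>" unfolding p_elem_def by blast
  show "\<forall>i<CARD('n). h *v vs i - vs i \<in> vec.span (vs ` {..<i})"
  proof (intro allI impI)
    fix i assume i: "i < CARD('n)"
    obtain c where c: "h *v vs i - c *s vs i \<in> vec.span (vs ` {..<i})" using f h(1) i unfolding flag_def by blast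
    have "c ^ (CHAR('k) ^ a) = 1"
      by (rule torsion_eigenvalue[OF h(2) a vec.subspace_span flag_stable[OF f less_imp_le[OF i] h(1)] _ c])
        (use f i in \<open>auto simp: flag_def\<close>)
    then have "c = 1" by (rule freshman_root[OF p])
    then show "h *v vs i - vs i \<in> vec.span (vs ` {..<i})" using c by simp
  qed
next
  assume u: "\<forall>i<CARD('n). h *v vs i - vs i \<in> vec.span (vs ` {..<i})"
  obtain a m where m: "N = CHAR('k) ^ a * m" "coprime CHAR('k) m" "m > 0" by (rule nat_p_part[OF tor(1) p])
  have m0: "of_nat m \<noteq> (0 :: 'k)"
    using m(2) p unfolding of_nat_eq_0_iff_char_dvd by (metis coprime_absorb_left not_prime_unit)
  have pw: "(h [^]\<^bsub>GL\<^esub> k) *v vs i - vs i \<in> vec.span (vs ` {..<i})" if i: "i < CARD('n)" for i and k :: nat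
  proof (induction k)
    case 0
    then show ?case using vec.span_zero by simp
  next
    case (Suc k)
    have "h *v ((h [^]\<^bsub>GL\<^esub> k) *v vs i - vs i) + (h *v vs i - vs i) \<in> vec.span (vs ` {..<i})"
      using flag_stable[OF f less_imp_le[OF i] h(1) Suc] u i by (intro vec.span_add) auto
    then show ?case unfolding GL_pow_act'[OF h(2)] by (simp add: vec.diff)
  qed
  define w where "w = h [^]\<^bsub>GL\<^esub> (CHAR('k) ^ a)"
  have wc: "w \<in> carrier GL" unfolding w_def using h(2) by simp
  have wm: "w [^]\<^bsub>GL\<^esub> m = \<one>\<^bsub>GL\<^esub>" unfolding w_def using tor(2) m(1) GL.nat_pow_pow[OF h(2)] by simp
  have fixed: "\<forall>y\<in>vec.span (vs ` {..<i}). w *v y = y" if "i \<le> CARD('n)" for i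
    using that
  proof (induction i)
    case 0
    then show ?case by simp
  next
    case (Suc i)
    define x where "x = w *v vs i - vs i"
    have x: "w *v x = x" unfolding x_def using Suc pw[of i] unfolding w_def by simp
    have "(w [^]\<^bsub>GL\<^esub> k) *v vs i = vs i + of_nat k *s x" for k :: nat
    proof (induction k)
      case (Suc k)
      have "w *v vs i = vs i + x" unfolding x_def by simp
      then show ?case unfolding GL_pow_act'[OF wc] Suc by (simp add: vec.add vec.scale x vec.scale_left_distrib)
    qed simp
    from this[of m] have "of_nat m *s x = 0" by (simp add: wm)
    then have "x = 0" using m0 by simp
    then have wi: "w *v vs i = vs i" unfolding x_def by simp
    have "vec.span (vs ` {..<Suc i}) \<subseteq> {y. w *v y = y}"
    proof (rule vec.span_minimal)
      show "vs ` {..<Suc i} \<subseteq> {y. w *v y = y}"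
        using wi Suc vec.span_base[of _ "vs ` {..<i}"] by (auto simp: lessThan_Suc)
      show "vec.subspace {y. w *v y = y}" by (rule vec.subspaceI) (auto simp: vec.add vec.scale)
    qed
    then show ?case by blast
  qed
  have "w = mat 1" unfolding matrix_eq using fixed[OF order_refl] flag_full[OF f] by simp
  then show "p_elem h" unfolding p_elem_def w_def using h(2) by (auto simp: GL_one)
qed

locale full_flag =
  fixes H D :: "('k::field ^ 'n ^ 'n) set" and vs :: "nat \<Rightarrow> 'k ^ 'n"
  assumes p: "prime CHAR('k)" and H: "subgroup H GL" and f: "flag H D vs CARD('n)"
    and tor: "\<And>h. h \<in> H \<Longrightarrow> \<exists>N::nat. N > 0 \<and> h [^]\<^bsub>GL\<^esub> N = \<one>\<^bsub>GL\<^esub>"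
begin

lemma Hc: "h \<in> H \<Longrightarrow> h \<in> carrier GL"
  by (rule subgroup.mem_carrier[OF H])

lemma p_elem_iff: "h \<in> H \<Longrightarrow> p_elem h \<longleftrightarrow> (\<forall>i<CARD('n). h *v vs i - vs i \<in> vec.span (vs ` {..<i}))"
  using tor[of h] p_elem_flag_iff[OF p f _ Hc] by blast

lemma stab: "i < CARD('n) \<Longrightarrow> h \<in> H \<Longrightarrow> y \<in> vec.span (vs ` {..<i}) \<Longrightarrow> h *v y \<in> vec.span (vs ` {..<i})"
  using flag_stable[OF f] by simp

lemma p_elem_quotient:
  assumes g: "g \<in> H" and h: "h \<in> H"
    and e: "\<And>i. i < CARD('n) \<Longrightarrow> g *v vs i - h *v vs i \<in> vec.span (vs ` {..<i})"
  shows "p_elem (inv\<^bsub>GL\<^esub> h \<otimes>\<^bsub>GL\<^esub> g)"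
proof -
  have ih: "inv\<^bsub>GL\<^esub> h \<in> H" using subgroup.m_inv_closed[OF H h] .
  have "(inv\<^bsub>GL\<^esub> h \<otimes>\<^bsub>GL\<^esub> g) *v vs i - vs i \<in> vec.span (vs ` {..<i})" if i: "i < CARD('n)" for i
  proof -
    have "(inv\<^bsub>GL\<^esub> h) *v (g *v vs i - h *v vs i) \<in> vec.span (vs ` {..<i})" by (rule stab[OF i ih e[OF i]])
    then show ?thesis using Hc[OF h] by (simp add: GL_act vec.diff)
  qed
  then show ?thesis using p_elem_iff[OF subgroup.m_closed[OF H ih g]] by blast
qed

lemma p_elem_mult:
  assumes g: "g \<in> H" "p_elem g" and h: "h \<in> H" "p_elem h"
  shows "p_elem (g \<otimes>\<^bsub>GL\<^esub> h)"
proof -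
  have "(g \<otimes>\<^bsub>GL\<^esub> h) *v vs i - vs i \<in> vec.span (vs ` {..<i})" if i: "i < CARD('n)" for i
  proof -
    have "g *v (h *v vs i - vs i) + (g *v vs i - vs i) \<in> vec.span (vs ` {..<i})"
      using g h p_elem_iff stab[OF i g(1)] i by (intro vec.span_add) auto
    then show ?thesis by (simp add: GL_act vec.diff)
  qed
  then show ?thesis using p_elem_iff[OF subgroup.m_closed[OF H g(1) h(1)]] by blast
qed

lemma p_elem_subgroup: "subgroup {h \<in> H. p_elem h} GL"
proof (rule GL.subgroupI)
  show "{h \<in> H. p_elem h} \<subseteq> carrier GL" using Hc by blast
  have "p_elem \<one>\<^bsub>GL\<^esub>" unfolding p_elem_def by simp
  then show "{h \<in> H. p_elem h} \<noteq> {}" using subgroup.one_closed[OF H] by blast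
  fix a assume a: "a \<in> {h \<in> H. p_elem h}"
  then obtain k :: nat where k: "a [^]\<^bsub>GL\<^esub> (CHAR('k) ^ k) = \<one>\<^bsub>GL\<^esub>" unfolding p_elem_def by blast
  have "(inv\<^bsub>GL\<^esub> a) [^]\<^bsub>GL\<^esub> (CHAR('k) ^ k) = \<one>\<^bsub>GL\<^esub>" using k Hc a by (simp add: GL.nat_pow_inv)
  then have "p_elem (inv\<^bsub>GL\<^esub> a)" unfolding p_elem_def using Hc a by blast
  then show "inv\<^bsub>GL\<^esub> a \<in> {h \<in> H. p_elem h}" using subgroup.m_inv_closed[OF H] a by blast
  fix b assume b: "b \<in> {h \<in> H. p_elem h}"
  then show "a \<otimes>\<^bsub>GL\<^esub> b \<in> {h \<in> H. p_elem h}" using a p_elem_mult subgroup.m_closed[OF H] by blast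
qed

text \<open>Both \<open>a\<close> and \<open>b\<close> act on the quotient lines of the flag by
  scalars, which commute.\<close>

lemma p_elem_commutator:
  assumes a: "a \<in> H" and b: "b \<in> H"
  shows "p_elem (inv\<^bsub>GL\<^esub> (b \<otimes>\<^bsub>GL\<^esub> a) \<otimes>\<^bsub>GL\<^esub> (a \<otimes>\<^bsub>GL\<^esub> b))"
proof (rule p_elem_quotient)
  show "a \<otimes>\<^bsub>GL\<^esub> b \<in> H" "b \<otimes>\<^bsub>GL\<^esub> a \<in> H" using subgroup.m_closed[OF H] a b by blast+
  fix i assume i: "i < CARD('n)"
  obtain c where c: "a *v vs i - c *s vs i \<in> vec.span (vs ` {..<i})" using f a i unfolding flag_def by blast
  obtain e where e: "b *v vs i - e *s vs i \<in> vec.span (vs ` {..<i})" using f b i unfolding flag_def by blast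
  have "(a *v (b *v vs i - e *s vs i) + e *s (a *v vs i - c *s vs i))
      - (b *v (a *v vs i - c *s vs i) + c *s (b *v vs i - e *s vs i)) \<in> vec.span (vs ` {..<i})"
    by (intro vec.span_diff vec.span_add vec.span_scale stab i a b c e)
  then show "(a \<otimes>\<^bsub>GL\<^esub> b) *v vs i - (b \<otimes>\<^bsub>GL\<^esub> a) *v vs i \<in> vec.span (vs ` {..<i})"
    by (simp add: GL_act vec.diff vec.scale vec.scale_right_diff_distrib mult.commute[of e c])
qed

end

subsection \<open>Semisimple and p-elements\<close>

lemma (in group) pow_conj:
  assumes "y \<in> carrier G" "x \<in> carrier G"
  shows "(y \<otimes> x \<otimes> inv y) [^] (k::nat) = y \<otimes> x [^] k \<otimes> inv y"
proof (induction k)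
  case (Suc k)
  have "inv y \<otimes> (y \<otimes> (x \<otimes> inv y)) = x \<otimes> inv y" using assms by (simp flip: m_assoc)
  then show ?case using Suc assms by (simp add: m_assoc)
qed (use assms in simp)

lemma (in group) nat_pow_one_plus:
  assumes "x \<in> carrier G" "x [^] (m::nat) = \<one>"
  shows "x [^] (1 + m * t) = x"
proof -
  have "x [^] (1 + m * t) = x [^] (1::nat) \<otimes> x [^] (m * t)" by (rule nat_pow_mult[OF assms(1), symmetric])
  also have "x [^] (m * t) = (x [^] m) [^] t" by (rule nat_pow_pow[OF assms(1), symmetric])
  finally show ?thesis using assms by simp
qed

text \<open>The map \<open>(y, c) \<mapsto> s\<inverse> y s c y\<inverse>\<close> from \<open>P \<times> C\<^sub>P(s)\<close> to \<open>P\<close> has fibres of size at most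
  \<open>\<bar>C\<^sub>P(s)\<bar>\<close>, as the \<open>e\<close>-th power of \<open>y s c y\<inverse>\<close> is \<open>y s y\<inverse>\<close>; hence it is onto.\<close>

lemma (in group) conjugate_in_p_coset:
  fixes e :: nat
  assumes P: "subgroup P G" "finite P" and s: "s \<in> carrier G" "s [^] e = s"
    and norm: "\<And>y. y \<in> P \<Longrightarrow> inv s \<otimes> y \<otimes> s \<in> P" and e: "\<And>c. c \<in> P \<Longrightarrow> c [^] e = \<one>"
    and u: "u \<in> P" "(s \<otimes> u) [^] e = s \<otimes> u"
  shows "\<exists>y\<in>P. y \<otimes> s \<otimes> inv y = s \<otimes> u"
proof -
  define C where "C = {c \<in> P. c \<otimes> s = s \<otimes> c}"
  define f where "f = (\<lambda>(y, c). inv s \<otimes> (y \<otimes> s \<otimes> c \<otimes> inv y))"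
  have Pc: "y \<in> carrier G" if "y \<in> P" for y using subgroup.mem_carrier[OF P(1) that] .
  have Cc: "c \<in> P" "c \<in> carrier G" "c \<otimes> s = s \<otimes> c" if "c \<in> C" for c using that Pc unfolding C_def by auto
  have sf: "s \<otimes> f (y, c) = y \<otimes> s \<otimes> c \<otimes> inv y" if "y \<in> P" "c \<in> C" for y c
    unfolding f_def using that Pc Cc s(1) by (simp add: m_assoc flip: m_assoc[of s "inv s"])
  have pw: "(y \<otimes> s \<otimes> c \<otimes> inv y) [^] e = y \<otimes> s \<otimes> inv y" if y: "y \<in> P" and c: "c \<in> C" for y c
  proof -
    have "(s \<otimes> c) [^] e = s [^] e \<otimes> c [^] e" using pow_mult_distrib[of s c e] Cc[OF c] s(1) by simp
    then have "(s \<otimes> c) [^] e = s" using s e Cc(1)[OF c] by simp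
    then show ?thesis using pow_conj[of y "s \<otimes> c" e] s(1) Cc(2)[OF c] Pc[OF y] by (simp add: m_assoc)
  qed
  have fP: "f (y, c) \<in> P" if y: "y \<in> P" and c: "c \<in> C" for y c
  proof -
    have "inv s \<otimes> (y \<otimes> s \<otimes> c \<otimes> inv y) = (inv s \<otimes> y \<otimes> s) \<otimes> c \<otimes> inv y" using Pc[OF y] Cc(2)[OF c] s(1) by (simp add: m_assoc)
    then show ?thesis unfolding f_def
      using subgroup.m_closed[OF P(1) subgroup.m_closed[OF P(1) norm[OF y] Cc(1)[OF c]] subgroup.m_inv_closed[OF P(1) y]] by simp
  qed
  let ?I = "f ` (P \<times> C)"
  have fin: "finite C" unfolding C_def using P(2) by simp
  have "\<forall>z\<in>?I. \<exists>y\<in>P. \<exists>c\<in>C. f (y, c) = z" by blast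
  then obtain y0 where y0: "\<And>z. z \<in> ?I \<Longrightarrow> y0 z \<in> P" "\<And>z. z \<in> ?I \<Longrightarrow> \<exists>c\<in>C. f (y0 z, c) = z" by metis
  have same: "y \<otimes> s \<otimes> inv y = y' \<otimes> s \<otimes> inv y'" if "y \<in> P" "c \<in> C" "y' \<in> P" "c' \<in> C" "f (y, c) = f (y', c')" for y c y' c'
    using sf[OF that(1,2)] sf[OF that(3,4)] pw[OF that(1,2)] pw[OF that(3,4)] that(5) by simp
  have cen: "inv y' \<otimes> y \<in> C" if y: "y \<in> P" "y' \<in> P" and eq: "y \<otimes> s \<otimes> inv y = y' \<otimes> s \<otimes> inv y'" for y y'
  proof -
    have "inv y' \<otimes> y \<otimes> s = inv y' \<otimes> (y \<otimes> s \<otimes> inv y) \<otimes> y" using y Pc s(1) by (simp add: m_assoc)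
    also have "\<dots> = s \<otimes> (inv y' \<otimes> y)" unfolding eq using y Pc s(1) by (simp add: m_assoc flip: m_assoc[of "inv y'" y'])
    finally show ?thesis unfolding C_def using subgroup.m_closed[OF P(1) subgroup.m_inv_closed[OF P(1) y(2)] y(1)] by simp
  qed
  \<comment> \<open>Injection into image times centraliser: it keeps the value of \<open>f\<close>
    and the position of \<open>y\<close> relative to a chosen preimage. Preimages of one value
    conjugate \<open>s\<close> alike, so they differ by an element of \<open>C\<close>.\<close>
  let ?g = "\<lambda>x. (f x, inv (y0 (f x)) \<otimes> fst x)"
  have "card (P \<times> C) \<le> card (?I \<times> C)"
  proof (rule card_inj_on_le[of ?g])
    show "finite (?I \<times> C)" using P(2) fin by simp
    show "?g ` (P \<times> C) \<subseteq> ?I \<times> C"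
    proof (intro subsetI, elim imageE)
      fix z x assume z: "z = ?g x" and x: "x \<in> P \<times> C"
      then obtain y c where yc: "x = (y, c)" "y \<in> P" "c \<in> C" by blast
      have fI: "f x \<in> ?I" using x by blast
      obtain c0 where "c0 \<in> C" "f (y0 (f x), c0) = f x" using y0(2)[OF fI] by blast
      then have "inv (y0 (f x)) \<otimes> y \<in> C" using same[OF yc(2,3) y0(1)[OF fI]] cen[OF yc(2) y0(1)[OF fI]] yc(1) by simp
      then show "z \<in> ?I \<times> C" using z fI yc(1) by simp
    qed
    show "inj_on ?g (P \<times> C)"
    proof (rule inj_onI)
      fix x x' assume x: "x \<in> P \<times> C" and x': "x' \<in> P \<times> C" and eq: "?g x = ?g x'"
      obtain y c where yc: "x = (y, c)" "y \<in> P" "c \<in> C" using x by blast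
      obtain y' c' where yc': "x' = (y', c')" "y' \<in> P" "c' \<in> C" using x' by blast
      have z: "f x = f x'" "inv (y0 (f x)) \<otimes> y = inv (y0 (f x)) \<otimes> y'" using eq yc(1) yc'(1) by auto
      have "y0 (f x) \<in> carrier G" using y0(1) x Pc by blast
      then have yy: "y = y'" using z(2) Pc yc yc' by simp
      have "y \<otimes> s \<otimes> c \<otimes> inv y = y \<otimes> s \<otimes> c' \<otimes> inv y" using sf[OF yc(2,3)] sf[OF yc'(2,3)] z(1) yc(1) yc'(1) yy by simp
      then have "c = c'" using Pc[OF yc(2)] Cc(2)[OF yc(3)] Cc(2)[OF yc'(3)] s(1) by simp
      then show "x = x'" using yy yc(1) yc'(1) by simp
    qed
  qed
  moreover have "C \<noteq> {}" unfolding C_def using subgroup.one_closed[OF P(1)] s(1) by auto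
  then have "card C > 0" using fin by (simp add: card_gt_0_iff)
  ultimately have "card P \<le> card ?I" by (simp add: card_cartesian_product)
  moreover have "?I \<subseteq> P" using fP by auto
  ultimately have "?I = P" using P(2) by (simp add: card_seteq)
  then obtain y c where yc: "y \<in> P" "c \<in> C" "u = f (y, c)" using u(1) by blast
  have "s \<otimes> u = (y \<otimes> s \<otimes> c \<otimes> inv y) [^] e" using u(2) sf[OF yc(1,2)] yc(3) by simp
  then show ?thesis using pw[OF yc(1,2)] yc(1) by auto
qed

text \<open>Raising to the power \<open>q\<close> leaves elements of order dividing \<open>m\<close>
  alone and kills those whose order divides \<open>q\<close>; one exponent separates the two
  parts.\<close>

lemma p_power_exponent:
  fixes p m k :: nat
  assumes "coprime p m" "m > 0" "p > 1"
  obtains q t where "q = p ^ (k * totient m)" "q = 1 + m * t"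
proof -
  have "[p ^ totient m = 1] (mod m)" using assms(1) by (rule euler_theorem)
  then have "[(p ^ totient m) ^ k = 1 ^ k] (mod m)" by (rule cong_pow)
  then have "[p ^ (k * totient m) = 1] (mod m)" by (simp add: mult.commute flip: power_mult)
  moreover have "1 \<le> p ^ (k * totient m)" using assms(3) by simp
  ultimately obtain t where "p ^ (k * totient m) = 1 + m * t"
    by (metis cong_to_1_nat dvdE le_add_diff_inverse)
  then show thesis using that by blast
qed

lemma coprime_CHAR_iff: "prime CHAR('k::field) \<Longrightarrow> of_nat m \<noteq> (0 :: 'k) \<longleftrightarrow> coprime CHAR('k) m"
  unfolding of_nat_eq_0_iff_char_dvd by (metis coprime_absorb_left not_prime_unit prime_imp_coprime)

lemma ss_elemD:
  fixes s :: "'k::field ^ 'n ^ 'n"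
  assumes "ss_elem s" "prime CHAR('k)"
  obtains m :: nat where "m > 0" "coprime CHAR('k) m" "s [^]\<^bsub>GL\<^esub> m = \<one>\<^bsub>GL\<^esub>" "s \<in> carrier GL"
  using assms coprime_CHAR_iff unfolding ss_elem_def by blast

lemma ss_elemI:
  fixes s :: "'k::field ^ 'n ^ 'n"
  assumes "s \<in> carrier GL" "m > 0" "coprime CHAR('k) m" "s [^]\<^bsub>GL\<^esub> (m::nat) = \<one>\<^bsub>GL\<^esub>" "prime CHAR('k)"
  shows "ss_elem s"
  using assms coprime_CHAR_iff unfolding ss_elem_def by blast

lemma p_ss_elem_one:
  fixes s :: "'k::field ^ 'n ^ 'n"
  assumes "p_elem s" "ss_elem s" "prime CHAR('k)"
  shows "s = \<one>\<^bsub>GL\<^esub>"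
proof -
  obtain m :: nat where m: "coprime CHAR('k) m" "s [^]\<^bsub>GL\<^esub> m = \<one>\<^bsub>GL\<^esub>" "s \<in> carrier GL" by (rule ss_elemD[OF assms(2,3)])
  obtain k :: nat where k: "s [^]\<^bsub>GL\<^esub> (CHAR('k) ^ k) = \<one>\<^bsub>GL\<^esub>" using assms(1) unfolding p_elem_def by blast
  have "GL.ord s dvd m" "GL.ord s dvd CHAR('k) ^ k" using m(2) k GL.pow_eq_id[OF m(3)] by blast+
  moreover have "coprime (CHAR('k) ^ k) m" using m(1) by simp
  ultimately have "GL.ord s = 1" using coprime_common_divisor_nat by blast
  then show ?thesis using GL.pow_ord_eq_1[OF m(3)] m(3) by simp
qed

lemma ss_elem_mult:
  fixes s t :: "'k::field ^ 'n ^ 'n"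
  assumes p: "prime CHAR('k)" and st: "ss_elem s" "ss_elem t" "s ** t = t ** s"
  shows "ss_elem (s \<otimes>\<^bsub>GL\<^esub> t)"
proof -
  obtain m :: nat where m: "m > 0" "coprime CHAR('k) m" "s [^]\<^bsub>GL\<^esub> m = \<one>\<^bsub>GL\<^esub>" "s \<in> carrier GL" by (rule ss_elemD[OF st(1) p])
  obtain l :: nat where l: "l > 0" "coprime CHAR('k) l" "t [^]\<^bsub>GL\<^esub> l = \<one>\<^bsub>GL\<^esub>" "t \<in> carrier GL" by (rule ss_elemD[OF st(2) p])
  have "(s \<otimes>\<^bsub>GL\<^esub> t) [^]\<^bsub>GL\<^esub> (m * l) = s [^]\<^bsub>GL\<^esub> (m * l) \<otimes>\<^bsub>GL\<^esub> t [^]\<^bsub>GL\<^esub> (l * m)"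
    using GL.pow_mult_distrib[of s t "m * l"] st(3) m(4) l(4) by (simp add: GL_mult mult.commute)
  also have "s [^]\<^bsub>GL\<^esub> (m * l) = \<one>\<^bsub>GL\<^esub>"
    unfolding GL.nat_pow_pow[OF m(4), symmetric] m(3) by (rule GL.nat_pow_one)
  also have "t [^]\<^bsub>GL\<^esub> (l * m) = \<one>\<^bsub>GL\<^esub>"
    unfolding GL.nat_pow_pow[OF l(4), symmetric] l(3) by (rule GL.nat_pow_one)
  also have "\<one>\<^bsub>GL\<^esub> \<otimes>\<^bsub>GL\<^esub> \<one>\<^bsub>GL\<^esub> = (\<one>\<^bsub>GL\<^esub> :: 'k ^ 'n ^ 'n)" by simp
  finally show ?thesis using m l by (intro ss_elemI[OF _ _ _ _ p, of _ "m * l"]) auto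
qed

lemma ss_elem_inv:
  assumes "ss_elem s" shows "ss_elem (inv\<^bsub>GL\<^esub> s)"
  using assms GL.nat_pow_inv[of s] unfolding ss_elem_def by auto

lemma GL_subgroup_pow: "subgroup H GL \<Longrightarrow> h \<in> H \<Longrightarrow> h [^]\<^bsub>GL\<^esub> (k::nat) \<in> H"
  by (induction k) (auto intro: subgroup.one_closed subgroup.m_closed)

text \<open>The Jordan decomposition inside the cyclic group of \<open>z\<close>: for a suitable
  exponent \<open>q\<close>, \<open>z ^ q\<close> has order prime to \<open>p\<close> and is fixed
  by raising to the power \<open>q\<close>, so \<open>z\<close> times its inverse is killed by
  \<open>q\<close>.\<close>

lemma p_ss_decomposition:
  fixes z :: "'k::field ^ 'n ^ 'n"
  assumes p: "prime CHAR('k)" and z: "z \<in> carrier GL" and N: "N > 0" "z [^]\<^bsub>GL\<^esub> (N::nat) = \<one>\<^bsub>GL\<^esub>"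
  shows "\<exists>q::nat. ss_elem (z [^]\<^bsub>GL\<^esub> q) \<and> p_elem (z \<otimes>\<^bsub>GL\<^esub> inv\<^bsub>GL\<^esub> (z [^]\<^bsub>GL\<^esub> q))"
proof -
  obtain a m where m: "N = CHAR('k) ^ a * m" "coprime CHAR('k) m" "m > 0" by (rule nat_p_part[OF N(1) p])
  obtain q t where q: "q = CHAR('k) ^ (a * totient m)" "q = 1 + m * t"
    by (rule p_power_exponent[OF m(2,3) prime_gt_1_nat[OF p]])
  have "totient m = Suc (totient m - 1)" using m(3) by simp
  then have qa: "q = CHAR('k) ^ a * CHAR('k) ^ (a * (totient m - 1))" unfolding q(1) by (metis mult_Suc_right power_add)
  let ?s = "z [^]\<^bsub>GL\<^esub> q"
  have "q * m = N * CHAR('k) ^ (a * (totient m - 1))" unfolding qa m(1) by simp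
  then have sm: "?s [^]\<^bsub>GL\<^esub> m = \<one>\<^bsub>GL\<^esub>" using GL.nat_pow_pow[OF z, of q m] GL.nat_pow_pow[OF z, of N] N(2) by simp
  have sc: "?s \<in> carrier GL" using z by simp
  have sq: "?s [^]\<^bsub>GL\<^esub> q = ?s" using GL.nat_pow_one_plus[OF sc sm, of t] unfolding q(2)[symmetric] .
  have "z \<otimes>\<^bsub>GL\<^esub> ?s = ?s \<otimes>\<^bsub>GL\<^esub> z" using GL.nat_pow_Suc2[OF z, of q] by simp
  then have "z \<otimes>\<^bsub>GL\<^esub> inv\<^bsub>GL\<^esub> ?s = inv\<^bsub>GL\<^esub> ?s \<otimes>\<^bsub>GL\<^esub> z"
    by (metis GL.inv_closed GL.inv_solve_left GL.inv_solve_right GL.m_assoc GL.m_closed sc z)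
  then have "(z \<otimes>\<^bsub>GL\<^esub> inv\<^bsub>GL\<^esub> ?s) [^]\<^bsub>GL\<^esub> q = ?s \<otimes>\<^bsub>GL\<^esub> (inv\<^bsub>GL\<^esub> ?s) [^]\<^bsub>GL\<^esub> q"
    using z sc by (intro GL.pow_mult_distrib) auto
  also have "\<dots> = \<one>\<^bsub>GL\<^esub>" unfolding GL.nat_pow_inv[OF sc] sq using sc by simp
  finally have "p_elem (z \<otimes>\<^bsub>GL\<^esub> inv\<^bsub>GL\<^esub> ?s)" unfolding p_elem_def q(1) using z by auto
  then show ?thesis using ss_elemI[OF sc m(3,2) sm p] by blast
qed

no_notation Matrix.vec_index (infixl \<open>$\<close> 100)
unbundle no fps_syntax

subsection \<open>Decomposition of connected solvable groups\<close>

context full_flag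
begin

text \<open>Commutators in \<open>H\<close> have \<open>p\<close>-power order, so the conjugate of
  \<open>s\<close> by \<open>b\<close> lies in the coset \<open>s P\<close> for a finite
  \<open>p\<close>-group \<open>P\<close>. There it is conjugate to \<open>s\<close> by some
  \<open>y\<close> in \<open>P\<close>, and \<open>y^-1 b\<close> centralises \<open>s\<close>. A
  finite subgroup containing \<open>s\<close> and \<open>b\<close> makes the counting
  possible.\<close>

lemma centralize_one:
  assumes loc: "\<And>s b. s \<in> H \<Longrightarrow> b \<in> H \<Longrightarrow> \<exists>\<Gamma>. finite \<Gamma> \<and> subgroup \<Gamma> GL \<and> {s, b} \<subseteq> \<Gamma>"
    and C: "subgroup C GL" "C \<subseteq> H" and s: "s \<in> C" "ss_elem s" and b: "b \<in> C"
  shows "\<exists>y\<in>C. p_elem y \<and> (inv\<^bsub>GL\<^esub> y \<otimes>\<^bsub>GL\<^esub> b) ** s = s ** (inv\<^bsub>GL\<^esub> y \<otimes>\<^bsub>GL\<^esub> b)"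
proof -
  obtain \<Gamma> where G: "finite \<Gamma>" "subgroup \<Gamma> GL" "s \<in> \<Gamma>" "b \<in> \<Gamma>" using loc[of s b] s(1) b C(2) by blast
  have sc: "s \<in> carrier GL" and bc: "b \<in> carrier GL" using s(1) b C(2) Hc by blast+
  define P where "P = \<Gamma> \<inter> (C \<inter> {h \<in> H. p_elem h})"
  have P: "subgroup P GL" unfolding P_def
    by (intro GL.subgroups_Inter_pair G(2) C(1) p_elem_subgroup)
  have finP: "finite P" unfolding P_def using G(1) by simp
  obtain M :: nat where M: "M > 0" "coprime CHAR('k) M" "s [^]\<^bsub>GL\<^esub> M = \<one>\<^bsub>GL\<^esub>" by (rule ss_elemD[OF s(2) p])
  have "\<forall>c\<in>P. \<exists>k::nat. c [^]\<^bsub>GL\<^esub> (CHAR('k) ^ k) = \<one>\<^bsub>GL\<^esub>" unfolding P_def p_elem_def by blast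
  then obtain k :: "'k ^ 'n ^ 'n \<Rightarrow> nat" where k: "\<And>c. c \<in> P \<Longrightarrow> c [^]\<^bsub>GL\<^esub> (CHAR('k) ^ k c) = \<one>\<^bsub>GL\<^esub>" by metis
  \<comment> \<open>\<open>K\<close> bounds all exponents occurring in the finite group
    \<open>P\<close>, so that the single exponent \<open>e\<close> kills \<open>P\<close> and fixes
    elements of order dividing \<open>M\<close>.\<close>
  define K where "K = (\<Sum>c\<in>P. k c)"
  obtain e t where e: "e = CHAR('k) ^ (K * totient M)" "e = 1 + M * t"
    by (rule p_power_exponent[OF M(2,1) prime_gt_1_nat[OF p]])
  have pow_e: "x [^]\<^bsub>GL\<^esub> e = x" if x: "x \<in> carrier GL" "x [^]\<^bsub>GL\<^esub> M = \<one>\<^bsub>GL\<^esub>" for x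
    using GL.nat_pow_one_plus[OF x, of t] unfolding e(2)[symmetric] .
  have ce: "c [^]\<^bsub>GL\<^esub> e = \<one>\<^bsub>GL\<^esub>" if c: "c \<in> P" for c
  proof -
    have "k c \<le> K" unfolding K_def using finP c by (simp add: member_le_sum)
    moreover have "totient M > 0" using M(1) by simp
    then have "K \<le> K * totient M" by (cases "totient M") auto
    ultimately obtain r where "K * totient M = k c + r" by (metis le_trans le_Suc_ex)
    then have "e = CHAR('k) ^ k c * CHAR('k) ^ r" unfolding e(1) by (simp add: power_add)
    moreover have "c \<in> carrier GL" using subgroup.mem_carrier[OF P c] .
    ultimately show ?thesis using GL.nat_pow_pow[of c "CHAR('k) ^ k c" "CHAR('k) ^ r"] k[OF c] by simp
  qed
  let ?u = "inv\<^bsub>GL\<^esub> s \<otimes>\<^bsub>GL\<^esub> (b \<otimes>\<^bsub>GL\<^esub> s \<otimes>\<^bsub>GL\<^esub> inv\<^bsub>GL\<^esub> b)"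
  have norm: "inv\<^bsub>GL\<^esub> s \<otimes>\<^bsub>GL\<^esub> y \<otimes>\<^bsub>GL\<^esub> s \<in> P" if y: "y \<in> P" for y
  proof -
    have yc: "y \<in> carrier GL" using subgroup.mem_carrier[OF P y] .
    obtain k :: nat where k: "y [^]\<^bsub>GL\<^esub> (CHAR('k) ^ k) = \<one>\<^bsub>GL\<^esub>" using y unfolding P_def p_elem_def by blast
    have "(inv\<^bsub>GL\<^esub> s \<otimes>\<^bsub>GL\<^esub> y \<otimes>\<^bsub>GL\<^esub> s) [^]\<^bsub>GL\<^esub> (CHAR('k) ^ k) = \<one>\<^bsub>GL\<^esub>"
      using GL.pow_conj[of "inv\<^bsub>GL\<^esub> s" y "CHAR('k) ^ k"] sc yc k by simp
    then have "p_elem (inv\<^bsub>GL\<^esub> s \<otimes>\<^bsub>GL\<^esub> y \<otimes>\<^bsub>GL\<^esub> s)" unfolding p_elem_def using sc yc by blast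
    moreover have "inv\<^bsub>GL\<^esub> s \<otimes>\<^bsub>GL\<^esub> y \<otimes>\<^bsub>GL\<^esub> s \<in> L" if "subgroup L GL" "s \<in> L" "y \<in> L" for L
      using that subgroup.m_closed subgroup.m_inv_closed by metis
    ultimately show ?thesis using y G(2,3) C s(1) unfolding P_def by auto
  qed
  have uP: "?u \<in> P"
  proof -
    have ib: "inv\<^bsub>GL\<^esub> b \<in> H" "s \<in> H" using subgroup.m_inv_closed[OF C(1) b] s(1) C(2) by blast+
    have "p_elem (inv\<^bsub>GL\<^esub> (inv\<^bsub>GL\<^esub> b \<otimes>\<^bsub>GL\<^esub> s) \<otimes>\<^bsub>GL\<^esub> (s \<otimes>\<^bsub>GL\<^esub> inv\<^bsub>GL\<^esub> b))"
      by (rule p_elem_commutator[OF ib(2,1)])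
    moreover have "inv\<^bsub>GL\<^esub> (inv\<^bsub>GL\<^esub> b \<otimes>\<^bsub>GL\<^esub> s) \<otimes>\<^bsub>GL\<^esub> (s \<otimes>\<^bsub>GL\<^esub> inv\<^bsub>GL\<^esub> b) = ?u"
      using sc bc by (simp add: GL.inv_mult_group GL.m_assoc)
    moreover have "?u \<in> L" if "subgroup L GL" "s \<in> L" "b \<in> L" for L
      using that subgroup.m_closed subgroup.m_inv_closed by metis
    ultimately show ?thesis using G(2-4) C s(1) b unfolding P_def by auto
  qed
  have su: "s \<otimes>\<^bsub>GL\<^esub> ?u = b \<otimes>\<^bsub>GL\<^esub> s \<otimes>\<^bsub>GL\<^esub> inv\<^bsub>GL\<^esub> b"
    using sc bc by (simp flip: GL.m_assoc[of s "inv\<^bsub>GL\<^esub> s"])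
  have "(b \<otimes>\<^bsub>GL\<^esub> s \<otimes>\<^bsub>GL\<^esub> inv\<^bsub>GL\<^esub> b) [^]\<^bsub>GL\<^esub> M = \<one>\<^bsub>GL\<^esub>" using GL.pow_conj[OF bc sc, of M] M(3) bc by simp
  then have "(s \<otimes>\<^bsub>GL\<^esub> ?u) [^]\<^bsub>GL\<^esub> e = s \<otimes>\<^bsub>GL\<^esub> ?u" unfolding su using sc bc by (intro pow_e) auto
  then obtain y where y: "y \<in> P" "y \<otimes>\<^bsub>GL\<^esub> s \<otimes>\<^bsub>GL\<^esub> inv\<^bsub>GL\<^esub> y = b \<otimes>\<^bsub>GL\<^esub> s \<otimes>\<^bsub>GL\<^esub> inv\<^bsub>GL\<^esub> b"
    using GL.conjugate_in_p_coset[OF P finP sc pow_e[OF sc M(3)] norm ce uP] su by auto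
  have yc: "y \<in> carrier GL" using subgroup.mem_carrier[OF P y(1)] .
  have "inv\<^bsub>GL\<^esub> y \<otimes>\<^bsub>GL\<^esub> b \<otimes>\<^bsub>GL\<^esub> s = inv\<^bsub>GL\<^esub> y \<otimes>\<^bsub>GL\<^esub> (b \<otimes>\<^bsub>GL\<^esub> s \<otimes>\<^bsub>GL\<^esub> inv\<^bsub>GL\<^esub> b) \<otimes>\<^bsub>GL\<^esub> b"
    using yc bc sc by (simp add: GL.m_assoc)
  also have "\<dots> = s \<otimes>\<^bsub>GL\<^esub> (inv\<^bsub>GL\<^esub> y \<otimes>\<^bsub>GL\<^esub> b)"
    unfolding y(2)[symmetric] using yc bc sc by (simp add: GL.m_assoc flip: GL.m_assoc[of "inv\<^bsub>GL\<^esub> y" y])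
  finally show ?thesis using y(1) unfolding P_def GL_mult by blast
qed

text \<open>The elements are treated one by one. The correction for \<open>s\<close> is made inside
  the centraliser \<open>C\<close> of the earlier elements, which contains \<open>s\<close> by
  commutativity, so earlier relations survive.\<close>

lemma centralize_finite:
  assumes loc: "\<And>s b. s \<in> H \<Longrightarrow> b \<in> H \<Longrightarrow> \<exists>\<Gamma>. finite \<Gamma> \<and> subgroup \<Gamma> GL \<and> {s, b} \<subseteq> \<Gamma>"
    and E: "finite E"
  shows "E \<subseteq> H \<Longrightarrow> (\<And>s. s \<in> E \<Longrightarrow> ss_elem s) \<Longrightarrow> (\<And>s t. s \<in> E \<Longrightarrow> t \<in> E \<Longrightarrow> s ** t = t ** s) \<Longrightarrow> b \<in> H \<Longrightarrow>
    \<exists>y\<in>H. p_elem y \<and> (\<forall>s\<in>E. (inv\<^bsub>GL\<^esub> y \<otimes>\<^bsub>GL\<^esub> b) ** s = s ** (inv\<^bsub>GL\<^esub> y \<otimes>\<^bsub>GL\<^esub> b))"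
  using E
proof (induction E rule: finite_induct)
  case empty
  have "p_elem \<one>\<^bsub>GL\<^esub>" unfolding p_elem_def by simp
  then show ?case using subgroup.one_closed[OF H] by blast
next
  case (insert s E)
  then obtain y where y: "y \<in> H" "p_elem y" "\<And>t. t \<in> E \<Longrightarrow> (inv\<^bsub>GL\<^esub> y \<otimes>\<^bsub>GL\<^esub> b) ** t = t ** (inv\<^bsub>GL\<^esub> y \<otimes>\<^bsub>GL\<^esub> b)"
    by blast
  let ?b = "inv\<^bsub>GL\<^esub> y \<otimes>\<^bsub>GL\<^esub> b"
  have bH: "?b \<in> H" using subgroup.m_closed[OF H subgroup.m_inv_closed[OF H y(1)] insert.prems(4)] .
  define C where "C = {x \<in> H. \<forall>t\<in>E. x \<otimes>\<^bsub>GL\<^esub> t = t \<otimes>\<^bsub>GL\<^esub> x}"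
  have Ec: "t \<in> carrier GL" if "t \<in> E" for t using that insert.prems(1) Hc by blast
  have C: "subgroup C GL"
  proof (rule GL.subgroupI)
    show "C \<subseteq> carrier GL" unfolding C_def using Hc by blast
    have "\<one>\<^bsub>GL\<^esub> \<in> C" unfolding C_def using Ec subgroup.one_closed[OF H] by simp
    then show "C \<noteq> {}" by blast
    fix a assume a: "a \<in> C"
    have ac: "a \<in> carrier GL" using a Hc unfolding C_def by blast
    have "inv\<^bsub>GL\<^esub> a \<otimes>\<^bsub>GL\<^esub> t = t \<otimes>\<^bsub>GL\<^esub> inv\<^bsub>GL\<^esub> a" if t: "t \<in> E" for t
    proof -
      have "inv\<^bsub>GL\<^esub> a \<otimes>\<^bsub>GL\<^esub> t = inv\<^bsub>GL\<^esub> a \<otimes>\<^bsub>GL\<^esub> (t \<otimes>\<^bsub>GL\<^esub> a) \<otimes>\<^bsub>GL\<^esub> inv\<^bsub>GL\<^esub> a" using ac Ec[OF t] by (simp add: GL.m_assoc)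
      also have "t \<otimes>\<^bsub>GL\<^esub> a = a \<otimes>\<^bsub>GL\<^esub> t" using a t unfolding C_def by simp
      finally show ?thesis using ac Ec[OF t] by (simp flip: GL.m_assoc)
    qed
    then show "inv\<^bsub>GL\<^esub> a \<in> C" using a subgroup.m_inv_closed[OF H] unfolding C_def by blast
    fix c assume c: "c \<in> C"
    have cc: "c \<in> carrier GL" using c Hc unfolding C_def by blast
    have "a \<otimes>\<^bsub>GL\<^esub> c \<otimes>\<^bsub>GL\<^esub> t = t \<otimes>\<^bsub>GL\<^esub> (a \<otimes>\<^bsub>GL\<^esub> c)" if t: "t \<in> E" for t
    proof -
      have "a \<otimes>\<^bsub>GL\<^esub> c \<otimes>\<^bsub>GL\<^esub> t = a \<otimes>\<^bsub>GL\<^esub> (t \<otimes>\<^bsub>GL\<^esub> c)" using c t ac cc Ec[OF t] unfolding C_def by (simp add: GL.m_assoc)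
      also have "\<dots> = (a \<otimes>\<^bsub>GL\<^esub> t) \<otimes>\<^bsub>GL\<^esub> c" using ac cc Ec[OF t] by (simp add: GL.m_assoc)
      also have "a \<otimes>\<^bsub>GL\<^esub> t = t \<otimes>\<^bsub>GL\<^esub> a" using a t unfolding C_def by simp
      finally show ?thesis using ac cc Ec[OF t] by (simp add: GL.m_assoc)
    qed
    then show "a \<otimes>\<^bsub>GL\<^esub> c \<in> C" using a c subgroup.m_closed[OF H] unfolding C_def by blast
  qed
  have CH: "C \<subseteq> H" unfolding C_def by blast
  have sC: "s \<in> C" unfolding C_def GL_mult using insert.prems(1,3) by blast
  have bC: "?b \<in> C" unfolding C_def using y(3) bH by (simp add: GL_mult)
  obtain y' where y': "y' \<in> C" "p_elem y'" "(inv\<^bsub>GL\<^esub> y' \<otimes>\<^bsub>GL\<^esub> ?b) ** s = s ** (inv\<^bsub>GL\<^esub> y' \<otimes>\<^bsub>GL\<^esub> ?b)"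
    using centralize_one[OF loc C CH sC _ bC] insert.prems(2) by blast
  have "inv\<^bsub>GL\<^esub> y' \<otimes>\<^bsub>GL\<^esub> ?b \<in> C" using subgroup.m_closed[OF C subgroup.m_inv_closed[OF C y'(1)] bC] .
  then have cent: "\<forall>t\<in>insert s E. (inv\<^bsub>GL\<^esub> y' \<otimes>\<^bsub>GL\<^esub> ?b) ** t = t ** (inv\<^bsub>GL\<^esub> y' \<otimes>\<^bsub>GL\<^esub> ?b)"
    using y'(3) unfolding C_def GL_mult by blast
  have y'H: "y' \<in> H" using y'(1) CH by blast
  have eq: "inv\<^bsub>GL\<^esub> y' \<otimes>\<^bsub>GL\<^esub> ?b = inv\<^bsub>GL\<^esub> (y \<otimes>\<^bsub>GL\<^esub> y') \<otimes>\<^bsub>GL\<^esub> b"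
    using Hc[OF y(1)] Hc[OF y'H] Hc[OF insert.prems(4)] by (simp add: GL.inv_mult_group GL.m_assoc)
  show ?case
    by (intro bexI[of _ "y \<otimes>\<^bsub>GL\<^esub> y'"] conjI p_elem_mult[OF y(1,2) y'H y'(2)]
        subgroup.m_closed[OF H y(1) y'H] cent[unfolded eq])
qed

end

text \<open>Matrices, flattened to vectors indexed by pairs, form a finite-dimensional space; so
  \<open>D\<close> contains a basis of its span, and commuting with \<open>b\<close> is a linear
  condition.\<close>

lemma finite_same_centralizer:
  fixes D :: "('k::field ^ 'n ^ 'n) set"
  shows "\<exists>E. finite E \<and> E \<subseteq> D \<and> (\<forall>b. (\<forall>e\<in>E. b ** e = e ** b) \<longrightarrow> (\<forall>d\<in>D. b ** d = d ** b))"
proof -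
  define f :: "'k ^ 'n ^ 'n \<Rightarrow> 'k ^ ('n \<times> 'n)" where "f A = (\<chi> p. A $ fst p $ snd p)" for A
  define g :: "'k ^ ('n \<times> 'n) \<Rightarrow> 'k ^ 'n ^ 'n" where "g v = (\<chi> i j. v $ (i, j))" for v
  have gf: "g (f A) = A" for A unfolding f_def g_def by (simp add: Finite_Cartesian_Product.vec_eq_iff)
  obtain B where B: "B \<subseteq> f ` D" "vec.independent B" "f ` D \<subseteq> vec.span B" by (rule vec.basis_exists[of "f ` D"])
  have fin: "finite (g ` B)" using vec.finiteI_independent[OF B(2)] by simp
  have sub: "g ` B \<subseteq> D" using B(1) gf by auto
  have cen: "b ** d = d ** b" if b: "\<forall>e\<in>g ` B. b ** e = e ** b" and d: "d \<in> D" for b d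
  proof -
    have "vec.span B \<subseteq> {v. b ** g v = g v ** b}"
    proof (rule vec.span_minimal)
      show "B \<subseteq> {v. b ** g v = g v ** b}" using b by blast
      have g0: "g 0 = 0" and gadd: "g (v + w) = g v + g w" for v w unfolding g_def by (simp_all add: Finite_Cartesian_Product.vec_eq_iff)
      have gs: "b ** g (c *s v) = (\<chi> i j. c * (b ** g v) $ i $ j)" "g (c *s v) ** b = (\<chi> i j. c * (g v ** b) $ i $ j)" for c v
        unfolding g_def by (simp_all add: Finite_Cartesian_Product.vec_eq_iff matrix_matrix_mult_def sum_distrib_left mult_ac)
      show "vec.subspace {v. b ** g v = g v ** b}"
      proof (rule vec.subspaceI)
        show "0 \<in> {v. b ** g v = g v ** b}" unfolding mem_Collect_eq g0
          by (simp add: matrix_matrix_mult_def Finite_Cartesian_Product.vec_eq_iff)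
        show "v + w \<in> {v. b ** g v = g v ** b}" if "v \<in> {v. b ** g v = g v ** b}" "w \<in> {v. b ** g v = g v ** b}" for v w
          using that unfolding mem_Collect_eq gadd
            Finite_Cartesian_Product.vec_eq_iff matrix_matrix_mult_def
          by (simp add: distrib_left distrib_right sum.distrib)
        show "c *s v \<in> {v. b ** g v = g v ** b}" if "v \<in> {v. b ** g v = g v ** b}" for c v
          using that unfolding mem_Collect_eq gs by (simp only:)
      qed
    qed
    then show ?thesis using B(3) d gf by force
  qed
  show ?thesis by (intro exI[of _ "g ` B"] conjI allI impI ballI fin sub) (rule cen)
qed

lemma matrix_eq_on_basis:
  fixes A B P :: "'k::field ^ 'n ^ 'n"
  assumes P: "P \<in> carrier GL" and eq: "\<And>j. A *v (P *v axis j 1) = B *v (P *v axis j 1)"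
  shows "A = B"
proof -
  have col: "(M *v axis j 1) $ i = M $ i $ j" for M :: "'k ^ 'n ^ 'n" and i j
    by (simp add: matrix_vector_mult_def axis_def if_distrib cong: if_cong)
  have "(A ** P) $ i $ j = (B ** P) $ i $ j" for i j :: 'n
    using eq[of j] unfolding matrix_vector_mul_assoc by (simp flip: col)
  then have AB: "A ** P = B ** P" by (simp add: Finite_Cartesian_Product.vec_eq_iff)
  have "P ** inv\<^bsub>GL\<^esub> P = mat 1" using GL.r_inv[OF P] by (simp add: GL_mult GL_one)
  then show ?thesis using arg_cong[OF AB, of "\<lambda>M. M ** inv\<^bsub>GL\<^esub> P"] by (simp flip: matrix_mul_assoc)
qed

text \<open>For \<open>N = p^a m\<close> the eigenvalues are \<open>N\<close>-th roots of unity,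
  hence \<open>m\<close>-th roots as \<open>p\<close>-power roots are trivial; so the
  \<open>m\<close>-th power fixes a basis.\<close>

lemma ss_elem_diagonal:
  fixes A P :: "'k::field ^ 'n ^ 'n"
  assumes p: "prime CHAR('k)" and A: "A \<in> carrier GL" and P: "P \<in> carrier GL"
    and N: "N > 0" "A [^]\<^bsub>GL\<^esub> (N::nat) = \<one>\<^bsub>GL\<^esub>"
    and d: "\<And>j. \<exists>c. A *v (P *v axis j 1) = c *s (P *v axis j 1)"
  shows "ss_elem A"
proof -
  obtain a m where m: "N = CHAR('k) ^ a * m" "coprime CHAR('k) m" "m > 0" by (rule nat_p_part[OF N(1) p])
  have "(A [^]\<^bsub>GL\<^esub> m) *v (P *v axis j 1) = P *v axis j 1" for j
  proof -
    obtain c where c: "A *v (P *v axis j 1) = c *s (P *v axis j 1)" using d by blast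
    have pow: "(A [^]\<^bsub>GL\<^esub> k) *v (P *v axis j 1) = c ^ k *s (P *v axis j 1)" for k :: nat
    proof (induction k)
      case (Suc k)
      show ?case unfolding GL_pow_act'[OF A] Suc by (simp add: vec.scale c vec.scale_scale mult.commute)
    qed simp
    have nz: "P *v axis j 1 \<noteq> 0"
    proof
      assume "P *v axis j 1 = 0"
      then have "(inv\<^bsub>GL\<^esub> P) *v (P *v axis j 1) = 0" by simp
      then show False using P by simp
    qed
    have "(c ^ N - 1) *s (P *v axis j 1) = 0" using pow[of N] N(2) by (simp add: vec.scale_left_diff_distrib)
    then have "c ^ N = 1" using nz by simp
    then have "(c ^ m) ^ (CHAR('k) ^ a) = 1" unfolding m(1) by (simp add: mult.commute flip: power_mult)
    then have "c ^ m = 1" by (rule freshman_root[OF p])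
    then show ?thesis using pow[of m] by simp
  qed
  then have "A [^]\<^bsub>GL\<^esub> m = \<one>\<^bsub>GL\<^esub>" by (intro matrix_eq_on_basis[OF P]) simp
  then show ?thesis using ss_elemI[OF A m(3,2) _ p] by blast
qed

lemma diagonal_eigen_iff:
  fixes A Q :: "'k::field ^ 'n ^ 'n"
  assumes Q: "Q \<in> carrier GL"
  shows "(\<forall>i j. i \<noteq> j \<longrightarrow> (Q ** A ** inv\<^bsub>GL\<^esub> Q) $ i $ j = 0) \<longleftrightarrow>
    (\<forall>j. \<exists>c. A *v ((inv\<^bsub>GL\<^esub> Q) *v axis j 1) = c *s ((inv\<^bsub>GL\<^esub> Q) *v axis j 1))"
proof -
  have col: "(M *v axis j 1) $ i = M $ i $ j" for M :: "'k ^ 'n ^ 'n" and i j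
    by (simp add: matrix_vector_mult_def axis_def if_distrib cong: if_cong)
  have act: "(Q ** A ** inv\<^bsub>GL\<^esub> Q) *v axis j 1 = Q *v (A *v ((inv\<^bsub>GL\<^esub> Q) *v axis j 1))" for j
    by (simp flip: matrix_vector_mul_assoc)
  show ?thesis
  proof (intro iffI allI impI)
    fix j assume d: "\<forall>i j. i \<noteq> j \<longrightarrow> (Q ** A ** inv\<^bsub>GL\<^esub> Q) $ i $ j = 0"
    define c where "c = (Q ** A ** inv\<^bsub>GL\<^esub> Q) $ j $ j"
    have "(Q ** A ** inv\<^bsub>GL\<^esub> Q) *v axis j 1 = c *s axis j 1"
      using d unfolding Finite_Cartesian_Product.vec_eq_iff col by (auto simp: c_def axis_def)
    then have "(inv\<^bsub>GL\<^esub> Q) *v (Q *v (A *v ((inv\<^bsub>GL\<^esub> Q) *v axis j 1))) = (inv\<^bsub>GL\<^esub> Q) *v (c *s axis j 1)"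
      unfolding act by simp
    then show "\<exists>c. A *v ((inv\<^bsub>GL\<^esub> Q) *v axis j 1) = c *s ((inv\<^bsub>GL\<^esub> Q) *v axis j 1)"
      using Q by (auto simp: vec.scale)
  next
    fix i j :: 'n assume "\<forall>j. \<exists>c. A *v ((inv\<^bsub>GL\<^esub> Q) *v axis j 1) = c *s ((inv\<^bsub>GL\<^esub> Q) *v axis j 1)" and ij: "i \<noteq> j"
    then obtain c where c: "A *v ((inv\<^bsub>GL\<^esub> Q) *v axis j 1) = c *s ((inv\<^bsub>GL\<^esub> Q) *v axis j 1)" by blast
    have "(Q ** A ** inv\<^bsub>GL\<^esub> Q) *v axis j 1 = c *s axis j 1" unfolding act c using Q by (simp add: vec.scale)
    then have "((Q ** A ** inv\<^bsub>GL\<^esub> Q) *v axis j 1) $ i = 0" using ij by (simp add: axis_def)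
    then show "(Q ** A ** inv\<^bsub>GL\<^esub> Q) $ i $ j = 0" unfolding col .
  qed
qed

lemma zariski_closed_Int:
  assumes "zariski_closed C" "zariski_closed D" shows "zariski_closed (C \<inter> D)"
proof -
  obtain P Q where P: "P \<subseteq> poly_functions" "C = {A \<in> carrier GL. \<forall>f\<in>P. f A = 0}"
    and Q: "Q \<subseteq> poly_functions" "D = {A \<in> carrier GL. \<forall>f\<in>Q. f A = 0}"
    using assms unfolding zariski_closed_def by blast
  have CD: "C \<inter> D = {A \<in> carrier GL. \<forall>f\<in>P \<union> Q. f A = 0}" unfolding P(2) Q(2) by auto
  have PQ: "P \<union> Q \<subseteq> poly_functions" using P(1) Q(1) by simp
  show ?thesis unfolding zariski_closed_def by (rule exI[of _ "P \<union> Q"]) (rule conjI[OF PQ CD])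
qed

lemma zariski_connected_image:
  assumes V: "zariski_connected V" "V \<subseteq> carrier GL" and M: "reg_map M" and im: "M ` V \<subseteq> carrier GL"
  shows "zariski_connected (M ` V)"
proof -
  have pre: "\<exists>C'. zariski_closed C' \<and> (\<forall>A\<in>V. A \<in> C' \<longleftrightarrow> M A \<in> C)" if C: "zariski_closed C" for C
  proof -
    obtain P where P: "P \<subseteq> poly_functions" "C = {A \<in> carrier GL. \<forall>f\<in>P. f A = 0}"
      using C unfolding zariski_closed_def by blast
    have "(\<lambda>f A. f (M A)) ` P \<subseteq> reg_functions" using poly_comp_reg_map[OF M] P(1) by blast
    then have cl: "zariski_closed {A \<in> carrier GL. \<forall>\<phi>\<in>(\<lambda>f A. f (M A)) ` P. \<phi> A = 0}" (is "zariski_closed ?C'")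
      by (rule reg_zero_closed)
    have "\<forall>A\<in>V. A \<in> ?C' \<longleftrightarrow> M A \<in> C" using V(2) im unfolding P(2) by auto
    with cl show ?thesis by (intro exI[of _ ?C'] conjI)
  qed
  show ?thesis
    unfolding zariski_connected_def
  proof
    assume "\<exists>C D. zariski_closed C \<and> zariski_closed D \<and> M ` V \<subseteq> C \<union> D \<and> C \<inter> D \<inter> M ` V = {} \<and>
      C \<inter> M ` V \<noteq> {} \<and> D \<inter> M ` V \<noteq> {}"
    then obtain C D where CD: "zariski_closed C" "zariski_closed D" "M ` V \<subseteq> C \<union> D" "C \<inter> D \<inter> M ` V = {}"
      "C \<inter> M ` V \<noteq> {}" "D \<inter> M ` V \<noteq> {}" by blast
    obtain C' where C': "zariski_closed C'" "\<forall>A\<in>V. A \<in> C' \<longleftrightarrow> M A \<in> C" using pre[OF CD(1)] by blast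
    obtain D' where D': "zariski_closed D'" "\<forall>A\<in>V. A \<in> D' \<longleftrightarrow> M A \<in> D" using pre[OF CD(2)] by blast
    have "V \<subseteq> C'" by (rule zariski_connectedD[OF V(1) C'(1) D'(1)]) (use C' D' CD in blast)+
    then show False using C' CD(4,6) by blast
  qed
qed

lemma (in group) nat_pow_comm_left:
  assumes "x \<in> carrier G" "d \<in> carrier G" "x \<otimes> d = d \<otimes> x"
  shows "x [^] (n::nat) \<otimes> d = d \<otimes> x [^] n"
proof (induction n)
  case (Suc n)
  have "x [^] Suc n \<otimes> d = x [^] n \<otimes> (d \<otimes> x)" using assms by (simp add: m_assoc)
  also have "\<dots> = (x [^] n \<otimes> d) \<otimes> x" using assms by (simp add: m_assoc)
  also have "\<dots> = d \<otimes> x [^] Suc n" unfolding Suc using assms by (simp add: m_assoc)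
  finally show ?case .
qed (use assms in simp)

lemma solvable_derived_series:
  assumes H: "subgroup H GL" and "solvable (GL\<lparr>carrier := H\<rparr>)"
  shows "\<exists>d. (derived GL ^^ d) H = {\<one>\<^bsub>GL\<^esub>}"
proof -
  interpret K: group "GL\<lparr>carrier := H\<rparr>" using GL.subgroup_imp_group[OF H] .
  obtain d where d: "(derived (GL\<lparr>carrier := H\<rparr>) ^^ d) H = {\<one>\<^bsub>GL\<^esub>}"
    using assms(2) K.solvable_iff_trivial_derived_seq by auto
  have "(derived (GL\<lparr>carrier := H\<rparr>) ^^ k) H = (derived GL ^^ k) H \<and> (derived GL ^^ k) H \<subseteq> H" for k
  proof (induction k)
    case (Suc k)
    then have "derived (GL\<lparr>carrier := H\<rparr>) ((derived GL ^^ k) H) = derived GL ((derived GL ^^ k) H)"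
      using GL.derived_consistent[OF _ H] by blast
    moreover have "derived GL ((derived GL ^^ k) H) \<subseteq> H"
      using GL.derived_incl[OF _ H] Suc by blast
    ultimately show ?case using Suc by simp
  qed simp
  then show ?thesis using d by metis
qed

text \<open>A maximal set of commuting semisimple elements containing the torus is the full diagonal part of the
  group in a suitable basis, hence the image of the group under a polynomial map, hence connected, and by
  maximality equal to the torus.\<close>

theorem connected_solvable_decomposition:
  fixes \<G> H T :: "('f::{field,finite} alg_closure ^ 'n ^ 'n) set"
  assumes solv: "closed_connected_solvable H" and HG: "H \<subseteq> \<G>" and T: "maximal_torus \<G> T" "T \<subseteq> H"
  shows "subgroup {h \<in> H. p_elem h} GL"
    and "\<And>b. b \<in> H \<Longrightarrow> \<exists>y\<in>H. \<exists>s\<in>T. p_elem y \<and> b = y \<otimes>\<^bsub>GL\<^esub> s"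
    and "\<And>s. s \<in> T \<Longrightarrow> ss_elem s"
proof -
  have p: "prime CHAR('f alg_closure)" by (simp add: CHAR_prime)
  have H: "subgroup H GL" "zariski_closed H" "zariski_connected H"
    using solv unfolding closed_connected_solvable_def closed_connected_subgroup_def by auto
  have Hc: "h \<in> carrier GL" if "h \<in> H" for h using subgroup.mem_carrier[OF H(1) that] .
  obtain d where d: "(derived GL ^^ d) H = {\<one>\<^bsub>GL\<^esub>}"
    using solvable_derived_series[OF H(1)] solv unfolding closed_connected_solvable_def by blast
  have tor: "\<exists>N::nat. N > 0 \<and> h [^]\<^bsub>GL\<^esub> N = \<one>\<^bsub>GL\<^esub>" if "h \<in> H" for h using GL_torsion[OF Hc[OF that]] .
  have commute: "A ** B = B ** A" if P: "P \<in> carrier GL"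
      and A: "\<And>j. \<exists>c. A *v (P *v axis j 1) = c *s (P *v axis j 1)"
      and B: "\<And>j. \<exists>c. B *v (P *v axis j 1) = c *s (P *v axis j 1)" for A B P :: "'f alg_closure ^ 'n ^ 'n"
  proof (rule matrix_eq_on_basis[OF P])
    fix j
    obtain a where a: "A *v (P *v axis j 1) = a *s (P *v axis j 1)" using A by blast
    obtain b where b: "B *v (P *v axis j 1) = b *s (P *v axis j 1)" using B by blast
    have "A *v (B *v (P *v axis j 1)) = B *v (A *v (P *v axis j 1))"
      unfolding a b vec.scale by (simp add: a b vec.scale_left_commute)
    then show "(A ** B) *v (P *v axis j 1) = (B ** A) *v (P *v axis j 1)" by (simp only: matrix_vector_mul_assoc[symmetric])
  qed
  have "torus T" using T(1) unfolding maximal_torus_def by (rule conjunct1)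
  then have "\<exists>Q0 :: 'f alg_closure ^ 'n ^ 'n. invertible Q0 \<and> (\<forall>A\<in>T. \<forall>i j. i \<noteq> j \<longrightarrow> (Q0 ** A ** matrix_inv Q0) $ i $ j = 0)"
    unfolding torus_def by (rule conjunct2)
  then obtain Q0 :: "'f alg_closure ^ 'n ^ 'n"
    where "invertible Q0 \<and> (\<forall>A\<in>T. \<forall>i j. i \<noteq> j \<longrightarrow> (Q0 ** A ** matrix_inv Q0) $ i $ j = 0)" by (rule exE)
  then have Q0: "invertible Q0" "\<And>A i j. A \<in> T \<Longrightarrow> i \<noteq> j \<Longrightarrow> (Q0 ** A ** matrix_inv Q0) $ i $ j = 0" by simp_all
  have Q0c: "Q0 \<in> carrier GL" using Q0(1) by (simp add: GL_carrier)
  have T_eigen: "\<exists>c. A *v ((inv\<^bsub>GL\<^esub> Q0) *v axis j 1) = c *s ((inv\<^bsub>GL\<^esub> Q0) *v axis j 1)" if "A \<in> T" for A j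
    using diagonal_eigen_iff[OF Q0c, of A] Q0(2)[OF that] unfolding GL_inv_eq[OF Q0c] by blast
  show T_ss: "ss_elem s" if s: "s \<in> T" for s
  proof -
    have sH: "s \<in> H" using s T(2) by blast
    then show ?thesis using tor[OF sH] ss_elem_diagonal[OF p Hc[OF sH] GL.inv_closed[OF Q0c] _ _ T_eigen[OF s]] by blast
  qed
  \<comment> \<open>Bare sets are compared here, without group structure or topology; that a maximal
    one is a closed connected group is proved afterwards.\<close>
  define \<A> where "\<A> = {D. T \<subseteq> D \<and> D \<subseteq> H \<and> (\<forall>d\<in>D. ss_elem d) \<and> (\<forall>d\<in>D. \<forall>e\<in>D. d ** e = e ** d)}"
  have "T \<in> \<A>" unfolding \<A>_def using T(2) T_ss commute[OF GL.inv_closed[OF Q0c] T_eigen T_eigen] by blast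
  moreover have "\<Union>\<C> \<in> \<A>" if ch: "\<C> \<noteq> {}" "subset.chain \<A> \<C>" for \<C>
  proof -
    have sub: "\<C> \<subseteq> \<A>" and cmp: "\<And>x y. x \<in> \<C> \<Longrightarrow> y \<in> \<C> \<Longrightarrow> x \<subseteq> y \<or> y \<subseteq> x"
      using ch(2) unfolding subset_chain_def by auto
    have "d ** e = e ** d" if de: "d \<in> \<Union>\<C>" "e \<in> \<Union>\<C>" for d e
    proof -
      obtain x y where xy: "x \<in> \<C>" "y \<in> \<C>" "d \<in> x" "e \<in> y" using de by blast
      obtain z where "z \<in> \<C>" "d \<in> z" "e \<in> z" using cmp[OF xy(1,2)] xy by blast
      then show ?thesis using sub unfolding \<A>_def by blast
    qed
    moreover have "T \<subseteq> \<Union>\<C>" using ch(1) sub unfolding \<A>_def by blast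
    moreover have "\<Union>\<C> \<subseteq> H" "\<forall>d\<in>\<Union>\<C>. ss_elem d" using sub unfolding \<A>_def by blast+
    ultimately show ?thesis unfolding \<A>_def by blast
  qed
  ultimately have "\<exists>D\<in>\<A>. \<forall>D'\<in>\<A>. D \<subseteq> D' \<longrightarrow> D' = D" by (intro subset_Zorn_nonempty) auto
  then obtain D where DA: "D \<in> \<A>" and Dmax: "\<And>D'. D' \<in> \<A> \<Longrightarrow> D \<subseteq> D' \<Longrightarrow> D' = D" by blast
  have D: "T \<subseteq> D" "D \<subseteq> H" "\<And>d. d \<in> D \<Longrightarrow> ss_elem d" "\<And>d e. d \<in> D \<Longrightarrow> e \<in> D \<Longrightarrow> d ** e = e ** d"
    using DA unfolding \<A>_def by auto
  have inD: "s \<in> D" if s: "s \<in> H" "ss_elem s" "\<And>d. d \<in> D \<Longrightarrow> s ** d = d ** s" for s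
  proof -
    have "insert s D \<in> \<A>" unfolding \<A>_def using D s by auto
    then show ?thesis using Dmax[of "insert s D"] by blast
  qed
  obtain vs where vs: "flag H D vs CARD('n)" using flag_exists[OF H(1,3) d tor D(2,3,4) order_refl] by blast
  interpret fl: full_flag H D vs by (rule full_flag.intro[OF p H(1) vs tor])
  show "subgroup {h \<in> H. p_elem h} GL" by (rule fl.p_elem_subgroup)
  have loc: "\<exists>\<Gamma>. finite \<Gamma> \<and> subgroup \<Gamma> GL \<and> {s, b} \<subseteq> \<Gamma>" if "s \<in> H" "b \<in> H" for s b
  proof -
    have sub: "{s, b} \<subseteq> carrier GL" using that Hc by blast
    show ?thesis by (rule GL_locally_finite[OF _ sub]) (simp, blast)
  qed
  \<comment> \<open>A correction \<open>y\<close> makes \<open>b\<close> commute with all of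
    \<open>D\<close>, through a finite subset with the same centraliser. The part of order prime to
    \<open>p\<close> of the result is a power of it, so commutes with \<open>D\<close> and belongs
    to \<open>D\<close> by maximality; the \<open>p\<close>-part joins \<open>y\<close>.\<close>
  have dec: "\<exists>y\<in>H. \<exists>s\<in>D. p_elem y \<and> b = y \<otimes>\<^bsub>GL\<^esub> s" if b: "b \<in> H" for b
  proof -
    obtain E where E: "finite E" "E \<subseteq> D" "\<And>b. (\<forall>e\<in>E. b ** e = e ** b) \<Longrightarrow> (\<forall>d\<in>D. b ** d = d ** b)"
      using finite_same_centralizer[of D] by blast
    have "\<exists>y\<in>H. p_elem y \<and> (\<forall>s\<in>E. (inv\<^bsub>GL\<^esub> y \<otimes>\<^bsub>GL\<^esub> b) ** s = s ** (inv\<^bsub>GL\<^esub> y \<otimes>\<^bsub>GL\<^esub> b))"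
      by (rule fl.centralize_finite[OF loc E(1)]) (use E(2) D b in blast)+
    then obtain y where y: "y \<in> H" "p_elem y" "\<forall>s\<in>E. (inv\<^bsub>GL\<^esub> y \<otimes>\<^bsub>GL\<^esub> b) ** s = s ** (inv\<^bsub>GL\<^esub> y \<otimes>\<^bsub>GL\<^esub> b)" by blast
    define z where "z = inv\<^bsub>GL\<^esub> y \<otimes>\<^bsub>GL\<^esub> b"
    have zD: "z ** d = d ** z" if "d \<in> D" for d using E(3)[OF y(3)] that unfolding z_def by blast
    have zH: "z \<in> H" unfolding z_def using subgroup.m_closed[OF H(1) subgroup.m_inv_closed[OF H(1) y(1)] b] .
    obtain N :: nat where N: "N > 0" "z [^]\<^bsub>GL\<^esub> N = \<one>\<^bsub>GL\<^esub>" using tor[OF zH] by blast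
    obtain q :: nat where q: "ss_elem (z [^]\<^bsub>GL\<^esub> q)" "p_elem (z \<otimes>\<^bsub>GL\<^esub> inv\<^bsub>GL\<^esub> (z [^]\<^bsub>GL\<^esub> q))"
      using p_ss_decomposition[OF p Hc[OF zH] N] by blast
    let ?s = "z [^]\<^bsub>GL\<^esub> q"
    have sH: "?s \<in> H" by (rule GL_subgroup_pow[OF H(1) zH])
    have "?s ** d = d ** ?s" if "d \<in> D" for d
      using GL.nat_pow_comm_left[OF Hc[OF zH], of d q] zD[OF that] Hc[of d] that D(2) unfolding GL_mult by blast
    then have sD: "?s \<in> D" by (rule inD[OF sH q(1)])
    let ?z = "z \<otimes>\<^bsub>GL\<^esub> inv\<^bsub>GL\<^esub> ?s"
    have zs: "?z \<in> H" using subgroup.m_closed[OF H(1) zH subgroup.m_inv_closed[OF H(1) sH]] .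
    have "b = y \<otimes>\<^bsub>GL\<^esub> z" unfolding z_def using Hc[OF y(1)] Hc[OF b] by (simp flip: GL.m_assoc)
    also have "\<dots> = y \<otimes>\<^bsub>GL\<^esub> ?z \<otimes>\<^bsub>GL\<^esub> ?s" using Hc[OF y(1)] Hc[OF zH] by (simp add: GL.m_assoc)
    finally show ?thesis
      by (intro bexI[of _ "y \<otimes>\<^bsub>GL\<^esub> ?z"] bexI[OF _ sD] conjI fl.p_elem_mult[OF y(1,2) zs q(2)] subgroup.m_closed[OF H(1) y(1) zs])
  qed
  obtain ix :: "'n \<Rightarrow> nat" where ix: "bij_betw ix UNIV {0..<CARD('n)}" using ex_bij_betw_finite_nat[of "UNIV :: 'n set"] by auto
  have ixn: "ix j < CARD('n)" for j using bij_betwE[OF ix] by simp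
  have ixs: "\<exists>j. i = ix j" if "i < CARD('n)" for i
    using that bij_betw_imp_surj_on[OF ix] by (metis atLeastLessThan_iff imageE zero_le)
  define P :: "'f alg_closure ^ 'n ^ 'n" where "P = (\<chi> i j. vs (ix j) $ i)"
  have Pv: "P *v axis j 1 = vs (ix j)" for j
    unfolding P_def by (simp add: Finite_Cartesian_Product.vec_eq_iff matrix_vector_mult_def axis_def if_distrib cong: if_cong)
  have "vec.span (vs ` {..<CARD('n)}) \<subseteq> range (\<lambda>x. P *v x)"
  proof (rule vec.span_minimal)
    show "vs ` {..<CARD('n)} \<subseteq> range (\<lambda>x. P *v x)" using ixs Pv by (metis (no_types, lifting) image_subsetI lessThan_iff rangeI)
    show "vec.subspace (range (\<lambda>x. P *v x))"
    proof (rule vec.subspaceI)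
      show "0 \<in> range (\<lambda>x. P *v x)" by (rule range_eqI[of _ _ 0]) simp
      show "x + y \<in> range (\<lambda>x. P *v x)" if xy: "x \<in> range (\<lambda>x. P *v x)" "y \<in> range (\<lambda>x. P *v x)" for x y
      proof -
        obtain a b where "x = P *v a" "y = P *v b" using xy by blast
        then have "x + y = P *v (a + b)" by (simp only: vec.add)
        then show ?thesis by blast
      qed
      show "c *s x \<in> range (\<lambda>x. P *v x)" if x: "x \<in> range (\<lambda>x. P *v x)" for c x
      proof -
        obtain a where "x = P *v a" using x by blast
        then have "c *s x = P *v (c *s a)" by (simp only: vec.scale)
        then show ?thesis by blast
      qed
    qed
  qed
  then have "surj (\<lambda>x. P *v x)" using flag_full[OF vs] by auto
  then obtain B where B: "P ** B = mat 1" using matrix_right_invertible_surjective[of P] by blast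
  have Pc: "P \<in> carrier GL" unfolding GL_carrier invertible_def using B matrix_left_right_inverse1[OF B] by blast
  define Q where "Q = inv\<^bsub>GL\<^esub> P"
  have Qc: "Q \<in> carrier GL" and QP: "inv\<^bsub>GL\<^esub> Q = P" unfolding Q_def using Pc by auto
  have Qv: "Q *v vs (ix j) = axis j 1" for j unfolding Q_def Pv[symmetric] using Pc by simp
  have tri: "(Q *v x) $ j = 0" if x: "x \<in> vec.span (vs ` {..<ix j})" for x j
  proof -
    have "vec.span (vs ` {..<ix j}) \<subseteq> {x. (Q *v x) $ j = 0}"
    proof (rule vec.span_minimal)
      show "vs ` {..<ix j} \<subseteq> {x. (Q *v x) $ j = 0}"
      proof
        fix x assume "x \<in> vs ` {..<ix j}"
        then obtain i where i: "x = vs i" "i < ix j" by blast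
        obtain l where l: "i = ix l" using ixs[OF less_trans[OF i(2) ixn]] by blast
        then have "l \<noteq> j" using i(2) by auto
        then show "x \<in> {x. (Q *v x) $ j = 0}" unfolding i(1) l mem_Collect_eq Qv by (simp add: axis_def)
      qed
      show "vec.subspace {x. (Q *v x) $ j = 0}" by (rule vec.subspaceI) (auto simp: vec.add vec.scale)
    qed
    then show ?thesis using x by blast
  qed
  \<comment> \<open>Taking the diagonal part in the flag basis is a regular map. On a product of a
    \<open>p\<close>-element and an element of \<open>D\<close> it returns the latter, since the
    first is unitriangular.\<close>
  define \<rho> where "\<rho> A = P \<otimes>\<^bsub>GL\<^esub> (\<chi> i j. if i = j then (Q \<otimes>\<^bsub>GL\<^esub> A \<otimes>\<^bsub>GL\<^esub> P) $ i $ j else 0) \<otimes>\<^bsub>GL\<^esub> Q" for A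
  have col: "(M *v axis j 1) $ i = M $ i $ j" for M :: "'f alg_closure ^ 'n ^ 'n" and i j
    by (simp add: matrix_vector_mult_def axis_def if_distrib cong: if_cong)
  have \<rho>v: "\<rho> A *v vs (ix j) = (Q *v (A *v vs (ix j))) $ j *s vs (ix j)" for A j
  proof -
    have e: "(Q \<otimes>\<^bsub>GL\<^esub> A \<otimes>\<^bsub>GL\<^esub> P) $ j $ j = (Q *v (A *v vs (ix j))) $ j"
      unfolding col[symmetric] GL_act Pv ..
    have "(\<chi> i j. if i = j then (Q \<otimes>\<^bsub>GL\<^esub> A \<otimes>\<^bsub>GL\<^esub> P) $ i $ j else 0) *v axis j 1 = (Q *v (A *v vs (ix j))) $ j *s axis j 1"
      unfolding Finite_Cartesian_Product.vec_eq_iff col by (auto simp: e axis_def)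
    then show ?thesis unfolding \<rho>_def GL_act Qv by (simp only: vec.scale Pv)
  qed
  have eqv: "A = B" if "\<And>j. A *v vs (ix j) = B *v vs (ix j)" for A B :: "'f alg_closure ^ 'n ^ 'n"
    by (rule matrix_eq_on_basis[OF Pc]) (simp only: Pv that)
  have \<rho>s: "\<rho> (y \<otimes>\<^bsub>GL\<^esub> s) = s" if y: "y \<in> H" "p_elem y" and s: "s \<in> D" for y s
  proof (rule eqv)
    fix j
    obtain c where c: "s *v vs (ix j) = c *s vs (ix j)" using vs s ixn unfolding flag_def by blast
    have "y *v vs (ix j) - vs (ix j) \<in> vec.span (vs ` {..<ix j})" using fl.p_elem_iff[OF y(1)] y(2) ixn by blast
    then have "(Q *v (y *v vs (ix j) - vs (ix j))) $ j = 0" by (rule tri)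
    then have "(Q *v (y *v vs (ix j))) $ j = 1" by (simp add: vec.diff Qv axis_def)
    then have "(Q *v ((y \<otimes>\<^bsub>GL\<^esub> s) *v vs (ix j))) $ j = c" by (simp add: GL_act c vec.scale)
    then show "\<rho> (y \<otimes>\<^bsub>GL\<^esub> s) *v vs (ix j) = s *v vs (ix j)" unfolding \<rho>v c by simp
  qed
  have one: "\<one>\<^bsub>GL\<^esub> \<in> H" "p_elem (\<one>\<^bsub>GL\<^esub> :: 'f alg_closure ^ 'n ^ 'n)"
    using subgroup.one_closed[OF H(1)] unfolding p_elem_def by auto
  have img: "\<rho> ` H = D"
  proof (intro equalityI subsetI)
    fix x assume "x \<in> \<rho> ` H"
    then obtain b where b: "b \<in> H" "x = \<rho> b" by blast
    then show "x \<in> D" using dec[OF b(1)] \<rho>s by auto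
  next
    fix s assume s: "s \<in> D"
    then have "\<rho> s = s" using \<rho>s[OF one s] Hc D(2) by auto
    then show "s \<in> \<rho> ` H" using s D(2) by (metis image_eqI subsetD)
  qed
  have rm: "reg_map (\<lambda>A. Q \<otimes>\<^bsub>GL\<^esub> A \<otimes>\<^bsub>GL\<^esub> P)" by (intro reg_map_mult reg_map_const reg_map_id)
  have "(\<lambda>A. (\<chi> i j. if i = j then (Q \<otimes>\<^bsub>GL\<^esub> A \<otimes>\<^bsub>GL\<^esub> P) $ i $ j else 0) $ i $ j) \<in> reg_functions" for i j
    using rm reg_const[of 0] unfolding reg_map_def by (cases "i = j") simp_all
  then have "reg_map (\<lambda>A. \<chi> i j. if i = j then (Q \<otimes>\<^bsub>GL\<^esub> A \<otimes>\<^bsub>GL\<^esub> P) $ i $ j else 0)"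
    unfolding reg_map_def by blast
  then have "reg_map \<rho>" unfolding \<rho>_def by (intro reg_map_mult reg_map_const)
  then have conn: "zariski_connected D"
    using zariski_connected_image[OF H(3) subgroup.subset[OF H(1)], of \<rho>] img D(2) subgroup.subset[OF H(1)] by auto
  have D_eigen: "\<exists>c. A *v (P *v axis j 1) = c *s (P *v axis j 1)" if "A \<in> D" for A j
    using vs that ixn unfolding flag_def Pv by blast
  \<comment> \<open>Vanishing of the off-diagonal entries is a closed condition; elements of
    \<open>H\<close> satisfying it are semisimple, being diagonal of finite order, and commute with
    \<open>D\<close>.\<close>
  have Deq: "D = H \<inter> {A \<in> carrier GL. \<forall>\<phi>\<in>(\<lambda>(i, j) A. (Q \<otimes>\<^bsub>GL\<^esub> A \<otimes>\<^bsub>GL\<^esub> P) $ i $ j) ` {(i, j). i \<noteq> j}. \<phi> A = 0}"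
  proof (intro equalityI subsetI)
    fix A assume A: "A \<in> D"
    have "\<forall>i j. i \<noteq> j \<longrightarrow> (Q ** A ** P) $ i $ j = 0"
      using diagonal_eigen_iff[OF Qc, of A] D_eigen[OF A] unfolding QP by blast
    then show "A \<in> H \<inter> {A \<in> carrier GL. \<forall>\<phi>\<in>(\<lambda>(i, j) A. (Q \<otimes>\<^bsub>GL\<^esub> A \<otimes>\<^bsub>GL\<^esub> P) $ i $ j) ` {(i, j). i \<noteq> j}. \<phi> A = 0}"
      using A D(2) Hc by (auto simp: GL_mult)
  next
    fix A assume A: "A \<in> H \<inter> {A \<in> carrier GL. \<forall>\<phi>\<in>(\<lambda>(i, j) A. (Q \<otimes>\<^bsub>GL\<^esub> A \<otimes>\<^bsub>GL\<^esub> P) $ i $ j) ` {(i, j). i \<noteq> j}. \<phi> A = 0}"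
    then have AH: "A \<in> H" by blast
    have "\<forall>i j. i \<noteq> j \<longrightarrow> (Q ** A ** P) $ i $ j = 0" using A by (auto simp: GL_mult)
    then have ev: "\<exists>c. A *v (P *v axis j 1) = c *s (P *v axis j 1)" for j
      using diagonal_eigen_iff[OF Qc, of A] unfolding QP by blast
    have "ss_elem A" using tor[OF AH] ss_elem_diagonal[OF p Hc[OF AH] Pc _ _ ev] by blast
    then show "A \<in> D" by (rule inD[OF AH _ commute[OF Pc ev D_eigen]])
  qed
  have "(\<lambda>(i, j) A. (Q \<otimes>\<^bsub>GL\<^esub> A \<otimes>\<^bsub>GL\<^esub> P) $ i $ j) ` {(i, j). i \<noteq> j} \<subseteq> reg_functions"
    using rm unfolding reg_map_def by auto
  then have closed: "zariski_closed D" by (subst Deq) (intro zariski_closed_Int H(2) reg_zero_closed)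
  have "subgroup D GL"
  proof (rule GL.subgroupI)
    show "D \<subseteq> carrier GL" using D(2) Hc by blast
    have "ss_elem (\<one>\<^bsub>GL\<^esub> :: 'f alg_closure ^ 'n ^ 'n)" unfolding ss_elem_def by (auto intro!: exI[of _ 1])
    then show "D \<noteq> {}" using inD[OF one(1)] by (auto simp: GL_one)
    fix a assume a: "a \<in> D"
    have ic: "inv\<^bsub>GL\<^esub> a ** d = d ** inv\<^bsub>GL\<^esub> a" if "d \<in> D" for d
    proof -
      have "a \<otimes>\<^bsub>GL\<^esub> d = d \<otimes>\<^bsub>GL\<^esub> a" using D(4)[OF a that] by (simp only: GL_mult)
      moreover have "a \<in> carrier GL" "d \<in> carrier GL" using a that D(2) Hc by blast+
      ultimately have "inv\<^bsub>GL\<^esub> a \<otimes>\<^bsub>GL\<^esub> (a \<otimes>\<^bsub>GL\<^esub> d) \<otimes>\<^bsub>GL\<^esub> inv\<^bsub>GL\<^esub> a = inv\<^bsub>GL\<^esub> a \<otimes>\<^bsub>GL\<^esub> (d \<otimes>\<^bsub>GL\<^esub> a) \<otimes>\<^bsub>GL\<^esub> inv\<^bsub>GL\<^esub> a"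
        by simp
      then have "d \<otimes>\<^bsub>GL\<^esub> inv\<^bsub>GL\<^esub> a = inv\<^bsub>GL\<^esub> a \<otimes>\<^bsub>GL\<^esub> d"
        using \<open>a \<in> carrier GL\<close> \<open>d \<in> carrier GL\<close> by (simp add: GL.m_assoc flip: GL.m_assoc[of "inv\<^bsub>GL\<^esub> a" a])
      then show ?thesis by (simp only: GL_mult)
    qed
    have aH: "a \<in> H" using a D(2) by (rule subsetD[rotated])
    show "inv\<^bsub>GL\<^esub> a \<in> D"
      by (rule inD[OF subgroup.m_inv_closed[OF H(1) aH] ss_elem_inv[OF D(3)[OF a]] ic])
    fix b assume b: "b \<in> D"
    have bH: "b \<in> H" using b D(2) by (rule subsetD[rotated])
    have mc: "(a \<otimes>\<^bsub>GL\<^esub> b) ** d = d ** (a \<otimes>\<^bsub>GL\<^esub> b)" if "d \<in> D" for d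
    proof -
      have "(a ** b) ** d = a ** (d ** b)" by (simp only: matrix_mul_assoc[symmetric] D(4)[OF b that])
      also have "\<dots> = (d ** a) ** b" by (simp only: matrix_mul_assoc D(4)[OF a that])
      finally show ?thesis by (simp only: GL_mult matrix_mul_assoc)
    qed
    show "a \<otimes>\<^bsub>GL\<^esub> b \<in> D"
      by (rule inD[OF subgroup.m_closed[OF H(1) aH bH] ss_elem_mult[OF p D(3)[OF a] D(3)[OF b] D(4)[OF a b]] mc])
  qed
  then have ccs: "closed_connected_subgroup D"
    unfolding closed_connected_subgroup_def using closed conn by (intro conjI)
  have inv_Q: "invertible Q" using Qc by (simp only: GL_carrier)
  have diag: "\<forall>A\<in>D. \<forall>i j. i \<noteq> j \<longrightarrow> (Q ** A ** matrix_inv Q) $ i $ j = 0"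
  proof
    fix A assume "A \<in> D"
    then have "\<forall>j. \<exists>c. A *v (P *v axis j 1) = c *s (P *v axis j 1)" using D_eigen by (intro allI)
    then show "\<forall>i j. i \<noteq> j \<longrightarrow> (Q ** A ** matrix_inv Q) $ i $ j = 0"
      using diagonal_eigen_iff[OF Qc, of A] unfolding QP GL_inv_eq[OF Qc, symmetric] by (rule iffD2[rotated])
  qed
  have "torus D" unfolding torus_def by (intro conjI ccs exI[of _ Q] inv_Q diag)
  moreover have "\<forall>T'. torus T' \<and> T \<subseteq> T' \<and> T' \<subseteq> \<G> \<longrightarrow> T' = T"
    using T(1) unfolding maximal_torus_def by (elim conjE)
  ultimately have "D = T" using D(1) subset_trans[OF D(2) HG] by (elim allE[of _ D]) simp
  then show "\<exists>y\<in>H. \<exists>s\<in>T. p_elem y \<and> b = y \<otimes>\<^bsub>GL\<^esub> s" if "b \<in> H" for b using dec[OF that] by simp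
qed

subsection \<open>Finite groups of Lie type\<close>

text \<open>\<open>U \<times> B\<close> maps onto the double coset by \<open>(u, b) \<mapsto> u n b\<close>, with fibres in bijection with
  \<open>U \<inter> n B n\<inverse>\<close>, whose order divides that of the \<open>p\<close>-group \<open>U\<close>.\<close>

lemma (in group) card_double_coset:
  fixes p :: nat
  assumes B: "subgroup B G" "finite B" and U: "subgroup U G" "U \<subseteq> B" and T: "T \<subseteq> B"
    and dec: "\<And>b. b \<in> B \<Longrightarrow> \<exists>u\<in>U. \<exists>t\<in>T. b = u \<otimes> t"
    and n: "n \<in> carrier G" "\<And>t. t \<in> T \<Longrightarrow> \<exists>t'\<in>T. t \<otimes> n = n \<otimes> t'"
    and p: "prime p" "card U = p ^ a"
  shows "\<exists>e. card {b \<otimes> n \<otimes> b' | b b'. b \<in> B \<and> b' \<in> B} = card B * p ^ e"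
proof -
  define X' where "X' = {b \<otimes> n \<otimes> b' | b b'. b \<in> B \<and> b' \<in> B}"
  define K where "K = {u \<in> U. inv n \<otimes> u \<otimes> n \<in> B}"
  have Bc: "b \<in> carrier G" if "b \<in> B" for b using subgroup.mem_carrier[OF B(1) that] .
  have Uc: "u \<in> carrier G" if "u \<in> U" for u using subgroup.mem_carrier[OF U(1) that] .
  have fU: "finite U" using U(2) B(2) finite_subset by blast
  have K: "subgroup K G"
  proof (rule subgroupI)
    show "K \<subseteq> carrier G" unfolding K_def using Uc by blast
    have "\<one> \<in> K" unfolding K_def using subgroup.one_closed[OF U(1)] subgroup.one_closed[OF B(1)] n(1) by simp
    then show "K \<noteq> {}" by blast
    fix a assume a: "a \<in> K"
    then have ac: "a \<in> carrier G" unfolding K_def using Uc by blast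
    have "inv (inv n \<otimes> a \<otimes> n) \<in> B" using a subgroup.m_inv_closed[OF B(1)] unfolding K_def by blast
    then have "inv n \<otimes> inv a \<otimes> n \<in> B" using ac n(1) by (simp add: inv_mult_group m_assoc)
    then show "inv a \<in> K" using a subgroup.m_inv_closed[OF U(1)] unfolding K_def by blast
    fix b assume b: "b \<in> K"
    then have bc: "b \<in> carrier G" unfolding K_def using Uc by blast
    have "(inv n \<otimes> a \<otimes> n) \<otimes> (inv n \<otimes> b \<otimes> n) \<in> B" using a b subgroup.m_closed[OF B(1)] unfolding K_def by blast
    moreover have "(inv n \<otimes> a \<otimes> n) \<otimes> (inv n \<otimes> b \<otimes> n) = inv n \<otimes> (a \<otimes> b) \<otimes> n"
      using ac bc n(1) by (simp add: m_assoc flip: m_assoc[of n "inv n"])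
    ultimately show "a \<otimes> b \<in> K" using a b subgroup.m_closed[OF U(1)] unfolding K_def by simp
  qed
  have Xc: "z \<in> carrier G" if "z \<in> X'" for z using that Bc n(1) unfolding X'_def by auto
  \<comment> \<open>An element of \<open>T\<close> passes through \<open>n\<close> and is absorbed
    by \<open>B\<close> on the right, so the left factor may be taken in \<open>U\<close>.\<close>
  have ex: "\<exists>u\<in>U. inv n \<otimes> (inv u \<otimes> z) \<in> B" if z: "z \<in> X'" for z
  proof -
    obtain b b' where b: "z = b \<otimes> n \<otimes> b'" "b \<in> B" "b' \<in> B" using z unfolding X'_def by blast
    obtain u t where u: "u \<in> U" "t \<in> T" "b = u \<otimes> t" using dec[OF b(2)] by blast
    obtain t' where t': "t' \<in> T" "t \<otimes> n = n \<otimes> t'" using n(2)[OF u(2)] by blast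
    have c: "u \<in> carrier G" "t \<in> carrier G" "t' \<in> carrier G" "b' \<in> carrier G" using u t' b T Uc Bc by blast+
    have "inv n \<otimes> (inv u \<otimes> z) = inv n \<otimes> ((inv u \<otimes> u) \<otimes> (t \<otimes> n) \<otimes> b')"
      unfolding b(1) u(3) using c n(1) by (simp add: m_assoc flip: m_assoc[of "inv u" u])
    also have "\<dots> = (inv n \<otimes> n) \<otimes> t' \<otimes> b'" unfolding t'(2) using c n(1) by (simp add: m_assoc flip: m_assoc[of "inv n" n])
    also have "\<dots> = t' \<otimes> b'" using c n(1) by simp
    finally have e: "inv n \<otimes> (inv u \<otimes> z) = t' \<otimes> b'" .
    have "t' \<in> B" using t'(1) T by blast
    then show ?thesis using subgroup.m_closed[OF B(1) _ b(3)] by (intro bexI[OF _ u(1)]) (simp only: e)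
  qed
  define u0 where "u0 z = (SOME u. u \<in> U \<and> inv n \<otimes> (inv u \<otimes> z) \<in> B)" for z
  have "u0 z \<in> U \<and> inv n \<otimes> (inv (u0 z) \<otimes> z) \<in> B" if "z \<in> X'" for z
    unfolding u0_def by (rule someI_ex) (use ex[OF that] in blast)
  then have u0: "\<And>z. z \<in> X' \<Longrightarrow> u0 z \<in> U" "\<And>z. z \<in> X' \<Longrightarrow> inv n \<otimes> (inv (u0 z) \<otimes> z) \<in> B" by blast+
  have inX: "u \<otimes> n \<otimes> b \<in> X'" if "u \<in> U" "b \<in> B" for u b using that U(2) unfolding X'_def by blast
  let ?f = "\<lambda>(u, b). (u \<otimes> n \<otimes> b, inv (u0 (u \<otimes> n \<otimes> b)) \<otimes> u)"
  let ?g = "\<lambda>(z, k). (u0 z \<otimes> k, inv n \<otimes> (inv (u0 z \<otimes> k) \<otimes> z))"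
  have "bij_betw ?f (U \<times> B) (X' \<times> K)"
  proof (rule bij_betw_byWitness[of _ ?g])
    show "\<forall>x\<in>U \<times> B. ?g (?f x) = x"
    proof
      fix x assume "x \<in> U \<times> B"
      then obtain u b where x: "x = (u, b)" "u \<in> U" "b \<in> B" by blast
      let ?v = "u0 (u \<otimes> n \<otimes> b)"
      have c: "u \<in> carrier G" "b \<in> carrier G" "?v \<in> carrier G" using x Uc Bc u0(1)[OF inX[OF x(2,3)]] by blast+
      have 1: "?v \<otimes> (inv ?v \<otimes> u) = u" using c by (simp flip: m_assoc)
      have 2: "inv n \<otimes> (inv u \<otimes> (u \<otimes> n \<otimes> b)) = b"
        using c n(1) by (simp add: m_assoc[of u] flip: m_assoc[of "inv u" u] m_assoc[of "inv n" n])
      show "?g (?f x) = x" unfolding x(1) by (simp only: prod.case 1 2)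
    qed
    show "\<forall>x\<in>X' \<times> K. ?f (?g x) = x"
    proof
      fix x assume "x \<in> X' \<times> K"
      then obtain z k where x: "x = (z, k)" "z \<in> X'" "k \<in> K" by blast
      have c: "u0 z \<in> carrier G" "k \<in> carrier G" "z \<in> carrier G"
        using x(3) Uc u0(1)[OF x(2)] Xc[OF x(2)] unfolding K_def by blast+
      have cancel: "w \<otimes> n \<otimes> (inv n \<otimes> (inv w \<otimes> z)) = z" if w: "w \<in> carrier G" for w
      proof -
        have "w \<otimes> n \<otimes> (inv n \<otimes> (inv w \<otimes> z)) = w \<otimes> ((n \<otimes> inv n) \<otimes> (inv w \<otimes> z))"
          using w n(1) c by (simp only: m_assoc m_closed inv_closed)
        also have "\<dots> = w \<otimes> (inv w \<otimes> z)" using w n(1) c by simp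
        also have "\<dots> = (w \<otimes> inv w) \<otimes> z" using w c by (simp only: m_assoc m_closed inv_closed)
        finally show ?thesis using w c by simp
      qed
      have 1: "u0 z \<otimes> k \<otimes> n \<otimes> (inv n \<otimes> (inv (u0 z \<otimes> k) \<otimes> z)) = z" using c by (intro cancel) simp
      have 2: "inv (u0 z) \<otimes> (u0 z \<otimes> k) = k" using c by (simp flip: m_assoc)
      show "?f (?g x) = x" unfolding x(1) by (simp only: prod.case 1 2)
    qed
    show "?f ` (U \<times> B) \<subseteq> X' \<times> K"
    proof (intro subsetI, elim imageE)
      fix y x assume y: "y = ?f x" and "x \<in> U \<times> B"
      then obtain u b where x: "x = (u, b)" "u \<in> U" "b \<in> B" by blast
      let ?z = "u \<otimes> n \<otimes> b"
      have z: "?z \<in> X'" by (rule inX[OF x(2,3)])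
      have c: "u \<in> carrier G" "b \<in> carrier G" "u0 ?z \<in> carrier G" using x Uc Bc u0(1)[OF z] by blast+
      have "inv n \<otimes> (inv (u0 ?z) \<otimes> u) \<otimes> n = (inv n \<otimes> (inv (u0 ?z) \<otimes> ?z)) \<otimes> inv b"
        using c n(1) by (simp add: m_assoc)
      then have "inv n \<otimes> (inv (u0 ?z) \<otimes> u) \<otimes> n \<in> B"
        using subgroup.m_closed[OF B(1) u0(2)[OF z] subgroup.m_inv_closed[OF B(1) x(3)]] by simp
      then have "inv (u0 ?z) \<otimes> u \<in> K"
        unfolding K_def using subgroup.m_closed[OF U(1) subgroup.m_inv_closed[OF U(1) u0(1)[OF z]] x(2)] by blast
      then show "y \<in> X' \<times> K" using z unfolding y x(1) by (simp only: prod.case mem_Times_iff fst_conv snd_conv simp_thms)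
    qed
    show "?g ` (X' \<times> K) \<subseteq> U \<times> B"
    proof (intro subsetI, elim imageE)
      fix y x assume y: "y = ?g x" and "x \<in> X' \<times> K"
      then obtain z k where x: "x = (z, k)" "z \<in> X'" "k \<in> K" by blast
      have kU: "k \<in> U" "inv n \<otimes> inv k \<otimes> n \<in> B"
        using x(3) subgroup.m_inv_closed[OF K x(3)] unfolding K_def by blast+
      have c: "u0 z \<in> carrier G" "k \<in> carrier G" "z \<in> carrier G" using kU(1) Uc u0(1)[OF x(2)] Xc[OF x(2)] by blast+
      have "inv n \<otimes> (inv (u0 z \<otimes> k) \<otimes> z) = (inv n \<otimes> inv k \<otimes> n) \<otimes> (inv n \<otimes> (inv (u0 z) \<otimes> z))"
      proof -
        have "(inv n \<otimes> inv k \<otimes> n) \<otimes> (inv n \<otimes> (inv (u0 z) \<otimes> z)) = inv n \<otimes> inv k \<otimes> ((n \<otimes> inv n) \<otimes> (inv (u0 z) \<otimes> z))"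
          using c n(1) by (simp only: m_assoc m_closed inv_closed)
        then show ?thesis using c n(1) by (simp add: inv_mult_group m_assoc)
      qed
      then have "inv n \<otimes> (inv (u0 z \<otimes> k) \<otimes> z) \<in> B" using subgroup.m_closed[OF B(1) kU(2) u0(2)[OF x(2)]] by simp
      moreover have "u0 z \<otimes> k \<in> U" using subgroup.m_closed[OF U(1) u0(1)[OF x(2)] kU(1)] .
      ultimately show "y \<in> U \<times> B" unfolding y x(1) by (simp only: prod.case mem_Times_iff fst_conv snd_conv simp_thms)
    qed
  qed
  then have "card (U \<times> B) = card (X' \<times> K)" by (rule bij_betw_same_card)
  then have cnt: "p ^ a * card B = card X' * card K" by (simp add: card_cartesian_product p(2))
  interpret GU: group "G\<lparr>carrier := U\<rparr>" using subgroup_imp_group[OF U(1)] .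
  have sK: "subgroup K (G\<lparr>carrier := U\<rparr>)" by (rule subgroup_incl[OF K U(1)]) (auto simp: K_def)
  have "card (rcosets\<^bsub>G\<lparr>carrier := U\<rparr>\<^esub> K) * card K = p ^ a"
    using GU.lagrange[OF sK] by (simp add: Coset.order_def p(2))
  then have "card K dvd p ^ a"
    using dvd_triv_right[of "card K" "card (rcosets\<^bsub>G\<lparr>carrier := U\<rparr>\<^esub> K)"] by (simp only:)
  then obtain c where c: "c \<le> a" "card K = p ^ c" using divides_primepow_nat[OF p(1)] by blast
  have "card B * p ^ (a - c) * p ^ c = card X' * p ^ c" using cnt c by (simp add: mult.commute mult.left_commute flip: power_add)
  then have "card X' = card B * p ^ (a - c)" using p(1) by (simp add: prime_gt_0_nat)
  then show ?thesis unfolding X'_def by blast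
qed

context lie_type_datum
begin

lemma G_subgroup: "subgroup \<G> GL"
  using reductive unfolding connected_reductive_def closed_connected_subgroup_def by blast

lemma F_closed: "A \<in> \<G> \<Longrightarrow> F A \<in> \<G>"
  and F_mult: "A \<in> \<G> \<Longrightarrow> B \<in> \<G> \<Longrightarrow> F (A \<otimes>\<^bsub>GL\<^esub> B) = F A \<otimes>\<^bsub>GL\<^esub> F B"
  using steinberg unfolding steinberg_endomorphism_def hom_def by auto

lemma F_one: "F \<one>\<^bsub>GL\<^esub> = \<one>\<^bsub>GL\<^esub>"
proof -
  have o: "\<one>\<^bsub>GL\<^esub> \<in> \<G>" using subgroup.one_closed[OF G_subgroup] .
  then have "F \<one>\<^bsub>GL\<^esub> \<otimes>\<^bsub>GL\<^esub> F \<one>\<^bsub>GL\<^esub> = F \<one>\<^bsub>GL\<^esub>" using F_mult[OF o o] by simp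
  then show ?thesis using subgroup.mem_carrier[OF G_subgroup F_closed[OF o]] GL.r_cancel_one by blast
qed

lemma F_inv:
  assumes A: "A \<in> \<G>" shows "F (inv\<^bsub>GL\<^esub> A) = inv\<^bsub>GL\<^esub> F A"
proof -
  have i: "inv\<^bsub>GL\<^esub> A \<in> \<G>" "A \<in> carrier GL"
    using subgroup.m_inv_closed[OF G_subgroup A] subgroup.mem_carrier[OF G_subgroup A] .
  have "F (inv\<^bsub>GL\<^esub> A) \<otimes>\<^bsub>GL\<^esub> F A = \<one>\<^bsub>GL\<^esub>" unfolding F_mult[OF i(1) A, symmetric] GL.l_inv[OF i(2)] by (rule F_one)
  then show ?thesis
    using GL.inv_equality subgroup.mem_carrier[OF G_subgroup F_closed] A i(1) by metis
qed

lemma F_pow: "A \<in> \<G> \<Longrightarrow> F (A [^]\<^bsub>GL\<^esub> (k::nat)) = F A [^]\<^bsub>GL\<^esub> k"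
  by (induction k) (simp_all add: F_one F_mult GL_subgroup_pow[OF G_subgroup])

lemma fixed_subgroup:
  assumes "subgroup L GL" "L \<subseteq> \<G>" shows "subgroup (fixed_points F L) GL"
proof (rule GL.subgroupI)
  show "fixed_points F L \<subseteq> carrier GL" unfolding fixed_points_def using subgroup.subset[OF assms(1)] by blast
  show "fixed_points F L \<noteq> {}" unfolding fixed_points_def using subgroup.one_closed[OF assms(1)] F_one by blast
  fix a assume "a \<in> fixed_points F L"
  then have a: "a \<in> L" "F a = a" "a \<in> \<G>" unfolding fixed_points_def using assms(2) by auto
  then show "inv\<^bsub>GL\<^esub> a \<in> fixed_points F L"
    unfolding fixed_points_def using F_inv[OF a(3)] subgroup.m_inv_closed[OF assms(1)] by simp
  fix b assume "b \<in> fixed_points F L"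
  then have b: "b \<in> L" "F b = b" "b \<in> \<G>" unfolding fixed_points_def using assms(2) by auto
  then show "a \<otimes>\<^bsub>GL\<^esub> b \<in> fixed_points F L"
    unfolding fixed_points_def using F_mult[OF a(3) b(3)] a subgroup.m_closed[OF assms(1)] by simp
qed

text \<open>In both alternatives of \<open>steinberg_endomorphism\<close> some power of
  \<open>F\<close> agrees with a positive power of Frobenius, which fixes only finitely many
  matrices.\<close>

lemma finite_fixed: "finite (fixed_points F \<G>)"
proof -
  obtain m k where m: "m > 0" "\<And>A. A \<in> \<G> \<Longrightarrow> (F ^^ k) A = (frobenius ^^ m) A"
    using steinberg unfolding steinberg_endomorphism_def by blast
  have "(F ^^ k) A = A" if "F A = A" for A using that by (induction k) auto
  then have "fixed_points F \<G> \<subseteq> {A. (frobenius ^^ m) A = A}" unfolding fixed_points_def using m(2)[symmetric] by auto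
  then show ?thesis using finite_frobenius_fixed[OF m(1)] finite_subset by blast
qed

lemma borel_G: "\<B> \<subseteq> \<G>" and borel_solvable: "closed_connected_solvable \<B>" and borel_subgroup_GL: "subgroup \<B> GL"
  using borel(1) unfolding borel_subgroup_def closed_connected_solvable_def closed_connected_subgroup_def by blast+

lemma torus_subgroup_GL: "subgroup \<T> GL"
  using torus(1) unfolding maximal_torus_def torus_def closed_connected_subgroup_def by blast

text \<open>From \<open>F b = b\<close> it follows that \<open>y^-1 F(y) = t F(t)^-1\<close>. The
  left side has \<open>p\<close>-power order and the right side order prime to \<open>p\<close>, so
  both are trivial and the two factors are fixed separately.\<close>

lemma fixed_borel_decomposition:
  assumes b: "b \<in> fixed_points F \<B>"
  shows "\<exists>y\<in>fixed_points F {h \<in> \<B>. p_elem h}. \<exists>t\<in>fixed_points F \<T>. b = y \<otimes>\<^bsub>GL\<^esub> t"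
proof -
  note sd = connected_solvable_decomposition[OF borel_solvable borel_G torus(1,3)]
  have bB: "b \<in> \<B>" "F b = b" using b unfolding fixed_points_def by auto
  obtain y t where y: "y \<in> \<B>" "t \<in> \<T>" "p_elem y" "b = y \<otimes>\<^bsub>GL\<^esub> t" using sd(2)[OF bB(1)] by blast
  have G: "y \<in> \<G>" "t \<in> \<G>" using y borel_G torus(3) by blast+
  have FyB: "F y \<in> \<B>" and FtT: "F t \<in> \<T>" using y borel(2) torus(2) by blast+
  have c: "y \<in> carrier GL" "t \<in> carrier GL" "F y \<in> carrier GL" "F t \<in> carrier GL"
    using subgroup.mem_carrier[OF G_subgroup] G F_closed by blast+
  obtain k :: nat where k: "y [^]\<^bsub>GL\<^esub> (CHAR('f alg_closure) ^ k) = \<one>\<^bsub>GL\<^esub>" using y(3) unfolding p_elem_def by blast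
  have "F y [^]\<^bsub>GL\<^esub> (CHAR('f alg_closure) ^ k) = \<one>\<^bsub>GL\<^esub>" unfolding F_pow[OF G(1), symmetric] k by (rule F_one)
  then have pF: "p_elem (F y)" unfolding p_elem_def using c(3) by blast
  have eq: "F y \<otimes>\<^bsub>GL\<^esub> F t = y \<otimes>\<^bsub>GL\<^esub> t" using bB(2) y(4) F_mult[OF G] by simp
  have e: "inv\<^bsub>GL\<^esub> y \<otimes>\<^bsub>GL\<^esub> F y = t \<otimes>\<^bsub>GL\<^esub> inv\<^bsub>GL\<^esub> F t"
  proof -
    have "inv\<^bsub>GL\<^esub> y \<otimes>\<^bsub>GL\<^esub> F y = inv\<^bsub>GL\<^esub> y \<otimes>\<^bsub>GL\<^esub> (F y \<otimes>\<^bsub>GL\<^esub> F t) \<otimes>\<^bsub>GL\<^esub> inv\<^bsub>GL\<^esub> F t" using c by (simp add: GL.m_assoc)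
    also have "\<dots> = (inv\<^bsub>GL\<^esub> y \<otimes>\<^bsub>GL\<^esub> y) \<otimes>\<^bsub>GL\<^esub> t \<otimes>\<^bsub>GL\<^esub> inv\<^bsub>GL\<^esub> F t"
      unfolding eq using c by (simp only: GL.m_assoc GL.m_closed GL.inv_closed)
    finally show ?thesis using c by simp
  qed
  have "inv\<^bsub>GL\<^esub> y \<otimes>\<^bsub>GL\<^esub> F y \<in> {h \<in> \<B>. p_elem h}"
    using subgroup.m_closed[OF sd(1) subgroup.m_inv_closed[OF sd(1)]] y(1,3) FyB pF by blast
  moreover have "ss_elem (t \<otimes>\<^bsub>GL\<^esub> inv\<^bsub>GL\<^esub> F t)"
    by (rule sd(3)[OF subgroup.m_closed[OF torus_subgroup_GL y(2) subgroup.m_inv_closed[OF torus_subgroup_GL FtT]]])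
  ultimately have one: "inv\<^bsub>GL\<^esub> y \<otimes>\<^bsub>GL\<^esub> F y = \<one>\<^bsub>GL\<^esub>" unfolding e by (intro p_ss_elem_one) (auto simp: CHAR_prime)
  then have "y \<otimes>\<^bsub>GL\<^esub> (inv\<^bsub>GL\<^esub> y \<otimes>\<^bsub>GL\<^esub> F y) = y" using c by simp
  then have Fy: "F y = y" using c by (simp flip: GL.m_assoc)
  then have "F t = t" using eq c by simp
  then show ?thesis using y Fy unfolding fixed_points_def by blast
qed

end

theorem theorem1p1:
  fixes \<G> \<B> \<T> :: "(('f::{field,finite}) alg_closure ^ 'n ^ 'n) set"
    and F :: "'f alg_closure ^ 'n ^ 'n \<Rightarrow> 'f alg_closure ^ 'n ^ 'n"
    and S :: "('f alg_closure ^ 'n ^ 'n) set set"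
    and \<alpha> :: complex
  assumes "lie_type_datum \<G> F \<B> \<T>"
    and "BN_pair (lie_type_datum.finite_lie_group \<G> F)
           (lie_type_datum.finite_borel F \<B>)
           (lie_type_datum.finite_normalizer \<G> F \<T>) S"
    and "BN_pair.edge_eigenvalue (lie_type_datum.finite_lie_group \<G> F)
           (lie_type_datum.finite_borel F \<B>)
           (lie_type_datum.finite_normalizer \<G> F \<T>) S \<alpha>"
  shows "\<exists>k::nat. k > 0 \<and> (\<exists>j::int. \<alpha> ^ k = of_nat CARD('f) powi j)"
proof -
  interpret L: lie_type_datum \<G> F \<B> \<T> by (rule assms(1))
  let ?G = "L.finite_lie_group" and ?B = "L.finite_borel" and ?N = "L.finite_normalizer"
  have carrier_G: "carrier ?G = fixed_points F \<G>" unfolding L.finite_lie_group_def by simp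
  have fin: "finite (carrier ?G)" unfolding carrier_G by (rule L.finite_fixed)
  interpret finite_BN_pair ?G ?B ?N S
    by (rule finite_BN_pair.intro[OF assms(2) finite_BN_pair_axioms.intro[OF fin]])
  have G_mult: "x \<otimes>\<^bsub>?G\<^esub> y = x \<otimes>\<^bsub>GL\<^esub> y" for x y
    unfolding L.finite_lie_group_def by simp
  let ?p = "CHAR('f)"
  have p: "prime ?p" by (rule CHAR_prime)
  let ?U = "fixed_points F {h \<in> \<B>. p_elem h}"
  note sd = connected_solvable_decomposition[OF L.borel_solvable L.borel_G L.torus(1,3)]
  have U: "subgroup ?U GL" using L.borel_G by (intro L.fixed_subgroup sd(1)) blast
  have B: "subgroup ?B GL" unfolding L.finite_borel_def by (rule L.fixed_subgroup[OF L.borel_subgroup_GL L.borel_G])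
  have BG: "?B \<subseteq> fixed_points F \<G>" unfolding L.finite_borel_def fixed_points_def using L.borel_G by blast
  have fB: "finite ?B" using BG L.finite_fixed finite_subset by blast
  have UB: "?U \<subseteq> ?B" unfolding L.finite_borel_def fixed_points_def by blast
  have TB: "fixed_points F \<T> \<subseteq> ?B" unfolding L.finite_borel_def fixed_points_def using L.torus(3) by blast
  interpret GU: group "GL\<lparr>carrier := ?U\<rparr>" using GL.subgroup_imp_group[OF U] .
  have "\<exists>a. card (carrier (GL\<lparr>carrier := ?U\<rparr>)) = ?p ^ a"
  proof (rule GU.p_group_order[OF _ p])
    show "finite (carrier (GL\<lparr>carrier := ?U\<rparr>))" using fB UB finite_subset by auto
    fix x assume "x \<in> carrier (GL\<lparr>carrier := ?U\<rparr>)"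
    then have "p_elem x" unfolding fixed_points_def by simp
    then show "\<exists>k. x [^]\<^bsub>GL\<lparr>carrier := ?U\<rparr>\<^esub> (?p ^ k) = \<one>\<^bsub>GL\<lparr>carrier := ?U\<rparr>\<^esub>"
      unfolding p_elem_def by (simp flip: GL.nat_pow_consistent)
  qed
  then obtain a where a: "card ?U = ?p ^ a" by auto
  \<comment> \<open>Every element of the Weyl group has a representative \<open>n\<close> fixed by
    \<open>F\<close> and normalising the torus, so the double coset count applies with the
    \<open>F\<close>-fixed points of the torus.\<close>
  have cells: "\<exists>e. card (cell w) = card ?B * ?p ^ e" if w: "w \<in> carrier W" for w
  proof -
    obtain n where n: "n \<in> ?N" "n \<in> w" "w = {t \<otimes>\<^bsub>?G\<^esub> n | t. t \<in> ?B \<inter> ?N}"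
      by (rule weyl_elemE[OF w])
    have nn: "(n \<in> \<G> \<and> (\<lambda>M. n ** M ** matrix_inv n) ` \<T> = \<T>) \<and> F n = n"
      using n(1) unfolding L.finite_normalizer_def fixed_points_def torus_normalizer_def mem_Collect_eq .
    note nN = conjunct1[OF conjunct1[OF nn]] conjunct2[OF nn] conjunct2[OF conjunct1[OF nn]]
    have nc: "n \<in> carrier GL" using subgroup.mem_carrier[OF L.G_subgroup nN(1)] .
    have "cell w = {b \<otimes>\<^bsub>GL\<^esub> n \<otimes>\<^bsub>GL\<^esub> b' | b b'. b \<in> ?B \<and> b' \<in> ?B}"
    proof (intro equalityI subsetI)
      fix g assume "g \<in> cell w"
      then obtain b m b' where g: "b \<in> ?B" "m \<in> w" "b' \<in> ?B" "g = b \<otimes>\<^bsub>GL\<^esub> m \<otimes>\<^bsub>GL\<^esub> b'"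
        unfolding cell_iff G_mult by blast
      obtain t where t: "t \<in> ?B" "m = t \<otimes>\<^bsub>GL\<^esub> n" using g(2) unfolding n(3) G_mult by blast
      have "b \<otimes>\<^bsub>GL\<^esub> m = (b \<otimes>\<^bsub>GL\<^esub> t) \<otimes>\<^bsub>GL\<^esub> n"
        unfolding t(2) using subgroup.mem_carrier[OF B] g(1) t(1) nc by (simp add: GL.m_assoc)
      then show "g \<in> {b \<otimes>\<^bsub>GL\<^esub> n \<otimes>\<^bsub>GL\<^esub> b' | b b'. b \<in> ?B \<and> b' \<in> ?B}"
        using g(3,4) subgroup.m_closed[OF B g(1) t(1)] by auto
    next
      fix g assume "g \<in> {b \<otimes>\<^bsub>GL\<^esub> n \<otimes>\<^bsub>GL\<^esub> b' | b b'. b \<in> ?B \<and> b' \<in> ?B}"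
      then show "g \<in> cell w" unfolding cell_iff G_mult using n(2) by blast
    qed
    moreover have "\<exists>e. card {b \<otimes>\<^bsub>GL\<^esub> n \<otimes>\<^bsub>GL\<^esub> b' | b b'. b \<in> ?B \<and> b' \<in> ?B} = card ?B * ?p ^ e"
    proof (rule GL.card_double_coset[OF B fB U UB TB _ nc _ p a])
      show "\<exists>u\<in>?U. \<exists>t\<in>fixed_points F \<T>. b = u \<otimes>\<^bsub>GL\<^esub> t" if "b \<in> ?B" for b
        using that unfolding L.finite_borel_def by (rule L.fixed_borel_decomposition)
      fix t assume "t \<in> fixed_points F \<T>"
      then have t: "t \<in> \<T>" "F t = t" unfolding fixed_points_def by auto
      have "t \<in> (\<lambda>M. n ** M ** matrix_inv n) ` \<T>" using t(1) by (simp only: nN(3))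
      then obtain t' where t'0: "t = n ** t' ** matrix_inv n" "t' \<in> \<T>" by (rule imageE)
      then have t': "t' \<in> \<T>" "t = n \<otimes>\<^bsub>GL\<^esub> t' \<otimes>\<^bsub>GL\<^esub> inv\<^bsub>GL\<^esub> n"
        unfolding GL_inv_eq[OF nc] GL_mult by (simp_all only:)
      have G: "t' \<in> \<G>" "t \<in> \<G>" "inv\<^bsub>GL\<^esub> n \<in> \<G>"
        using t(1) t'(1) L.torus(3) L.borel_G subgroup.m_inv_closed[OF L.G_subgroup nN(1)] by blast+
      have c: "t' \<in> carrier GL" "t \<in> carrier GL" using G subgroup.mem_carrier[OF L.G_subgroup] by blast+
      have tn: "t \<otimes>\<^bsub>GL\<^esub> n = n \<otimes>\<^bsub>GL\<^esub> t'" unfolding t'(2) using c nc by (simp add: GL.m_assoc)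
      \<comment> \<open>Normalisation descends to fixed points: \<open>F\<close> fixes
        \<open>t\<close> and \<open>n\<close>, hence also \<open>t'\<close>.\<close>
      have "F (t \<otimes>\<^bsub>GL\<^esub> n) = t \<otimes>\<^bsub>GL\<^esub> n" using L.F_mult[OF G(2) nN(1)] t(2) nN(2) by simp
      then have "n \<otimes>\<^bsub>GL\<^esub> F t' = n \<otimes>\<^bsub>GL\<^esub> t'" unfolding tn using L.F_mult[OF nN(1) G(1)] nN(2) by simp
      then have "F t' = t'" using nc c(1) subgroup.mem_carrier[OF L.G_subgroup L.F_closed[OF G(1)]] by simp
      then have "t' \<in> fixed_points F \<T>" using t'(1) unfolding fixed_points_def by blast
      then show "\<exists>t'\<in>fixed_points F \<T>. t \<otimes>\<^bsub>GL\<^esub> n = n \<otimes>\<^bsub>GL\<^esub> t'" using tn by blast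
    qed
    ultimately show ?thesis by simp
  qed
  obtain k j where k: "k > 0" "\<alpha> ^ k = of_nat ?p powi j"
    using edge_eigenvalue_power[OF assms(3) prime_gt_0_nat[OF p] cells] by blast
  obtain e where e: "e > 0" "CARD('f) = ?p ^ e" using CARD_prime_power[where 'f = 'f] by blast
  \<comment> \<open>The indices are powers of the characteristic; with \<open>q = p^e\<close>, the
    exponent is multiplied by \<open>e\<close> to reach a power of \<open>q\<close>.\<close>
  have "\<alpha> ^ (k * e) = (of_nat ?p powi j) ^ e" by (simp add: power_mult k(2))
  also have "\<dots> = of_nat CARD('f) powi j" unfolding e(2) of_nat_power power_int_power power_int_power' by (simp add: mult.commute)
  finally show ?thesis using k(1) e(1) by (intro exI[of _ "k * e"]) auto
qed

end
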